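(* Let $\dim(\mathcal G)=+\infty$ and let $V=(M_\psi\otimes K^* )\mathscr V(M_\psi\otimes K)$ with $\nu_0>3$, $0\le\mathscr V\in\mathcal B(\ell^2(\mathbb Z_h,\mathcal G))$ and $K\in\mathfrak S_2(\mathcal G)$. Fix $s\in I_Q$ such that the thresholds $\mu_s$ and $\frac4{h^2}+\mu_s$ are non-degenerate and $\mathrm{Rank}\,P_s\mathbf VP_s^*=\mathrm{Rank}\,P_s\mathbf V_JP_s^*=+\infty$. Then the SSF admits singularities at (i.e. is unbounded near) the thresholds $\mu_s$ and $\frac4{h^2}+\mu_s$, with $$\xi(\lambda;H^-,H_Q)\sim-\mathrm{Tr}\,\mathbf 1_{(\frac2h\sqrt{\mu_s-\lambda},+\infty)}(P_s\mathbf VP_s^* )\ \text{ as }\lambda\nearrow\mu_s,\qquad \xi(\lambda;H^-,H_Q)=\mathcal O(1)\ \text{ as }\lambda\searrow\tfrac4{h^2}+\mu_s,$$ and $$\xi(\lambda;H^+,H_Q)=\mathcal O(1)\ \text{ as }\lambda\nearrow\mu_s,\qquad -\xi(\lambda;H^+,H_Q)\sim-\mathrm{Tr}\,\mathbf 1_{(\frac2h\sqrt{\lambda-4/h^2-\mu_s},+\infty)}(P_s\mathbf V_JP_s^* )\ \text{ as }\lambda\searrow\tfrac4{h^2}+\mu_s.$$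
   Context: Let $h>0$, $\mathbb Z_h=\{hn:n\in\mathbb Z\}$, and let $\mathcal G$ be a separable complex Hilbert space. $\ell^2(\mathbb Z_h)=\ell^2(\mathbb Z_h,\mathbb C)$ has scalar product $\langle\varphi,\phi\rangle=\sum_{n\in\mathbb Z}\overline{\varphi(hn)}\phi(hn)$, and $\ell^2(\mathbb Z_h,\mathcal G)$ is identified with $\ell^2(\mathbb Z_h)\otimes\mathcal G$. On $\ell^2(\mathbb Z_h)$, $(-\Delta_h\phi)(hn)=h^{-2}\big(2\phi(hn)-\phi(h(n+1))-\phi(h(n-1))\big)$, whose spectrum is $[0,4/h^2]$. $Q$ is a self-adjoint operator on $\mathcal G$ such that either $Q=0$, or $Q\ne0$ and $\mathcal G=\bigoplus_{s=1}^d\mathrm{Ker}(Q-\mu_s)$ with $d<+\infty$ and $\mu_1,\dots,\mu_d$ the distinct (real) eigenvalues of $Q$. If $Q=0$ put $I_Q=\{0\}$, $\mu_0=0$, $\pi_0=I_{\mathcal G}$; if $Q\neq0$ put $I_Q=\{1,\dots,d\}$ and let $\pi_s$ be the orthogonal projection onto $\mathrm{Ker}(Q-\mu_s)$. $H_Q=-\Delta_h\otimes I_{\mathcal G}+I_{\ell^2(\mathbb Z_h)}\otimes Q$; the threshold set is $\mathscr E_Q=\{\mu_s,\mu_s+4/h^2\}_{s\in I_Q}$. If $Q\ne0$, $\mu_s$ (resp. $\frac4{h^2}+\mu_s$) is non-degenerate if $\mu_s\ne\frac4{h^2}+\mu_{s'}$ (resp. $\frac4{h^2}+\mu_s\neq\mu_{s'}$)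 for all $s'\ne s$; if $Q=0$ both thresholds $0,4/h^2$ count as non-degenerate. $\mathfrak S_p$ denotes the Schatten class. $\langle n\rangle=(1+n^2)^{1/2}$, $\psi(hn)=\langle n\rangle^{-\nu_0/2}$, $M_\psi$ is multiplication by $\psi$ on $\ell^2(\mathbb Z_h)$. $H^\pm=H_Q\pm V$. Spectral shift function: put $\mathscr M=\mathscr V^{1/2}(M_\psi\otimes K)\in\mathfrak S_2$ (so $V=\mathscr M^*\mathscr M$) and $T(z)=\mathscr M(H_Q-z)^{-1}\mathscr M^*$. For each $\lambda\in\mathbb R\setminus\mathscr E_Q$ the limit $T(\lambda+i0)=\lim_{\varepsilon\searrow0}T(\lambda+i\varepsilon)$ exists in $\mathfrak S_2$; $A(\lambda+i0)$ and $B(\lambda+i0)$ are its real and imaginary (self-adjoint) parts, $0\le B(\lambda+i0)\in\mathfrak S_1$. For compact self-adjoint $S$ and $r>0$, $\mathscr N_\pm(r,S)=\mathrm{Rank}\,\mathbf 1_{(r,\infty)}(\pm S)$. The SSF is identified with its representative $\xi(\lambda;H^\pm,H_Q)=\pm\frac1\pi\int_{\mathbb R}\mathscr N_\mp(1,A(\lambda+i0)+tB(\lambda+i0))\frac{dt}{1+t^2}$, $\lambda\in\mathbb R\setminus\mathscr E_Q$. Effective operators: $\langle\psi|:\ell^2(\mathbb Z_h)\to\mathbb C$, $\phi\mapsto\langle\psi,\phi\rangle$; $(J\varphi)(hn)=(-1)^n\varphi(hn)$; $P_s=\langle\psi|\otimes\pi_s:\ell^2(\mathbb Z_h)\otimes\mathcal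 G\to\mathbb C\otimes\mathcal G$; $\mathbf V=(I\otimes K^* )\mathscr V(I\otimes K)$; $\mathbf V_J=(J\otimes I_{\mathcal G})^*\mathbf V(J\otimes I_{\mathcal G})$. Notation $\sim$: for real functionals $F_1(V,\lambda),F_2(V,\lambda)$, $F_1(V,\lambda)\sim F_2(V,\lambda)$ as $\lambda\to\lambda_0$ means that for every $\varepsilon\in(0,1)$, $$F_2((1-\varepsilon)^{-1}V,\lambda)+\mathcal O_\varepsilon(1)\le F_1(V,\lambda)\le F_2((1+\varepsilon)^{-1}V,\lambda)+\mathcal O_\varepsilon(1),\quad\lambda\to\lambda_0,$$ where $F(cV,\lambda)$ is $F$ with $\mathscr V$ replaced by $c\mathscr V$ ($\nu_0$, $K$ fixed). *)

theory Defs
  imports "HOL-Analysis.Analysis" "HOL-Library.Extended_Nat" "HOL-Library.Landau_Symbols"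
begin

section \<open>Complex Hilbert spaces\<close>

text \<open>The scalar product is antilinear in its first argument.  Its real part is the
  real inner product of the underlying class, which also supplies positivity, the norm and
  the topology.\<close>

class complex_inner = real_inner +
  fixes scaleC :: "complex \<Rightarrow> 'a \<Rightarrow> 'a" (infixr "*\<^sub>C" 75)
    and cinner :: "'a \<Rightarrow> 'a \<Rightarrow> complex"
  assumes scaleC_add_right: "a *\<^sub>C (x + y) = a *\<^sub>C x + a *\<^sub>C y"
    and scaleC_add_left: "(a + b) *\<^sub>C x = a *\<^sub>C x + b *\<^sub>C x"
    and scaleC_scaleC: "a *\<^sub>C b *\<^sub>C x = (a * b) *\<^sub>C x"
    and scaleR_eq_scaleC: "scaleR r x = complex_of_real r *\<^sub>C x"
    and cinner_commute: "cinner x y = cnj (cinner y x)"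
    and cinner_add_right: "cinner x (y + z) = cinner x y + cinner x z"
    and cinner_scaleC_right: "cinner x (a *\<^sub>C y) = a * cinner x y"
    and Re_cinner: "Re (cinner x y) = inner x y"

class chilbert_space = complex_inner + complete_space

global_interpretation cvec: vector_space "scaleC :: complex \<Rightarrow> 'a \<Rightarrow> 'a::complex_inner"
proof
  fix x :: 'a
  show "1 *\<^sub>C x = x"
    using scaleR_eq_scaleC[of 1 x] by simp
qed (simp_all add: scaleC_add_right scaleC_add_left scaleC_scaleC)

instantiation complex :: chilbert_space
begin

definition scaleC_complex :: "complex \<Rightarrow> complex \<Rightarrow> complex"
  where "scaleC_complex a x = a * x"

definition cinner_complex :: "complex \<Rightarrow> complex \<Rightarrow> complex"
  where "cinner_complex x y = cnj x * y"

instance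
  by standard
    (auto simp: scaleC_complex_def cinner_complex_def inner_complex_def algebra_simps
      scaleR_conv_of_real)

end

lemma norm_scaleC: "norm (a *\<^sub>C x) = cmod a * norm (x :: 'a::complex_inner)"
proof -
  have "cinner (a *\<^sub>C x) (a *\<^sub>C x) = a * cinner (a *\<^sub>C x) x"
    by (rule cinner_scaleC_right)
  also have "cinner (a *\<^sub>C x) x = cnj (cinner x (a *\<^sub>C x))"
    by (rule cinner_commute)
  also have "a * \<dots> = (a * cnj a) * cnj (cinner x x)"
    by (simp add: cinner_scaleC_right)
  also have "a * cnj a = complex_of_real ((cmod a)\<^sup>2)"
    by (rule complex_norm_square[symmetric])
  finally have "Re (cinner (a *\<^sub>C x) (a *\<^sub>C x)) = (cmod a)\<^sup>2 * Re (cinner x x)"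
    by simp
  then show ?thesis
    by (simp add: Re_cinner norm_eq_sqrt_inner real_sqrt_mult)
qed

lemma cinner_norm_bound: "cmod (cinner x y) \<le> norm x * norm (y :: 'a::complex_inner)"
proof (cases "cinner x y = 0")
  case False
  define a where "a = cnj (sgn (cinner x y))"
  have a: "cmod a = 1"
    using False by (simp add: a_def norm_sgn)
  have "cinner x (a *\<^sub>C y) = complex_of_real (cmod (cinner x y))"
    using False
    by (simp add: cinner_scaleC_right a_def sgn_eq complex_norm_square[symmetric]
        power2_eq_square mult.commute flip: complex_norm_square)
  then have "cmod (cinner x y) = inner x (a *\<^sub>C y)"
    by (metis Re_cinner Re_complex_of_real)
  also have "\<dots> \<le> norm x * norm (a *\<^sub>C y)"
    by (rule norm_cauchy_schwarz)
  finally show ?thesis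
    by (simp add: norm_scaleC a)
qed simp


section \<open>The space of square-summable sequences on the lattice\<close>

text \<open>A function on \<open>\<int>\<^sub>h = {h n | n \<in> \<int>}\<close> is encoded by its values as a function of the
  index \<open>n\<close>.  The scalar product carries no weight \<open>h\<close>, so the space does not depend on \<open>h\<close>.\<close>

typedef (overloaded) 'a ell2 =
  "{f :: int \<Rightarrow> 'a::real_normed_vector. (\<lambda>n. (norm (f n))\<^sup>2) summable_on UNIV}"
  by (rule exI[of _ "\<lambda>_. 0"]) simp

setup_lifting type_definition_ell2

lemma ell2_add:
  fixes f g :: "int \<Rightarrow> 'a::real_normed_vector"
  assumes "(\<lambda>n. (norm (f n))\<^sup>2) summable_on UNIV" "(\<lambda>n. (norm (g n))\<^sup>2) summable_on UNIV"
  shows "(\<lambda>n. (norm (f n + g n))\<^sup>2) summable_on UNIV"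
proof (rule summable_on_comparison_test)
  show "(\<lambda>n. 2 * (norm (f n))\<^sup>2 + 2 * (norm (g n))\<^sup>2) summable_on UNIV"
    using assms by (intro summable_on_add summable_on_cmult_right)
  fix n :: int
  have "(norm (f n + g n))\<^sup>2 \<le> (norm (f n) + norm (g n))\<^sup>2"
    by (intro power_mono norm_triangle_ineq) simp
  also have "\<dots> \<le> 2 * (norm (f n))\<^sup>2 + 2 * (norm (g n))\<^sup>2"
    using sum_squares_bound[of "norm (f n)" "norm (g n)"] by (simp add: power2_sum)
  finally show "(norm (f n + g n))\<^sup>2 \<le> 2 * (norm (f n))\<^sup>2 + 2 * (norm (g n))\<^sup>2" .
qed simp

lemma ell2_scale:
  fixes f :: "int \<Rightarrow> 'a::real_normed_vector" and g :: "int \<Rightarrow> 'b::real_normed_vector"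
  assumes "(\<lambda>n. (norm (f n))\<^sup>2) summable_on UNIV" "\<And>n. norm (g n) = c * norm (f n)"
  shows "(\<lambda>n. (norm (g n))\<^sup>2) summable_on UNIV"
  using summable_on_cmult_right[OF assms(1), of "c\<^sup>2"] by (simp add: assms(2) power_mult_distrib)

lemma ell2_cinner_summable:
  fixes f g :: "int \<Rightarrow> 'a::complex_inner"
  assumes "(\<lambda>n. (norm (f n))\<^sup>2) summable_on UNIV" "(\<lambda>n. (norm (g n))\<^sup>2) summable_on UNIV"
  shows "(\<lambda>n. cinner (f n) (g n)) summable_on UNIV"
proof (rule abs_summable_summable, rule summable_on_comparison_test)
  show "(\<lambda>n. (norm (f n))\<^sup>2 + (norm (g n))\<^sup>2) summable_on UNIV"
    using assms by (intro summable_on_add)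
  fix n :: int
  have "cmod (cinner (f n) (g n)) \<le> norm (f n) * norm (g n)"
    by (rule cinner_norm_bound)
  also have "\<dots> \<le> (norm (f n))\<^sup>2 + (norm (g n))\<^sup>2"
    using sum_squares_bound[of "norm (f n)" "norm (g n)"]
      mult_nonneg_nonneg[OF norm_ge_zero[of "f n"] norm_ge_zero[of "g n"]]
    by linarith
  finally show "cmod (cinner (f n) (g n)) \<le> (norm (f n))\<^sup>2 + (norm (g n))\<^sup>2" .
qed simp

lemma ell2_inner_infsum:
  fixes f g :: "int \<Rightarrow> 'a::complex_inner"
  assumes "(\<lambda>n. (norm (f n))\<^sup>2) summable_on UNIV" "(\<lambda>n. (norm (g n))\<^sup>2) summable_on UNIV"
  shows "((\<lambda>n. inner (f n) (g n)) has_sum Re (\<Sum>\<^sub>\<infinity>n. cinner (f n) (g n))) UNIV"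
  using has_sum_Re[OF has_sum_infsum[OF ell2_cinner_summable[OF assms]]]
  by (simp add: Re_cinner)

instantiation ell2 :: (complex_inner) complex_inner
begin

lift_definition zero_ell2 :: "'a ell2" is "\<lambda>_. 0" by simp

lift_definition plus_ell2 :: "'a ell2 \<Rightarrow> 'a ell2 \<Rightarrow> 'a ell2" is "\<lambda>f g n. f n + g n"
  by (rule ell2_add)

lift_definition uminus_ell2 :: "'a ell2 \<Rightarrow> 'a ell2" is "\<lambda>f n. - f n"
  by simp

lift_definition minus_ell2 :: "'a ell2 \<Rightarrow> 'a ell2 \<Rightarrow> 'a ell2" is "\<lambda>f g n. f n - g n"
  using ell2_add[of _ "\<lambda>n. - _ n"] by simp

lift_definition scaleR_ell2 :: "real \<Rightarrow> 'a ell2 \<Rightarrow> 'a ell2" is "\<lambda>r f n. r *\<^sub>R f n"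
  by (erule ell2_scale) (rule norm_scaleR)

lift_definition scaleC_ell2 :: "complex \<Rightarrow> 'a ell2 \<Rightarrow> 'a ell2" is "\<lambda>a f n. a *\<^sub>C f n"
  by (erule ell2_scale) (rule norm_scaleC)

lift_definition cinner_ell2 :: "'a ell2 \<Rightarrow> 'a ell2 \<Rightarrow> complex"
  is "\<lambda>f g. \<Sum>\<^sub>\<infinity>n. cinner (f n) (g n)" .

definition inner_ell2 :: "'a ell2 \<Rightarrow> 'a ell2 \<Rightarrow> real"
  where "inner_ell2 f g = Re (cinner f g)"

definition norm_ell2 :: "'a ell2 \<Rightarrow> real"
  where "norm_ell2 f = sqrt (inner f f)"

definition dist_ell2 :: "'a ell2 \<Rightarrow> 'a ell2 \<Rightarrow> real"
  where "dist_ell2 f g = norm (f - g)"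

definition sgn_ell2 :: "'a ell2 \<Rightarrow> 'a ell2"
  where "sgn_ell2 f = inverse (norm f) *\<^sub>R f"

definition uniformity_ell2 :: "('a ell2 \<times> 'a ell2) filter"
  where "uniformity_ell2 = (INF e\<in>{0 <..}. principal {(x, y). dist x y < e})"

definition open_ell2 :: "'a ell2 set \<Rightarrow> bool"
  where "open_ell2 U = (\<forall>x\<in>U. \<forall>\<^sub>F (x', y) in uniformity. x' = x \<longrightarrow> y \<in> U)"

instance
proof
  fix x y z :: "'a ell2" and a b :: complex and r s :: real
  show "x + y + z = x + (y + z)" "x + y = y + x" "0 + x = x" "- x + x = 0" "x - y = x + - y"
    by (transfer; simp add: algebra_simps)+
  show "r *\<^sub>R (x + y) = r *\<^sub>R x + r *\<^sub>R y" "(r + s) *\<^sub>R x = r *\<^sub>R x + s *\<^sub>R x"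
    "r *\<^sub>R s *\<^sub>R x = (r * s) *\<^sub>R x" "1 *\<^sub>R x = x"
    by (transfer; simp add: algebra_simps)+
  show "a *\<^sub>C (x + y) = a *\<^sub>C x + a *\<^sub>C y"
    by transfer (simp add: scaleC_add_right)
  show "(a + b) *\<^sub>C x = a *\<^sub>C x + b *\<^sub>C x"
    by transfer (simp add: scaleC_add_left)
  show "a *\<^sub>C b *\<^sub>C x = (a * b) *\<^sub>C x"
    by transfer (simp add: scaleC_scaleC)
  show "r *\<^sub>R x = complex_of_real r *\<^sub>C x"
    by transfer (simp add: scaleR_eq_scaleC)
  show comm: "cinner u v = cnj (cinner v u)" for u v :: "'a ell2"
    by transfer (subst infsum_cnj[symmetric], intro infsum_cong, rule cinner_commute)
  show addr: "cinner u (v + w) = cinner u v + cinner u w" for u v w :: "'a ell2"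
    by transfer (simp add: cinner_add_right infsum_add ell2_cinner_summable)
  show scr: "cinner u (a *\<^sub>C v) = a * cinner u v" for a and u v :: "'a ell2"
    by transfer (simp add: cinner_scaleC_right infsum_cmult_right ell2_cinner_summable)
  show "Re (cinner x y) = inner x y"
    by (simp add: inner_ell2_def)
  show comm': "inner u v = inner v u" for u v :: "'a ell2"
    unfolding inner_ell2_def by (subst comm) simp
  show "inner (x + y) z = inner x z + inner y z"
    by (subst (1 2 3) comm') (simp add: inner_ell2_def addr)
  have "r *\<^sub>R u = complex_of_real r *\<^sub>C u" for u :: "'a ell2"
    by transfer (simp add: scaleR_eq_scaleC)
  then show "inner (r *\<^sub>R x) y = r * inner x y"
    by (subst (1 2) comm') (simp add: inner_ell2_def scr)
  have self: "((\<lambda>n. (norm (Rep_ell2 u n))\<^sup>2) has_sum inner u u) UNIV" for u :: "'a ell2"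
    using ell2_inner_infsum[of "Rep_ell2 u" "Rep_ell2 u"] Rep_ell2[of u]
    by (simp add: inner_ell2_def cinner_ell2.rep_eq power2_norm_eq_inner)
  show pos: "0 \<le> inner x x"
    using self[of x] by (rule has_sum_nonneg) simp
  show "(inner x x = 0) = (x = 0)"
  proof
    assume "inner x x = 0"
    then have h: "((\<lambda>n. (norm (Rep_ell2 x n))\<^sup>2) has_sum 0) UNIV"
      using self[of x] by simp
    have "Rep_ell2 x n = 0" for n
    proof -
      have "(\<Sum>n\<in>{n}. (norm (Rep_ell2 x n))\<^sup>2) \<le> 0"
        by (rule finite_sum_le_has_sum[OF h]) simp_all
      then show ?thesis by simp
    qed
    then show "x = 0"
      by (simp add: fun_eq_iff Rep_ell2_inject[symmetric] zero_ell2.rep_eq)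
  next
    assume "x = 0"
    then have "((\<lambda>n. 0) has_sum inner x x) (UNIV :: int set)"
      using self[of x] by (simp add: zero_ell2.rep_eq)
    then show "inner x x = 0"
      by (rule has_sum_unique) simp
  qed
qed (simp_all add: norm_ell2_def dist_ell2_def sgn_ell2_def uniformity_ell2_def open_ell2_def)

end

lemma ell2_has_sum_norm:
  fixes f :: "'a::complex_inner ell2"
  shows "((\<lambda>n. (norm (Rep_ell2 f n))\<^sup>2) has_sum (norm f)\<^sup>2) UNIV"
  using ell2_inner_infsum[of "Rep_ell2 f" "Rep_ell2 f"] Rep_ell2[of f]
  by (simp add: power2_norm_eq_inner inner_ell2_def cinner_ell2.rep_eq)

lemma ell2_sum_le:
  fixes f :: "'a::complex_inner ell2"
  assumes "finite F"
  shows "(\<Sum>n\<in>F. (norm (Rep_ell2 f n))\<^sup>2) \<le> (norm f)\<^sup>2"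
  by (rule finite_sum_le_has_sum[OF ell2_has_sum_norm assms subset_UNIV]) (rule zero_le_power2)

lemma ell2_coord_le:
  fixes f :: "'a::complex_inner ell2"
  shows "norm (Rep_ell2 f n) \<le> norm f"
proof (rule power2_le_imp_le)
  show "(norm (Rep_ell2 f n))\<^sup>2 \<le> (norm f)\<^sup>2"
    using ell2_sum_le[of "{n}" f] by simp
qed (rule norm_ge_zero)

instance ell2 :: (chilbert_space) chilbert_space
proof
  fix X :: "nat \<Rightarrow> 'a ell2"
  assume X: "Cauchy X"
  have coord: "Cauchy (\<lambda>i. Rep_ell2 (X i) n)" for n
    unfolding Cauchy_def
  proof (intro allI impI)
    fix e :: real assume "0 < e"
    then obtain N where N: "\<And>i j. N \<le> i \<Longrightarrow> N \<le> j \<Longrightarrow> dist (X i) (X j) < e"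
      using X unfolding Cauchy_def by blast
    have "dist (Rep_ell2 (X i) n) (Rep_ell2 (X j) n) < e" if "N \<le> i" "N \<le> j" for i j
      using N[OF that] ell2_coord_le[of "X i - X j" n] by (simp add: dist_norm minus_ell2.rep_eq)
    then show "\<exists>M. \<forall>i\<ge>M. \<forall>j\<ge>M. dist (Rep_ell2 (X i) n) (Rep_ell2 (X j) n) < e"
      by blast
  qed
  define f where "f n = lim (\<lambda>i. Rep_ell2 (X i) n)" for n
  have f: "(\<lambda>i. Rep_ell2 (X i) n) \<longlonglongrightarrow> f n" for n
    using coord[of n] unfolding f_def by (simp add: Cauchy_convergent_iff convergent_LIMSEQ_iff)
  have tail: "\<exists>N. \<forall>i\<ge>N. \<forall>F. finite F \<longrightarrow> (\<Sum>n\<in>F. (norm (Rep_ell2 (X i) n - f n))\<^sup>2) \<le> e\<^sup>2"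
    if "0 < e" for e :: real
  proof -
    obtain N where N: "\<And>i j. N \<le> i \<Longrightarrow> N \<le> j \<Longrightarrow> dist (X i) (X j) < e"
      using X \<open>0 < e\<close> unfolding Cauchy_def by blast
    have "(\<Sum>n\<in>F. (norm (Rep_ell2 (X i) n - f n))\<^sup>2) \<le> e\<^sup>2" if "N \<le> i" "finite F" for i F
    proof (rule tendsto_upperbound)
      show "(\<lambda>j. \<Sum>n\<in>F. (norm (Rep_ell2 (X i) n - Rep_ell2 (X j) n))\<^sup>2)
          \<longlonglongrightarrow> (\<Sum>n\<in>F. (norm (Rep_ell2 (X i) n - f n))\<^sup>2)"
        by (intro tendsto_intros f)
      have "(\<Sum>n\<in>F. (norm (Rep_ell2 (X i) n - Rep_ell2 (X j) n))\<^sup>2) \<le> e\<^sup>2" if "N \<le> j" for j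
      proof -
        have "(norm (X i - X j))\<^sup>2 \<le> e\<^sup>2"
          using N[OF \<open>N \<le> i\<close> that] by (intro power_mono) (simp_all add: dist_norm)
        then show ?thesis
          using ell2_sum_le[OF \<open>finite F\<close>, of "X i - X j"] by (simp add: minus_ell2.rep_eq)
      qed
      then show "\<forall>\<^sub>F j in sequentially.
          (\<Sum>n\<in>F. (norm (Rep_ell2 (X i) n - Rep_ell2 (X j) n))\<^sup>2) \<le> e\<^sup>2"
        by (rule eventually_sequentiallyI)
    qed simp
    then show ?thesis by blast
  qed
  have memd: "(\<lambda>n. (norm (Rep_ell2 (X i) n - f n))\<^sup>2) summable_on UNIV"
    if "\<And>F. finite F \<Longrightarrow> (\<Sum>n\<in>F. (norm (Rep_ell2 (X i) n - f n))\<^sup>2) \<le> e\<^sup>2" for i and e :: real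
    using that by (intro nonneg_bdd_above_summable_on bdd_aboveI2[of _ _ "e\<^sup>2"]) auto
  obtain i0 where "\<And>F. finite F \<Longrightarrow> (\<Sum>n\<in>F. (norm (Rep_ell2 (X i0) n - f n))\<^sup>2) \<le> 1\<^sup>2"
    using tail[of 1] by auto
  from memd[OF this] have "(\<lambda>n. (norm (- (Rep_ell2 (X i0) n - f n)))\<^sup>2) summable_on UNIV"
    by (simp only: norm_minus_cancel)
  then have "(\<lambda>n. (norm (Rep_ell2 (X i0) n + - (Rep_ell2 (X i0) n - f n)))\<^sup>2) summable_on UNIV"
    using Rep_ell2[of "X i0"] by (intro ell2_add) simp_all
  then have mem: "(\<lambda>n. (norm (f n))\<^sup>2) summable_on UNIV"
    by simp
  have "X \<longlonglongrightarrow> Abs_ell2 f"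
  proof (rule metric_LIMSEQ_I)
    fix e :: real assume "0 < e"
    then obtain N where N: "\<And>i F. N \<le> i \<Longrightarrow> finite F \<Longrightarrow>
        (\<Sum>n\<in>F. (norm (Rep_ell2 (X i) n - f n))\<^sup>2) \<le> (e / 2)\<^sup>2"
      using tail[of "e / 2"] by auto
    have "dist (X i) (Abs_ell2 f) < e" if "N \<le> i" for i
    proof -
      have "((\<lambda>n. (norm (Rep_ell2 (X i) n - f n))\<^sup>2) has_sum (norm (X i - Abs_ell2 f))\<^sup>2) UNIV"
        using ell2_has_sum_norm[of "X i - Abs_ell2 f"] mem
        by (simp add: minus_ell2.rep_eq Abs_ell2_inverse)
      then have "(norm (X i - Abs_ell2 f))\<^sup>2 \<le> (e / 2)\<^sup>2"
        by (rule has_sum_le_finite_sums) (rule N[OF that])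
      then have "norm (X i - Abs_ell2 f) \<le> e / 2"
        by (rule power2_le_imp_le) (use \<open>0 < e\<close> in simp)
      then show ?thesis
        using \<open>0 < e\<close> by (simp add: dist_norm)
    qed
    then show "\<exists>N. \<forall>i\<ge>N. dist (X i) (Abs_ell2 f) < e" by blast
  qed
  then show "convergent X"
    by (auto simp: convergent_def)
qed


section \<open>Operators\<close>

definition bounded_clinear :: "('a::complex_inner \<Rightarrow> 'b::complex_inner) \<Rightarrow> bool"
  where "bounded_clinear T \<longleftrightarrow> bounded_linear T \<and> (\<forall>a x. T (a *\<^sub>C x) = a *\<^sub>C T x)"

definition cadjoint :: "('a::complex_inner \<Rightarrow> 'b::complex_inner) \<Rightarrow> 'b \<Rightarrow> 'a"
  where "cadjoint T = (THE S. \<forall>x y. cinner (S y) x = cinner y (T x))"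

definition selfadjoint_op :: "('a::complex_inner \<Rightarrow> 'a) \<Rightarrow> bool"
  where "selfadjoint_op T \<longleftrightarrow>
    bounded_clinear T \<and> (\<forall>x y. cinner (T x) y = cinner x (T y))"

definition positive_op :: "('a::complex_inner \<Rightarrow> 'a) \<Rightarrow> bool"
  where "positive_op T \<longleftrightarrow>
    bounded_clinear T \<and> (\<forall>x. cinner x (T x) \<in> \<real> \<and> 0 \<le> Re (cinner x (T x)))"

definition sqrt_op :: "('a::complex_inner \<Rightarrow> 'a) \<Rightarrow> 'a \<Rightarrow> 'a"
  where "sqrt_op T = (THE S. positive_op S \<and> S \<circ> S = T)"

definition resolvent :: "('a::complex_inner \<Rightarrow> 'a) \<Rightarrow> complex \<Rightarrow> 'a \<Rightarrow> 'a"
  where "resolvent T z = inv (\<lambda>x. T x - z *\<^sub>C x)"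

definition re_op :: "('a::complex_inner \<Rightarrow> 'a) \<Rightarrow> 'a \<Rightarrow> 'a"
  where "re_op T = (\<lambda>x. (1 / 2) *\<^sub>C (T x + cadjoint T x))"

definition im_op :: "('a::complex_inner \<Rightarrow> 'a) \<Rightarrow> 'a \<Rightarrow> 'a"
  where "im_op T = (\<lambda>x. (1 / (2 * \<i>)) *\<^sub>C (T x - cadjoint T x))"

definition cdim :: "'a::complex_inner set \<Rightarrow> enat"
  where "cdim X =
    (if \<exists>B. finite B \<and> X \<subseteq> cvec.span B then enat (cvec.dim X) else \<infinity>)"

definition rank_op :: "('a::complex_inner \<Rightarrow> 'b::complex_inner) \<Rightarrow> enat"
  where "rank_op T = cdim (range T)"

definition orth_proj :: "'a::complex_inner set \<Rightarrow> 'a \<Rightarrow> 'a"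
  where "orth_proj X x = (THE y. y \<in> X \<and> (\<forall>w\<in>X. cinner w (x - y) = 0))"

definition eigenspace :: "('a::complex_inner \<Rightarrow> 'a) \<Rightarrow> real \<Rightarrow> 'a set"
  where "eigenspace T r = {x. T x = complex_of_real r *\<^sub>C x}"

text \<open>The spectral projection \<open>1\<^bsub>\<Omega>\<^esub>(T)\<close> of a compact self-adjoint operator: such an operator
  is diagonalizable, so \<open>1\<^bsub>\<Omega>\<^esub>(T)\<close> is the orthogonal sum of the projections onto the
  \<open>Ker (T - r)\<close> with \<open>r \<in> \<Omega>\<close>.\<close>

definition spectral_proj :: "real set \<Rightarrow> ('a::complex_inner \<Rightarrow> 'a) \<Rightarrow> 'a \<Rightarrow> 'a"
  where "spectral_proj \<Omega> T = orth_proj (closure (cvec.span (\<Union>r\<in>\<Omega>. eigenspace T r)))"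

definition N_plus :: "real \<Rightarrow> ('a::complex_inner \<Rightarrow> 'a) \<Rightarrow> enat"
  where "N_plus r S = rank_op (spectral_proj {r<..} S)"

definition N_minus :: "real \<Rightarrow> ('a::complex_inner \<Rightarrow> 'a) \<Rightarrow> enat"
  where "N_minus r S = rank_op (spectral_proj {r<..} (\<lambda>x. - S x))"

definition orthonormal_basis :: "'a::complex_inner set \<Rightarrow> bool"
  where "orthonormal_basis B \<longleftrightarrow>
    (\<forall>x\<in>B. \<forall>y\<in>B. cinner x y = (if x = y then 1 else 0)) \<and> closure (cvec.span B) = UNIV"

text \<open>The Hilbert-Schmidt class and norm and the trace (of a trace class operator) do not
  depend on the orthonormal basis, so an arbitrary one is selected.\<close>

definition some_onb :: "'a::complex_inner set"
  where "some_onb = (SOME B. orthonormal_basis B)"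

definition hilbert_schmidt :: "('a::complex_inner \<Rightarrow> 'b::complex_inner) \<Rightarrow> bool"
  where "hilbert_schmidt T \<longleftrightarrow>
    bounded_clinear T \<and> (\<lambda>e. (norm (T e))\<^sup>2) summable_on some_onb"

definition hs_norm :: "('a::complex_inner \<Rightarrow> 'b::complex_inner) \<Rightarrow> real"
  where "hs_norm T = sqrt (\<Sum>\<^sub>\<infinity>e\<in>some_onb. (norm (T e))\<^sup>2)"

definition trace_op :: "('a::complex_inner \<Rightarrow> 'a) \<Rightarrow> complex"
  where "trace_op T = (\<Sum>\<^sub>\<infinity>e\<in>some_onb. cinner e (T e))"


section \<open>Operators on the lattice\<close>

lift_definition tensor_vec :: "complex ell2 \<Rightarrow> 'a::complex_inner \<Rightarrow> 'a ell2"
  is "\<lambda>\<phi> g n. \<phi> n *\<^sub>C g"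
  subgoal for \<phi> g
    by (rule ell2_scale[of \<phi> _ "norm g"]) (simp_all add: norm_scaleC mult.commute)
  done

text \<open>The bounded extension of \<open>\<phi> \<otimes> g \<mapsto> A \<phi> \<otimes> B g\<close>, under the identification of
  \<open>\<ell>\<^sup>2(\<int>\<^sub>h) \<otimes> \<G>\<close> with \<open>\<ell>\<^sup>2(\<int>\<^sub>h, \<G>)\<close>.\<close>

definition tensor_op ::
    "(complex ell2 \<Rightarrow> complex ell2) \<Rightarrow> ('a::complex_inner \<Rightarrow> 'a) \<Rightarrow> 'a ell2 \<Rightarrow> 'a ell2"
  where "tensor_op A B = (THE T. bounded_clinear T \<and>
    (\<forall>\<phi> g. T (tensor_vec \<phi> g) = tensor_vec (A \<phi>) (B g)))"

text \<open>\<open>\<langle>\<psi>| \<otimes> B\<close>, with \<open>\<complex> \<otimes> \<G>\<close> identified with \<open>\<G>\<close>.\<close>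

definition bra_tensor_op ::
    "complex ell2 \<Rightarrow> ('a::complex_inner \<Rightarrow> 'a) \<Rightarrow> 'a ell2 \<Rightarrow> 'a"
  where "bra_tensor_op \<psi> B = (THE T. bounded_clinear T \<and>
    (\<forall>\<phi> g. T (tensor_vec \<phi> g) = cinner \<psi> \<phi> *\<^sub>C B g))"

lemma ell2_shift:
  fixes f :: "int \<Rightarrow> 'a::real_normed_vector"
  assumes "(\<lambda>n. (norm (f n))\<^sup>2) summable_on UNIV"
  shows "(\<lambda>n. (norm (f (n + k)))\<^sup>2) summable_on UNIV"
proof -
  have "bij (\<lambda>n::int. n + k)"
    by (rule bij_plus_right)
  from summable_on_reindex_bij_betw[OF this, of "\<lambda>n. (norm (f n))\<^sup>2"] show ?thesis
    using assms by simp
qed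

lift_definition neg_laplacian :: "real \<Rightarrow> complex ell2 \<Rightarrow> complex ell2"
  is "\<lambda>h \<phi> n. (2 * \<phi> n - \<phi> (n + 1) - \<phi> (n - 1)) / complex_of_real (h\<^sup>2)"
proof -
  fix h :: real and \<phi> :: "int \<Rightarrow> complex"
  assume \<phi>: "(\<lambda>n. (cmod (\<phi> n))\<^sup>2) summable_on UNIV"
  have "(\<lambda>n. (cmod (2 * \<phi> n))\<^sup>2) summable_on UNIV"
    by (rule ell2_scale[OF \<phi>]) (rule norm_mult)
  moreover have "(\<lambda>n. (cmod (- \<phi> (n + k)))\<^sup>2) summable_on UNIV" for k
    using ell2_shift[OF \<phi>] by simp
  ultimately have *: "(\<lambda>n. (cmod ((2 * \<phi> n + - \<phi> (n + 1)) + - \<phi> (n + - 1)))\<^sup>2) summable_on UNIV"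
    by (intro ell2_add)
  show "(\<lambda>n. (cmod ((2 * \<phi> n - \<phi> (n + 1) - \<phi> (n - 1)) / complex_of_real (h\<^sup>2)))\<^sup>2)
      summable_on UNIV"
    by (rule ell2_scale[OF *, where c = "1 / cmod (complex_of_real (h\<^sup>2))"])
      (simp add: norm_divide)
qed

lift_definition parity_op :: "complex ell2 \<Rightarrow> complex ell2"
  is "\<lambda>\<phi> n. (- 1) powi n * \<phi> n"
  by (simp add: norm_mult norm_power_int)

definition psi :: "real \<Rightarrow> int \<Rightarrow> real"
  where "psi \<nu> n = sqrt (1 + (real_of_int n)\<^sup>2) powr (- \<nu> / 2)"

text \<open>The definitions of \<open>psi_vec\<close> and \<open>mult_psi\<close> are meaningful because
  \<open>psi \<nu>\<close> is square summable for \<open>\<nu> > 1\<close> and bounded for \<open>\<nu> \<ge> 0\<close>.\<close>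

definition psi_vec :: "real \<Rightarrow> complex ell2"
  where "psi_vec \<nu> = Abs_ell2 (\<lambda>n. complex_of_real (psi \<nu> n))"

definition mult_psi :: "real \<Rightarrow> complex ell2 \<Rightarrow> complex ell2"
  where "mult_psi \<nu> \<phi> = Abs_ell2 (\<lambda>n. complex_of_real (psi \<nu> n) * Rep_ell2 \<phi> n)"


section \<open>The free operator and its thresholds\<close>

definition free_op :: "real \<Rightarrow> ('g::complex_inner \<Rightarrow> 'g) \<Rightarrow> 'g ell2 \<Rightarrow> 'g ell2"
  where "free_op h Q = (\<lambda>\<Phi>. tensor_op (neg_laplacian h) id \<Phi> + tensor_op id Q \<Phi>)"

definition index_set :: "('g::complex_inner \<Rightarrow> 'g) \<Rightarrow> nat \<Rightarrow> nat set"
  where "index_set Q d = (if Q = (\<lambda>_. 0) then {0} else {1..d})"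

text \<open>For \<open>Q \<noteq> 0\<close>: the \<open>\<mu> s\<close> with \<open>1 \<le> s \<le> d\<close> are the distinct eigenvalues of \<open>Q\<close> and
  \<open>\<G>\<close> is the sum of their eigenspaces; for self-adjoint \<open>Q\<close> this sum is automatically direct
  and orthogonal.\<close>

definition spectral_data :: "('g::complex_inner \<Rightarrow> 'g) \<Rightarrow> nat \<Rightarrow> (nat \<Rightarrow> real) \<Rightarrow> bool"
  where "spectral_data Q d \<mu> \<longleftrightarrow>
    (if Q = (\<lambda>_. 0) then \<mu> 0 = 0
     else inj_on \<mu> {1..d} \<and> {r. eigenspace Q r \<noteq> {0}} = \<mu> ` {1..d} \<and>
       (\<forall>x. \<exists>y. (\<forall>s\<in>{1..d}. y s \<in> eigenspace Q (\<mu> s)) \<and> x = (\<Sum>s\<in>{1..d}. y s)))"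

text \<open>For \<open>Q = 0\<close> and \<open>\<mu> 0 = 0\<close> this is the identity.\<close>

definition eigenproj :: "('g::complex_inner \<Rightarrow> 'g) \<Rightarrow> (nat \<Rightarrow> real) \<Rightarrow> nat \<Rightarrow> 'g \<Rightarrow> 'g"
  where "eigenproj Q \<mu> s = orth_proj (eigenspace Q (\<mu> s))"

definition nondegenerate_lower ::
    "real \<Rightarrow> ('g::complex_inner \<Rightarrow> 'g) \<Rightarrow> nat \<Rightarrow> (nat \<Rightarrow> real) \<Rightarrow> nat \<Rightarrow> bool"
  where "nondegenerate_lower h Q d \<mu> s \<longleftrightarrow>
    Q = (\<lambda>_. 0) \<or> (\<forall>s'\<in>index_set Q d - {s}. \<mu> s \<noteq> 4 / h\<^sup>2 + \<mu> s')"

definition nondegenerate_upper ::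
    "real \<Rightarrow> ('g::complex_inner \<Rightarrow> 'g) \<Rightarrow> nat \<Rightarrow> (nat \<Rightarrow> real) \<Rightarrow> nat \<Rightarrow> bool"
  where "nondegenerate_upper h Q d \<mu> s \<longleftrightarrow>
    Q = (\<lambda>_. 0) \<or> (\<forall>s'\<in>index_set Q d - {s}. 4 / h\<^sup>2 + \<mu> s \<noteq> \<mu> s')"


section \<open>The spectral shift function\<close>

definition sandwiched_resolvent ::
    "('a::complex_inner \<Rightarrow> 'a) \<Rightarrow> ('a \<Rightarrow> 'a) \<Rightarrow> complex \<Rightarrow> 'a \<Rightarrow> 'a"
  where "sandwiched_resolvent H\<^sub>0 M z = M \<circ> resolvent H\<^sub>0 z \<circ> cadjoint M"

definition boundary_value ::
    "('a::complex_inner \<Rightarrow> 'a) \<Rightarrow> ('a \<Rightarrow> 'a) \<Rightarrow> real \<Rightarrow> 'a \<Rightarrow> 'a"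
  where "boundary_value H\<^sub>0 M l =
    (let T = (\<lambda>\<epsilon>. sandwiched_resolvent H\<^sub>0 M (Complex l \<epsilon>)) in
     THE S. hilbert_schmidt S \<and>
       (\<forall>\<^sub>F \<epsilon> in at_right 0. hilbert_schmidt (T \<epsilon>)) \<and>
       ((\<lambda>\<epsilon>. hs_norm (\<lambda>x. T \<epsilon> x - S x)) \<longlongrightarrow> 0) (at_right 0))"

text \<open>The representatives of the spectral shift functions of the pairs
  \<open>(H\<^sub>0 + M\<^sup>* M, H\<^sub>0)\<close> and \<open>(H\<^sub>0 - M\<^sup>* M, H\<^sub>0)\<close>, given by Pushnitski's formula in terms of
  the real and imaginary parts of the boundary value at \<open>l + i0\<close>; meaningful at every \<open>l\<close>
  where that boundary value exists.\<close>

definition ssf_plus :: "('a::complex_inner \<Rightarrow> 'a) \<Rightarrow> ('a \<Rightarrow> 'a) \<Rightarrow> real \<Rightarrow> real"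
  where "ssf_plus H\<^sub>0 M l =
    (let A = re_op (boundary_value H\<^sub>0 M l); B = im_op (boundary_value H\<^sub>0 M l) in
     1 / pi * (\<integral>t. real (the_enat (N_minus 1 (\<lambda>x. A x + complex_of_real t *\<^sub>C B x)))
                 / (1 + t\<^sup>2) \<partial>lborel))"

definition ssf_minus :: "('a::complex_inner \<Rightarrow> 'a) \<Rightarrow> ('a \<Rightarrow> 'a) \<Rightarrow> real \<Rightarrow> real"
  where "ssf_minus H\<^sub>0 M l =
    (let A = re_op (boundary_value H\<^sub>0 M l); B = im_op (boundary_value H\<^sub>0 M l) in
     - (1 / pi) * (\<integral>t. real (the_enat (N_plus 1 (\<lambda>x. A x + complex_of_real t *\<^sub>C B x)))
                 / (1 + t\<^sup>2) \<partial>lborel))"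

text \<open>The factor \<open>M = W\<^bsup>1/2\<^esup> (M\<^sub>\<psi> \<otimes> K)\<close> of the perturbation
  \<open>V = (M\<^sub>\<psi> \<otimes> K\<^sup>*) W (M\<^sub>\<psi> \<otimes> K) = M\<^sup>* M\<close>.  Below, \<open>xi_plus\<close> and \<open>xi_minus\<close> are the spectral
  shift functions \<open>\<xi>(l; H\<^sub>Q + V, H\<^sub>Q)\<close> and \<open>\<xi>(l; H\<^sub>Q - V, H\<^sub>Q)\<close> with \<open>H\<^sub>Q = free_op h Q\<close>.\<close>

definition factor_op ::
    "real \<Rightarrow> ('g::complex_inner \<Rightarrow> 'g) \<Rightarrow> ('g ell2 \<Rightarrow> 'g ell2) \<Rightarrow> 'g ell2 \<Rightarrow> 'g ell2"
  where "factor_op \<nu> K W = sqrt_op W \<circ> tensor_op (mult_psi \<nu>) K"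

definition xi_plus ::
    "real \<Rightarrow> ('g::complex_inner \<Rightarrow> 'g) \<Rightarrow> real \<Rightarrow> ('g \<Rightarrow> 'g) \<Rightarrow> ('g ell2 \<Rightarrow> 'g ell2) \<Rightarrow> real \<Rightarrow> real"
  where "xi_plus h Q \<nu> K W = ssf_plus (free_op h Q) (factor_op \<nu> K W)"

definition xi_minus ::
    "real \<Rightarrow> ('g::complex_inner \<Rightarrow> 'g) \<Rightarrow> real \<Rightarrow> ('g \<Rightarrow> 'g) \<Rightarrow> ('g ell2 \<Rightarrow> 'g ell2) \<Rightarrow> real \<Rightarrow> real"
  where "xi_minus h Q \<nu> K W = ssf_minus (free_op h Q) (factor_op \<nu> K W)"


section \<open>Effective operators\<close>

definition bold_V :: "('g::complex_inner \<Rightarrow> 'g) \<Rightarrow> ('g ell2 \<Rightarrow> 'g ell2) \<Rightarrow> 'g ell2 \<Rightarrow> 'g ell2"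
  where "bold_V K W = tensor_op id (cadjoint K) \<circ> W \<circ> tensor_op id K"

definition bold_VJ :: "('g::complex_inner \<Rightarrow> 'g) \<Rightarrow> ('g ell2 \<Rightarrow> 'g ell2) \<Rightarrow> 'g ell2 \<Rightarrow> 'g ell2"
  where "bold_VJ K W =
    cadjoint (tensor_op parity_op id) \<circ> bold_V K W \<circ> tensor_op parity_op id"

definition P_op ::
    "real \<Rightarrow> ('g::complex_inner \<Rightarrow> 'g) \<Rightarrow> (nat \<Rightarrow> real) \<Rightarrow> nat \<Rightarrow> 'g ell2 \<Rightarrow> 'g"
  where "P_op \<nu> Q \<mu> s = bra_tensor_op (psi_vec \<nu>) (eigenproj Q \<mu> s)"

definition effective_op ::
    "real \<Rightarrow> ('g::complex_inner \<Rightarrow> 'g) \<Rightarrow> (nat \<Rightarrow> real) \<Rightarrow> nat \<Rightarrow> ('g ell2 \<Rightarrow> 'g ell2) \<Rightarrow> 'g \<Rightarrow> 'g"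
  where "effective_op \<nu> Q \<mu> s X = P_op \<nu> Q \<mu> s \<circ> X \<circ> cadjoint (P_op \<nu> Q \<mu> s)"

text \<open>The relation \<open>F\<^sub>1(V, \<lambda>) \<sim> F\<^sub>2(V, \<lambda>)\<close> as \<open>\<lambda>\<close> tends along the filter \<open>F\<close>.  The functionals
  depend on \<open>V\<close> through \<open>W\<close>, so that \<open>F\<^sub>2(c V, \<lambda>)\<close> is \<open>F\<^sub>2 (c W) \<lambda>\<close>.\<close>

definition sim_functional ::
    "real filter \<Rightarrow> ('a::complex_inner \<Rightarrow> 'a) \<Rightarrow>
     (('a \<Rightarrow> 'a) \<Rightarrow> real \<Rightarrow> real) \<Rightarrow> (('a \<Rightarrow> 'a) \<Rightarrow> real \<Rightarrow> real) \<Rightarrow> bool"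
  where "sim_functional F W F\<^sub>1 F\<^sub>2 \<longleftrightarrow>
    (\<forall>\<epsilon>\<in>{0<..<1}. \<exists>C. \<forall>\<^sub>F l in F.
       F\<^sub>2 (\<lambda>x. complex_of_real (1 / (1 - \<epsilon>)) *\<^sub>C W x) l - C \<le> F\<^sub>1 W l \<and>
       F\<^sub>1 W l \<le> F\<^sub>2 (\<lambda>x. complex_of_real (1 / (1 + \<epsilon>)) *\<^sub>C W x) l + C)"

end

theory Submission imports Defs begin

text \<open>The boundary value \<open>T(\<lambda> + i0)\<close> sandwiches the convolution kernel
  \<open>\<Sum>\<^sub>s c\<^sub>s \<zeta>\<^sub>s\<^sup>|\<^sup>n\<^sup>-\<^sup>m\<^sup>| \<pi>\<^sub>s\<close>, where \<open>\<zeta>\<^sub>s\<close> solves \<open>\<zeta> + 1 / \<zeta> = 2 - h\<^sup>2 (\<lambda> - \<mu>\<^sub>s)\<close> in the closed unit disc.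
  At distance \<open>k\<^sup>2\<close> from a non-degenerate threshold only \<open>c\<^sub>s\<close> blows up, like \<open>h / (2 k)\<close> at the lower
  and like \<open>- h / (2 k)\<close> at the upper edge of the channel.  Replacing \<open>c\<^sub>s \<zeta>\<^sub>s\<^sup>|\<^sup>n\<^sup>-\<^sup>m\<^sup>|\<close> by its rank one
  singular part leaves a kernel of linear growth in \<open>\<bar>n - m\<bar>\<close>, uniformly in \<open>k\<close>; this is where
  \<open>\<nu>\<^sub>0 > 3\<close> is needed.  Hence \<open>Re T = \<plusminus> (h / (2 k)) Y Y\<^sup>*\<close> up to a remainder, with \<open>Y\<^sup>* Y\<close> the effective
  operator, and with one Hilbert-Schmidt operator \<open>Z\<close>, independent of \<open>\<lambda>\<close>, the quadratic form of the
  remainder is bounded by \<open>C \<parallel>x\<parallel> \<parallel>Z x\<parallel>\<close> and that of \<open>Im T\<close> by \<open>C \<parallel>Z x\<parallel>\<^sup>2\<close>.  By the min-max principle the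
  number of eigenvalues of \<open>Re T + t Im T\<close> above \<open>1\<close> is then, after an \<open>\<epsilon>\<close>-change of the spectral
  parameter, that of the singular part up to a constant and the number of eigenvalues of \<open>Z\<^sup>* Z\<close> above
  \<open>\<epsilon> / (2 C \<bar>t\<bar>)\<close>; the latter is integrable against \<open>dt / (1 + t\<^sup>2)\<close> because \<open>Z\<^sup>* Z\<close> is of trace class.\<close>

section \<open>Hilbert space geometry\<close>

text \<open>Each count is realised by a finite orthonormal set of eigenvectors: an
  \<open>eigen_frame\<close> at r > 0 carries the eigenvalues above r, and the form is at most r on
  its complement. Comparing counts is then linear algebra, since the span of a larger orthonormal
  set contains a nonzero vector orthogonal to a smaller finite set. \<open>ssf_plus\<close> and
  \<open>ssf_minus\<close> are Bochner integrals, equal to 0 off the integrable functions, so even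
  one-sided bounds require measurability in t, which comes from lower semicontinuity of the count.
  Im T has to be bounded quadratically in Z x: a bound C |x| |Z x| would lead to square roots of the
  eigenvalues of Z^* Z, which need not be summable. The quadratic bound holds because just outside
  its band channel s has a real symmetric kernel and drops out of Im T; the kernels of the other
  channels stay bounded. In Re T the linear growth of the remainder costs one of the two factors Z
  x. At the upper edge the root is negative, and writing (-1)^|n-m| as (-1)^n (-1)^m is the source
  of J.\<close>

instance chilbert_space \<subseteq> banach ..

lemma cinner_add_left: "cinner (x + y) (z::'a::complex_inner) = cinner x z + cinner y z"
  by (subst (1 2 3) cinner_commute) (simp add: cinner_add_right)

lemma cinner_scaleC_left: "cinner (a *\<^sub>C x) (y::'a::complex_inner) = cnj a * cinner x y"
  by (subst (1 2) cinner_commute) (simp add: cinner_scaleC_right)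

lemma cinner_zero_left [simp]: "cinner 0 (y::'a::complex_inner) = 0"
  using cinner_add_left[of 0 0 y] by simp

lemma cinner_zero_right [simp]: "cinner (y::'a::complex_inner) 0 = 0"
  using cinner_add_right[of y 0 0] by simp

lemma cinner_minus_right: "cinner x (- y::'a::complex_inner) = - cinner x y"
  using cinner_add_right[of x y "- y"] by (simp add: eq_neg_iff_add_eq_0 add.commute)

lemma cinner_minus_left: "cinner (- x) (y::'a::complex_inner) = - cinner x y"
  using cinner_add_left[of x "- x" y] by (simp add: eq_neg_iff_add_eq_0 add.commute)

lemma cinner_diff_right: "cinner x (y - z::'a::complex_inner) = cinner x y - cinner x z"
  using cinner_add_right[of x y "- z"] by (simp add: cinner_minus_right)

lemma cinner_diff_left: "cinner (x - y) (z::'a::complex_inner) = cinner x z - cinner y z"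
  using cinner_add_left[of x "- y" z] by (simp add: cinner_minus_left)

lemma cinner_sum_right: "cinner x (\<Sum>i\<in>I. f i :: 'a::complex_inner) = (\<Sum>i\<in>I. cinner x (f i))"
  by (induction I rule: infinite_finite_induct) (simp_all add: cinner_add_right)

lemma cinner_sum_left: "cinner (\<Sum>i\<in>I. f i) (x :: 'a::complex_inner) = (\<Sum>i\<in>I. cinner (f i) x)"
  by (induction I rule: infinite_finite_induct) (simp_all add: cinner_add_left)

lemma cinner_scaleR_right: "cinner x (r *\<^sub>R y::'a::complex_inner) = of_real r * cinner x y"
  by (simp add: scaleR_eq_scaleC cinner_scaleC_right)

lemma cinner_scaleR_left: "cinner (r *\<^sub>R x) (y::'a::complex_inner) = of_real r * cinner x y"
  by (simp add: scaleR_eq_scaleC cinner_scaleC_left)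

lemma cinner_self: "cinner x (x::'a::complex_inner) = of_real ((norm x)\<^sup>2)"
proof (rule complex_eqI)
  show "Re (cinner x x) = Re (of_real ((norm x)\<^sup>2))"
    by (simp add: Re_cinner power2_norm_eq_inner)
  have "cinner x x = cnj (cinner x x)" by (rule cinner_commute)
  then show "Im (cinner x x) = Im (of_real ((norm x)\<^sup>2))"
    by (metis Im_complex_of_real Reals_cnj_iff complex_is_Real_iff)
qed

lemma cinner_eq_zero_commute: "cinner x (y::'a::complex_inner) = 0 \<longleftrightarrow> cinner y x = 0"
  by (subst cinner_commute) simp

lemma bounded_bilinear_cinner: "bounded_bilinear (cinner :: 'a::complex_inner \<Rightarrow> 'a \<Rightarrow> complex)"
  by standard (auto simp: cinner_add_left cinner_add_right cinner_scaleR_left cinner_scaleR_right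
      scaleR_conv_of_real intro!: exI[of _ 1] cinner_norm_bound)

lemma bounded_bilinear_scaleC:
  "bounded_bilinear (scaleC :: complex \<Rightarrow> 'a::complex_inner \<Rightarrow> 'a)"
  by standard (auto simp: scaleC_add_left scaleC_add_right scaleR_eq_scaleC scaleC_scaleC
      norm_scaleC mult.commute scaleR_conv_of_real scaleC_complex_def intro!: exI[of _ 1])

lemmas tendsto_cinner = bounded_bilinear.tendsto[OF bounded_bilinear_cinner]
lemmas tendsto_scaleC = bounded_bilinear.tendsto[OF bounded_bilinear_scaleC]
lemmas bounded_linear_cinner_right = bounded_bilinear.bounded_linear_right[OF bounded_bilinear_cinner]
lemmas bounded_linear_scaleC_right = bounded_bilinear.bounded_linear_right[OF bounded_bilinear_scaleC]
lemmas bounded_linear_scaleC_left = bounded_bilinear.bounded_linear_left[OF bounded_bilinear_scaleC]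

lemma scaleC_one [simp]: "1 *\<^sub>C (x::'a::complex_inner) = x"
  using scaleR_eq_scaleC[of 1 x] by simp

lemma norm_diff_square:
  "(norm (x - y::'a::complex_inner))\<^sup>2 = (norm x)\<^sup>2 - 2 * Re (cinner x y) + (norm y)\<^sup>2"
  by (simp add: Re_cinner power2_norm_eq_inner inner_diff_left inner_diff_right inner_commute)

lemma norm_add_square:
  "(norm (x + y::'a::complex_inner))\<^sup>2 = (norm x)\<^sup>2 + 2 * Re (cinner x y) + (norm y)\<^sup>2"
  by (simp add: Re_cinner power2_norm_eq_inner inner_add_left inner_add_right inner_commute)

lemma cinner_ext: "(\<And>w. cinner w x = cinner w y) \<Longrightarrow> x = (y::'a::complex_inner)"
  by (metis cinner_diff_right cinner_self eq_iff_diff_eq_0 norm_eq_zero of_real_eq_0_iff zero_eq_power2)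

lemma bounded_clinearD:
  assumes "bounded_clinear T"
  shows "T (x + y) = T x + T y" "T (a *\<^sub>C x) = a *\<^sub>C T x" "T 0 = 0" "T (x - y) = T x - T y"
    "T (- x) = - T x" "T (r *\<^sub>R x) = r *\<^sub>R T x"
  using assms unfolding bounded_clinear_def
  by (auto simp: linear_simps bounded_linear.linear linear_add linear_scale)

lemma bounded_clinear_sum:
  "bounded_clinear T \<Longrightarrow> T (\<Sum>i\<in>I. f i) = (\<Sum>i\<in>I. T (f i))"
  unfolding bounded_clinear_def using linear_sum bounded_linear.linear by blast

lemma bounded_clinear_bound:
  assumes "bounded_clinear T"
  obtains C where "C > 0" "\<And>x. norm (T x) \<le> C * norm x"
  using assms bounded_linear.pos_bounded[of T] unfolding bounded_clinear_def
  by (metis mult.commute)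

lemma bounded_clinearI:
  assumes "\<And>x y. T (x + y) = T x + T y" "\<And>a x. T (a *\<^sub>C x) = a *\<^sub>C T x"
    "\<And>x. norm (T x) \<le> C * norm x"
  shows "bounded_clinear T"
  unfolding bounded_clinear_def
  using assms by (auto intro!: bounded_linear_intro[where K = C] simp: scaleR_eq_scaleC mult.commute)

lemma bounded_clinear_compose:
  "bounded_clinear S \<Longrightarrow> bounded_clinear T \<Longrightarrow> bounded_clinear (S \<circ> T)"
  unfolding bounded_clinear_def comp_def using bounded_linear_compose by fastforce

lemma bounded_clinear_add:
  "bounded_clinear S \<Longrightarrow> bounded_clinear T \<Longrightarrow> bounded_clinear (\<lambda>x. S x + T x)"
  unfolding bounded_clinear_def using bounded_linear_add by (fastforce simp: scaleC_add_right)

lemma bounded_clinear_diff: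
  "bounded_clinear S \<Longrightarrow> bounded_clinear T \<Longrightarrow> bounded_clinear (\<lambda>x. S x - T x)"
  unfolding bounded_clinear_def using bounded_linear_sub
  by (fastforce simp: cvec.scale_right_diff_distrib)

lemma bounded_clinear_scaleC: "bounded_clinear T \<Longrightarrow> bounded_clinear (\<lambda>x. c *\<^sub>C T x)"
  unfolding bounded_clinear_def
  using bounded_linear_compose[OF bounded_linear_scaleC_right]
  by (auto simp: scaleC_scaleC mult.commute)

lemma bounded_clinear_id: "bounded_clinear (\<lambda>x. x)"
  by (rule bounded_clinearI[where C = 1]) auto

lemma bounded_clinear_zero: "bounded_clinear (\<lambda>x. 0)"
  by (rule bounded_clinearI[where C = 1]) auto

section \<open>Finite orthonormal sets and projections onto their spans\<close>

definition orthonormal :: "'a::complex_inner set \<Rightarrow> bool"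
  where "orthonormal B \<longleftrightarrow> (\<forall>x\<in>B. \<forall>y\<in>B. cinner x y = (if x = y then 1 else 0))"

lemma orthonormal_subset: "orthonormal B \<Longrightarrow> A \<subseteq> B \<Longrightarrow> orthonormal A"
  unfolding orthonormal_def by blast

lemma orthonormalD: "orthonormal B \<Longrightarrow> x \<in> B \<Longrightarrow> y \<in> B \<Longrightarrow> cinner x y = (if x = y then 1 else 0)"
  unfolding orthonormal_def by blast

lemma orthonormal_norm: "orthonormal B \<Longrightarrow> x \<in> B \<Longrightarrow> norm x = 1"
  using orthonormalD[of B x x] cinner_self[of x]
  by (metis abs_norm_cancel of_real_eq_1_iff real_sqrt_abs real_sqrt_one)

lemma orthonormal_insert:
  assumes "orthonormal B" "norm v = 1" "\<And>x. x \<in> B \<Longrightarrow> cinner x v = 0"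
  shows "orthonormal (insert v B)"
  using assms cinner_self[of v] cinner_eq_zero_commute
  unfolding orthonormal_def by (auto simp: cinner_eq_zero_commute)

text \<open>An explicit form of the orthogonal projection onto the span of a finite orthonormal J;
  the definite description \<open>orth_proj\<close> is reduced to it in
  \<open>spectral_proj_frame\<close>.\<close>

definition fproj :: "'a::complex_inner set \<Rightarrow> 'a \<Rightarrow> 'a"
  where "fproj J x = (\<Sum>e\<in>J. cinner e x *\<^sub>C e)"

lemma cinner_onb_sum:
  assumes "finite J" "orthonormal J" "f \<in> J"
  shows "cinner f (\<Sum>e\<in>J. a e *\<^sub>C e) = a f"
proof -
  have "cinner f (\<Sum>e\<in>J. a e *\<^sub>C e) = (\<Sum>e\<in>J. if e = f then a e else 0)"
    unfolding cinner_sum_right cinner_scaleC_right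
    by (rule sum.cong) (use assms(2,3) in \<open>auto simp: orthonormalD[OF assms(2)]\<close>)
  then show ?thesis using assms by simp
qed

lemma norm_onb_sum:
  assumes "finite J" "orthonormal J"
  shows "(norm (\<Sum>e\<in>J. a e *\<^sub>C e))\<^sup>2 = (\<Sum>e\<in>J. (cmod (a e))\<^sup>2)"
proof -
  have "complex_of_real ((norm (\<Sum>e\<in>J. a e *\<^sub>C e))\<^sup>2) = (\<Sum>f\<in>J. cnj (a f) * a f)"
    unfolding cinner_self[symmetric] cinner_sum_left[of _ J] cinner_scaleC_left
    by (rule sum.cong) (simp_all add: cinner_onb_sum assms)
  also have "\<dots> = complex_of_real (\<Sum>e\<in>J. (cmod (a e))\<^sup>2)"
    by (simp add: complex_norm_square mult.commute flip: of_real_power)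
  finally show ?thesis by (simp only: of_real_eq_iff)
qed

lemma cinner_fproj:
  assumes "finite J" "orthonormal J" "f \<in> J"
  shows "cinner f (fproj J x) = cinner f x"
  unfolding fproj_def by (rule cinner_onb_sum[OF assms])

lemma fproj_orth:
  assumes "finite J" "orthonormal J" "f \<in> J"
  shows "cinner f (x - fproj J x) = 0"
  by (simp add: cinner_diff_right cinner_fproj[OF assms])

lemma fproj_in_span: "fproj J x \<in> cvec.span J"
  unfolding fproj_def by (intro cvec.span_sum cvec.span_scale cvec.span_base)

lemma orth_span:
  assumes "\<And>e. e \<in> J \<Longrightarrow> cinner e x = 0" "w \<in> cvec.span J"
  shows "cinner w x = 0"
  using assms(2)
proof (induction rule: cvec.span_induct_alt)
  case (step c u v)
  then show ?case by (simp add: cinner_add_left cinner_scaleC_left assms(1))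
qed simp

lemma fproj_span:
  assumes "finite J" "orthonormal J" "w \<in> cvec.span J"
  shows "fproj J w = w"
proof -
  have "w - fproj J w \<in> cvec.span J"
    by (intro cvec.span_diff assms fproj_in_span)
  then have "cinner (w - fproj J w) (w - fproj J w) = 0"
    by (rule orth_span[rotated]) (rule fproj_orth[OF assms(1,2)])
  then show ?thesis by (simp add: cinner_self)
qed

lemma pythagoras_fproj:
  assumes "finite J" "orthonormal J"
  shows "(norm x)\<^sup>2 = (norm (x - fproj J x))\<^sup>2 + (\<Sum>e\<in>J. (cmod (cinner e x))\<^sup>2)"
proof -
  have "cinner (fproj J x) (x - fproj J x) = 0"
    by (rule orth_span[OF _ fproj_in_span]) (rule fproj_orth[OF assms])
  then have "cinner (x - fproj J x) (fproj J x) = 0" by (simp only: cinner_eq_zero_commute)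
  then have "(norm (x - fproj J x + fproj J x))\<^sup>2 = (norm (x - fproj J x))\<^sup>2 + (norm (fproj J x))\<^sup>2"
    by (subst norm_add_square) simp
  then show ?thesis
    using norm_onb_sum[OF assms, of "\<lambda>e. cinner e x"] by (simp add: fproj_def)
qed

lemma bessel:
  assumes "finite J" "orthonormal J"
  shows "(\<Sum>e\<in>J. (cmod (cinner e x))\<^sup>2) \<le> (norm x)\<^sup>2"
  using pythagoras_fproj[OF assms, of x] by simp

lemma fproj_best:
  assumes "finite J" "orthonormal J" "y \<in> cvec.span J"
  shows "norm (x - fproj J x) \<le> norm (x - y)"
proof (rule power2_le_imp_le)
  have "cinner (fproj J x - y) (x - fproj J x) = 0"
    by (rule orth_span[of J])
      (auto intro: fproj_orth[OF assms(1,2)] cvec.span_diff fproj_in_span assms(3))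
  then have "cinner (x - fproj J x) (fproj J x - y) = 0" by (simp only: cinner_eq_zero_commute)
  then have "(norm (x - fproj J x + (fproj J x - y)))\<^sup>2
      = (norm (x - fproj J x))\<^sup>2 + (norm (fproj J x - y))\<^sup>2"
    by (subst norm_add_square) simp
  then show "(norm (x - fproj J x))\<^sup>2 \<le> (norm (x - y))\<^sup>2" by simp
qed simp

section \<open>Closed subspaces, the Riesz theorem and adjoints\<close>

lemma projection_exists:
  fixes x :: "'a::chilbert_space"
  assumes X: "closed X" "cvec.subspace X"
  shows "\<exists>y\<in>X. \<forall>w\<in>X. cinner w (x - y) = 0"
proof -
  have X0: "0 \<in> X" using X(2) by (rule cvec.subspace_0)
  define m where "m = (INF y\<in>X. norm (x - y))"
  have bdd: "bdd_below ((\<lambda>y. norm (x - y)) ` X)" by (rule bdd_belowI[of _ 0]) auto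
  have m_le: "m \<le> norm (x - y)" if "y \<in> X" for y
    unfolding m_def using bdd that by (rule cINF_lower)
  have m0: "0 \<le> m" unfolding m_def by (rule cINF_greatest) (use X0 in auto)
  have "\<exists>y\<in>X. norm (x - y) < m + inverse (real (Suc n))" for n
  proof -
    have "m < m + inverse (real (Suc n))" by simp
    moreover have "X \<noteq> {}" using X0 by auto
    ultimately show ?thesis
      using cINF_less_iff[OF \<open>X \<noteq> {}\<close> bdd, of "m + inverse (real (Suc n))"]
      unfolding m_def by blast
  qed
  then obtain u where u: "\<And>n. u n \<in> X" "\<And>n. norm (x - u n) < m + inverse (real (Suc n))"
    by metis
  \<comment> \<open>The parallelogram identity for x - u i and x - u j: midpoints of the minimising
    sequence stay in X, hence at distance at least m from x, and this makes u a Cauchy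
    sequence.\<close>
  have par: "(norm (u i - u j))\<^sup>2 \<le> 2 * (norm (x - u i))\<^sup>2 + 2 * (norm (x - u j))\<^sup>2 - 4 * m\<^sup>2" for i j
  proof -
    have "(1/2) *\<^sub>R (u i + u j) \<in> X"
      using X(2) u(1) by (simp add: scaleR_eq_scaleC cvec.subspace_def)
    then have "m \<le> norm (x - (1/2) *\<^sub>R (u i + u j))" by (rule m_le)
    then have "m\<^sup>2 \<le> (norm (x - (1/2) *\<^sub>R (u i + u j)))\<^sup>2" using m0 by (rule power_mono)
    moreover have "(x - u i) + (x - u j) = 2 *\<^sub>R (x - (1/2) *\<^sub>R (u i + u j))"
      by (simp add: algebra_simps scaleR_2)
    then have "(norm ((x - u i) + (x - u j)))\<^sup>2 = 4 * (norm (x - (1/2) *\<^sub>R (u i + u j)))\<^sup>2"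
      by (simp add: power_mult_distrib)
    moreover have "(norm ((x - u i) - (x - u j)))\<^sup>2 + (norm ((x - u i) + (x - u j)))\<^sup>2
      = 2 * (norm (x - u i))\<^sup>2 + 2 * (norm (x - u j))\<^sup>2"
      unfolding norm_diff_square norm_add_square by simp
    moreover have "(norm ((x - u i) - (x - u j)))\<^sup>2 = (norm (u i - u j))\<^sup>2"
      by (simp add: norm_minus_commute)
    ultimately show ?thesis by linarith
  qed
  have lim: "(\<lambda>n. norm (x - u n)) \<longlonglongrightarrow> m"
  proof (rule tendsto_sandwich[of "\<lambda>_. m" _ _ "\<lambda>n. m + inverse (real (Suc n))"])
    show "(\<lambda>n. m + inverse (real (Suc n))) \<longlonglongrightarrow> m"
      using tendsto_add[OF tendsto_const LIMSEQ_inverse_real_of_nat, of m] by simp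
    show "\<forall>\<^sub>F n in sequentially. norm (x - u n) \<le> m + inverse (real (Suc n))"
      by (rule always_eventually) (use u(2) less_imp_le in blast)
  qed (use m_le u(1) in auto)
  have "Cauchy u"
  proof (rule metric_CauchyI)
    fix e :: real assume "0 < e"
    have "(\<lambda>n. (norm (x - u n))\<^sup>2) \<longlonglongrightarrow> m\<^sup>2" by (intro tendsto_intros lim)
    then obtain N where N: "\<And>n. n \<ge> N \<Longrightarrow> \<bar>(norm (x - u n))\<^sup>2 - m\<^sup>2\<bar> < e\<^sup>2 / 4"
      using LIMSEQ_D[of _ "m\<^sup>2" "e\<^sup>2 / 4"] \<open>0 < e\<close> by auto
    have "dist (u i) (u j) < e" if "i \<ge> N" "j \<ge> N" for i j
    proof -
      have "(norm (u i - u j))\<^sup>2 < e\<^sup>2"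
        using par[of i j] N[OF that(1)] N[OF that(2)] by linarith
      then show ?thesis using \<open>0 < e\<close> by (simp add: dist_norm power_less_imp_less_base)
    qed
    then show "\<exists>M. \<forall>i\<ge>M. \<forall>j\<ge>M. dist (u i) (u j) < e" by blast
  qed
  then obtain y where y: "u \<longlonglongrightarrow> y" using Cauchy_convergent_iff convergent_def by blast
  have yX: "y \<in> X" using X(1) u(1) y by (rule closed_sequentially)
  have "(\<lambda>n. norm (x - u n)) \<longlonglongrightarrow> norm (x - y)" by (intro tendsto_intros y)
  then have my: "norm (x - y) = m" using lim LIMSEQ_unique by blast
  have "cinner w (x - y) = 0" if w: "w \<in> X" for w
  proof (cases "w = 0")
    case False
    \<comment> \<open>The multiple of w that minimises |x - y - c w|; minimality of y then leaves no
      room for a nonzero \<open>cinner w (x - y)\<close>.\<close>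
    define c where "c = cinner w (x - y) / of_real ((norm w)\<^sup>2)"
    have "y + c *\<^sub>C w \<in> X" using yX w X(2) by (simp add: cvec.subspace_def)
    then have "m \<le> norm (x - (y + c *\<^sub>C w))" by (rule m_le)
    then have "m\<^sup>2 \<le> (norm ((x - y) - c *\<^sub>C w))\<^sup>2" using m0 by (simp add: power_mono algebra_simps)
    also have "\<dots> = m\<^sup>2 - 2 * Re (c * cinner (x - y) w) + (cmod c * norm w)\<^sup>2"
      by (simp add: norm_diff_square my cinner_scaleC_right norm_scaleC)
    also have "cinner (x - y) w = cnj (cinner w (x - y))" by (rule cinner_commute)
    also have "c * cnj (cinner w (x - y)) = of_real ((cmod (cinner w (x - y)))\<^sup>2 / (norm w)\<^sup>2)"
      by (simp add: c_def complex_norm_square[symmetric] flip: of_real_power)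
    also have "(cmod c * norm w)\<^sup>2 = (cmod (cinner w (x - y)))\<^sup>2 / (norm w)\<^sup>2"
    proof -
      have "cmod c = cmod (cinner w (x - y)) / (norm w)\<^sup>2"
        unfolding c_def norm_divide norm_of_real by simp
      then show ?thesis using False by (simp add: power2_eq_square)
    qed
    finally have "(cmod (cinner w (x - y)))\<^sup>2 / (norm w)\<^sup>2 \<le> 0" by simp
    then show ?thesis using False by (simp add: divide_le_0_iff)
  qed simp
  then show ?thesis using yX by blast
qed

lemma orth_proj_eq:
  assumes "y \<in> X" "\<And>w. w \<in> X \<Longrightarrow> cinner w (x - y) = 0" "cvec.subspace X"
  shows "orth_proj X x = y"
  unfolding orth_proj_def
proof (rule the_equality)
  fix y' assume y': "y' \<in> X \<and> (\<forall>w\<in>X. cinner w (x - y') = 0)"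
  have "y' - y \<in> X" using y' assms by (simp add: cvec.subspace_diff)
  then have "cinner (y' - y) (x - y) = 0" "cinner (y' - y) (x - y') = 0" using y' assms by auto
  then have "cinner (y' - y) (y' - y) = 0" by (simp add: cinner_diff_right)
  then show "y' = y" by (simp add: cinner_self)
qed (use assms in auto)

text \<open>For nonzero f the kernel is a closed hyperplane, and a vector v orthogonal to it
  represents f up to a scalar, because f(x) v - f(v) x lies in the kernel for every x.\<close>

lemma riesz_representation:
  fixes f :: "'a::chilbert_space \<Rightarrow> complex"
  assumes f: "bounded_clinear f"
  shows "\<exists>y. \<forall>x. f x = cinner y x"
proof (cases "\<forall>x. f x = 0")
  case True
  then show ?thesis by (intro exI[of _ 0]) auto
next
  case False
  then obtain x0 where x0: "f x0 \<noteq> 0" by blast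
  define X where "X = {x. f x = 0}"
  have "continuous_on UNIV f"
    using f by (simp add: bounded_clinear_def linear_continuous_on)
  then have "closed X"
    unfolding X_def using continuous_closed_vimage[of "{0}" f]
    by (simp add: vimage_def continuous_on_eq_continuous_at)
  moreover have "cvec.subspace X"
    unfolding X_def cvec.subspace_def by (auto simp: bounded_clinearD[OF f])
  ultimately obtain y0 where y0: "y0 \<in> X" "\<And>w. w \<in> X \<Longrightarrow> cinner w (x0 - y0) = 0"
    using projection_exists by blast
  define v where "v = x0 - y0"
  have fv: "f v = f x0" using y0(1) by (simp add: v_def X_def bounded_clinearD[OF f])
  then have "v \<noteq> 0" using x0 bounded_clinearD(3)[OF f] by auto
  have "f x = cinner ((cnj (f v) / of_real ((norm v)\<^sup>2)) *\<^sub>C v) x" for x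
  proof -
    have "f x *\<^sub>C v - f v *\<^sub>C x \<in> X"
      by (simp add: X_def bounded_clinearD[OF f] scaleC_complex_def)
    then have "cinner (f x *\<^sub>C v - f v *\<^sub>C x) v = 0" using y0(2) by (simp add: v_def)
    then have "cinner v (f x *\<^sub>C v - f v *\<^sub>C x) = 0" by (simp add: cinner_eq_zero_commute)
    then have "f x * of_real ((norm v)\<^sup>2) = f v * cinner v x"
      by (simp only: cinner_diff_right cinner_scaleC_right cinner_self right_minus_eq)
    then show ?thesis using \<open>v \<noteq> 0\<close> by (simp add: cinner_scaleC_left field_simps)
  qed
  then show ?thesis by blast
qed

text \<open>The weak identity fixes S y for each y, so the definite description in
  \<open>cadjoint\<close> has a single candidate. The explicit adjoints of \<open>Y\<close>, of
  \<open>M\<close> and of the coordinatewise maps are identified this way.\<close>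

lemma cadjoint_eqI:
  assumes "\<And>x y. cinner (S y) x = cinner y (T x)"
  shows "cadjoint T = S"
  unfolding cadjoint_def
proof (rule the_equality)
  fix S' assume "\<forall>x y. cinner (S' y) x = cinner y (T x)"
  then show "S' = S"
  proof (rule_tac ext, rule_tac cinner_ext)
    fix y w assume a: "\<forall>x y. cinner (S' y) x = cinner y (T x)"
    show "cinner w (S' y) = cinner w (S y)"
      by (subst (1 2) cinner_commute) (simp add: a assms)
  qed
qed (use assms in auto)

lemma cadjoint_works:
  fixes T :: "'a::chilbert_space \<Rightarrow> 'b::complex_inner"
  assumes T: "bounded_clinear T"
  shows "cinner (cadjoint T y) x = cinner y (T x)"
proof -
  have "\<exists>z. \<forall>x. cinner y (T x) = cinner z x" for y
  proof (rule riesz_representation)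
    obtain C where C: "C > 0" "\<And>x. norm (T x) \<le> C * norm x"
      using bounded_clinear_bound[OF T] by blast
    show "bounded_clinear (\<lambda>x. cinner y (T x))"
    proof (rule bounded_clinearI[where C = "norm y * C"])
      fix x
      have "cmod (cinner y (T x)) \<le> norm y * norm (T x)" by (rule cinner_norm_bound)
      also have "\<dots> \<le> norm y * (C * norm x)" by (rule mult_left_mono[OF C(2)]) simp
      finally show "cmod (cinner y (T x)) \<le> norm y * C * norm x" by simp
    qed (simp_all add: bounded_clinearD[OF T] cinner_add_right cinner_scaleC_right scaleC_complex_def)
  qed
  then obtain S where S: "\<And>y x. cinner y (T x) = cinner (S y) x" by metis
  then have "cadjoint T = S" by (intro cadjoint_eqI) simp
  then show ?thesis using S by simp
qed

lemma cadjoint_works':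
  fixes T :: "'a::chilbert_space \<Rightarrow> 'b::complex_inner"
  assumes T: "bounded_clinear T"
  shows "cinner x (cadjoint T y) = cinner (T x) y"
  by (subst (1 2) cinner_commute) (simp add: cadjoint_works[OF T])

lemma cadjoint_bound:
  fixes T :: "'a::chilbert_space \<Rightarrow> 'b::complex_inner"
  assumes T: "bounded_clinear T" and C: "\<And>x. norm (T x) \<le> C * norm x" and C0: "0 \<le> C"
  shows "norm (cadjoint T y) \<le> C * norm y"
proof (cases "cadjoint T y = 0")
  case True
  then show ?thesis using C0 by simp
next
  case False
  have "(norm (cadjoint T y))\<^sup>2 = Re (cinner (cadjoint T y) (cadjoint T y))" by (simp add: cinner_self)
  also have "\<dots> = Re (cinner y (T (cadjoint T y)))" by (simp add: cadjoint_works[OF T])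
  also have "\<dots> \<le> norm y * norm (T (cadjoint T y))"
    using cinner_norm_bound complex_Re_le_cmod order_trans by blast
  also have "\<dots> \<le> norm y * (C * norm (cadjoint T y))" by (intro mult_left_mono C) simp
  finally show ?thesis using False by (simp add: power2_eq_square mult_ac)
qed

lemma bounded_clinear_cadjoint:
  fixes T :: "'a::chilbert_space \<Rightarrow> 'b::complex_inner"
  assumes T: "bounded_clinear T"
  shows "bounded_clinear (cadjoint T)"
proof -
  obtain C where C: "C > 0" "\<And>x. norm (T x) \<le> C * norm x"
    using bounded_clinear_bound[OF T] by blast
  show ?thesis
  proof (rule bounded_clinearI[where C = C])
    show "norm (cadjoint T x) \<le> C * norm x" for x using C by (intro cadjoint_bound[OF T]) auto
  qed (rule cinner_ext, simp add: cadjoint_works'[OF T] cinner_add_right cinner_scaleC_right)+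
qed

section \<open>Orthonormal bases and the Parseval identity\<close>

lemma span_closure_subspace:
  "cvec.subspace (closure (cvec.span (B :: 'a::complex_inner set)))"
proof -
  note sq = closure_sequential
  show ?thesis
    unfolding cvec.subspace_def
  proof (intro conjI ballI allI)
    show "0 \<in> closure (cvec.span B)" using closure_subset cvec.span_zero by blast
    fix x y c assume "x \<in> closure (cvec.span B)"
    then obtain f where f: "\<And>n. f n \<in> cvec.span B" "f \<longlonglongrightarrow> x" unfolding sq by blast
    then have "(\<lambda>n. c *\<^sub>C f n) \<longlonglongrightarrow> c *\<^sub>C x" "\<And>n. c *\<^sub>C f n \<in> cvec.span B"
      by (auto intro: tendsto_scaleC cvec.span_scale)
    then show "c *\<^sub>C x \<in> closure (cvec.span B)" unfolding sq by (intro exI[of _ "\<lambda>n. c *\<^sub>C f n"]) auto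
    assume "y \<in> closure (cvec.span B)"
    then obtain g where "\<And>n. g n \<in> cvec.span B" "g \<longlonglongrightarrow> y" unfolding sq by blast
    with f have "(\<lambda>n. f n + g n) \<longlonglongrightarrow> x + y" "\<And>n. f n + g n \<in> cvec.span B"
      by (auto intro: tendsto_intros cvec.span_add)
    then show "x + y \<in> closure (cvec.span B)" unfolding sq by (intro exI[of _ "\<lambda>n. f n + g n"]) auto
  qed
qed

lemma orth_closure_span:
  assumes "\<And>e. e \<in> J \<Longrightarrow> cinner e x = 0" "w \<in> closure (cvec.span J)"
  shows "cinner w (x::'a::complex_inner) = 0"
proof -
  obtain f where f: "\<And>n. f n \<in> cvec.span J" "f \<longlonglongrightarrow> w"
    using assms(2) unfolding closure_sequential by blast
  have "(\<lambda>n. cinner (f n) x) \<longlonglongrightarrow> cinner w x" by (intro tendsto_cinner f tendsto_const)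
  moreover have "cinner (f n) x = 0" for n using orth_span[OF assms(1) f(1)] by blast
  ultimately show ?thesis using LIMSEQ_unique[OF _ tendsto_const] by force
qed

text \<open>Zorn's lemma gives a maximal orthonormal set; were its span not dense, the normalised
  residual of a projection onto the closure would enlarge it. This gives \<open>some_onb\<close> its
  meaning in \<open>hilbert_schmidt\<close>, \<open>hs_norm\<close> and
  \<open>trace_op\<close>.\<close>

lemma orthonormal_basis_exists: "\<exists>B :: 'a::chilbert_space set. orthonormal_basis B"
proof -
  have "\<exists>M\<in>{B :: 'a set. orthonormal B}. \<forall>X\<in>{B. orthonormal B}. M \<subseteq> X \<longrightarrow> X = M"
  proof (rule subset_Zorn_nonempty)
    show "{B :: 'a set. orthonormal B} \<noteq> {}" by (auto simp: orthonormal_def)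
    fix C :: "'a set set" assume C: "C \<noteq> {}" "subset.chain {B. orthonormal B} C"
    show "\<Union>C \<in> {B. orthonormal B}"
      unfolding mem_Collect_eq orthonormal_def
    proof (intro ballI)
      fix x y assume "x \<in> \<Union>C" "y \<in> \<Union>C"
      then obtain X Y where XY: "X \<in> C" "Y \<in> C" "x \<in> X" "y \<in> Y" by blast
      then have "X \<subseteq> Y \<or> Y \<subseteq> X" using C(2) by (auto simp: subset.chain_def)
      then obtain Z where "Z \<in> C" "x \<in> Z" "y \<in> Z" using XY by blast
      moreover have "orthonormal Z" using C(2) \<open>Z \<in> C\<close> by (auto simp: subset.chain_def)
      ultimately show "cinner x y = (if x = y then 1 else 0)" by (rule_tac orthonormalD)
    qed
  qed
  then obtain M :: "'a set" where M: "orthonormal M" "\<And>X. orthonormal X \<Longrightarrow> M \<subseteq> X \<Longrightarrow> X = M"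
    by blast
  have "x \<in> closure (cvec.span M)" for x
  proof (rule ccontr)
    assume x: "x \<notin> closure (cvec.span M)"
    obtain y where y: "y \<in> closure (cvec.span M)" "\<And>w. w \<in> closure (cvec.span M) \<Longrightarrow> cinner w (x - y) = 0"
      using projection_exists[OF closed_closure span_closure_subspace] by blast
    define v where "v = (1 / norm (x - y)) *\<^sub>R (x - y)"
    have ne: "x - y \<noteq> 0" using x y by auto
    have "cinner e v = 0" if "e \<in> M" for e
      using y(2)[of e] that closure_subset cvec.span_base
      unfolding v_def cinner_scaleR_right by fastforce
    moreover have nv: "norm v = 1" using ne by (simp add: v_def)
    ultimately have "orthonormal (insert v M)" by (intro orthonormal_insert M)
    then have "insert v M = M" by (intro M(2)) auto
    then have "v \<in> M" by blast
    then have "cinner v v = 0" using \<open>\<And>e. e \<in> M \<Longrightarrow> cinner e v = 0\<close> by blast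
    then show False using nv by (simp add: cinner_self)
  qed
  then show ?thesis using M(1) unfolding orthonormal_basis_def orthonormal_def by blast
qed

lemma some_onb:
  "orthonormal (some_onb :: 'a::chilbert_space set)"
  "closure (cvec.span (some_onb :: 'a set)) = UNIV"
proof -
  have "orthonormal_basis (some_onb :: 'a set)"
    unfolding some_onb_def using orthonormal_basis_exists by (rule someI_ex)
  then show "orthonormal (some_onb :: 'a::chilbert_space set)"
    "closure (cvec.span (some_onb :: 'a set)) = UNIV"
    unfolding orthonormal_basis_def orthonormal_def by auto
qed

text \<open>Bessel's inequality bounds the sum from above. From below, x is approximated in the span
  of finitely many basis vectors F, where \<open>fproj F x\<close> is the best
  approximation.\<close>

lemma parseval:
  fixes x :: "'a::chilbert_space"
  shows "((\<lambda>e. (cmod (cinner e x))\<^sup>2) has_sum (norm x)\<^sup>2) some_onb"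
proof -
  let ?f = "\<lambda>e. (cmod (cinner e x))\<^sup>2"
  have fin: "sum ?f F \<le> (norm x)\<^sup>2" if "finite F" "F \<subseteq> some_onb" for F
    using bessel[OF that(1) orthonormal_subset[OF some_onb(1) that(2)]] .
  have sm: "?f summable_on some_onb"
    by (rule nonneg_bdd_above_summable_on) (auto intro!: bdd_aboveI[of _ "(norm x)\<^sup>2"] fin)
  have "infsum ?f some_onb \<le> (norm x)\<^sup>2"
    using sm fin by (rule infsum_le_finite_sums)
  moreover have "(norm x)\<^sup>2 \<le> infsum ?f some_onb"
  proof (rule field_le_epsilon)
    fix e :: real assume "0 < e"
    have "x \<in> closure (cvec.span some_onb)" using some_onb(2) by auto
    then obtain y where y: "y \<in> cvec.span some_onb" "dist y x < sqrt e"
      unfolding closure_approachable using \<open>0 < e\<close> by (meson real_sqrt_gt_zero)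
    from y(1) obtain F r where F: "finite F" "F \<subseteq> some_onb" "y = (\<Sum>a\<in>F. r a *\<^sub>C a)"
      unfolding cvec.span_explicit by blast
    have oF: "orthonormal F" using orthonormal_subset[OF some_onb(1) F(2)] .
    have "y \<in> cvec.span F" unfolding F(3) by (intro cvec.span_sum cvec.span_scale cvec.span_base)
    then have "norm (x - fproj F x) \<le> norm (x - y)" by (rule fproj_best[OF F(1) oF])
    also have "\<dots> \<le> sqrt e" using y(2) by (simp add: dist_norm norm_minus_commute)
    finally have "(norm (x - fproj F x))\<^sup>2 \<le> e"
      using \<open>0 < e\<close> by (metis norm_ge_zero power_mono real_sqrt_pow2 less_imp_le)
    then have "(norm x)\<^sup>2 \<le> sum ?f F + e" using pythagoras_fproj[OF F(1) oF, of x] by linarith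
    moreover have "sum ?f F \<le> infsum ?f some_onb"
      by (rule finite_sum_le_infsum[OF sm F(1,2)]) auto
    ultimately show "(norm x)\<^sup>2 \<le> infsum ?f some_onb + e" by linarith
  qed
  ultimately show ?thesis using sm by (simp add: has_sum_iff)
qed

text \<open>Density and continuity; this separates Hilbert-Schmidt limits in
  \<open>hs_norm_limit_unique\<close>.\<close>

lemma bounded_clinear_eq_on_onb:
  fixes S T :: "'a::chilbert_space \<Rightarrow> 'b::complex_inner"
  assumes "bounded_clinear S" "bounded_clinear T" "\<And>e. e \<in> some_onb \<Longrightarrow> S e = T e"
  shows "S = T"
proof
  fix x :: 'a
  have sp: "S y = T y" if "y \<in> cvec.span some_onb" for y
    using that
    by (induction rule: cvec.span_induct_alt)
      (simp_all add: bounded_clinearD[OF assms(1)] bounded_clinearD[OF assms(2)] assms(3))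
  have "x \<in> closure (cvec.span some_onb)" by (simp add: some_onb(2))
  then obtain f where f: "\<And>n. f n \<in> cvec.span some_onb" "f \<longlonglongrightarrow> x"
    unfolding closure_sequential by blast
  have "(\<lambda>n. S (f n)) \<longlonglongrightarrow> S x" "(\<lambda>n. T (f n)) \<longlonglongrightarrow> T x"
    using assms(1,2) f(2) unfolding bounded_clinear_def by (auto intro: bounded_linear.tendsto)
  then show "S x = T x" using sp[OF f(1)] LIMSEQ_unique by simp
qed

section \<open>Spectral theory of form-compact operators\<close>

definition qform :: "('a::complex_inner \<Rightarrow> 'a) \<Rightarrow> 'a \<Rightarrow> real"
  where "qform S x = Re (cinner x (S x))"

text \<open>Subspaces of finite codimension enter only as complements of finite sets F, with
  \<open>card F\<close> bounding the codimension.\<close>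

definition orth_to :: "'a::complex_inner set \<Rightarrow> 'a \<Rightarrow> bool"
  where "orth_to F x \<longleftrightarrow> (\<forall>f\<in>F. cinner f x = 0)"

text \<open>For self-adjoint \<open>S\<close> the second condition is equivalent to compactness.\<close>

definition form_compact :: "('a::complex_inner \<Rightarrow> 'a) \<Rightarrow> bool"
  where "form_compact S \<longleftrightarrow> selfadjoint_op S \<and>
    (\<forall>\<epsilon>>0. \<exists>F. finite F \<and> (\<forall>x. orth_to F x \<longrightarrow> \<bar>qform S x\<bar> \<le> \<epsilon> * (norm x)\<^sup>2))"

definition eigen_system :: "('a::complex_inner \<Rightarrow> 'a) \<Rightarrow> real \<Rightarrow> 'a set \<Rightarrow> ('a \<Rightarrow> real) \<Rightarrow> bool"
  where "eigen_system S r J b \<longleftrightarrow> finite J \<and> orthonormal J \<and>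
    (\<forall>e\<in>J. S e = of_real (b e) *\<^sub>C e \<and> r < b e)"

text \<open>Completeness of the system above r is expressed by the form on the complement of J. This
  is the shape in which min-max uses it, and \<open>eigen_frame_span\<close> shows that J then spans
  all eigenvectors above r.\<close>

definition eigen_frame :: "('a::complex_inner \<Rightarrow> 'a) \<Rightarrow> real \<Rightarrow> 'a set \<Rightarrow> ('a \<Rightarrow> real) \<Rightarrow> bool"
  where "eigen_frame S r J b \<longleftrightarrow> eigen_system S r J b \<and>
    (\<forall>x. orth_to J x \<longrightarrow> qform S x \<le> r * (norm x)\<^sup>2)"

lemma orth_to_Un [simp]: "orth_to (F \<union> G) x \<longleftrightarrow> orth_to F x \<and> orth_to G x"
  unfolding orth_to_def by blast

section \<open>Dimension counts and min-max comparison\<close>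

lemma selfadjointD:
  assumes "selfadjoint_op S"
  shows "bounded_clinear S" "cinner (S x) y = cinner x (S y)"
  using assms unfolding selfadjoint_op_def by auto

text \<open>Gaussian elimination: the equation f is solved for an unknown i with nonzero pivot
  \<open>c f i\<close> and substituted into the others, which leaves one equation and one unknown
  fewer.\<close>

lemma homogeneous_system:
  fixes c :: "'f \<Rightarrow> 'j \<Rightarrow> 'k::field"
  assumes "finite F" "finite J" "card F < card J"
  shows "\<exists>a. (\<exists>j\<in>J. a j \<noteq> 0) \<and> (\<forall>f\<in>F. (\<Sum>j\<in>J. a j * c f j) = 0)"
  using assms
proof (induction F arbitrary: J c rule: finite_induct)
  case empty
  then obtain j where "j \<in> J" by fastforce
  then show ?case by (intro exI[of _ "\<lambda>_. 1"]) auto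
next
  case (insert f F)
  show ?case
  proof (cases "\<forall>j\<in>J. c f j = 0")
    case True
    have "card F < card J" using insert by simp
    then obtain a where a: "\<exists>j\<in>J. a j \<noteq> 0" "\<forall>f\<in>F. (\<Sum>j\<in>J. a j * c f j) = 0"
      using insert.IH[OF insert.prems(1), of c] by blast
    then show ?thesis using True by (intro exI[of _ a]) auto
  next
    case False
    then obtain i where i: "i \<in> J" "c f i \<noteq> 0" by blast
    have "card F < card (J - {i})" "finite (J - {i})"
      using insert i by (simp_all add: card_Diff_singleton)
    then obtain a where a: "\<exists>j\<in>J-{i}. a j \<noteq> 0"
      "\<forall>g\<in>F. (\<Sum>j\<in>J-{i}. a j * (c g j - c g i * c f j / c f i)) = 0"
      using insert.IH[of "J - {i}" "\<lambda>g j. c g j - c g i * c f j / c f i"] by blast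
    define s where "s = (\<Sum>j\<in>J-{i}. a j * c f j)"
    \<comment> \<open>The value at i is chosen so that the eliminated equation f holds.\<close>
    define a' where "a' j = (if j = i then - s / c f i else a j)" for j
    have split: "(\<Sum>j\<in>J. a' j * c g j) = - s / c f i * c g i + (\<Sum>j\<in>J-{i}. a j * c g j)" for g
      unfolding sum.remove[OF insert.prems(1) i(1)] a'_def by simp
    have "(\<Sum>j\<in>J. a' j * c g j) = 0" if "g \<in> F" for g
    proof -
      have "(\<Sum>j\<in>J-{i}. a j * (c g j - c g i * c f j / c f i))
        = (\<Sum>j\<in>J-{i}. a j * c g j) - (\<Sum>j\<in>J-{i}. (c g i / c f i) * (a j * c f j))"
        unfolding sum_subtractf[symmetric] by (rule sum.cong) (simp_all add: algebra_simps)
      also have "\<dots> = (\<Sum>j\<in>J-{i}. a j * c g j) - (c g i / c f i) * s"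
        by (simp add: s_def sum_distrib_left)
      finally have "(\<Sum>j\<in>J-{i}. a j * c g j) = (c g i / c f i) * s" using a(2) that by simp
      then show ?thesis unfolding split by simp
    qed
    moreover have "(\<Sum>j\<in>J. a' j * c f j) = 0" using split[of f] i by (simp add: s_def)
    moreover have "\<exists>j\<in>J. a' j \<noteq> 0" using a(1) by (auto simp: a'_def)
    ultimately show ?thesis by (intro exI[of _ a']) auto
  qed
qed

text \<open>Fewer linear conditions than free coefficients. The lower min-max bounds take their test
  vectors from here.\<close>

lemma orthonormal_combination:
  assumes "finite F" "finite J" "orthonormal J" "card F < card J"
  shows "\<exists>x\<in>cvec.span J. x \<noteq> 0 \<and> orth_to F x"
proof -
  obtain a where a: "\<exists>j\<in>J. a j \<noteq> 0" "\<forall>f\<in>F. (\<Sum>j\<in>J. a j * cinner f j) = 0"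
    using homogeneous_system[OF assms(1,2,4), of cinner] by blast
  define x where "x = (\<Sum>j\<in>J. a j *\<^sub>C j)"
  have "x \<in> cvec.span J" unfolding x_def by (intro cvec.span_sum cvec.span_scale cvec.span_base)
  moreover have "x \<noteq> 0"
    using a(1) cinner_onb_sum[OF assms(2,3), of _ a] unfolding x_def by force
  moreover have "orth_to F x"
    using a(2) by (simp add: orth_to_def x_def cinner_sum_right cinner_scaleC_right)
  ultimately show ?thesis by blast
qed

text \<open>The vectors of F may be dependent, hence only an inequality between the cardinalities;
  what has to survive are the orthogonality conditions.\<close>

lemma gram_schmidt:
  assumes "finite F"
  shows "\<exists>G. finite G \<and> orthonormal G \<and> card G \<le> card F \<and> (\<forall>x. orth_to G x \<longrightarrow> orth_to F x)"
  using assms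
proof (induction F)
  case empty
  show ?case by (intro exI[of _ "{}"]) (auto simp: orthonormal_def orth_to_def)
next
  case (insert f F)
  then obtain G where G: "finite G" "orthonormal G" "card G \<le> card F" "\<And>x. orth_to G x \<Longrightarrow> orth_to F x"
    by blast
  define v where "v = f - fproj G f"
  have vG: "cinner e v = 0" if "e \<in> G" for e
    unfolding v_def by (rule fproj_orth[OF G(1,2) that])
  have f: "cinner f x = cinner v x" if "orth_to G x" for x
    using that orth_span[OF _ fproj_in_span, of G x f]
    by (simp add: v_def cinner_diff_left orth_to_def)
  show ?case
  proof (cases "v = 0")
    case True
    then show ?thesis using G f insert by (intro exI[of _ G]) (auto simp: orth_to_def)
  next
    case False
    let ?u = "(1 / norm v) *\<^sub>R v"
    have "orthonormal (insert ?u G)"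
      by (rule orthonormal_insert[OF G(2)]) (use False vG in \<open>auto simp: cinner_scaleR_right\<close>)
    moreover have "orth_to (insert f F) x" if "orth_to (insert ?u G) x" for x
      using that G(4)[of x] f[of x] False by (auto simp: orth_to_def cinner_scaleR_left)
    ultimately show ?thesis using G insert
      by (intro exI[of _ "insert ?u G"]) (auto simp: card_insert_if)
  qed
qed

text \<open>The span of J is invariant under S and S is self-adjoint, so the cross terms between the
  projection and the residual vanish.\<close>

lemma qform_decomp:
  assumes S: "selfadjoint_op S" and J: "finite J" "orthonormal J" "\<forall>e\<in>J. S e = of_real (b e) *\<^sub>C e"
  shows "qform S x = (\<Sum>e\<in>J. b e * (cmod (cinner e x))\<^sup>2) + qform S (x - fproj J x)"
proof -
  note S' = selfadjointD[OF S]
  define p where "p = fproj J x"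
  define y where "y = x - p"
  have Sp: "S p = (\<Sum>e\<in>J. (cinner e x * of_real (b e)) *\<^sub>C e)"
    unfolding p_def fproj_def bounded_clinear_sum[OF S'(1)]
    by (rule sum.cong) (simp_all add: bounded_clinearD[OF S'(1)] J(3) scaleC_scaleC)
  have ey: "cinner e y = 0" if "e \<in> J" for e
    unfolding y_def p_def by (rule fproj_orth[OF J(1,2) that])
  have "cinner (S p) y = 0"
    unfolding Sp cinner_sum_left cinner_scaleC_left by (simp add: ey)
  then have 1: "cinner p (S y) = 0" "cinner y (S p) = 0"
    by (simp_all add: S'(2) cinner_eq_zero_commute[of y "S p"])
  have "cinner p (S p) = (\<Sum>f\<in>J. cnj (cinner f x) * (cinner f x * of_real (b f)))"
    unfolding p_def fproj_def cinner_sum_left cinner_scaleC_left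
    by (rule sum.cong) (simp_all add: cinner_onb_sum[OF J(1,2)] Sp[unfolded p_def fproj_def])
  also have "\<dots> = of_real (\<Sum>e\<in>J. b e * (cmod (cinner e x))\<^sup>2)"
    by (simp add: complex_norm_square mult_ac flip: of_real_power)
  finally have 2: "cinner p (S p) = of_real (\<Sum>e\<in>J. b e * (cmod (cinner e x))\<^sup>2)" .
  have "x = p + y" by (simp add: y_def)
  then have "cinner x (S x) = cinner p (S p) + cinner y (S y)"
    using 1 by (simp add: bounded_clinearD[OF S'(1)] cinner_add_left cinner_add_right)
  then show ?thesis using 2 by (simp add: qform_def y_def p_def)
qed

text \<open>Strictness holds because x has a nonzero coefficient along some e in J, where b e > r.
  It turns the intersection of this span with a complement into a contradiction.\<close>

lemma qform_span_gt:
  assumes S: "selfadjoint_op S" and J: "eigen_system S r J b" and x: "x \<in> cvec.span J" "x \<noteq> 0"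
  shows "qform S x > r * (norm x)\<^sup>2"
proof -
  have J': "finite J" "orthonormal J" "\<forall>e\<in>J. S e = of_real (b e) *\<^sub>C e" "\<And>e. e \<in> J \<Longrightarrow> r < b e"
    using J unfolding eigen_system_def by auto
  have px: "fproj J x = x" by (rule fproj_span[OF J'(1,2) x(1)])
  have n: "(norm x)\<^sup>2 = (\<Sum>e\<in>J. (cmod (cinner e x))\<^sup>2)"
    using pythagoras_fproj[OF J'(1,2), of x] px by simp
  have q: "qform S x = (\<Sum>e\<in>J. b e * (cmod (cinner e x))\<^sup>2)"
    using qform_decomp[OF S J'(1-3), of x] px by (simp add: qform_def)
  have "\<exists>e\<in>J. cinner e x \<noteq> 0"
  proof (rule ccontr)
    assume "\<not> ?thesis"
    then have "(norm x)\<^sup>2 = 0" unfolding n by simp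
    then show False using x(2) by simp
  qed
  then obtain e where e: "e \<in> J" "cinner e x \<noteq> 0" by blast
  have "(\<Sum>e\<in>J. r * (cmod (cinner e x))\<^sup>2) < (\<Sum>e\<in>J. b e * (cmod (cinner e x))\<^sup>2)"
  proof (rule sum_strict_mono_ex1[OF J'(1)])
    show "\<forall>e\<in>J. r * (cmod (cinner e x))\<^sup>2 \<le> b e * (cmod (cinner e x))\<^sup>2"
      by (intro ballI mult_right_mono less_imp_le[OF J'(4)]) auto
    show "\<exists>e\<in>J. r * (cmod (cinner e x))\<^sup>2 < b e * (cmod (cinner e x))\<^sup>2"
      using e J'(4)[OF e(1)] by (intro bexI[of _ e]) (auto intro!: mult_strict_right_mono)
  qed
  then show ?thesis unfolding q n sum_distrib_left .
qed

lemma eigen_system_card_le: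
  assumes "selfadjoint_op S" "eigen_system S r J b" "finite F"
    "\<And>x. orth_to F x \<Longrightarrow> qform S x \<le> r * (norm x)\<^sup>2"
  shows "card J \<le> card F"
proof (rule ccontr)
  assume "\<not> ?thesis"
  then obtain x where "x \<in> cvec.span J" "x \<noteq> 0" "orth_to F x"
    using orthonormal_combination[of F J] assms(2,3) unfolding eigen_system_def by force
  then show False using qform_span_gt[OF assms(1,2)] assms(4) by force
qed

section \<open>Existence of eigenvectors and of frames\<close>

lemma convergent_subsequence_finite:
  fixes c :: "'f \<Rightarrow> nat \<Rightarrow> complex"
  assumes "finite F" "\<And>f. f \<in> F \<Longrightarrow> bounded (range (c f))"
  shows "\<exists>s::nat \<Rightarrow> nat. strict_mono s \<and> (\<forall>f\<in>F. convergent (\<lambda>i. c f (s i)))"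
  using assms
proof (induction F)
  case empty
  show ?case by (intro exI[of _ id]) (auto simp: strict_mono_def)
next
  case (insert f F)
  then obtain s where s: "strict_mono s" "\<forall>g\<in>F. convergent (\<lambda>i. c g (s i))" by auto
  have "bounded (range (c f \<circ> s))"
    by (rule bounded_subset[of "range (c f)"]) (use insert in auto)
  then obtain l t where t: "strict_mono t" "((c f \<circ> s) \<circ> t) \<longlonglongrightarrow> l"
    using bounded_imp_convergent_subsequence by blast
  have "convergent (\<lambda>i. c g (s (t i)))" if "g \<in> F" for g
    using convergent_subseq_convergent[OF _ t(1), of "\<lambda>i. c g (s i)"] s(2) that
    by (simp add: comp_def)
  moreover have "convergent (\<lambda>i. c f (s (t i)))" using t(2) by (auto simp: convergent_def comp_def)
  ultimately show ?case using strict_mono_o[OF s(1) t(1)]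
    by (intro exI[of _ "s \<circ> t"]) (auto simp: comp_def)
qed

text \<open>The form is maximised on the unit sphere of the complement of J. With m the supremum, D
  = m - S is nonnegative on that complement, so a maximising sequence u satisfies D u \<rightarrow>
  0; the smallness of the form below the level m/2 off finitely many directions yields a convergent
  subsequence, whose limit is an eigenvector for m > r.\<close>

lemma eigenvector_exists:
  fixes S :: "'a::chilbert_space \<Rightarrow> 'a"
  assumes S: "form_compact S" and J: "finite J" "\<And>e. e \<in> J \<Longrightarrow> S e = of_real (b e) *\<^sub>C e"
    and r: "0 < r" and x: "orth_to J x" "qform S x > r * (norm x)\<^sup>2"
  shows "\<exists>v m. m > r \<and> norm v = 1 \<and> orth_to J v \<and> S v = of_real m *\<^sub>C v"
proof -
  have sa: "selfadjoint_op S" using S by (simp add: form_compact_def)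
  note S' = selfadjointD[OF sa]
  obtain M where M: "M > 0" "\<And>x. norm (S x) \<le> M * norm x" using bounded_clinear_bound[OF S'(1)] by blast
  define X where "X = {x. norm x = 1 \<and> orth_to J x}"
  have q_le: "qform S y \<le> M" if "y \<in> X" for y
  proof -
    have "qform S y \<le> cmod (cinner y (S y))" unfolding qform_def by (rule complex_Re_le_cmod)
    also have "\<dots> \<le> norm y * norm (S y)" by (rule cinner_norm_bound)
    finally show ?thesis using M(2)[of y] that by (simp add: X_def)
  qed
  have "x \<noteq> 0" using x(2) by (auto simp: qform_def)
  define x1 where "x1 = (1 / norm x) *\<^sub>R x"
  have q_scale: "qform S (t *\<^sub>R y) = t\<^sup>2 * qform S y" for t y
    by (simp add: qform_def bounded_clinearD(6)[OF S'(1)] cinner_scaleR_left cinner_scaleR_right power2_eq_square)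
  have x1: "x1 \<in> X" using \<open>x \<noteq> 0\<close> x(1) by (auto simp: X_def x1_def orth_to_def cinner_scaleR_right)
  have qx1: "r < qform S x1"
    unfolding x1_def q_scale using x(2) \<open>x \<noteq> 0\<close> by (simp add: power_divide field_simps)
  define m where "m = (SUP y\<in>X. qform S y)"
  have bdd: "bdd_above (qform S ` X)" by (rule bdd_aboveI[of _ M]) (auto simp: q_le)
  have mr: "r < m" unfolding m_def using cSUP_upper[OF x1 bdd] qx1 by linarith
  have qm: "qform S y \<le> m * (norm y)\<^sup>2" if "orth_to J y" for y
  proof (cases "y = 0")
    case False
    then have "(1 / norm y) *\<^sub>R y \<in> X" using that by (auto simp: X_def orth_to_def cinner_scaleR_right)
    then have "qform S ((1 / norm y) *\<^sub>R y) \<le> m" unfolding m_def by (rule cSUP_upper[OF _ bdd])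
    then show ?thesis unfolding q_scale using False by (simp add: power_divide field_simps)
  qed (simp add: qform_def)
  define D where "D y = m *\<^sub>R y - S y" for y
  have D_sa: "cinner (D y) z = cinner y (D z)" for y z
    by (simp add: D_def cinner_diff_left cinner_diff_right S'(2) cinner_scaleR_left cinner_scaleR_right)
  have D_lin: "D (y - z) = D y - D z" "D (t *\<^sub>R y) = t *\<^sub>R D y" for y z t
    by (simp_all add: D_def bounded_clinearD[OF S'(1)] algebra_simps)
  have ReD: "Re (cinner y (D y)) = m * (norm y)\<^sup>2 - qform S y" for y
    by (simp add: D_def cinner_diff_right cinner_scaleR_right cinner_self qform_def)
  have D_pos: "0 \<le> Re (cinner y (D y))" if "orth_to J y" for y
    using qm[OF that] ReD[of y] by simp
  have D_orth: "orth_to J (D y)" if "orth_to J y" for y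
    using that unfolding orth_to_def D_def
    by (auto simp: cinner_diff_right cinner_scaleR_right S'(2)[symmetric] J(2) cinner_scaleC_left)
  define N where "N = m + M"
  have N: "N > 0" using mr r M by (simp add: N_def)
  have D_norm: "norm (D y) \<le> N * norm y" for y
    using norm_triangle_ineq4[of "m *\<^sub>R y" "S y"] M(2)[of y] mr r by (simp add: D_def N_def algebra_simps)
  \<comment> \<open>Cauchy-Schwarz for the nonnegative form of \<open>D\<close>, obtained by testing
    positivity at y - D y / N, where N bounds the norm of \<open>D\<close>.\<close>
  have D_small: "(norm (D y))\<^sup>2 \<le> N * Re (cinner y (D y))" if "orth_to J y" for y
  proof -
    have DD: "cinner y (D (D y)) = of_real ((norm (D y))\<^sup>2)" by (simp add: D_sa[symmetric] cinner_self)
    have "orth_to J (y - (1/N) *\<^sub>R D y)"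
      using that D_orth[OF that] by (simp add: orth_to_def cinner_diff_right cinner_scaleR_right)
    then have "0 \<le> Re (cinner (y - (1/N) *\<^sub>R D y) (D (y - (1/N) *\<^sub>R D y)))" by (rule D_pos)
    also have "\<dots> = Re (cinner y (D y)) - 2 / N * (norm (D y))\<^sup>2 + (1/N)\<^sup>2 * Re (cinner (D y) (D (D y)))"
      using N by (simp add: D_lin cinner_diff_left cinner_diff_right cinner_scaleR_left cinner_scaleR_right
          cinner_self DD power2_eq_square field_simps)
    also have "Re (cinner (D y) (D (D y))) \<le> norm (D y) * norm (D (D y))"
      using cinner_norm_bound complex_Re_le_cmod order_trans by blast
    also have "\<dots> \<le> norm (D y) * (N * norm (D y))" by (intro mult_left_mono D_norm) simp
    also have "Re (cinner y (D y)) - 2 / N * (norm (D y))\<^sup>2 + (1/N)\<^sup>2 * (norm (D y) * (N * norm (D y)))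
      = Re (cinner y (D y)) - (norm (D y))\<^sup>2 / N"
      using N by (simp add: power2_eq_square field_simps)
    finally show ?thesis using N by (simp add: field_simps)
  qed
  have "\<exists>y\<in>X. m - inverse (real (Suc n)) < qform S y" for n
    using less_cSUP_iff[OF _ bdd, of "m - inverse (real (Suc n))"] x1 unfolding m_def by force
  then obtain u where u: "\<And>n. u n \<in> X" "\<And>n. m - inverse (real (Suc n)) < qform S (u n)" by metis
  have u1: "norm (u n) = 1" "orth_to J (u n)" for n using u(1) by (auto simp: X_def)
  have Du: "(\<lambda>n. norm (D (u n))) \<longlonglongrightarrow> 0"
  proof (rule tendsto_sandwich[of "\<lambda>_. 0" _ _ "\<lambda>n. sqrt (N * inverse (real (Suc n)))"])
    have "norm (D (u n)) \<le> sqrt (N * inverse (real (Suc n)))" for n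
    proof (rule real_le_rsqrt)
      have "Re (cinner (u n) (D (u n))) \<le> inverse (real (Suc n))"
        unfolding ReD using u(2)[of n] u1 by simp
      then show "(norm (D (u n)))\<^sup>2 \<le> N * inverse (real (Suc n))"
        using D_small[OF u1(2), of n] mult_left_mono[OF _ less_imp_le[OF N]] order_trans by blast
    qed
    then show "\<forall>\<^sub>F n in sequentially. norm (D (u n)) \<le> sqrt (N * inverse (real (Suc n)))" by simp
    have "(\<lambda>n. sqrt (N * inverse (real (Suc n)))) \<longlonglongrightarrow> sqrt (N * 0)"
      by (intro tendsto_intros LIMSEQ_inverse_real_of_nat)
    then show "(\<lambda>n. sqrt (N * inverse (real (Suc n)))) \<longlonglongrightarrow> 0" by simp
  qed auto
  have "\<forall>\<epsilon>>0. \<exists>F. finite F \<and> (\<forall>x. orth_to F x \<longrightarrow> \<bar>qform S x\<bar> \<le> \<epsilon> * (norm x)\<^sup>2)"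
    using S by (simp add: form_compact_def)
  \<comment> \<open>A level strictly between 0 and m; with m/2 the other m/2 remains as coercivity
    for the differences of the sequence.\<close>
  then obtain F where F: "finite F" "\<And>x. orth_to F x \<Longrightarrow> \<bar>qform S x\<bar> \<le> m / 2 * (norm x)\<^sup>2"
    using mr r by (metis half_gt_zero less_trans)
  obtain G where G: "finite G" "orthonormal G" "\<And>x. orth_to G x \<Longrightarrow> orth_to F x"
    using gram_schmidt[OF F(1)] by blast
  have "bounded (range (\<lambda>n. cinner e (u n)))" for e
    using cinner_norm_bound[of e "u _"] u1 by (intro boundedI[of _ "norm e"]) auto
  then obtain s where s: "strict_mono s" "\<And>e. e \<in> G \<Longrightarrow> convergent (\<lambda>i. cinner e (u (s i)))"
    using convergent_subsequence_finite[OF G(1), of "\<lambda>e n. cinner e (u n)"] by blast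
  define w where "w i = u (s i)" for i
  \<comment> \<open>Split d = a + c with a in the span of G. On c the form costs at most m/2, so the
    identity m |d|^2 = (d, D d) + (d, S d) can be solved for |d|, up to the finitely many
    coordinates in a.\<close>
  have key: "m / 2 * norm (w i - w j) \<le> norm (D (w i)) + norm (D (w j)) + 2 * M * norm (fproj G (w i - w j))"
    for i j
  proof -
    define d where "d = w i - w j"
    define a where "a = fproj G d"
    define c where "c = d - a"
    have oc: "orth_to G c" unfolding orth_to_def c_def a_def using fproj_orth[OF G(1,2)] by blast
    have nc: "norm c \<le> norm d"
      using fproj_best[OF G(1,2) cvec.span_zero, of d] by (simp add: c_def a_def)
    have "m * (norm d)\<^sup>2 = Re (cinner d (D d)) + qform S d" by (simp add: ReD)
    also have "Re (cinner d (D d)) \<le> norm d * norm (D d)"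
      using cinner_norm_bound complex_Re_le_cmod order_trans by blast
    also have "qform S d = Re (cinner a (S d)) + Re (cinner c (S a)) + qform S c"
      by (simp add: qform_def c_def bounded_clinearD[OF S'(1)] cinner_diff_left cinner_diff_right)
    also have "Re (cinner a (S d)) \<le> norm a * norm (S d)"
      using cinner_norm_bound complex_Re_le_cmod order_trans by blast
    also have "norm a * norm (S d) \<le> norm a * (M * norm d)" by (intro mult_left_mono M) simp
    also have "Re (cinner c (S a)) \<le> norm c * norm (S a)"
      using cinner_norm_bound complex_Re_le_cmod order_trans by blast
    also have "norm c * norm (S a) \<le> norm d * (M * norm a)" by (intro mult_mono nc M) auto
    also have "qform S c \<le> m / 2 * (norm c)\<^sup>2" using F(2)[OF G(3)[OF oc]] by simp
    also have "m / 2 * (norm c)\<^sup>2 \<le> m / 2 * (norm d)\<^sup>2"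
      using nc mr r by (intro mult_left_mono power_mono) auto
    finally have "norm d * (m / 2 * norm d) \<le> norm d * (norm (D d) + 2 * M * norm a)"
      by (simp add: power2_eq_square algebra_simps)
    then have "m / 2 * norm d \<le> norm (D d) + 2 * M * norm a"
    proof (cases "norm d = 0")
      case True
      then show ?thesis using M(1) by simp
    next
      case False
      then have "0 < norm d" by simp
      then show ?thesis
        using \<open>norm d * (m / 2 * norm d) \<le> _\<close> mult_le_cancel_left_pos by blast
    qed
    also have "norm (D d) \<le> norm (D (w i)) + norm (D (w j))"
      unfolding d_def D_lin by (rule norm_triangle_ineq4)
    finally show ?thesis by (simp add: d_def a_def)
  qed
  have "Cauchy w"
  proof (rule metric_CauchyI)
    fix e :: real assume e: "0 < e"
    define k where "k = m / 2 * e"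
    have k: "k > 0" using e mr r by (simp add: k_def)
    have "(\<lambda>n. norm (D (w n))) \<longlonglongrightarrow> 0"
      using LIMSEQ_subseq_LIMSEQ[OF Du s(1)] by (simp add: w_def comp_def)
    then obtain N1 where N1: "\<And>n. n \<ge> N1 \<Longrightarrow> norm (D (w n)) < k / 4"
      using LIMSEQ_D[of "\<lambda>n. norm (D (w n))" 0 "k / 4"] k by auto
    \<comment> \<open>The summand 1 keeps the denominator positive for empty G; the term with
      \<open>fproj G\<close> then contributes at most k/4 in \<open>key\<close>.\<close>
    define \<delta> where "\<delta> = k / (8 * M * (real (card G) + 1))"
    have \<delta>: "\<delta> > 0" using k M by (simp add: \<delta>_def)
    have "\<forall>e\<in>G. \<exists>N. \<forall>i\<ge>N. \<forall>j\<ge>N. cmod (cinner e (w i) - cinner e (w j)) < \<delta>"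
    proof
      fix f assume "f \<in> G"
      then have "Cauchy (\<lambda>i. cinner f (w i))" using s(2) by (simp add: w_def convergent_Cauchy)
      then show "\<exists>N. \<forall>i\<ge>N. \<forall>j\<ge>N. cmod (cinner f (w i) - cinner f (w j)) < \<delta>"
        using \<delta> by (simp add: Cauchy_def dist_norm)
    qed
    then obtain NN where NN: "\<And>f i j. f \<in> G \<Longrightarrow> i \<ge> NN f \<Longrightarrow> j \<ge> NN f \<Longrightarrow> cmod (cinner f (w i) - cinner f (w j)) < \<delta>"
      by metis
    define N2 where "N2 = Max (insert N1 (NN ` G))"
    have N2: "N1 \<le> N2" "\<And>f. f \<in> G \<Longrightarrow> NN f \<le> N2" unfolding N2_def using G(1) by auto
    have "dist (w i) (w j) < e" if ij: "i \<ge> N2" "j \<ge> N2" for i j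
    proof -
      have "norm (fproj G (w i - w j)) \<le> (\<Sum>f\<in>G. norm (cinner f (w i - w j) *\<^sub>C f))"
        unfolding fproj_def by (rule norm_sum)
      also have "\<dots> \<le> (\<Sum>f\<in>G. \<delta>)"
      proof (rule sum_mono)
        fix f assume f: "f \<in> G"
        have "cmod (cinner f (w i) - cinner f (w j)) < \<delta>"
          using NN[OF f] N2(2)[OF f] ij by (meson order_trans)
        then show "norm (cinner f (w i - w j) *\<^sub>C f) \<le> \<delta>"
          using orthonormal_norm[OF G(2) f] by (simp add: norm_scaleC cinner_diff_right)
      qed
      finally have "norm (fproj G (w i - w j)) \<le> real (card G) * \<delta>" by simp
      also have "\<dots> \<le> (real (card G) + 1) * \<delta>" using \<delta> by (simp add: algebra_simps)
      also have "\<dots> = k / (8 * M)"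
        unfolding \<delta>_def using of_nat_0_le_iff[of "card G", where 'a = real] by (simp add: add_nonneg_eq_0_iff)
      finally have "2 * M * norm (fproj G (w i - w j)) \<le> k / 4" using M(1) by (simp add: field_simps)
      moreover have "norm (D (w i)) < k / 4" "norm (D (w j)) < k / 4" using N1 N2(1) ij by (meson order_trans)+
      ultimately have "m / 2 * norm (w i - w j) < m / 2 * e" using key[of i j] k unfolding k_def by linarith
      then show ?thesis using mr r by (simp add: dist_norm)
    qed
    then show "\<exists>M. \<forall>i\<ge>M. \<forall>j\<ge>M. dist (w i) (w j) < e" by blast
  qed
  then obtain v where v: "w \<longlonglongrightarrow> v" using Cauchy_convergent_iff convergent_def by blast
  have "norm v = 1"
    using tendsto_norm[OF v] u1(1) by (simp add: w_def LIMSEQ_const_iff)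
  moreover have "cinner f v = 0" if "f \<in> J" for f
    using tendsto_cinner[OF tendsto_const v, of f] u1(2) that by (simp add: w_def orth_to_def LIMSEQ_const_iff)
  moreover have "D v = 0"
  proof -
    have "bounded_linear S" using S'(1) by (simp add: bounded_clinear_def)
    then have "(\<lambda>n. S (w n)) \<longlonglongrightarrow> S v" using v by (rule bounded_linear.tendsto)
    then have "(\<lambda>n. D (w n)) \<longlonglongrightarrow> D v" unfolding D_def by (intro tendsto_intros v)
    moreover have "(\<lambda>n. D (w n)) \<longlonglongrightarrow> 0"
      using LIMSEQ_subseq_LIMSEQ[OF Du s(1)] by (simp add: w_def comp_def tendsto_norm_zero_iff)
    ultimately show ?thesis by (rule LIMSEQ_unique)
  qed
  ultimately show ?thesis using mr
    by (intro exI[of _ v] exI[of _ m]) (simp add: orth_to_def D_def scaleR_eq_scaleC)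
qed

text \<open>Systems of eigenvectors above r have at most \<open>card F\<close> members, where F
  belongs to the level r in \<open>form_compact\<close>. One of maximal cardinality is a frame,
  since otherwise \<open>eigenvector_exists\<close> would add a vector.\<close>

theorem eigen_frame_exists:
  fixes S :: "'a::chilbert_space \<Rightarrow> 'a"
  assumes S: "form_compact S" and r: "0 < r"
  shows "\<exists>J b. eigen_frame S r J b"
proof -
  have sa: "selfadjoint_op S" using S by (simp add: form_compact_def)
  obtain F where F: "finite F" "\<And>x. orth_to F x \<Longrightarrow> \<bar>qform S x\<bar> \<le> r * (norm x)\<^sup>2"
    using S r unfolding form_compact_def by blast
  define P where "P J \<longleftrightarrow> (\<exists>b. eigen_system S r J b)" for J
  have bnd: "card J < Suc (card F)" if "P J" for J
    using that eigen_system_card_le[OF sa _ F(1)] F(2) unfolding P_def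
    by (metis abs_le_D1 less_Suc_eq_le)
  have "P {}" by (simp add: P_def eigen_system_def orthonormal_def)
  then obtain J where J: "P J" "\<And>J'. P J' \<Longrightarrow> card J' \<le> card J"
    using ex_has_greatest_nat[of P "{}" card "Suc (card F)"] bnd by blast
  then obtain b where b: "eigen_system S r J b" unfolding P_def by blast
  have "qform S x \<le> r * (norm x)\<^sup>2" if x: "orth_to J x" for x
  proof (rule ccontr)
    assume "\<not> ?thesis"
    then obtain v m where v: "m > r" "norm v = 1" "orth_to J v" "S v = of_real m *\<^sub>C v"
      using eigenvector_exists[OF S, of J b r x] b r x unfolding eigen_system_def by auto
    have "v \<notin> J" using v(2,3) by (auto simp: orth_to_def cinner_self)
    have "eigen_system S r (insert v J) (b(v := m))"
      using b v \<open>v \<notin> J\<close> orthonormal_insert[of J v] unfolding eigen_system_def orth_to_def by auto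
    then have "card (insert v J) \<le> card J" using J(2) P_def by blast
    then show False using \<open>v \<notin> J\<close> b by (simp add: eigen_system_def)
  qed
  then show ?thesis using b unfolding eigen_frame_def by blast
qed

text \<open>For an eigenvector v with eigenvalue above r, the residual v - \<open>fproj J v\<close>
  satisfies the same eigenvalue equation and is orthogonal to J, so the form bound forces it to
  vanish.\<close>

lemma eigen_frame_span:
  assumes sa: "selfadjoint_op S" and J: "eigen_frame S r J b"
  shows "cvec.span (\<Union>\<rho>\<in>{r<..}. eigenspace S \<rho>) = cvec.span J"
proof
  note S' = selfadjointD[OF sa]
  have J': "finite J" "orthonormal J" "\<And>e. e \<in> J \<Longrightarrow> S e = of_real (b e) *\<^sub>C e" "\<And>e. e \<in> J \<Longrightarrow> r < b e"
    "\<And>x. orth_to J x \<Longrightarrow> qform S x \<le> r * (norm x)\<^sup>2"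
    using J unfolding eigen_frame_def eigen_system_def by auto
  show "cvec.span J \<subseteq> cvec.span (\<Union>\<rho>\<in>{r<..}. eigenspace S \<rho>)"
    by (rule cvec.span_mono) (use J'(3,4) in \<open>auto simp: eigenspace_def\<close>)
  have "v \<in> cvec.span J" if \<rho>: "\<rho> > r" and v: "S v = of_real \<rho> *\<^sub>C v" for v \<rho>
  proof -
    define p where "p = fproj J v"
    have "cinner e v *\<^sub>C of_real (b e) *\<^sub>C e = cinner e v *\<^sub>C of_real \<rho> *\<^sub>C e" if e: "e \<in> J" for e
    proof -
      have "cinner (S e) v = cinner e (S v)" by (rule S'(2))
      then have "of_real (b e) * cinner e v = of_real \<rho> * cinner e v"
        using v J'(3)[OF e] by (simp add: cinner_scaleC_left cinner_scaleC_right)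
      then show ?thesis by (auto simp: scaleC_scaleC)
    qed
    then have Sp: "S p = of_real \<rho> *\<^sub>C p"
      unfolding p_def fproj_def bounded_clinear_sum[OF S'(1)] cvec.scale_sum_right
      by (intro sum.cong) (simp_all add: bounded_clinearD[OF S'(1)] J'(3) scaleC_scaleC mult.commute)
    have "qform S (v - p) = \<rho> * (norm (v - p))\<^sup>2"
      by (simp add: qform_def bounded_clinearD[OF S'(1)] v Sp cinner_scaleC_right cinner_self
          flip: cvec.scale_right_diff_distrib)
    moreover have "orth_to J (v - p)" unfolding orth_to_def p_def using fproj_orth[OF J'(1,2)] by blast
    ultimately have "\<rho> * (norm (v - p))\<^sup>2 \<le> r * (norm (v - p))\<^sup>2" using J'(5) by metis
    then have "v = p" using \<rho> by (auto simp: mult_le_cancel_right)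
    then show ?thesis unfolding p_def using fproj_in_span by metis
  qed
  then show "cvec.span (\<Union>\<rho>\<in>{r<..}. eigenspace S \<rho>) \<subseteq> cvec.span J"
    by (intro cvec.span_minimal) (auto simp: eigenspace_def)
qed

section \<open>Spectral projections, ranks and traces in terms of frames\<close>

lemma spectral_proj_frame:
  assumes sa: "selfadjoint_op S" and J: "eigen_frame S r J b"
  shows "spectral_proj {r<..} S = fproj J"
proof
  fix x
  have J': "finite J" "orthonormal J" using J unfolding eigen_frame_def eigen_system_def by auto
  show "spectral_proj {r<..} S x = fproj J x"
    unfolding spectral_proj_def eigen_frame_span[OF assms]
  proof (rule orth_proj_eq)
    show "fproj J x \<in> closure (cvec.span J)" using fproj_in_span closure_subset by blast
    show "cinner w (x - fproj J x) = 0" if "w \<in> closure (cvec.span J)" for w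
      by (rule orth_closure_span[OF _ that]) (rule fproj_orth[OF J'])
  qed (rule span_closure_subspace)
qed

lemma orthonormal_independent:
  assumes "orthonormal J" shows "cvec.independent J"
  unfolding cvec.independent_explicit_module
proof (intro allI impI)
  fix t u v assume t: "finite t" "t \<subseteq> J" "(\<Sum>v\<in>t. u v *\<^sub>C v) = 0" "v \<in> t"
  have "u v = cinner v (\<Sum>v\<in>t. u v *\<^sub>C v)"
    by (rule cinner_onb_sum[symmetric]) (use t orthonormal_subset[OF assms] in auto)
  then show "u v = 0" using t by simp
qed

lemma rank_fproj:
  assumes J: "finite J" "orthonormal J"
  shows "rank_op (fproj J) = enat (card J)"
proof -
  have "range (fproj J) = cvec.span J"
    using fproj_in_span fproj_span[OF J] by (metis (no_types, lifting) image_subsetI rangeI subsetI subset_antisym)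
  moreover have "cvec.dim (cvec.span J) = card J"
    using cvec.dim_eq_card_independent[OF orthonormal_independent[OF J(2)]] by simp
  ultimately show ?thesis using J(1) unfolding rank_op_def cdim_def by auto
qed

lemma N_plus_frame:
  assumes "selfadjoint_op S" "eigen_frame S r J b"
  shows "N_plus r S = enat (card J)"
  unfolding N_plus_def spectral_proj_frame[OF assms]
  using assms(2) by (intro rank_fproj) (auto simp: eigen_frame_def eigen_system_def)

lemma has_sum_finite_sum:
  fixes f :: "'i \<Rightarrow> 'a \<Rightarrow> 'b::topological_comm_monoid_add"
  assumes "finite I" "\<And>i. i \<in> I \<Longrightarrow> (f i has_sum s i) A"
  shows "((\<lambda>x. \<Sum>i\<in>I. f i x) has_sum (\<Sum>i\<in>I. s i)) A"
  using assms by (induction I) (auto intro: has_sum_add)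

text \<open>Parseval is applied to each of the finitely many f in J, so the trace is a finite sum of
  convergent series.\<close>

lemma trace_fproj:
  fixes J :: "'a::chilbert_space set"
  assumes J: "finite J" "orthonormal J"
  shows "trace_op (fproj J) = of_nat (card J)"
proof -
  have "((\<lambda>e. \<Sum>f\<in>J. (cmod (cinner e f))\<^sup>2) has_sum (\<Sum>f\<in>J. (norm f)\<^sup>2)) some_onb"
    by (rule has_sum_finite_sum[OF J(1)]) (rule parseval)
  then have "((\<lambda>e. complex_of_real (\<Sum>f\<in>J. (cmod (cinner e f))\<^sup>2)) has_sum
      complex_of_real (\<Sum>f\<in>J. (norm f)\<^sup>2)) some_onb"
    by (rule has_sum_of_real)
  also have "(\<lambda>e. complex_of_real (\<Sum>f\<in>J. (cmod (cinner e f))\<^sup>2)) = (\<lambda>e. cinner e (fproj J e))"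
  proof
    fix e
    have "cinner e (fproj J e) = (\<Sum>f\<in>J. cnj (cinner e f) * cinner e f)"
      unfolding fproj_def cinner_sum_right cinner_scaleC_right
      by (rule sum.cong[OF refl], subst cinner_commute) simp
    also have "\<dots> = complex_of_real (\<Sum>f\<in>J. (cmod (cinner e f))\<^sup>2)"
      by (simp add: complex_norm_square mult.commute flip: of_real_power)
    finally show "complex_of_real (\<Sum>f\<in>J. (cmod (cinner e f))\<^sup>2) = cinner e (fproj J e)" by simp
  qed
  also have "(\<Sum>f\<in>J. (norm f)\<^sup>2) = real (card J)" using orthonormal_norm[OF J(2)] by simp
  finally show ?thesis unfolding trace_op_def by (simp add: infsumI)
qed

section \<open>Eigenvalue counting for perturbed families\<close>

text \<open>\<open>the_enat\<close> is meaningful only on finite counts; \<open>nplus_obtain\<close>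
  provides finiteness for r > 0 and form-compact S.\<close>

definition nplus :: "real \<Rightarrow> ('a::complex_inner \<Rightarrow> 'a) \<Rightarrow> nat"
  where "nplus r S = the_enat (N_plus r S)"

definition pencil :: "('a::complex_inner \<Rightarrow> 'a) \<Rightarrow> ('a \<Rightarrow> 'a) \<Rightarrow> real \<Rightarrow> 'a \<Rightarrow> 'a"
  where "pencil A B t = (\<lambda>x. A x + complex_of_real t *\<^sub>C B x)"

text \<open>Hilbert-Schmidt control through all finite orthonormal sets at once, so that
  eigenvectors of any operator may be inserted.\<close>

definition hs_bound :: "('a::complex_inner \<Rightarrow> 'b::complex_inner) \<Rightarrow> real \<Rightarrow> bool"
  where "hs_bound Z C \<longleftrightarrow> (\<forall>J. finite J \<longrightarrow> orthonormal J \<longrightarrow> (\<Sum>e\<in>J. (norm (Z e))\<^sup>2) \<le> C)"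

lemma nplus_frame:
  assumes "selfadjoint_op S" "eigen_frame S r J b"
  shows "nplus r S = card J"
  by (simp add: nplus_def N_plus_frame[OF assms])

lemma nplus_obtain:
  fixes S :: "'a::chilbert_space \<Rightarrow> 'a"
  assumes "form_compact S" "0 < r"
  obtains J b where "eigen_frame S r J b" "nplus r S = card J"
  using eigen_frame_exists[OF assms] nplus_frame assms(1) unfolding form_compact_def by metis

lemma form_compact_sa: "form_compact S \<Longrightarrow> selfadjoint_op S"
  by (simp add: form_compact_def)

lemma nplus_le:
  fixes S :: "'a::chilbert_space \<Rightarrow> 'a"
  assumes S: "form_compact S" "0 < r" and F: "finite F" "\<And>x. orth_to F x \<Longrightarrow> qform S x \<le> r * (norm x)\<^sup>2"
  shows "nplus r S \<le> card F"
proof -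
  obtain J b where J: "eigen_frame S r J b" "nplus r S = card J" using nplus_obtain[OF S] .
  have "eigen_system S r J b" using J(1) by (simp add: eigen_frame_def)
  then show ?thesis using eigen_system_card_le[OF form_compact_sa[OF S(1)] _ F] J(2) by simp
qed

lemma nplus_antimono:
  fixes S :: "'a::chilbert_space \<Rightarrow> 'a"
  assumes S: "form_compact S" "0 < r" "r \<le> r'"
  shows "nplus r' S \<le> nplus r S"
proof -
  obtain J b where J: "eigen_frame S r J b" "nplus r S = card J" using nplus_obtain[OF S(1,2)] .
  have "qform S x \<le> r' * (norm x)\<^sup>2" if "orth_to J x" for x
  proof -
    have "qform S x \<le> r * (norm x)\<^sup>2" using J(1) that by (simp add: eigen_frame_def)
    also have "\<dots> \<le> r' * (norm x)\<^sup>2" using S(3) by (intro mult_right_mono) auto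
    finally show ?thesis .
  qed
  moreover have "finite J" using J by (simp add: eigen_frame_def eigen_system_def)
  ultimately show ?thesis using nplus_le[OF S(1), of r' J] S J by simp
qed

lemma eigen_frame_scale:
  assumes J: "eigen_frame S (r / c) J b" and c: "0 < c"
  shows "eigen_frame (\<lambda>x. complex_of_real c *\<^sub>C S x) r J (\<lambda>e. c * b e)"
proof -
  have "qform (\<lambda>x. complex_of_real c *\<^sub>C S x) x = c * qform S x" for x
    by (simp add: qform_def cinner_scaleC_right)
  moreover have "r < c * y \<longleftrightarrow> r / c < y" "c * y \<le> r * z \<longleftrightarrow> y \<le> r / c * z" for y z
    using c by (simp_all add: field_simps)
  ultimately show ?thesis
    using J unfolding eigen_frame_def eigen_system_def by (simp add: scaleC_scaleC)
qed

lemma selfadjoint_pencil: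
  assumes "selfadjoint_op A" "selfadjoint_op B"
  shows "selfadjoint_op (pencil A B t)"
  using assms unfolding selfadjoint_op_def pencil_def
  by (auto intro!: bounded_clinear_add bounded_clinear_scaleC
      simp: cinner_add_left cinner_add_right cinner_scaleC_left cinner_scaleC_right)

lemma selfadjoint_scale:
  assumes "selfadjoint_op A" shows "selfadjoint_op (\<lambda>x. complex_of_real c *\<^sub>C A x)"
  using assms unfolding selfadjoint_op_def
  by (auto intro!: bounded_clinear_scaleC simp: cinner_scaleC_left cinner_scaleC_right)

lemma qform_pencil: "qform (pencil A B t) x = qform A x + t * qform B x"
  by (simp add: qform_def pencil_def cinner_add_right cinner_scaleC_right)

lemma nplus_scale:
  fixes S :: "'a::chilbert_space \<Rightarrow> 'a"
  assumes "form_compact S" "0 < r" "0 < c"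
  shows "nplus r (\<lambda>x. complex_of_real c *\<^sub>C S x) = nplus (r / c) S"
proof -
  have "0 < r / c" using assms by simp
  then obtain J b where J: "eigen_frame S (r / c) J b" "nplus (r / c) S = card J"
    using nplus_obtain[OF assms(1)] by blast
  show ?thesis
    using nplus_frame[OF selfadjoint_scale[OF form_compact_sa[OF assms(1)]] eigen_frame_scale[OF J(1) assms(3)]] J(2)
    by simp
qed

lemma trace_spectral_proj:
  fixes S :: "'a::chilbert_space \<Rightarrow> 'a"
  assumes "form_compact S" "0 < r"
  shows "Re (trace_op (spectral_proj {r<..} S)) = real (nplus r S)"
proof -
  obtain J b where J: "eigen_frame S r J b" "nplus r S = card J" using nplus_obtain[OF assms] .
  then show ?thesis
    using spectral_proj_frame[OF form_compact_sa[OF assms(1)] J(1)] trace_fproj[of J]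
    by (simp add: eigen_frame_def eigen_system_def)
qed

text \<open>A maximal orthonormal set of vectors e with |Z e|^2 > \<delta> has at most C / \<delta>
  members, and a violating x in its complement could be normalised and added.\<close>

lemma hs_bound_small:
  assumes Z: "bounded_clinear Z" "hs_bound Z C" and \<delta>: "0 < \<delta>"
  shows "\<exists>F. finite F \<and> (\<forall>x. orth_to F x \<longrightarrow> (norm (Z x))\<^sup>2 \<le> \<delta> * (norm x)\<^sup>2)"
proof -
  define P where "P J \<longleftrightarrow> finite J \<and> orthonormal J \<and> (\<forall>e\<in>J. \<delta> < (norm (Z e))\<^sup>2)" for J
  have "card J < Suc (nat \<lceil>C / \<delta>\<rceil>)" if "P J" for J
  proof -
    have "real (card J) * \<delta> = (\<Sum>e\<in>J. \<delta>)" by simp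
    also have "\<dots> \<le> (\<Sum>e\<in>J. (norm (Z e))\<^sup>2)" using that by (intro sum_mono) (auto simp: P_def less_imp_le)
    also have "\<dots> \<le> C" using Z(2) that by (simp add: hs_bound_def P_def)
    finally have "real (card J) \<le> C / \<delta>" using \<delta> by (simp add: field_simps)
    then show ?thesis by linarith
  qed
  moreover have "P {}" by (simp add: P_def orthonormal_def)
  ultimately obtain J where J: "P J" "\<And>J'. P J' \<Longrightarrow> card J' \<le> card J"
    using ex_has_greatest_nat[of P "{}" card] by blast
  have "(norm (Z x))\<^sup>2 \<le> \<delta> * (norm x)\<^sup>2" if x: "orth_to J x" for x
  proof (rule ccontr)
    assume n: "\<not> ?thesis"
    then have "x \<noteq> 0" by (auto simp: bounded_clinearD[OF Z(1)])
    define v where "v = (1 / norm x) *\<^sub>R x"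
    have v: "norm v = 1" "orth_to J v" using \<open>x \<noteq> 0\<close> x by (auto simp: v_def orth_to_def cinner_scaleR_right)
    have "(norm (Z v))\<^sup>2 = (norm (Z x))\<^sup>2 / (norm x)\<^sup>2"
      by (simp add: v_def bounded_clinearD(6)[OF Z(1)] power_divide)
    moreover have "0 < (norm x)\<^sup>2" using \<open>x \<noteq> 0\<close> by simp
    ultimately have "\<delta> < (norm (Z v))\<^sup>2" using n by (simp add: pos_less_divide_eq)
    moreover have "v \<notin> J" using v by (auto simp: orth_to_def cinner_self)
    ultimately have "P (insert v J)" "card (insert v J) = Suc (card J)"
      using J(1) v orthonormal_insert[of J v] by (auto simp: P_def orth_to_def)
    then show False using J(2) by fastforce
  qed
  then show ?thesis using J(1) by (auto simp: P_def)
qed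

text \<open>Both terms of the bound are small where Z is, that is, off finitely many
  directions.\<close>

lemma form_compactI_hs:
  assumes S: "selfadjoint_op S" and Z: "bounded_clinear Z" "hs_bound Z C"
    and bnd: "\<And>x. \<bar>qform S x\<bar> \<le> a * norm x * norm (Z x) + b * (norm (Z x))\<^sup>2"
    and ab: "0 \<le> a" "0 \<le> b"
  shows "form_compact S"
  unfolding form_compact_def
proof (intro conjI allI impI S)
  fix \<epsilon> :: real assume \<epsilon>: "0 < \<epsilon>"
  \<comment> \<open>The minimum with 1 gives \<delta>^2 \<le> \<delta>, so that one choice serves
    the term linear in Z x and the quadratic one.\<close>
  define \<delta> where "\<delta> = min 1 (\<epsilon> / (a + b + 1))"
  have \<delta>: "0 < \<delta>" "\<delta> \<le> 1" "(a + b) * \<delta> \<le> \<epsilon>"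
  proof -
    show "0 < \<delta>" "\<delta> \<le> 1" using \<epsilon> ab by (auto simp: \<delta>_def)
    have "(a + b) * \<delta> \<le> (a + b + 1) * (\<epsilon> / (a + b + 1))"
      using ab \<epsilon> by (intro mult_mono) (auto simp: \<delta>_def)
    then show "(a + b) * \<delta> \<le> \<epsilon>" using ab by (simp add: add_nonneg_eq_0_iff)
  qed
  obtain F where F: "finite F" "\<And>x. orth_to F x \<Longrightarrow> (norm (Z x))\<^sup>2 \<le> \<delta>\<^sup>2 * (norm x)\<^sup>2"
    using hs_bound_small[OF Z zero_less_power[OF \<delta>(1)]] by blast
  have "\<bar>qform S x\<bar> \<le> \<epsilon> * (norm x)\<^sup>2" if "orth_to F x" for x
  proof -
    have 1: "norm (Z x) \<le> \<delta> * norm x"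
      by (rule power2_le_imp_le) (use F(2)[OF that] \<delta> in \<open>simp_all add: power_mult_distrib\<close>)
    have "\<bar>qform S x\<bar> \<le> a * norm x * (\<delta> * norm x) + b * (\<delta> * (norm x)\<^sup>2)"
    proof (rule order_trans[OF bnd add_mono])
      show "a * norm x * norm (Z x) \<le> a * norm x * (\<delta> * norm x)"
        using ab by (intro mult_left_mono 1) auto
      have "\<delta>\<^sup>2 \<le> \<delta>" using \<delta> by (simp add: power2_eq_square mult_left_le)
      then have "\<delta>\<^sup>2 * (norm x)\<^sup>2 \<le> \<delta> * (norm x)\<^sup>2" by (intro mult_right_mono) auto
      then show "b * (norm (Z x))\<^sup>2 \<le> b * (\<delta> * (norm x)\<^sup>2)"
        using F(2)[OF that] ab by (intro mult_left_mono) auto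
    qed
    also have "\<dots> = (a + b) * \<delta> * (norm x)\<^sup>2" by (simp add: algebra_simps power2_eq_square)
    also have "\<dots> \<le> \<epsilon> * (norm x)\<^sup>2" by (intro mult_right_mono \<delta>) auto
    finally show ?thesis .
  qed
  then show "\<exists>F. finite F \<and> (\<forall>x. orth_to F x \<longrightarrow> \<bar>qform S x\<bar> \<le> \<epsilon> * (norm x)\<^sup>2)" using F(1) by blast
qed

section \<open>Gram operators and their duals\<close>

lemma gram_selfadjoint:
  fixes Y :: "'a::chilbert_space \<Rightarrow> 'b::complex_inner"
  assumes Y: "bounded_clinear Y"
  shows "selfadjoint_op (\<lambda>x. cadjoint Y (Y x))" "qform (\<lambda>x. cadjoint Y (Y x)) x = (norm (Y x))\<^sup>2"
proof -
  show "selfadjoint_op (\<lambda>x. cadjoint Y (Y x))"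
    using bounded_clinear_compose[OF bounded_clinear_cadjoint[OF Y] Y]
    by (simp add: selfadjoint_op_def cadjoint_works[OF Y] cadjoint_works'[OF Y] comp_def)
  show "qform (\<lambda>x. cadjoint Y (Y x)) x = (norm (Y x))\<^sup>2"
    by (simp add: qform_def cadjoint_works'[OF Y] cinner_self)
qed

lemma form_compact_gram:
  fixes Z :: "'a::chilbert_space \<Rightarrow> 'b::complex_inner"
  assumes Z: "bounded_clinear Z" "hs_bound Z C"
  shows "form_compact (\<lambda>x. cadjoint Z (Z x))"
  by (rule form_compactI_hs[OF gram_selfadjoint(1)[OF Z(1)] Z, of 0 1])
    (auto simp: gram_selfadjoint(2)[OF Z(1)])

text \<open>The Hilbert-Schmidt control lives on the target space of Y. If g is orthogonal to the
  adjoint images of F, then Y g is orthogonal to F, where Z and hence Y^* is small; |Y g|^2 \<le>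
  |g| |Y^* Y g| carries this back to g.\<close>

lemma form_compact_gram_dual:
  fixes Y :: "'g::chilbert_space \<Rightarrow> 'h::chilbert_space" and Z :: "'h \<Rightarrow> 'b::complex_inner"
  assumes Z: "bounded_clinear Z" "hs_bound Z C" and Y: "bounded_clinear Y"
    and bnd: "\<And>x. norm (cadjoint Y x) \<le> a * norm (Z x)" and a: "0 < a"
  shows "form_compact (\<lambda>x. cadjoint Y (Y x))"
  unfolding form_compact_def
proof (intro conjI allI impI gram_selfadjoint(1)[OF Y])
  fix \<epsilon> :: real assume \<epsilon>: "0 < \<epsilon>"
  obtain F where F: "finite F" "\<And>x. orth_to F x \<Longrightarrow> (norm (Z x))\<^sup>2 \<le> \<epsilon> / a\<^sup>2 * (norm x)\<^sup>2"
    using hs_bound_small[OF Z divide_pos_pos[OF \<epsilon> zero_less_power[OF a]]] by blast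
  have "(norm (Y g))\<^sup>2 \<le> \<epsilon> * (norm g)\<^sup>2" if g: "orth_to (cadjoint Y ` F) g" for g
  proof -
    have "orth_to F (Y g)" using g by (auto simp: orth_to_def cadjoint_works[OF Y])
    then have "(norm (Z (Y g)))\<^sup>2 \<le> \<epsilon> / a\<^sup>2 * (norm (Y g))\<^sup>2" by (rule F(2))
    then have "a\<^sup>2 * (norm (Z (Y g)))\<^sup>2 \<le> \<epsilon> * (norm (Y g))\<^sup>2" using a by (simp add: field_simps)
    moreover have "(norm (cadjoint Y (Y g)))\<^sup>2 \<le> (a * norm (Z (Y g)))\<^sup>2" by (intro power_mono bnd) auto
    ultimately have 1: "(norm (cadjoint Y (Y g)))\<^sup>2 \<le> \<epsilon> * (norm (Y g))\<^sup>2" by (simp add: power_mult_distrib)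
    have "(norm (Y g))\<^sup>2 = Re (cinner g (cadjoint Y (Y g)))" using gram_selfadjoint(2)[OF Y, of g] by (simp add: qform_def)
    also have "\<dots> \<le> norm g * norm (cadjoint Y (Y g))"
      using cinner_norm_bound complex_Re_le_cmod order_trans by blast
    finally have "((norm (Y g))\<^sup>2)\<^sup>2 \<le> (norm g * norm (cadjoint Y (Y g)))\<^sup>2" by (rule power_mono) simp
    also have "\<dots> \<le> (norm g)\<^sup>2 * (\<epsilon> * (norm (Y g))\<^sup>2)"
      unfolding power_mult_distrib by (intro mult_left_mono 1) auto
    finally have "(norm (Y g))\<^sup>2 * (norm (Y g))\<^sup>2 \<le> (norm (Y g))\<^sup>2 * (\<epsilon> * (norm g)\<^sup>2)"
      by (simp add: power2_eq_square mult_ac)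
    then show ?thesis
    proof (cases "Y g = 0")
      case False
      then have p: "0 < (norm (Y g))\<^sup>2" by simp
      show ?thesis using \<open>_ \<le> (norm (Y g))\<^sup>2 * (\<epsilon> * (norm g)\<^sup>2)\<close> unfolding mult_le_cancel_left_pos[OF p] .
    qed (use \<epsilon> in simp)
  qed
  then show "\<exists>F. finite F \<and> (\<forall>x. orth_to F x \<longrightarrow> \<bar>qform (\<lambda>x. cadjoint Y (Y x)) x\<bar> \<le> \<epsilon> * (norm x)\<^sup>2)"
    using F(1) by (intro exI[of _ "cadjoint Y ` F"]) (simp add: gram_selfadjoint(2)[OF Y])
qed

text \<open>Y^* Y and Y Y^* have the same nonzero spectrum: the frame of the first, mapped by Y,
  gives at most as many linear conditions, and under these the second is at most \<rho>.\<close>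

lemma gram_frame_dual:
  fixes Y :: "'g::chilbert_space \<Rightarrow> 'h::chilbert_space"
  assumes Y: "bounded_clinear Y" and J: "eigen_frame (\<lambda>x. cadjoint Y (Y x)) \<rho> J b" and x: "orth_to (Y ` J) x" and \<rho>: "0 \<le> \<rho>"
  shows "(norm (cadjoint Y x))\<^sup>2 \<le> \<rho> * (norm x)\<^sup>2"
proof -
  define y where "y = cadjoint Y x"
  have "orth_to J y" using x by (auto simp: orth_to_def y_def cadjoint_works'[OF Y])
  then have 1: "(norm (Y y))\<^sup>2 \<le> \<rho> * (norm y)\<^sup>2"
    using J unfolding eigen_frame_def gram_selfadjoint(2)[OF Y] by blast
  have "(norm y)\<^sup>2 = Re (cinner (Y y) x)" by (simp add: y_def cadjoint_works'[OF Y, symmetric] cinner_self)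
  also have "\<dots> \<le> norm (Y y) * norm x"
    using cinner_norm_bound complex_Re_le_cmod order_trans by blast
  finally have "((norm y)\<^sup>2)\<^sup>2 \<le> (norm (Y y) * norm x)\<^sup>2" by (rule power_mono) simp
  also have "\<dots> \<le> \<rho> * (norm y)\<^sup>2 * (norm x)\<^sup>2"
    unfolding power_mult_distrib by (intro mult_right_mono 1) auto
  finally have *: "(norm y)\<^sup>2 * (norm y)\<^sup>2 \<le> (norm y)\<^sup>2 * (\<rho> * (norm x)\<^sup>2)"
    by (simp add: power2_eq_square mult_ac)
  show ?thesis
  proof (cases "y = 0")
    case True
    then show ?thesis using \<rho> by (simp add: y_def)
  next
    case False
    then have "0 < (norm y)\<^sup>2" by simp
    from * show ?thesis unfolding mult_le_cancel_left_pos[OF \<open>0 < (norm y)\<^sup>2\<close>] by (simp add: y_def)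
  qed
qed

text \<open>Finitely many eigenvalues above r exceed it by a common margin. Moving t changes the
  form by at most a multiple of |t - t0|, so the span of the old eigenvectors still forces as many
  eigenvalues above r.\<close>

lemma nplus_pencil_lsc:
  fixes A B :: "'a::chilbert_space \<Rightarrow> 'a"
  assumes fc: "\<And>t. form_compact (pencil A B t)" and B: "selfadjoint_op B" and r: "0 < r"
  shows "\<exists>\<delta>>0. \<forall>t. \<bar>t - t0\<bar> < \<delta> \<longrightarrow> nplus r (pencil A B t0) \<le> nplus r (pencil A B t)"
proof -
  obtain J b where J: "eigen_frame (pencil A B t0) r J b" "nplus r (pencil A B t0) = card J"
    using nplus_obtain[OF fc r] .
  have J': "finite J" "orthonormal J" "\<And>e. e \<in> J \<Longrightarrow> r < b e"
    using J(1) by (auto simp: eigen_frame_def eigen_system_def)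
  \<comment> \<open>The entry r + 1 covers an empty J.\<close>
  define r1 where "r1 = Min (insert (r + 1) (b ` J))"
  have r1: "r < r1" "\<And>e. e \<in> J \<Longrightarrow> r1 \<le> b e" using J' by (auto simp: r1_def)
  define r2 where "r2 = (r + r1) / 2"
  have r2: "r < r2" "\<And>e. e \<in> J \<Longrightarrow> r2 < b e" using r1 by (force simp: r2_def)+
  have sys: "eigen_system (pencil A B t0) r2 J b"
    using J(1) r2(2) by (simp add: eigen_frame_def eigen_system_def)
  obtain M where M: "M > 0" "\<And>x. norm (B x) \<le> M * norm x"
    using bounded_clinear_bound[OF selfadjointD(1)[OF B]] by blast
  have qB: "\<bar>qform B x\<bar> \<le> M * (norm x)\<^sup>2" for x
  proof -
    have "\<bar>qform B x\<bar> \<le> norm x * norm (B x)"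
      unfolding qform_def using abs_Re_le_cmod cinner_norm_bound order_trans by blast
    also have "\<dots> \<le> norm x * (M * norm x)" by (intro mult_left_mono M) simp
    finally show ?thesis by (simp add: power2_eq_square mult_ac)
  qed
  have "card J \<le> nplus r (pencil A B t)" if t: "\<bar>t - t0\<bar> < (r2 - r) / M" for t
  proof (rule ccontr)
    assume n: "\<not> ?thesis"
    obtain K c where K: "eigen_frame (pencil A B t) r K c" "nplus r (pencil A B t) = card K"
      using nplus_obtain[OF fc r] .
    obtain x where x: "x \<in> cvec.span J" "x \<noteq> 0" "orth_to K x"
      using orthonormal_combination[of K J] n K J' by (auto simp: eigen_frame_def eigen_system_def)
    have "r2 * (norm x)\<^sup>2 < qform (pencil A B t0) x"
      by (rule qform_span_gt[OF form_compact_sa[OF fc] sys x(1,2)])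
    also have "\<dots> = qform (pencil A B t) x + (t0 - t) * qform B x"
      by (simp add: qform_pencil algebra_simps)
    also have "\<dots> \<le> r * (norm x)\<^sup>2 + \<bar>t0 - t\<bar> * \<bar>qform B x\<bar>"
      using K(1) x(3) abs_ge_self[of "(t0 - t) * qform B x"]
      by (intro add_mono) (auto simp: eigen_frame_def abs_mult)
    also have "\<dots> \<le> r * (norm x)\<^sup>2 + (r2 - r) / M * (M * (norm x)\<^sup>2)"
      using t r2(1) M(1) by (intro add_left_mono mult_mono qB) (auto simp: abs_minus_commute)
    also have "\<dots> = r2 * (norm x)\<^sup>2" using M(1) by (simp add: field_simps)
    finally show False by simp
  qed
  then show ?thesis using J(2) r2(1) M(1) by (intro exI[of _ "(r2 - r) / M"]) auto
qed

lemma nplus_pencil_measurable: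
  fixes A B :: "'a::chilbert_space \<Rightarrow> 'a"
  assumes fc: "\<And>t. form_compact (pencil A B t)" and B: "selfadjoint_op B" and r: "0 < r"
  shows "(\<lambda>t. real (nplus r (pencil A B t))) \<in> borel_measurable borel"
proof (rule borel_measurableI_greater)
  fix y :: real
  let ?U = "{t. y < real (nplus r (pencil A B t))}"
  have "open ?U"
    unfolding open_dist
  proof
    fix t0 assume "t0 \<in> ?U"
    obtain \<delta> where "\<delta> > 0" "\<And>t. \<bar>t - t0\<bar> < \<delta> \<Longrightarrow> nplus r (pencil A B t0) \<le> nplus r (pencil A B t)"
      using nplus_pencil_lsc[OF assms, of t0] by blast
    then show "\<exists>e>0. \<forall>t. dist t t0 < e \<longrightarrow> t \<in> ?U"
      using \<open>t0 \<in> ?U\<close> by (intro exI[of _ \<delta>]) (force simp: dist_real_def)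
  qed
  then show "{t \<in> space borel. y < real (nplus r (pencil A B t))} \<in> sets borel" by simp
qed

section \<open>Weighted integrals of eigenvalue counts\<close>

lemma nn_integral_tail:
  fixes a :: real assumes a: "0 < a"
  shows "(\<integral>\<^sup>+t. ennreal (1 / (1 + t\<^sup>2)) * indicator {a..} t \<partial>lborel) \<le> ennreal (1 / a)"
proof -
  have "(\<integral>\<^sup>+t. ennreal (1 / t\<^sup>2) * indicator {a..} t \<partial>lborel) = ennreal (0 - (- 1 / a))"
  proof (rule nn_integral_FTC_atLeast)
    show "DERIV (\<lambda>t. - 1 / t) x :> 1 / x\<^sup>2" if "a \<le> x" for x
      using that a by (auto intro!: derivative_eq_intros simp: power2_eq_square)
    show "((\<lambda>t::real. - 1 / t) \<longlongrightarrow> 0) at_top"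
      using tendsto_minus[OF tendsto_inverse_0_at_top[OF filterlim_ident]]
      by (simp add: divide_inverse)
  qed auto
  moreover have "(\<integral>\<^sup>+t. ennreal (1 / (1 + t\<^sup>2)) * indicator {a..} t \<partial>lborel)
    \<le> (\<integral>\<^sup>+t. ennreal (1 / t\<^sup>2) * indicator {a..} t \<partial>lborel)"
  proof (rule nn_integral_mono)
    fix t :: real
    show "ennreal (1 / (1 + t\<^sup>2)) * indicator {a..} t \<le> ennreal (1 / t\<^sup>2) * indicator {a..} t"
      using a by (cases "a \<le> t") (auto intro!: ennreal_leI divide_left_mono mult_pos_pos add_pos_nonneg)
  qed
  ultimately show ?thesis by simp
qed

lemma nplus_zero_pencil_nonpos:
  fixes D :: "'a::chilbert_space \<Rightarrow> 'a"
  assumes fc: "form_compact (pencil (\<lambda>_. 0) D t)" and pos: "\<And>x. 0 \<le> qform D x" and "t \<le> 0" "0 < r"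
  shows "nplus r (pencil (\<lambda>_. 0) D t) = 0"
proof -
  have "nplus r (pencil (\<lambda>_. 0) D t) \<le> card ({} :: 'a set)"
  proof (rule nplus_le[OF fc \<open>0 < r\<close>])
    fix x
    have "qform (pencil (\<lambda>_. 0) D t) x = t * qform D x" by (simp add: qform_pencil) (simp add: qform_def)
    also have "\<dots> \<le> 0" using assms by (simp add: mult_nonpos_nonneg)
    also have "0 \<le> r * (norm x)\<^sup>2" using assms by simp
    finally show "qform (pencil (\<lambda>_. 0) D t) x \<le> r * (norm x)\<^sup>2" .
  qed simp
  then show ?thesis by simp
qed

text \<open>Counting along an eigenbasis of \<open>D\<close> is essential: the cruder bound \<open>t C / \<delta>\<close> of the
  integrand would make the integral diverge logarithmically.\<close>

lemma nplus_weighted_integral: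
  fixes D :: "'a::chilbert_space \<Rightarrow> 'a"
  assumes D: "form_compact D" and fc: "\<And>t. form_compact (pencil (\<lambda>_. 0) D t)"
    and pos: "\<And>x. 0 \<le> qform D x"
    and tr: "\<And>J. finite J \<Longrightarrow> orthonormal J \<Longrightarrow> (\<Sum>e\<in>J. qform D e) \<le> C" and \<delta>: "0 < \<delta>"
  shows "(\<integral>\<^sup>+t. ennreal (real (nplus \<delta> (pencil (\<lambda>_. 0) D t)) / (1 + t\<^sup>2)) \<partial>lborel) \<le> ennreal (C / \<delta>)"
proof -
  let ?g = "\<lambda>t. real (nplus \<delta> (pencil (\<lambda>_. 0) D t))"
  have sa: "selfadjoint_op D" using D by (rule form_compact_sa)
  have q: "qform (pencil (\<lambda>_. 0) D t) x = t * qform D x" for t x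
    by (simp add: qform_pencil) (simp add: qform_def)
  have meas [measurable]: "?g \<in> borel_measurable borel"
    by (rule nplus_pencil_measurable[OF fc sa \<delta>])
  \<comment> \<open>Up to the cutoff n only the finitely many eigenvalues above \<delta> / (n + 1)
    can be counted, with n + 1 instead of n for the sake of n = 0; monotone convergence removes the
    cutoff.\<close>
  let ?f = "\<lambda>n::nat. \<lambda>t. ennreal (?g t / (1 + t\<^sup>2)) * indicator {..real n} t"
  have bnd: "(\<integral>\<^sup>+t. ?f n t \<partial>lborel) \<le> ennreal (C / \<delta>)" for n
  proof -
    define T where "T = real n + 1"
    have T: "T > 0" by (simp add: T_def)
    have "0 < \<delta> / T" using \<delta> T by simp
    then obtain J b where J: "eigen_frame D (\<delta> / T) J b" using eigen_frame_exists[OF D] by blast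
    have J': "finite J" "orthonormal J" "\<forall>e\<in>J. D e = of_real (b e) *\<^sub>C e" "\<And>e. e \<in> J \<Longrightarrow> \<delta> / T < b e"
      "\<And>x. orth_to J x \<Longrightarrow> qform D x \<le> \<delta> / T * (norm x)\<^sup>2"
      using J by (auto simp: eigen_frame_def eigen_system_def)
    have b0: "0 < b e" if "e \<in> J" for e using J'(4)[OF that] \<open>0 < \<delta> / T\<close> by linarith
    have qb: "qform D e = b e" if "e \<in> J" for e
      using J'(3) that orthonormal_norm[OF J'(2) that] by (simp add: qform_def cinner_scaleC_right cinner_self)
    \<comment> \<open>The eigenvalue b e of \<open>D\<close> is counted only for t beyond \<delta> /
      b e, so the count is dominated by a finite sum of indicators.\<close>
    have g_le: "?g t \<le> (\<Sum>e\<in>J. indicator {\<delta> / b e..} t)" if t: "t \<le> real n" for t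
    proof (cases "t \<le> 0")
      case True
      then show ?thesis using nplus_zero_pencil_nonpos[OF fc pos _ \<delta>] by (simp add: sum_nonneg)
    next
      case False
      define F where "F = {e\<in>J. \<delta> < t * b e}"
      have "nplus \<delta> (pencil (\<lambda>_. 0) D t) \<le> card F"
      proof (rule nplus_le[OF fc \<delta>])
        show "finite F" using J'(1) by (simp add: F_def)
        fix x assume x: "orth_to F x"
        have "t * qform D x = (\<Sum>e\<in>J. t * b e * (cmod (cinner e x))\<^sup>2) + t * qform D (x - fproj J x)"
          unfolding qform_decomp[OF sa J'(1-3), of x] by (simp add: distrib_left sum_distrib_left mult.assoc)
        also have "\<dots> \<le> (\<Sum>e\<in>J. \<delta> * (cmod (cinner e x))\<^sup>2) + \<delta> * (norm (x - fproj J x))\<^sup>2"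
        proof (intro add_mono sum_mono)
          fix e assume e: "e \<in> J"
          show "t * b e * (cmod (cinner e x))\<^sup>2 \<le> \<delta> * (cmod (cinner e x))\<^sup>2"
          proof (cases "e \<in> F")
            case True
            then show ?thesis using x by (simp add: orth_to_def)
          next
            case False
            then show ?thesis using e by (intro mult_right_mono) (auto simp: F_def)
          qed
        next
          have "orth_to J (x - fproj J x)" unfolding orth_to_def using fproj_orth[OF J'(1,2)] by blast
          then have "t * qform D (x - fproj J x) \<le> T * (\<delta> / T * (norm (x - fproj J x))\<^sup>2)"
            using False t pos T by (intro mult_mono J'(5)) (auto simp: T_def)
          then show "t * qform D (x - fproj J x) \<le> \<delta> * (norm (x - fproj J x))\<^sup>2" using T by simp
        qed
        also have "\<dots> = \<delta> * (norm x)\<^sup>2"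
          unfolding pythagoras_fproj[OF J'(1,2), of x] by (simp add: distrib_left sum_distrib_left)
        finally show "qform (pencil (\<lambda>_. 0) D t) x \<le> \<delta> * (norm x)\<^sup>2" unfolding q .
      qed
      then have "?g t \<le> real (card F)" by simp
      also have "\<dots> = (\<Sum>e\<in>F. 1)" by simp
      also have "\<dots> = (\<Sum>e\<in>F. indicator {\<delta> / b e..} t)"
      proof (rule sum.cong[OF refl])
        fix e assume "e \<in> F"
        then have "\<delta> < t * b e" "0 < b e" using b0 by (auto simp: F_def)
        then have "\<delta> / b e \<le> t" by (simp add: field_simps)
        then show "1 = (indicator {\<delta> / b e..} t :: real)" by simp
      qed
      also have "\<dots> \<le> (\<Sum>e\<in>J. indicator {\<delta> / b e..} t)"
        by (rule sum_mono2[OF J'(1)]) (auto simp: F_def)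
      finally show ?thesis .
    qed
    have "(\<integral>\<^sup>+t. ?f n t \<partial>lborel) \<le> (\<integral>\<^sup>+t. (\<Sum>e\<in>J. ennreal (1 / (1 + t\<^sup>2)) * indicator {\<delta> / b e..} t) \<partial>lborel)"
    proof (rule nn_integral_mono)
      fix t :: real
      show "?f n t \<le> (\<Sum>e\<in>J. ennreal (1 / (1 + t\<^sup>2)) * indicator {\<delta> / b e..} t)"
      proof (cases "t \<le> real n")
        case True
        have "?g t / (1 + t\<^sup>2) \<le> (\<Sum>e\<in>J. indicator {\<delta> / b e..} t) / (1 + t\<^sup>2)"
          using g_le[OF True] by (intro divide_right_mono) (auto simp: add_nonneg_nonneg)
        also have "\<dots> = (\<Sum>e\<in>J. 1 / (1 + t\<^sup>2) * indicator {\<delta> / b e..} t)"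
          by (simp add: sum_divide_distrib)
        finally have "ennreal (?g t / (1 + t\<^sup>2)) \<le> ennreal (\<Sum>e\<in>J. 1 / (1 + t\<^sup>2) * indicator {\<delta> / b e..} t)"
          by (rule ennreal_leI)
        also have "\<dots> = (\<Sum>e\<in>J. ennreal (1 / (1 + t\<^sup>2) * indicator {\<delta> / b e..} t))"
          by (rule sum_ennreal[symmetric]) (auto intro!: divide_nonneg_nonneg add_nonneg_nonneg)
        also have "\<dots> = (\<Sum>e\<in>J. ennreal (1 / (1 + t\<^sup>2)) * indicator {\<delta> / b e..} t)"
          by (intro sum.cong refl) (auto split: split_indicator)
        finally show ?thesis using True by simp
      qed simp
    qed
    also have "\<dots> = (\<Sum>e\<in>J. \<integral>\<^sup>+t. ennreal (1 / (1 + t\<^sup>2)) * indicator {\<delta> / b e..} t \<partial>lborel)"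
      by (rule nn_integral_sum) measurable
    \<comment> \<open>Each indicator integrates to at most b e / \<delta>, the reciprocal of its
      starting point; the sum over J is a partial trace of \<open>D\<close>, bounded by C for every
      cutoff.\<close>
    also have "\<dots> \<le> (\<Sum>e\<in>J. ennreal (b e / \<delta>))"
    proof (rule sum_mono)
      fix e assume e: "e \<in> J"
      show "(\<integral>\<^sup>+t. ennreal (1 / (1 + t\<^sup>2)) * indicator {\<delta> / b e..} t \<partial>lborel) \<le> ennreal (b e / \<delta>)"
        using nn_integral_tail[of "\<delta> / b e"] b0[OF e] \<delta> by simp
    qed
    also have "\<dots> = ennreal (\<Sum>e\<in>J. b e / \<delta>)"
      by (rule sum_ennreal) (use b0 \<delta> in \<open>auto intro!: divide_nonneg_nonneg less_imp_le\<close>)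
    also have "(\<Sum>e\<in>J. b e / \<delta>) = (\<Sum>e\<in>J. qform D e) / \<delta>"
      by (simp add: sum_divide_distrib qb)
    also have "ennreal ((\<Sum>e\<in>J. qform D e) / \<delta>) \<le> ennreal (C / \<delta>)"
      using tr[OF J'(1,2)] \<delta> by (intro ennreal_leI divide_right_mono) auto
    finally show ?thesis .
  qed
  have inc: "incseq ?f"
    by (rule incseq_SucI, rule le_funI) (auto split: split_indicator)
  have "(SUP n. ?f n t) = ennreal (?g t / (1 + t\<^sup>2))" for t
  proof (rule antisym)
    show "(SUP n. ?f n t) \<le> ennreal (?g t / (1 + t\<^sup>2))" by (rule SUP_least) (auto split: split_indicator)
    obtain n :: nat where "t \<le> real n" using real_arch_simple by blast
    then have "ennreal (?g t / (1 + t\<^sup>2)) = ?f n t" by simp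
    also have "\<dots> \<le> (SUP n. ?f n t)" by (rule SUP_upper) simp
    finally show "ennreal (?g t / (1 + t\<^sup>2)) \<le> (SUP n. ?f n t)" .
  qed
  then have "(\<integral>\<^sup>+t. ennreal (?g t / (1 + t\<^sup>2)) \<partial>lborel) = (\<integral>\<^sup>+t. (SUP n. ?f n t) \<partial>lborel)" by simp
  also have "\<dots> = (SUP n. \<integral>\<^sup>+t. ?f n t \<partial>lborel)"
    by (rule nn_integral_monotone_convergence_SUP[OF inc]) measurable
  also have "\<dots> \<le> ennreal (C / \<delta>)" by (rule SUP_least) (rule bnd)
  finally show ?thesis .
qed

section \<open>Spectral shift integrals and their comparison with counts\<close>

lemma cauchy_density:
  "integrable lborel (\<lambda>t::real. 1 / (1 + t\<^sup>2))" "(\<integral>t. 1 / (1 + (t::real)\<^sup>2) \<partial>lborel) = pi"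
proof -
  note lims = tendsto_arctan_at_top tendsto_arctan_at_bot
  have D: "DERIV arctan x :> 1 / (1 + x\<^sup>2)" for x
    using DERIV_arctan[of x] by (simp add: inverse_eq_divide)
  have c: "isCont (\<lambda>t::real. 1 / (1 + t\<^sup>2)) x" for x
    by (intro continuous_intros) (simp add: add_nonneg_eq_0_iff)
  have A: "((arctan \<circ> real_of_ereal) \<longlongrightarrow> - (pi / 2)) (at_right (-\<infinity>))"
    unfolding ereal_tendsto_simps by (rule lims)
  have B: "((arctan \<circ> real_of_ereal) \<longlongrightarrow> pi / 2) (at_left \<infinity>)"
    unfolding ereal_tendsto_simps by (rule lims)
  have I: "set_integrable lborel (einterval (-\<infinity>) \<infinity>) (\<lambda>t::real. 1 / (1 + t\<^sup>2))"
    "(LBINT t=-\<infinity>..\<infinity>. 1 / (1 + t\<^sup>2)) = pi / 2 - (- (pi / 2))"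
    by (rule interval_integral_FTC_nonneg[where F = arctan]; use D c A B in \<open>simp\<close>)+
  have e: "einterval (-\<infinity>) \<infinity> = UNIV" by (auto simp: einterval_def)
  show "integrable lborel (\<lambda>t::real. 1 / (1 + t\<^sup>2))"
    using I(1) by (simp add: e set_integrable_def)
  show "(\<integral>t. 1 / (1 + (t::real)\<^sup>2) \<partial>lborel) = pi"
    using I(2) by (simp add: e interval_lebesgue_integral_def set_lebesgue_integral_def)
qed

text \<open>Common form of both spectral shift functions, up to sign; for H^+ the operators A and B
  enter negated, see \<open>xi_signed\<close>.\<close>

definition ssf_int :: "('a::complex_inner \<Rightarrow> 'a) \<Rightarrow> ('a \<Rightarrow> 'a) \<Rightarrow> real"
  where "ssf_int A B = 1 / pi * (\<integral>t. real (nplus 1 (pencil A B t)) / (1 + t\<^sup>2) \<partial>lborel)"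

text \<open>The bound \<open>up\<close> also makes the count integrable, which the lower estimate
  requires as much as the upper one. The total mass of the weight is pi, which turns k into k /
  pi.\<close>

lemma ssf_int_estimate:
  fixes A B :: "'a::chilbert_space \<Rightarrow> 'a" and h :: "real \<Rightarrow> real"
  assumes fc: "\<And>t. form_compact (pencil A B t)" and B: "selfadjoint_op B"
    and h: "integrable lborel (\<lambda>t. h t / (1 + t\<^sup>2))" "(\<integral>t. h t / (1 + t\<^sup>2) \<partial>lborel) \<le> k"
    and up: "\<And>t. real (nplus 1 (pencil A B t)) \<le> u + h t"
    and lo: "\<And>t. l - h t \<le> real (nplus 1 (pencil A B t))"
  shows "l - k / pi \<le> ssf_int A B" "ssf_int A B \<le> u + k / pi"
proof -
  let ?N = "\<lambda>t. real (nplus 1 (pencil A B t))"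
  have [measurable]: "?N \<in> borel_measurable borel"
    by (rule nplus_pencil_measurable[OF fc B]) simp
  have pos: "0 < 1 + t\<^sup>2" for t :: real by (simp add: add_pos_nonneg)
  have iu: "integrable lborel (\<lambda>t. u * (1 / (1 + t\<^sup>2)) + h t / (1 + t\<^sup>2))"
    by (intro Bochner_Integration.integrable_add integrable_mult_right cauchy_density h)
  have il: "integrable lborel (\<lambda>t. l * (1 / (1 + t\<^sup>2)) - h t / (1 + t\<^sup>2))"
    by (intro Bochner_Integration.integrable_diff integrable_mult_right cauchy_density h)
  have iN: "integrable lborel (\<lambda>t. ?N t / (1 + t\<^sup>2))"
  proof (rule Bochner_Integration.integrable_bound[OF iu])
    show "AE t in lborel. norm (?N t / (1 + t\<^sup>2)) \<le> norm (u * (1 / (1 + t\<^sup>2)) + h t / (1 + t\<^sup>2))"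
    proof (rule AE_I2)
      fix t :: real
      have "?N t / (1 + t\<^sup>2) \<le> (u + h t) / (1 + t\<^sup>2)" using pos[of t] up[of t] by (intro divide_right_mono) auto
      then have "?N t / (1 + t\<^sup>2) \<le> u * (1 / (1 + t\<^sup>2)) + h t / (1 + t\<^sup>2)" by (simp add: add_divide_distrib)
      moreover have "0 \<le> ?N t / (1 + t\<^sup>2)" using pos[of t] by simp
      ultimately show "norm (?N t / (1 + t\<^sup>2)) \<le> norm (u * (1 / (1 + t\<^sup>2)) + h t / (1 + t\<^sup>2))" by simp
    qed
  qed measurable
  have "(\<integral>t. ?N t / (1 + t\<^sup>2) \<partial>lborel) \<le> (\<integral>t. u * (1 / (1 + t\<^sup>2)) + h t / (1 + t\<^sup>2) \<partial>lborel)"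
  proof (rule integral_mono[OF iN iu])
    fix t :: real
    have "?N t / (1 + t\<^sup>2) \<le> (u + h t) / (1 + t\<^sup>2)" using pos[of t] up[of t] by (intro divide_right_mono) auto
    then show "?N t / (1 + t\<^sup>2) \<le> u * (1 / (1 + t\<^sup>2)) + h t / (1 + t\<^sup>2)" by (simp add: add_divide_distrib)
  qed
  also have "\<dots> = u * pi + (\<integral>t. h t / (1 + t\<^sup>2) \<partial>lborel)"
    by (subst Bochner_Integration.integral_add[OF integrable_mult_right[OF cauchy_density(1)] h(1)])
      (simp only: integral_mult_right_zero cauchy_density(2))
  also have "\<dots> \<le> u * pi + k" using h(2) by simp
  finally have "(\<integral>t. ?N t / (1 + t\<^sup>2) \<partial>lborel) / pi \<le> (u * pi + k) / pi"
    by (intro divide_right_mono) auto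
  then show "ssf_int A B \<le> u + k / pi" unfolding ssf_int_def by (simp add: add_divide_distrib)
  have "l * pi - k \<le> l * pi - (\<integral>t. h t / (1 + t\<^sup>2) \<partial>lborel)" using h(2) by simp
  also have "\<dots> = (\<integral>t. l * (1 / (1 + t\<^sup>2)) - h t / (1 + t\<^sup>2) \<partial>lborel)"
    by (subst Bochner_Integration.integral_diff[OF integrable_mult_right[OF cauchy_density(1)] h(1)])
      (simp only: integral_mult_right_zero cauchy_density(2))
  also have "\<dots> \<le> (\<integral>t. ?N t / (1 + t\<^sup>2) \<partial>lborel)"
  proof (rule integral_mono[OF il iN])
    fix t :: real
    have "(l - h t) / (1 + t\<^sup>2) \<le> ?N t / (1 + t\<^sup>2)" using pos[of t] lo[of t] by (intro divide_right_mono) auto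
    then show "l * (1 / (1 + t\<^sup>2)) - h t / (1 + t\<^sup>2) \<le> ?N t / (1 + t\<^sup>2)" by (simp add: diff_divide_distrib)
  qed
  finally have "(l * pi - k) / pi \<le> (\<integral>t. ?N t / (1 + t\<^sup>2) \<partial>lborel) / pi"
    by (intro divide_right_mono) auto
  then show "l - k / pi \<le> ssf_int A B" unfolding ssf_int_def by (simp add: diff_divide_distrib)
qed

text \<open>Provides for each t linear conditions under which the remainder costs at most \<epsilon>
  |x|^2, their number being integrable against the weight. The term linear in Z x takes a fixed
  number of conditions, the term proportional to t the counts of
  \<open>nplus_weighted_integral\<close>.\<close>

lemma remainder_frames:
  fixes Z :: "'a::chilbert_space \<Rightarrow> 'b::complex_inner"
  assumes Z: "bounded_clinear Z" "hs_bound Z C0" and C: "0 < C" and \<epsilon>: "0 < \<epsilon>"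
  shows "\<exists>h k. integrable lborel (\<lambda>t. h t / (1 + t\<^sup>2)) \<and> (\<integral>t. h t / (1 + t\<^sup>2) \<partial>lborel) \<le> k \<and>
    (\<forall>t. \<exists>F. finite F \<and> real (card F) \<le> h t \<and> (\<forall>x. orth_to F x \<longrightarrow>
        C * norm x * norm (Z x) + \<bar>t\<bar> * (C * (norm (Z x))\<^sup>2) \<le> \<epsilon> * (norm x)\<^sup>2))"
proof -
  define D where "D = (\<lambda>x. cadjoint Z (Z x))"
  have qD: "qform D x = (norm (Z x))\<^sup>2" for x unfolding D_def by (rule gram_selfadjoint(2)[OF Z(1)])
  have saD: "selfadjoint_op D" unfolding D_def by (rule gram_selfadjoint(1)[OF Z(1)])
  have fcD: "form_compact D" unfolding D_def by (rule form_compact_gram[OF Z])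
  have sa0: "selfadjoint_op (\<lambda>_::'a. 0::'a)" by (simp add: selfadjoint_op_def bounded_clinear_zero)
  have q: "qform (pencil (\<lambda>_. 0) D t) x = t * (norm (Z x))\<^sup>2" for t x
    by (simp add: qform_pencil qD) (simp add: qform_def)
  have fc: "form_compact (pencil (\<lambda>_. 0) D t)" for t
    by (rule form_compactI_hs[OF selfadjoint_pencil[OF sa0 saD] Z, where a = 0 and b = "\<bar>t\<bar>"]) (auto simp: q abs_mult)
  \<comment> \<open>Each of the two remainder terms receives \<epsilon> / 2.\<close>
  define \<delta> where "\<delta> = \<epsilon> / (2 * C)"
  have \<delta>: "0 < \<delta>" using C \<epsilon> by (simp add: \<delta>_def)
  define g where "g t = real (nplus \<delta> (pencil (\<lambda>_. 0) D t))" for t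
  have [measurable]: "g \<in> borel_measurable borel"
    unfolding g_def by (rule nplus_pencil_measurable[OF fc saD \<delta>])
  have tr: "(\<Sum>e\<in>J. qform D e) \<le> C0" if "finite J" "orthonormal J" for J
    using Z(2) that by (simp add: qD hs_bound_def)
  have nn: "(\<integral>\<^sup>+t. ennreal (g t / (1 + t\<^sup>2)) \<partial>lborel) \<le> ennreal (C0 / \<delta>)"
    unfolding g_def by (rule nplus_weighted_integral[OF fcD fc _ tr \<delta>]) (simp add: qD)
  have pos: "0 \<le> g t / (1 + t\<^sup>2)" for t by (simp add: g_def add_nonneg_nonneg)
  have ig: "integrable lborel (\<lambda>t. g t / (1 + t\<^sup>2))"
  proof (rule integrableI_bounded)
    show "(\<integral>\<^sup>+t. ennreal (norm (g t / (1 + t\<^sup>2))) \<partial>lborel) < \<infinity>"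
      unfolding real_norm_def abs_of_nonneg[OF pos] infinity_ennreal_def
      by (rule order_le_less_trans[OF nn ennreal_less_top])
  qed measurable
  have "integrable lborel (\<lambda>t. g (0 + (-1) * t) / (1 + (0 + (-1) * t)\<^sup>2))"
    by (rule lborel_integrable_real_affine[OF ig]) simp
  then have ig': "integrable lborel (\<lambda>t. g (- t) / (1 + t\<^sup>2))" by simp
  obtain F where F: "finite F" "\<And>x. orth_to F x \<Longrightarrow> (norm (Z x))\<^sup>2 \<le> \<delta>\<^sup>2 * (norm x)\<^sup>2"
    using hs_bound_small[OF Z zero_less_power[OF \<delta>]] by blast
  \<comment> \<open>One of g t and g (- t) is the count at |t| and the other is nonnegative; the
    integrability of the sum follows by reflection.\<close>
  define h where "h t = real (card F) + (g t + g (- t))" for t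
  have ih: "integrable lborel (\<lambda>t. h t / (1 + t\<^sup>2))"
    using Bochner_Integration.integrable_add[OF integrable_mult_right[OF cauchy_density(1), of "real (card F)"]
        Bochner_Integration.integrable_add[OF ig ig']]
    by (simp add: h_def add_divide_distrib)
  have "\<exists>F. finite F \<and> real (card F) \<le> h t \<and> (\<forall>x. orth_to F x \<longrightarrow>
        C * norm x * norm (Z x) + \<bar>t\<bar> * (C * (norm (Z x))\<^sup>2) \<le> \<epsilon> * (norm x)\<^sup>2)" for t
  proof -
    obtain J b where J: "eigen_frame (pencil (\<lambda>_. 0) D \<bar>t\<bar>) \<delta> J b" "nplus \<delta> (pencil (\<lambda>_. 0) D \<bar>t\<bar>) = card J"
      using nplus_obtain[OF fc \<delta>] .
    have "real (card (F \<union> J)) \<le> real (card F) + real (card J)" by (metis card_Un_le of_nat_add of_nat_mono)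
    also have "real (card J) \<le> g t + g (- t)"
      using J(2) by (cases "0 \<le> t") (simp_all add: g_def)
    finally have 1: "real (card (F \<union> J)) \<le> h t" by (simp add: h_def)
    have 2: "C * norm x * norm (Z x) + \<bar>t\<bar> * (C * (norm (Z x))\<^sup>2) \<le> \<epsilon> * (norm x)\<^sup>2"
      if x: "orth_to (F \<union> J) x" for x
    proof -
      have "norm (Z x) \<le> \<delta> * norm x"
        by (rule power2_le_imp_le) (use F(2)[of x] x \<delta> in \<open>simp_all add: power_mult_distrib\<close>)
      then have "C * norm x * norm (Z x) \<le> C * norm x * (\<delta> * norm x)" using C by (intro mult_left_mono) auto
      also have "\<dots> = \<epsilon> / 2 * (norm x)\<^sup>2" using C by (simp add: \<delta>_def power2_eq_square)
      finally have a: "C * norm x * norm (Z x) \<le> \<epsilon> / 2 * (norm x)\<^sup>2" .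
      have "\<bar>t\<bar> * (norm (Z x))\<^sup>2 \<le> \<delta> * (norm x)\<^sup>2" using J(1) x unfolding eigen_frame_def q by simp
      then have "C * (\<bar>t\<bar> * (norm (Z x))\<^sup>2) \<le> C * (\<delta> * (norm x)\<^sup>2)" using C by (intro mult_left_mono) auto
      also have "\<dots> = \<epsilon> / 2 * (norm x)\<^sup>2" using C by (simp add: \<delta>_def)
      finally show ?thesis using a by (simp add: mult_ac)
    qed
    show ?thesis using 1 2 F(1) J(1)
      by (intro exI[of _ "F \<union> J"]) (simp add: eigen_frame_def eigen_system_def del: orth_to_Un)
  qed
  then show ?thesis using ih by blast
qed

lemma card_Un_image_le:
  assumes "finite F" "finite J"
  shows "card (F \<union> f ` J) \<le> card F + card J"
  using card_Un_le[of F "f ` J"] card_image_le[OF assms(2), of f] by linarith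

text \<open>K is chosen before A, B, Y, c and a, hence uniform in the energy when c = \<plusminus> h
  / (2 k) is inserted. The form of A is c times that of Y Y^* up to a remainder. For c > 0 the count
  above 1 is compared with that of Y^* Y above (1 \<plusminus> \<epsilon>) / c; for c \<le> 0 only
  the remainder can produce eigenvalues above 1.\<close>

theorem ssf_int_bounds:
  fixes Z :: "'h::chilbert_space \<Rightarrow> 'b::complex_inner"
  assumes Z: "bounded_clinear Z" "hs_bound Z C0" and C: "0 < C" and \<epsilon>: "0 < \<epsilon>" "\<epsilon> < 1"
  shows "\<exists>K. \<forall>A B (Y::'g::chilbert_space \<Rightarrow> 'h) c a.
    selfadjoint_op A \<longrightarrow> selfadjoint_op B \<longrightarrow> bounded_clinear Y \<longrightarrow> 0 < a \<longrightarrow>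
    (\<forall>x. norm (cadjoint Y x) \<le> a * norm (Z x)) \<longrightarrow>
    (\<forall>x. \<bar>qform A x - c * (norm (cadjoint Y x))\<^sup>2\<bar> \<le> C * norm x * norm (Z x)) \<longrightarrow>
    (\<forall>x. \<bar>qform B x\<bar> \<le> C * (norm (Z x))\<^sup>2) \<longrightarrow>
    (0 < c \<longrightarrow> real (nplus ((1 + \<epsilon>) / c) (\<lambda>g. cadjoint Y (Y g))) - K \<le> ssf_int A B \<and>
       ssf_int A B \<le> real (nplus ((1 - \<epsilon>) / c) (\<lambda>g. cadjoint Y (Y g))) + K) \<and>
    (c \<le> 0 \<longrightarrow> \<bar>ssf_int A B\<bar> \<le> K)"
proof -
  obtain h k where h: "integrable lborel (\<lambda>t. h t / (1 + t\<^sup>2))" "(\<integral>t. h t / (1 + t\<^sup>2) \<partial>lborel) \<le> k"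
    "\<And>t. \<exists>F. finite F \<and> real (card F) \<le> h t \<and> (\<forall>x. orth_to F x \<longrightarrow>
        C * norm x * norm (Z x) + \<bar>t\<bar> * (C * (norm (Z x))\<^sup>2) \<le> \<epsilon> * (norm x)\<^sup>2)"
    using remainder_frames[OF Z C \<epsilon>(1)] by blast
  show ?thesis
  proof (intro exI[of _ "k / pi"] allI impI)
    fix A B and Y :: "'g \<Rightarrow> 'h" and c a :: real
    assume A: "selfadjoint_op A" and B: "selfadjoint_op B" and Y: "bounded_clinear Y" and a: "0 < a"
      and Ya: "\<forall>x. norm (cadjoint Y x) \<le> a * norm (Z x)"
      and qA: "\<forall>x. \<bar>qform A x - c * (norm (cadjoint Y x))\<^sup>2\<bar> \<le> C * norm x * norm (Z x)"
      and qB: "\<forall>x. \<bar>qform B x\<bar> \<le> C * (norm (Z x))\<^sup>2"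
    \<comment> \<open>Compactness is qualitative, so the constants here may depend on c, a and t;
      the bound \<open>k\<close> obtained above does not.\<close>
    have fc: "form_compact (pencil A B t)" for t
    proof (rule form_compactI_hs[OF selfadjoint_pencil[OF A B] Z,
          where a = C and b = "\<bar>c\<bar> * a\<^sup>2 + \<bar>t\<bar> * C"])
      fix x
      have "(norm (cadjoint Y x))\<^sup>2 \<le> (a * norm (Z x))\<^sup>2" using Ya by (intro power_mono) auto
      then have "\<bar>c\<bar> * (norm (cadjoint Y x))\<^sup>2 \<le> \<bar>c\<bar> * a\<^sup>2 * (norm (Z x))\<^sup>2"
        using mult_left_mono[of "(norm (cadjoint Y x))\<^sup>2" "(a * norm (Z x))\<^sup>2" "\<bar>c\<bar>"]
        by (simp add: power_mult_distrib mult.assoc)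
      then have 1: "\<bar>c * (norm (cadjoint Y x))\<^sup>2\<bar> \<le> \<bar>c\<bar> * a\<^sup>2 * (norm (Z x))\<^sup>2" by (simp add: abs_mult)
      have 2: "\<bar>t * qform B x\<bar> \<le> \<bar>t\<bar> * (C * (norm (Z x))\<^sup>2)"
        unfolding abs_mult using qB by (intro mult_left_mono) auto
      have 3: "\<bar>qform A x - c * (norm (cadjoint Y x))\<^sup>2\<bar> \<le> C * norm x * norm (Z x)" using qA by blast
      show "\<bar>qform (pencil A B t) x\<bar> \<le> C * norm x * norm (Z x) + (\<bar>c\<bar> * a\<^sup>2 + \<bar>t\<bar> * C) * (norm (Z x))\<^sup>2"
        unfolding qform_pencil distrib_right using 1 2 3 by (simp add: mult.assoc)
    qed (use C in auto)
    let ?E = "\<lambda>g. cadjoint Y (Y g)"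
    have fcE: "form_compact ?E" by (rule form_compact_gram_dual[OF Z Y _ a]) (use Ya in blast)
    note saE = gram_selfadjoint(1)[OF Y] and qE = gram_selfadjoint(2)[OF Y]
    have rem: "\<bar>qform (pencil A B t) x - c * (norm (cadjoint Y x))\<^sup>2\<bar>
        \<le> C * norm x * norm (Z x) + \<bar>t\<bar> * (C * (norm (Z x))\<^sup>2)" for t x
    proof -
      have "\<bar>t * qform B x\<bar> \<le> \<bar>t\<bar> * (C * (norm (Z x))\<^sup>2)"
        unfolding abs_mult using qB by (intro mult_left_mono) auto
      moreover have "\<bar>qform A x - c * (norm (cadjoint Y x))\<^sup>2\<bar> \<le> C * norm x * norm (Z x)" using qA by blast
      ultimately show ?thesis unfolding qform_pencil by linarith
    qed
    \<comment> \<open>On the complement of F and of the image under Y of a frame above (1 -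
      \<epsilon>) / c, the singular part is at most 1 - \<epsilon> and the remainder at most
      \<epsilon>.\<close>
    have up: "real (nplus 1 (pencil A B t)) \<le> real (nplus ((1 - \<epsilon>) / c) ?E) + h t" if c: "0 < c" for t
    proof -
      obtain F where F: "finite F" "real (card F) \<le> h t" "\<And>x. orth_to F x \<Longrightarrow>
        C * norm x * norm (Z x) + \<bar>t\<bar> * (C * (norm (Z x))\<^sup>2) \<le> \<epsilon> * (norm x)\<^sup>2" using h(3) by blast
      have "0 < (1 - \<epsilon>) / c" using c \<epsilon> by simp
      then obtain J b where J: "eigen_frame ?E ((1 - \<epsilon>) / c) J b" "nplus ((1 - \<epsilon>) / c) ?E = card J"
        using nplus_obtain[OF fcE] by blast
      have fJ: "finite J" using J(1) by (simp add: eigen_frame_def eigen_system_def)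
      have "nplus 1 (pencil A B t) \<le> card (F \<union> Y ` J)"
      proof (rule nplus_le[OF fc])
        fix x assume x: "orth_to (F \<union> Y ` J) x"
        have "(norm (cadjoint Y x))\<^sup>2 \<le> (1 - \<epsilon>) / c * (norm x)\<^sup>2"
          using x c \<epsilon> by (intro gram_frame_dual[OF Y J(1)]) auto
        then have "c * (norm (cadjoint Y x))\<^sup>2 \<le> (1 - \<epsilon>) * (norm x)\<^sup>2" using c by (simp add: field_simps)
        then show "qform (pencil A B t) x \<le> 1 * (norm x)\<^sup>2"
          using rem[of t x] F(3)[of x] x by (simp add: algebra_simps)
      qed (use F fJ in auto)
      also have "\<dots> \<le> card F + card J" by (rule card_Un_image_le[OF F(1) fJ])
      finally show ?thesis using F(2) J(2) by simp
    qed
    have up0: "real (nplus 1 (pencil A B t)) \<le> 0 + h t" if c: "c \<le> 0" for t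
    proof -
      obtain F where F: "finite F" "real (card F) \<le> h t" "\<And>x. orth_to F x \<Longrightarrow>
        C * norm x * norm (Z x) + \<bar>t\<bar> * (C * (norm (Z x))\<^sup>2) \<le> \<epsilon> * (norm x)\<^sup>2" using h(3) by blast
      have "nplus 1 (pencil A B t) \<le> card F"
      proof (rule nplus_le[OF fc])
        fix x assume x: "orth_to F x"
        have "c * (norm (cadjoint Y x))\<^sup>2 \<le> 0" using c by (simp add: mult_nonpos_nonneg)
        moreover have "\<epsilon> * (norm x)\<^sup>2 \<le> 1 * (norm x)\<^sup>2" using \<epsilon> by (intro mult_right_mono) auto
        ultimately show "qform (pencil A B t) x \<le> 1 * (norm x)\<^sup>2"
          using rem[of t x] F(3)[OF x] by linarith
      qed (use F in auto)
      then show ?thesis using F(2) by simp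
    qed
    have lo0: "0 - h t \<le> real (nplus 1 (pencil A B t))" for t
    proof -
      have "0 \<le> h t" using h(3)[of t] of_nat_0_le_iff order_trans by blast
      then show ?thesis by simp
    qed
    have lo: "real (nplus ((1 + \<epsilon>) / c) ?E) - h t \<le> real (nplus 1 (pencil A B t))" if c: "0 < c" for t
    proof -
      obtain F where F: "finite F" "real (card F) \<le> h t" "\<And>x. orth_to F x \<Longrightarrow>
        C * norm x * norm (Z x) + \<bar>t\<bar> * (C * (norm (Z x))\<^sup>2) \<le> \<epsilon> * (norm x)\<^sup>2" using h(3) by blast
      have "0 < (1 + \<epsilon>) / c" using c \<epsilon> by simp
      then obtain J b where J: "eigen_frame ?E ((1 + \<epsilon>) / c) J b" "nplus ((1 + \<epsilon>) / c) ?E = card J"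
        using nplus_obtain[OF fcE] by blast
      obtain L d where L: "eigen_frame (pencil A B t) 1 L d" "nplus 1 (pencil A B t) = card L"
        using nplus_obtain[OF fc, of 1 t] by auto
      have fin: "finite L" "finite J" "orthonormal J" "eigen_system ?E ((1 + \<epsilon>) / c) J b"
        using L J by (auto simp: eigen_frame_def eigen_system_def)
      \<comment> \<open>Otherwise some nonzero g in the span of J has Y g orthogonal to F and L.
        Then c |Y g|^2 > (1 + \<epsilon>) |g|^2 while c |Y^* Y g|^2 \<le> (1 + \<epsilon>) |Y g|^2,
        which contradicts |Y g|^2 \<le> |g| |Y^* Y g|.\<close>
      have "card J \<le> card F + card L"
      proof (rule ccontr)
        assume "\<not> ?thesis"
        moreover have "card (cadjoint Y ` (F \<union> L)) \<le> card F + card L"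
          using card_image_le[of "F \<union> L" "cadjoint Y"] card_Un_le[of F L] F(1) fin(1) by force
        ultimately obtain g where g: "g \<in> cvec.span J" "g \<noteq> 0" "orth_to (cadjoint Y ` (F \<union> L)) g"
          using orthonormal_combination[of "cadjoint Y ` (F \<union> L)" J] F(1) fin by auto
        have oY: "orth_to (F \<union> L) (Y g)" using g(3) by (auto simp: orth_to_def cadjoint_works[OF Y] simp del: orth_to_Un)
        have "(1 + \<epsilon>) / c * (norm g)\<^sup>2 < (norm (Y g))\<^sup>2"
          using qform_span_gt[OF saE fin(4) g(1,2)] by (simp add: qE)
        then have g1: "(1 + \<epsilon>) * (norm g)\<^sup>2 < c * (norm (Y g))\<^sup>2" using c by (simp add: field_simps)
        have "(norm (Y g))\<^sup>2 = Re (cinner g (cadjoint Y (Y g)))" using qE[of g] by (simp add: qform_def)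
        also have "\<dots> \<le> norm g * norm (cadjoint Y (Y g))"
          using cinner_norm_bound complex_Re_le_cmod order_trans by blast
        finally have "((norm (Y g))\<^sup>2)\<^sup>2 \<le> (norm g * norm (cadjoint Y (Y g)))\<^sup>2" by (rule power_mono) simp
        then have g2: "((norm (Y g))\<^sup>2)\<^sup>2 \<le> (norm g)\<^sup>2 * (norm (cadjoint Y (Y g)))\<^sup>2" by (simp add: power_mult_distrib)
        have ng: "0 < (norm g)\<^sup>2" using g(2) by simp
        have nY: "0 < (norm (Y g))\<^sup>2"
          using g1 ng c \<epsilon> by (smt (verit) mult_nonneg_nonneg zero_le_power2 mult_pos_pos zero_less_mult_pos)
        have q1: "qform (pencil A B t) (Y g) \<le> (norm (Y g))\<^sup>2"
          using L(1) oY unfolding eigen_frame_def by simp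
        have q2: "c * (norm (cadjoint Y (Y g)))\<^sup>2 \<le> (1 + \<epsilon>) * (norm (Y g))\<^sup>2"
          using q1 rem[of t "Y g"] F(3)[of "Y g"] oY by (simp add: algebra_simps)
        have "(1 + \<epsilon>) * (norm g)\<^sup>2 * (norm (Y g))\<^sup>2 < c * (norm (Y g))\<^sup>2 * (norm (Y g))\<^sup>2"
          by (rule mult_strict_right_mono[OF g1 nY])
        also have "\<dots> = c * ((norm (Y g))\<^sup>2)\<^sup>2" by (simp only: power2_eq_square mult.assoc)
        also have "\<dots> \<le> c * ((norm g)\<^sup>2 * (norm (cadjoint Y (Y g)))\<^sup>2)" using c g2 by (intro mult_left_mono) auto
        also have "\<dots> = (norm g)\<^sup>2 * (c * (norm (cadjoint Y (Y g)))\<^sup>2)" by (simp add: mult_ac)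
        also have "\<dots> \<le> (norm g)\<^sup>2 * ((1 + \<epsilon>) * (norm (Y g))\<^sup>2)" using q2 by (intro mult_left_mono) auto
        finally show False by (simp add: mult_ac)
      qed
      then show ?thesis using F(2) J(2) L(2) by simp
    qed
    show "(0 < c \<longrightarrow> real (nplus ((1 + \<epsilon>) / c) ?E) - k / pi \<le> ssf_int A B \<and>
       ssf_int A B \<le> real (nplus ((1 - \<epsilon>) / c) ?E) + k / pi) \<and> (c \<le> 0 \<longrightarrow> \<bar>ssf_int A B\<bar> \<le> k / pi)"
    proof (intro conjI impI)
      assume c: "0 < c"
      show "real (nplus ((1 + \<epsilon>) / c) ?E) - k / pi \<le> ssf_int A B"
        by (rule ssf_int_estimate(1)[OF fc B h(1,2) up[OF c] lo[OF c]])
      show "ssf_int A B \<le> real (nplus ((1 - \<epsilon>) / c) ?E) + k / pi"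
        by (rule ssf_int_estimate(2)[OF fc B h(1,2) up[OF c] lo[OF c]])
    next
      assume c: "c \<le> 0"
      show "\<bar>ssf_int A B\<bar> \<le> k / pi"
        using ssf_int_estimate[OF fc B h(1,2) up0[OF c] lo0] by linarith
    qed
  qed
qed

text \<open>If the counts stayed bounded, they would be constant below some r. A vector orthogonal
  to the frame J at r and outside the kernel of Y would raise the count at a smaller level, so Y
  vanishes on the complement of J and the range of Y^* Y lies in the span of J.\<close>

lemma nplus_unbounded:
  fixes Y :: "'g::chilbert_space \<Rightarrow> 'h::complex_inner"
  assumes Y: "bounded_clinear Y" and fc: "form_compact (\<lambda>g. cadjoint Y (Y g))"
    and rank: "rank_op (\<lambda>g. cadjoint Y (Y g)) = \<infinity>"
  shows "\<exists>r0>0. \<forall>r. 0 < r \<longrightarrow> r < r0 \<longrightarrow> N \<le> nplus r (\<lambda>g. cadjoint Y (Y g))"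
proof (rule ccontr)
  assume n: "\<not> ?thesis"
  let ?E = "\<lambda>g. cadjoint Y (Y g)"
  note sa = form_compact_sa[OF fc] and q = gram_selfadjoint(2)[OF Y]
  have small: "nplus r ?E < N" if "0 < r" for r
  proof -
    from n that obtain r' where "0 < r'" "r' < r" "\<not> N \<le> nplus r' ?E" by blast
    then show ?thesis using nplus_antimono[OF fc, of r' r] by simp
  qed
  then obtain r where r: "0 < r" "\<And>r'. 0 < r' \<Longrightarrow> nplus r' ?E \<le> nplus r ?E"
    using ex_has_greatest_nat[of "\<lambda>r. 0 < r" 1 "\<lambda>r. nplus r ?E" N] by auto
  obtain J b where J: "eigen_frame ?E r J b" "nplus r ?E = card J" using nplus_obtain[OF fc r(1)] .
  have J': "finite J" "orthonormal J" "\<forall>e\<in>J. ?E e = of_real (b e) *\<^sub>C e" "\<And>e. e \<in> J \<Longrightarrow> r < b e"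
    using J(1) by (auto simp: eigen_frame_def eigen_system_def)
  have ker: "Y x = 0" if x: "orth_to J x" for x
  proof (rule ccontr)
    assume Yx: "Y x \<noteq> 0"
    then have "x \<noteq> 0" by (auto simp: bounded_clinearD[OF Y])
    define v where "v = (1 / norm x) *\<^sub>R x"
    have v: "norm v = 1" "orth_to J v" "Y v \<noteq> 0"
      using \<open>x \<noteq> 0\<close> x Yx by (auto simp: v_def orth_to_def cinner_scaleR_right bounded_clinearD(6)[OF Y])
    have vJ: "v \<notin> J" using v by (auto simp: orth_to_def cinner_self)
    \<comment> \<open>At most r, so that the eigenvalues of J still lie above it, and at most half
      of |Y v|^2, so that the form at v exceeds it strictly.\<close>
    define \<rho> where "\<rho> = min r ((norm (Y v))\<^sup>2 / 2)"
    have \<rho>: "0 < \<rho>" "\<rho> \<le> r" "\<rho> < (norm (Y v))\<^sup>2" using r v by (auto simp: \<rho>_def min_def)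
    obtain L d where L: "eigen_frame ?E \<rho> L d" "nplus \<rho> ?E = card L" using nplus_obtain[OF fc \<rho>(1)] .
    have fL: "finite L" using L(1) by (simp add: eigen_frame_def eigen_system_def)
    have on: "orthonormal (insert v J)" using v J'(2) orthonormal_insert[of J v] by (auto simp: orth_to_def)
    have "card L < card (insert v J)" using r(2)[OF \<rho>(1)] J(2) L(2) J'(1) vJ by simp
    then obtain y where y: "y \<in> cvec.span (insert v J)" "y \<noteq> 0" "orth_to L y"
      using orthonormal_combination[OF fL _ on] J'(1) by auto
    have py: "fproj (insert v J) y = y" by (rule fproj_span[OF _ on y(1)]) (use J'(1) in simp)
    \<comment> \<open>The vector y has components along J and v only, so its form is explicit. Being
      at most \<rho> |y|^2, it forces the component along v to vanish, and then contradicts the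
      eigenvalues above r.\<close>
    then have yJ: "y - fproj J y = cinner v y *\<^sub>C v" using J'(1) vJ by (simp add: fproj_def algebra_simps)
    have ny: "(norm y)\<^sup>2 = (cmod (cinner v y))\<^sup>2 + (\<Sum>e\<in>J. (cmod (cinner e y))\<^sup>2)"
      using pythagoras_fproj[OF J'(1,2), of y] v(1) by (simp add: yJ norm_scaleC)
    have qy: "qform ?E y = (\<Sum>e\<in>J. b e * (cmod (cinner e y))\<^sup>2) + (norm (Y v))\<^sup>2 * (cmod (cinner v y))\<^sup>2"
      by (subst qform_decomp[OF sa J'(1-3)])
        (simp add: yJ q bounded_clinearD(2)[OF Y] norm_scaleC power_mult_distrib mult.commute)
    have "qform ?E y \<le> \<rho> * (norm y)\<^sup>2" using L(1) y(3) by (simp add: eigen_frame_def)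
    moreover have a: "(\<Sum>e\<in>J. \<rho> * (cmod (cinner e y))\<^sup>2) \<le> (\<Sum>e\<in>J. b e * (cmod (cinner e y))\<^sup>2)"
      using J'(4) \<rho>(2) by (intro sum_mono mult_right_mono) force+
    ultimately have "(norm (Y v))\<^sup>2 * (cmod (cinner v y))\<^sup>2 \<le> \<rho> * (cmod (cinner v y))\<^sup>2"
      unfolding qy ny by (simp add: distrib_left sum_distrib_left)
    then have "cinner v y = 0" using \<rho>(3) by (auto simp: mult_le_cancel_right)
    then have yJ': "fproj J y = y" using yJ by simp
    then have ysp: "y \<in> cvec.span J" using fproj_in_span by metis
    have "r * (norm y)\<^sup>2 < qform ?E y"
      using qform_span_gt[OF sa _ ysp y(2)] J(1) unfolding eigen_frame_def by blast
    moreover have "\<rho> * (norm y)\<^sup>2 \<le> r * (norm y)\<^sup>2" using \<rho>(2) by (intro mult_right_mono) auto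
    ultimately show False using \<open>qform ?E y \<le> \<rho> * (norm y)\<^sup>2\<close> by simp
  qed
  have "?E x \<in> cvec.span J" for x
  proof -
    have "Y (x - fproj J x) = 0" by (rule ker) (use fproj_orth[OF J'(1,2)] in \<open>simp add: orth_to_def\<close>)
    then have "?E x = ?E (fproj J x)" by (simp add: bounded_clinearD[OF Y])
    also have "\<dots> = (\<Sum>e\<in>J. cinner e x *\<^sub>C ?E e)"
      unfolding fproj_def bounded_clinear_sum[OF selfadjointD(1)[OF sa]]
      by (simp add: bounded_clinearD(2)[OF selfadjointD(1)[OF sa]])
    also have "\<dots> = (\<Sum>e\<in>J. cinner e x *\<^sub>C of_real (b e) *\<^sub>C e)" using J'(3) by simp
    also have "\<dots> \<in> cvec.span J" by (intro cvec.span_sum cvec.span_scale cvec.span_base)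
    finally show ?thesis .
  qed
  then have "range ?E \<subseteq> cvec.span J" by blast
  then have "rank_op ?E \<noteq> \<infinity>" using J'(1) unfolding rank_op_def cdim_def by auto
  then show False using rank by simp
qed

section \<open>Square roots of positive operators\<close>

lemma positive_opD:
  assumes "positive_op T"
  shows "bounded_clinear T" "Im (cinner x (T x)) = 0" "0 \<le> Re (cinner x (T x))"
  using assms unfolding positive_op_def complex_is_Real_iff by auto

text \<open>Polarisation: the imaginary part of the form vanishes at x + y and at x + i y.\<close>

lemma positive_op_selfadjoint:
  assumes T: "positive_op T"
  shows "selfadjoint_op T"
proof -
  note L = positive_opD(1)[OF T]
  have "cinner (T x) y = cinner x (T y)" for x y
  proof -
    have im: "Im (cinner x (T z)) + Im (cinner z (T x)) = 0" for z
      using positive_opD(2)[OF T, of "x + z"] positive_opD(2)[OF T, of x] positive_opD(2)[OF T, of z]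
      by (simp add: bounded_clinearD[OF L] cinner_add_left cinner_add_right)
    have "Im (cinner x (T y)) = - Im (cinner y (T x))" using im[of y] by simp
    moreover have "Re (cinner x (T y)) = Re (cinner y (T x))"
      using im[of "\<i> *\<^sub>C y"] by (simp add: bounded_clinearD[OF L] cinner_scaleC_left cinner_scaleC_right)
    ultimately have "cinner x (T y) = cnj (cinner y (T x))" by (simp add: complex_eq_iff)
    then show ?thesis by (simp add: cinner_commute[of "T x" y])
  qed
  then show ?thesis using L by (simp add: selfadjoint_op_def)
qed

lemma positive_opI:
  assumes "selfadjoint_op T" "\<And>x. 0 \<le> Re (cinner x (T x))"
  shows "positive_op T"
proof -
  have "cinner x (T x) = cnj (cinner x (T x))" for x
    using selfadjointD(2)[OF assms(1), of x x] cinner_commute[of x "T x"] by simp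
  then have "cinner x (T x) \<in> \<real>" for x using Reals_cnj_iff by metis
  then show ?thesis using assms selfadjointD(1) by (simp add: positive_op_def)
qed

text \<open>Cauchy-Schwarz for the form of T, with positivity tested at x - T x / N.\<close>

lemma positive_op_norm:
  assumes T: "positive_op T" and N: "0 < N" "\<And>z. qform T z \<le> N * (norm z)\<^sup>2"
  shows "(norm (T x))\<^sup>2 \<le> N * qform T x"
proof -
  note L = positive_opD(1)[OF T] and S = selfadjointD(2)[OF positive_op_selfadjoint[OF T]]
  have e: "cinner x (T (T x)) = of_real ((norm (T x))\<^sup>2)" by (simp add: S[symmetric] cinner_self)
  have "0 \<le> qform T (x - (1 / N) *\<^sub>R T x)" using positive_opD(3)[OF T] by (simp add: qform_def)
  also have "\<dots> = qform T x - 2 / N * (norm (T x))\<^sup>2 + (1 / N)\<^sup>2 * qform T (T x)"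
    using N(1) by (simp add: qform_def bounded_clinearD[OF L] cinner_diff_left cinner_diff_right
        cinner_scaleR_left cinner_scaleR_right e cinner_self power2_eq_square field_simps)
  also have "\<dots> \<le> qform T x - 2 / N * (norm (T x))\<^sup>2 + (1 / N)\<^sup>2 * (N * (norm (T x))\<^sup>2)"
    by (intro add_left_mono mult_left_mono N) simp
  also have "\<dots> = qform T x - (norm (T x))\<^sup>2 / N" using N(1) by (simp add: power2_eq_square field_simps)
  finally show ?thesis using N(1) by (simp add: field_simps)
qed

lemma qform_bounded:
  assumes "bounded_clinear T"
  obtains N where "0 < N" "\<And>z. \<bar>qform T z\<bar> \<le> N * (norm z)\<^sup>2"
proof -
  obtain N where N: "N > 0" "\<And>x. norm (T x) \<le> N * norm x" using bounded_clinear_bound[OF assms] by blast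
  have "\<bar>qform T z\<bar> \<le> N * (norm z)\<^sup>2" for z
  proof -
    have "\<bar>qform T z\<bar> \<le> norm z * norm (T z)"
      unfolding qform_def using abs_Re_le_cmod cinner_norm_bound order_trans by blast
    also have "\<dots> \<le> norm z * (N * norm z)" by (intro mult_left_mono N) simp
    finally show ?thesis by (simp add: power2_eq_square mult_ac)
  qed
  then show ?thesis using that N(1) by blast
qed

text \<open>\<open>X\<close> is a polynomial in \<open>A\<close> with nonnegative coefficients, \<open>r\<close> is its value at \<open>1\<close>;
  hence \<open>X\<close> has norm at most \<open>r\<close> if \<open>A\<close> is a contraction.\<close>

inductive nonneg_poly :: "('a::complex_inner \<Rightarrow> 'a) \<Rightarrow> ('a \<Rightarrow> 'a) \<Rightarrow> real \<Rightarrow> bool" for A where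
  zero: "nonneg_poly A (\<lambda>_. 0) 0"
| base: "nonneg_poly A A 1"
| add: "nonneg_poly A X r \<Longrightarrow> nonneg_poly A Y q \<Longrightarrow> nonneg_poly A (\<lambda>x. X x + Y x) (r + q)"
| comp: "nonneg_poly A X r \<Longrightarrow> nonneg_poly A Y q \<Longrightarrow> nonneg_poly A (\<lambda>x. X (Y x)) (r * q)"
| half: "nonneg_poly A X r \<Longrightarrow> nonneg_poly A (\<lambda>x. (1/2) *\<^sub>R X x) (r / 2)"

lemma nonneg_poly_bound:
  assumes "nonneg_poly A X r" and A: "bounded_clinear A" "\<And>x. norm (A x) \<le> norm x"
  shows "bounded_clinear X \<and> 0 \<le> r \<and> (\<forall>x. norm (X x) \<le> r * norm x)"
  using assms(1)
proof induction
  case zero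
  then show ?case by (simp add: bounded_clinear_zero)
next
  case base
  then show ?case using A by simp
next
  case (add X r Y q)
  have "norm (X x + Y x) \<le> (r + q) * norm x" for x
    using add norm_triangle_ineq[of "X x" "Y x"] by (smt (verit) distrib_right)
  then show ?case using add by (simp add: bounded_clinear_add)
next
  case (comp X r Y q)
  have "norm (X (Y x)) \<le> r * q * norm x" for x
  proof -
    have "norm (X (Y x)) \<le> r * norm (Y x)" using comp by blast
    also have "\<dots> \<le> r * (q * norm x)" using comp by (intro mult_left_mono) auto
    finally show ?thesis by simp
  qed
  then show ?case using comp bounded_clinear_compose[of X Y] by (simp add: comp_def)
next
  case (half X r)
  have "bounded_clinear (\<lambda>x. (1/2) *\<^sub>R X x)"
    using half bounded_clinear_scaleC[of X "1/2"] by (simp add: scaleR_eq_scaleC)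
  then show ?case using half by simp
qed

lemma nonneg_poly_commute:
  assumes "nonneg_poly A X r" and C: "bounded_clinear C" "\<And>x. C (A x) = A (C x)"
  shows "C (X x) = X (C x)"
  using assms(1)
  by (induction arbitrary: x) (simp_all add: bounded_clinearD[OF C(1)] C(2))

lemma nonneg_poly_commute2:
  assumes "nonneg_poly A X r" "nonneg_poly A Y q" and A: "bounded_clinear A" "\<And>x. norm (A x) \<le> norm x"
  shows "Y (X x) = X (Y x)"
proof -
  have "A (Y x) = Y (A x)" for x by (rule nonneg_poly_commute[OF assms(2) A(1)]) simp
  then show ?thesis
    using nonneg_poly_bound[OF assms(2) A] by (intro nonneg_poly_commute[OF assms(1)]) auto
qed

text \<open>A fixed point Y of this iteration satisfies (1 - Y)^2 = 1 - A, so 1 - Y is a square root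
  of 1 - A.\<close>

primrec sqrt_iter :: "('a::complex_inner \<Rightarrow> 'a) \<Rightarrow> nat \<Rightarrow> 'a \<Rightarrow> 'a" where
  "sqrt_iter A 0 = (\<lambda>_. 0)"
| "sqrt_iter A (Suc n) = (\<lambda>x. (1/2) *\<^sub>R (A x + sqrt_iter A n (sqrt_iter A n x)))"

text \<open>The same iteration with A replaced by the number 1. It increases and stays below 1, and
  its increments bound those of \<open>sqrt_iter\<close> when A is a contraction.\<close>

primrec sqrt_iter_val :: "nat \<Rightarrow> real" where
  "sqrt_iter_val 0 = 0"
| "sqrt_iter_val (Suc n) = (1 + sqrt_iter_val n * sqrt_iter_val n) / 2"

lemma sqrt_iter_poly: "nonneg_poly A (sqrt_iter A n) (sqrt_iter_val n)"
proof (induction n)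
  case (Suc n)
  then show ?case
    using nonneg_poly.half[OF nonneg_poly.add[OF nonneg_poly.base nonneg_poly.comp[OF Suc Suc]]] by simp
qed (simp add: nonneg_poly.zero)

text \<open>Iterates commute, so the next difference is half the product of the current difference
  with the sum of two iterates, and nonnegative coefficients are inherited. The induction starts
  from A / 2.\<close>

lemma sqrt_iter_diff_poly:
  assumes A: "bounded_clinear A" "\<And>x. norm (A x) \<le> norm x"
  shows "nonneg_poly A (\<lambda>x. sqrt_iter A (Suc n) x - sqrt_iter A n x) (sqrt_iter_val (Suc n) - sqrt_iter_val n)"
proof (induction n)
  case 0
  then show ?case using nonneg_poly.half[OF nonneg_poly.base, of A] by simp
next
  case (Suc n)
  let ?Y = "sqrt_iter A n" and ?Y' = "sqrt_iter A (Suc n)"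
  let ?y = "sqrt_iter_val n" and ?y' = "sqrt_iter_val (Suc n)"
  have lin: "bounded_clinear ?Y" "bounded_clinear ?Y'"
    using nonneg_poly_bound[OF sqrt_iter_poly A] by blast+
  have "nonneg_poly A (\<lambda>x. (1/2) *\<^sub>R ((\<lambda>x. ?Y' x - ?Y x) (?Y' x + ?Y x))) ((?y' - ?y) * (?y' + ?y) / 2)"
    by (intro nonneg_poly.half nonneg_poly.comp[OF Suc] nonneg_poly.add sqrt_iter_poly)
  also have "(\<lambda>x. (1/2) *\<^sub>R ((\<lambda>x. ?Y' x - ?Y x) (?Y' x + ?Y x)))
    = (\<lambda>x. sqrt_iter A (Suc (Suc n)) x - ?Y' x)"
  proof
    fix x
    have c: "?Y (?Y' x) = ?Y' (?Y x)"
      by (rule nonneg_poly_commute2[OF sqrt_iter_poly sqrt_iter_poly A])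
    have "(?Y' (?Y' x + ?Y x) - ?Y (?Y' x + ?Y x)) = ?Y' (?Y' x) - ?Y (?Y x)"
      by (simp only: bounded_clinearD(1)[OF lin(1)] bounded_clinearD(1)[OF lin(2)] c) simp
    moreover have "sqrt_iter A (Suc (Suc n)) x - ?Y' x = (1/2) *\<^sub>R (A x + ?Y' (?Y' x)) - (1/2) *\<^sub>R (A x + ?Y (?Y x))"
      by simp
    then have "sqrt_iter A (Suc (Suc n)) x - ?Y' x = (1/2) *\<^sub>R (?Y' (?Y' x) - ?Y (?Y x))"
      by (simp only: scaleR_right_diff_distrib[symmetric] add_diff_cancel_left)
    ultimately show "(1/2) *\<^sub>R ((\<lambda>x. ?Y' x - ?Y x) (?Y' x + ?Y x)) = sqrt_iter A (Suc (Suc n)) x - ?Y' x"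
      by (simp only:)
  qed
  also have "(?y' - ?y) * (?y' + ?y) / 2 = sqrt_iter_val (Suc (Suc n)) - ?y'"
    by (simp add: field_simps)
  finally show ?case .
qed

lemma sqrt_iter_val_bounds: "0 \<le> sqrt_iter_val n" "sqrt_iter_val n \<le> 1"
proof -
  have "0 \<le> sqrt_iter_val n \<and> sqrt_iter_val n \<le> 1"
    by (induction n) (auto intro: mult_le_one add_nonneg_nonneg)
  then show "0 \<le> sqrt_iter_val n" "sqrt_iter_val n \<le> 1" by auto
qed

text \<open>Operator increments are dominated by those of a convergent scalar sequence, so the
  iterates converge strongly to a contraction Y, and S = 1 - Y. The clause on operators C commuting
  with A later gives uniqueness of the root.\<close>

lemma positive_contraction_sqrt:
  fixes A :: "'a::chilbert_space \<Rightarrow> 'a"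
  assumes A: "positive_op A" "\<And>x. qform A x \<le> (norm x)\<^sup>2"
  shows "\<exists>S. positive_op S \<and> (\<forall>x. S (S x) = x - A x) \<and>
    (\<forall>C. bounded_clinear C \<longrightarrow> (\<forall>x. C (A x) = A (C x)) \<longrightarrow> (\<forall>x. C (S x) = S (C x)))"
proof -
  note lin = positive_opD(1)[OF A(1)] and sa = positive_op_selfadjoint[OF A(1)]
  have contr: "norm (A x) \<le> norm x" for x
  proof (rule power2_le_imp_le)
    have "(norm (A x))\<^sup>2 \<le> 1 * qform A x" by (rule positive_op_norm[OF A(1)]) (use A(2) in auto)
    then show "(norm (A x))\<^sup>2 \<le> (norm x)\<^sup>2" using A(2)[of x] by linarith
  qed simp
  let ?Y = "sqrt_iter A" and ?y = sqrt_iter_val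
  have Ylin: "bounded_clinear (?Y n)" and Yb: "norm (?Y n x) \<le> ?y n * norm x" for n x
    using nonneg_poly_bound[OF sqrt_iter_poly lin contr] by blast+
  have inc: "?y n \<le> ?y (Suc n)" and step: "norm (?Y (Suc n) x - ?Y n x) \<le> (?y (Suc n) - ?y n) * norm x" for n x
    using nonneg_poly_bound[OF sqrt_iter_diff_poly[OF lin contr] lin contr, of n] by auto
  have tele: "norm (?Y (n + k) x - ?Y n x) \<le> (?y (n + k) - ?y n) * norm x" for n k x
  proof -
    define u v where "u i = ?Y i x" and "v i = ?y i" for i
    have st: "norm (u (Suc i) - u i) \<le> (v (Suc i) - v i) * norm x" for i
      unfolding u_def v_def by (rule step)
    have "norm (u (n + k) - u n) \<le> (v (n + k) - v n) * norm x"
    proof (induction k)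
      case (Suc k)
      have "norm (u (n + Suc k) - u n) \<le> norm (u (Suc (n + k)) - u (n + k)) + norm (u (n + k) - u n)"
        using norm_triangle_ineq[of "u (Suc (n + k)) - u (n + k)" "u (n + k) - u n"] by simp
      also have "\<dots> \<le> (v (Suc (n + k)) - v (n + k)) * norm x + (v (n + k) - v n) * norm x"
        by (intro add_mono st Suc)
      finally show ?case by (simp add: algebra_simps)
    qed simp
    then show ?thesis by (simp only: u_def v_def)
  qed
  have "incseq ?y" by (rule incseq_SucI) (rule inc)
  then obtain l where l: "?y \<longlonglongrightarrow> l" "\<And>n. ?y n \<le> l"
    using incseq_convergent[OF \<open>incseq ?y\<close>, of 1] sqrt_iter_val_bounds(2) by auto
  have bnd: "norm (?Y m x - ?Y n x) \<le> (l - ?y n) * norm x" if "n \<le> m" for m n x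
  proof -
    have "norm (?Y m x - ?Y n x) \<le> (?y m - ?y n) * norm x" using tele[of n "m - n" x] that by simp
    also have "\<dots> \<le> (l - ?y n) * norm x" using l(2) by (intro mult_right_mono) auto
    finally show ?thesis .
  qed
  have "Cauchy (\<lambda>n. ?Y n x)" for x
  proof (rule metric_CauchyI)
    fix e :: real assume "0 < e"
    have "(\<lambda>n. (l - ?y n) * norm x) \<longlonglongrightarrow> (l - l) * norm x" by (intro tendsto_intros l)
    then obtain N where N: "\<And>n. n \<ge> N \<Longrightarrow> \<bar>(l - ?y n) * norm x\<bar> < e / 2"
      using LIMSEQ_D[of _ "(l - l) * norm x" "e / 2"] \<open>0 < e\<close> by auto
    have "dist (?Y i x) (?Y j x) < e" if "i \<ge> N" "j \<ge> N" for i j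
    proof -
      have "dist (?Y i x) (?Y j x) \<le> dist (?Y i x) (?Y N x) + dist (?Y j x) (?Y N x)"
        by (rule dist_triangle2)
      then show ?thesis using bnd[OF that(1), of x] bnd[OF that(2), of x] N[of N] by (simp add: dist_norm)
    qed
    then show "\<exists>M. \<forall>i\<ge>M. \<forall>j\<ge>M. dist (?Y i x) (?Y j x) < e" by blast
  qed
  then have "\<exists>z. (\<lambda>n. ?Y n x) \<longlonglongrightarrow> z" for x using Cauchy_convergent_iff convergent_def by blast
  then obtain Y where Y: "\<And>x. (\<lambda>n. ?Y n x) \<longlonglongrightarrow> Y x" by metis
  have Yn: "norm (Y x) \<le> norm x" for x
  proof (rule LIMSEQ_le_const2[OF tendsto_norm[OF Y]], intro exI allI impI)
    fix n
    have "norm (?Y n x) \<le> ?y n * norm x" by (rule Yb)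
    also have "\<dots> \<le> 1 * norm x" using sqrt_iter_val_bounds by (intro mult_right_mono) auto
    finally show "norm (?Y n x) \<le> norm x" by simp
  qed
  have Ylin': "bounded_clinear Y"
  proof (rule bounded_clinearI[where C = 1])
    fix x y a
    have "(\<lambda>n. ?Y n (x + y)) \<longlonglongrightarrow> Y x + Y y"
      unfolding bounded_clinearD(1)[OF Ylin] by (intro tendsto_add Y)
    then show "Y (x + y) = Y x + Y y" using Y LIMSEQ_unique by blast
    have "(\<lambda>n. ?Y n (a *\<^sub>C x)) \<longlonglongrightarrow> a *\<^sub>C Y x"
      unfolding bounded_clinearD(2)[OF Ylin] by (intro tendsto_scaleC tendsto_const Y)
    then show "Y (a *\<^sub>C x) = a *\<^sub>C Y x" using Y LIMSEQ_unique by blast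
  qed (use Yn in simp)
  have YY: "Y x = (1/2) *\<^sub>R (A x + Y (Y x))" for x
  proof -
    \<comment> \<open>The outer factor varies with n; since all iterates are contractions, the inner
      one may be replaced by its limit.\<close>
    have "(\<lambda>n. ?Y n (?Y n x) - ?Y n (Y x)) \<longlonglongrightarrow> 0"
    proof (rule tendsto_norm_zero_cancel, rule tendsto_sandwich[of "\<lambda>_. 0" _ _ "\<lambda>n. norm (?Y n x - Y x)"])
      have "norm (?Y n (?Y n x) - ?Y n (Y x)) \<le> norm (?Y n x - Y x)" for n
      proof -
        have "norm (?Y n (?Y n x - Y x)) \<le> ?y n * norm (?Y n x - Y x)" by (rule Yb)
        also have "\<dots> \<le> 1 * norm (?Y n x - Y x)" using sqrt_iter_val_bounds by (intro mult_right_mono) auto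
        finally show ?thesis by (simp add: bounded_clinearD[OF Ylin])
      qed
      then show "\<forall>\<^sub>F n in sequentially. norm (?Y n (?Y n x) - ?Y n (Y x)) \<le> norm (?Y n x - Y x)" by simp
      show "(\<lambda>n. norm (?Y n x - Y x)) \<longlonglongrightarrow> 0" using tendsto_norm_zero[OF LIM_zero[OF Y]] .
    qed auto
    then have "(\<lambda>n. ?Y n (?Y n x) - ?Y n (Y x) + ?Y n (Y x)) \<longlonglongrightarrow> 0 + Y (Y x)" by (intro tendsto_add Y)
    then have "(\<lambda>n. ?Y n (?Y n x)) \<longlonglongrightarrow> Y (Y x)" by simp
    then have "(\<lambda>n. ?Y (Suc n) x) \<longlonglongrightarrow> (1/2) *\<^sub>R (A x + Y (Y x))"
      by (simp only: sqrt_iter.simps) (intro tendsto_intros)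
    moreover have "(\<lambda>n. ?Y (Suc n) x) \<longlonglongrightarrow> Y x" using Y by (rule LIMSEQ_Suc)
    ultimately show ?thesis by (metis LIMSEQ_unique)
  qed
  have "cinner (?Y n x) z = cinner x (?Y n z)" for n x z
    by (induction n arbitrary: x z)
      (simp_all add: cinner_scaleR_left cinner_scaleR_right cinner_add_left cinner_add_right selfadjointD(2)[OF sa])
  then have Ysa: "cinner (Y x) z = cinner x (Y z)" for x z
    using LIMSEQ_unique[OF tendsto_cinner[OF Y tendsto_const, of x z]] tendsto_cinner[OF tendsto_const Y, of x z]
    by simp
  define S where "S = (\<lambda>x. x - Y x)"
  have Slin: "bounded_clinear S" unfolding S_def by (intro bounded_clinear_diff bounded_clinear_id Ylin')
  have "positive_op S"
  proof (rule positive_opI)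
    show "selfadjoint_op S"
      using Slin by (simp add: selfadjoint_op_def S_def cinner_diff_left cinner_diff_right Ysa)
    fix x
    have "Re (cinner x (Y x)) \<le> norm x * norm (Y x)"
      using cinner_norm_bound complex_Re_le_cmod order_trans by blast
    also have "\<dots> \<le> norm x * norm x" by (intro mult_left_mono Yn) simp
    finally show "0 \<le> Re (cinner x (S x))" by (simp add: S_def cinner_diff_right cinner_self power2_eq_square)
  qed
  moreover have "S (S x) = x - A x" for x
  proof -
    have "S (S x) = x - 2 *\<^sub>R Y x + Y (Y x)"
      by (simp add: S_def bounded_clinearD[OF Ylin'] scaleR_2)
    also have "2 *\<^sub>R Y x = A x + Y (Y x)" by (subst YY) simp
    finally show ?thesis by simp
  qed
  moreover have "C (S x) = S (C x)" if C: "bounded_clinear C" "\<forall>x. C (A x) = A (C x)" for C x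
  proof -
    have "C (?Y n x) = ?Y n (C x)" for n
      by (rule nonneg_poly_commute[OF sqrt_iter_poly C(1)]) (use C in blast)
    moreover have "(\<lambda>n. C (?Y n x)) \<longlonglongrightarrow> C (Y x)"
      using C(1) Y unfolding bounded_clinear_def by (auto intro: bounded_linear.tendsto)
    ultimately have "C (Y x) = Y (C x)" using Y[of "C x"] LIMSEQ_unique by force
    then show ?thesis by (simp add: S_def bounded_clinearD[OF C(1)])
  qed
  ultimately show ?thesis by blast
qed

text \<open>The contraction case is applied to A = 1 - T / N, where N bounds the form of T, and the
  root is rescaled by sqrt N.\<close>

lemma positive_sqrt_exists:
  fixes T :: "'a::chilbert_space \<Rightarrow> 'a"
  assumes T: "positive_op T"
  shows "\<exists>S. positive_op S \<and> S \<circ> S = T \<and>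
    (\<forall>C. bounded_clinear C \<longrightarrow> (\<forall>x. C (T x) = T (C x)) \<longrightarrow> (\<forall>x. C (S x) = S (C x)))"
proof -
  note lin = positive_opD(1)[OF T] and sa = positive_op_selfadjoint[OF T]
  obtain N where N: "0 < N" "\<And>z. \<bar>qform T z\<bar> \<le> N * (norm z)\<^sup>2" using qform_bounded[OF lin] by blast
  define A where "A = (\<lambda>x. x - (1 / N) *\<^sub>R T x)"
  have qA: "qform A x = (norm x)\<^sup>2 - qform T x / N" for x
    by (simp add: qform_def A_def cinner_diff_right cinner_scaleR_right cinner_self)
  have A: "positive_op A"
  proof (rule positive_opI)
    show "selfadjoint_op A"
      unfolding selfadjoint_op_def A_def scaleR_eq_scaleC
      by (auto intro!: bounded_clinear_diff bounded_clinear_id bounded_clinear_scaleC lin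
          simp: cinner_diff_left cinner_diff_right cinner_scaleC_left cinner_scaleC_right selfadjointD(2)[OF sa])
    show "0 \<le> Re (cinner x (A x))" for x
    proof -
      have "qform T x / N \<le> (norm x)\<^sup>2"
        using N(1) abs_le_D1[OF N(2)] by (simp add: pos_divide_le_eq mult.commute)
      then show ?thesis using qA[of x] by (simp add: qform_def)
    qed
  qed
  have "qform A x \<le> (norm x)\<^sup>2" for x
    using positive_opD(3)[OF T, of x] N(1) by (simp add: qA) (simp add: qform_def)
  then obtain S where S: "positive_op S" "\<And>x. S (S x) = x - A x"
    "\<And>C x. bounded_clinear C \<Longrightarrow> (\<forall>x. C (A x) = A (C x)) \<Longrightarrow> C (S x) = S (C x)"
    using positive_contraction_sqrt[OF A] by blast
  define R where "R = (\<lambda>x. complex_of_real (sqrt N) *\<^sub>C S x)"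
  note Slin = positive_opD(1)[OF S(1)]
  have "positive_op R"
  proof (rule positive_opI)
    show "selfadjoint_op R" unfolding R_def by (rule selfadjoint_scale[OF positive_op_selfadjoint[OF S(1)]])
    show "0 \<le> Re (cinner x (R x))" for x
      using positive_opD(3)[OF S(1), of x] N(1) by (simp add: R_def cinner_scaleC_right)
  qed
  moreover have "R \<circ> R = T"
  proof
    fix x
    have "complex_of_real (sqrt N) * complex_of_real (sqrt N) = complex_of_real N"
      using N(1) by (simp flip: of_real_mult)
    then have "(R \<circ> R) x = complex_of_real N *\<^sub>C S (S x)"
      by (simp add: R_def bounded_clinearD[OF Slin] scaleC_scaleC)
    also have "\<dots> = complex_of_real N *\<^sub>C (1 / N) *\<^sub>R T x" by (simp add: S(2) A_def)
    also have "\<dots> = T x" using N(1) by (simp add: scaleR_eq_scaleC scaleC_scaleC)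
    finally show "(R \<circ> R) x = T x" .
  qed
  moreover have "C (R x) = R (C x)" if C: "bounded_clinear C" "\<forall>x. C (T x) = T (C x)" for C x
  proof -
    have "\<forall>x. C (A x) = A (C x)" using C by (simp add: A_def bounded_clinearD[OF C(1)])
    then show ?thesis using S(3)[OF C(1)] by (simp add: R_def bounded_clinearD[OF C(1)])
  qed
  ultimately show ?thesis by blast
qed

lemma positive_op_zero:
  assumes T: "positive_op T" and z: "qform T x = 0"
  shows "T x = 0"
proof -
  obtain N where N: "0 < N" "\<And>z. \<bar>qform T z\<bar> \<le> N * (norm z)\<^sup>2"
    using qform_bounded[OF positive_opD(1)[OF T]] by blast
  have "(norm (T x))\<^sup>2 \<le> N * qform T x"
    by (rule positive_op_norm[OF T N(1)]) (use N(2) abs_le_D1 in blast)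
  then show ?thesis using z by simp
qed

text \<open>Uniqueness resolves the definite description. A second root R commutes with T = R^2 and
  therefore with S. For y = S x - R x this gives (S + R) y = 0, so both nonnegative forms vanish at
  y; hence S y = R y = 0 and |y|^2 = 0.\<close>

theorem sqrt_op_props:
  fixes T :: "'a::chilbert_space \<Rightarrow> 'a"
  assumes T: "positive_op T"
  shows "positive_op (sqrt_op T)" "sqrt_op T (sqrt_op T x) = T x"
proof -
  obtain S where S: "positive_op S" "S \<circ> S = T"
    "\<And>C x. bounded_clinear C \<Longrightarrow> (\<forall>x. C (T x) = T (C x)) \<Longrightarrow> C (S x) = S (C x)"
    using positive_sqrt_exists[OF T] by blast
  have "sqrt_op T = S"
    unfolding sqrt_op_def
  proof (rule the_equality)
    fix R assume R: "positive_op R \<and> R \<circ> R = T"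
    have RR: "R (R x) = T x" and SS: "S (S x) = T x" for x using R S(2) by (auto simp: fun_eq_iff)
    note Rl = positive_opD(1)[of R] and Sl = positive_opD(1)[OF S(1)]
    have Rl: "bounded_clinear R" using R positive_opD(1) by blast
    have comm: "R (S x) = S (R x)" for x by (rule S(3)[OF Rl]) (simp add: RR[symmetric])
    show "R = S"
    proof
      fix x
      define y where "y = S x - R x"
      have "S y + R y = 0" by (simp add: y_def bounded_clinearD[OF Rl] bounded_clinearD[OF Sl] comm RR SS)
      then have "qform S y + qform R y = 0"
        by (simp add: qform_def flip: plus_complex.sel cinner_add_right)
      moreover have "0 \<le> qform S y" "0 \<le> qform R y"
        using positive_opD(3) S(1) R by (auto simp: qform_def)
      ultimately have "qform S y = 0" "qform R y = 0" by linarith+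
      then have "S y = 0" "R y = 0" using positive_op_zero S(1) R by blast+
      have "cinner y y = cinner (S x - R x) y" by (simp add: y_def)
      also have "\<dots> = cinner x (S y) - cinner x (R y)"
        using positive_op_selfadjoint S(1) R selfadjointD(2) by (metis cinner_diff_left)
      also have "\<dots> = 0" using \<open>S y = 0\<close> \<open>R y = 0\<close> by simp
      finally show "R x = S x" by (simp add: y_def cinner_self)
    qed
  qed (use S in auto)
  then show "positive_op (sqrt_op T)" "sqrt_op T (sqrt_op T x) = T x" using S(1,2) by (simp, metis comp_apply)
qed

section \<open>Operators on square-summable sequences\<close>

definition sq_summable :: "(int \<Rightarrow> 'a::real_normed_vector) \<Rightarrow> bool"
  where "sq_summable f \<longleftrightarrow> (\<lambda>n. (norm (f n))\<^sup>2) summable_on UNIV"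

lemma Rep_Abs_ell2: "sq_summable f \<Longrightarrow> Rep_ell2 (Abs_ell2 f) = f"
  unfolding sq_summable_def by (rule Abs_ell2_inverse) simp

lemma sq_summable_Rep: "sq_summable (Rep_ell2 f)"
  using Rep_ell2[of f] by (simp add: sq_summable_def)

lemma ell2_eqI: "(\<And>n. Rep_ell2 f n = Rep_ell2 g n) \<Longrightarrow> f = g"
  by (simp add: Rep_ell2_inject[symmetric] fun_eq_iff)

lemmas ell2_rep = plus_ell2.rep_eq minus_ell2.rep_eq zero_ell2.rep_eq scaleC_ell2.rep_eq
  scaleR_ell2.rep_eq uminus_ell2.rep_eq tensor_vec.rep_eq

lemma sq_summable_bound:
  assumes f: "sq_summable f" and g: "\<And>n. norm (g n) \<le> c * norm (f n)"
  shows "sq_summable g"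
  unfolding sq_summable_def
proof (rule summable_on_comparison_test)
  show "(\<lambda>n. c\<^sup>2 * (norm (f n))\<^sup>2) summable_on UNIV"
    using f unfolding sq_summable_def by (rule summable_on_cmult_right)
  show "(norm (g n))\<^sup>2 \<le> c\<^sup>2 * (norm (f n))\<^sup>2" for n
    using power_mono[OF g, of n 2] by (simp add: power_mult_distrib)
qed simp

lemma ell2_norm_bound:
  fixes f :: "'a::complex_inner ell2" and g :: "'b::complex_inner ell2"
  assumes "\<And>n. norm (Rep_ell2 g n) \<le> c * norm (Rep_ell2 f n)" "0 \<le> c"
  shows "norm g \<le> c * norm f"
proof (rule power2_le_imp_le)
  have "((\<lambda>n. c\<^sup>2 * (norm (Rep_ell2 f n))\<^sup>2) has_sum c\<^sup>2 * (norm f)\<^sup>2) UNIV"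
    by (rule has_sum_cmult_right[OF ell2_has_sum_norm])
  then have "(norm g)\<^sup>2 \<le> c\<^sup>2 * (norm f)\<^sup>2"
    by (rule has_sum_mono[OF ell2_has_sum_norm])
      (use power_mono[OF assms(1), of _ 2] in \<open>simp add: power_mult_distrib\<close>)
  then show "(norm g)\<^sup>2 \<le> (c * norm f)\<^sup>2" by (simp add: power_mult_distrib)
qed (use assms in simp)

lemma cinner_ell2_has_sum:
  fixes f g :: "'a::complex_inner ell2"
  shows "((\<lambda>n. cinner (Rep_ell2 f n) (Rep_ell2 g n)) has_sum cinner f g) UNIV"
  using ell2_cinner_summable[of "Rep_ell2 f" "Rep_ell2 g"] sq_summable_Rep[of f] sq_summable_Rep[of g]
  unfolding cinner_ell2.rep_eq sq_summable_def by simp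

lemma ell2_norm_eqI:
  fixes f :: "'a::complex_inner ell2"
  assumes "((\<lambda>n. (norm (Rep_ell2 f n))\<^sup>2) has_sum s) UNIV"
  shows "(norm f)\<^sup>2 = s"
  using has_sum_unique[OF ell2_has_sum_norm assms] .

text \<open>Operators acting site by site; M_\<psi> \<otimes> K, I \<otimes> K, I \<otimes> Q and J
  \<otimes> I are all of this type.\<close>

definition ell2_map :: "(int \<Rightarrow> 'a \<Rightarrow> 'b) \<Rightarrow> 'a::complex_inner ell2 \<Rightarrow> 'b::complex_inner ell2"
  where "ell2_map B f = Abs_ell2 (\<lambda>n. B n (Rep_ell2 f n))"

locale bounded_family =
  fixes B :: "int \<Rightarrow> 'a::complex_inner \<Rightarrow> 'b::complex_inner" and c :: real
  assumes lin: "\<And>n. bounded_clinear (B n)" and bnd: "\<And>n x. norm (B n x) \<le> c * norm x" and c0: "0 \<le> c"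
begin

lemma rep: "Rep_ell2 (ell2_map B f) = (\<lambda>n. B n (Rep_ell2 f n))"
  unfolding ell2_map_def by (rule Rep_Abs_ell2[OF sq_summable_bound[OF sq_summable_Rep bnd]])

lemma norm_le: "norm (ell2_map B f) \<le> c * norm f"
  by (rule ell2_norm_bound[OF _ c0]) (simp add: rep bnd)

lemma clin: "bounded_clinear (ell2_map B)"
  by (rule bounded_clinearI[OF _ _ norm_le])
    (rule ell2_eqI; simp add: rep ell2_rep bounded_clinearD[OF lin])+

end

lemma ell2_map_adjoint:
  fixes B :: "int \<Rightarrow> 'a::chilbert_space \<Rightarrow> 'b::complex_inner"
  assumes "bounded_family B c"
  shows "bounded_family (\<lambda>n. cadjoint (B n)) c" "cadjoint (ell2_map B) = ell2_map (\<lambda>n. cadjoint (B n))"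
proof -
  interpret B: bounded_family B c by fact
  show a: "bounded_family (\<lambda>n. cadjoint (B n)) c"
    by unfold_locales
      (auto intro: bounded_clinear_cadjoint[OF B.lin] cadjoint_bound[OF B.lin B.bnd B.c0] B.c0)
  interpret A: bounded_family "\<lambda>n. cadjoint (B n)" c by fact
  show "cadjoint (ell2_map B) = ell2_map (\<lambda>n. cadjoint (B n))"
  proof (rule cadjoint_eqI)
    fix x y
    show "cinner (ell2_map (\<lambda>n. cadjoint (B n)) y) x = cinner y (ell2_map B x)"
      using cinner_ell2_has_sum[of "ell2_map (\<lambda>n. cadjoint (B n)) y" x] cinner_ell2_has_sum[of y "ell2_map B x"]
      by (simp add: A.rep B.rep cadjoint_works[OF B.lin] has_sum_unique)
  qed
qed

lemma bounded_family_scale: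
  fixes a :: "int \<Rightarrow> complex"
  assumes "bounded_clinear (K :: 'a::complex_inner \<Rightarrow> 'b::complex_inner)" "\<And>n. cmod (a n) \<le> c"
    "\<And>x. norm (K x) \<le> k * norm x" "0 \<le> k"
  shows "bounded_family (\<lambda>n x. a n *\<^sub>C K x) (c * k)"
proof
  have c: "0 \<le> c" using assms(2)[of 0] norm_ge_zero order_trans by blast
  show "bounded_clinear (\<lambda>x. a n *\<^sub>C K x)" for n by (rule bounded_clinear_scaleC[OF assms(1)])
  show "norm (a n *\<^sub>C K x) \<le> c * k * norm x" for n x
    using mult_mono[OF assms(2)[of n] assms(3)[of x] c] by (simp add: norm_scaleC mult.assoc)
  show "0 \<le> c * k" using c assms(4) by simp
qed

section \<open>Reduction to elementary tensors\<close>

definition delta :: "int \<Rightarrow> complex ell2"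
  where "delta n = Abs_ell2 (\<lambda>m. if m = n then 1 else 0)"

lemma Rep_delta: "Rep_ell2 (delta n) = (\<lambda>m. if m = n then 1 else 0)"
proof -
  have "(\<lambda>m. (norm (if m = n then 1 else 0 :: complex))\<^sup>2) summable_on UNIV"
  proof (rule summable_on_cong_neutral[THEN iffD1])
    show "(\<lambda>m. (norm (if m = n then 1 else 0 :: complex))\<^sup>2) summable_on {n}" by simp
  qed auto
  then show ?thesis unfolding delta_def by (intro Rep_Abs_ell2) (simp add: sq_summable_def)
qed

text \<open>The squared error of a partial sum is the missing tail of the norm series. Every summand
  is an elementary tensor, so these determine bounded operators.\<close>

lemma delta_has_sum:
  fixes f :: "'a::complex_inner ell2"
  shows "((\<lambda>n. tensor_vec (delta n) (Rep_ell2 f n)) has_sum f) UNIV"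
proof -
  let ?t = "\<lambda>n. tensor_vec (delta n) (Rep_ell2 f n)"
  have rep: "Rep_ell2 (sum ?t F) m = (if m \<in> F then Rep_ell2 f m else 0)" if "finite F" for F m
    using that by (induction F) (auto simp: ell2_rep Rep_delta)
  have eq: "(norm (sum ?t F - f))\<^sup>2 = (norm f)\<^sup>2 - (\<Sum>n\<in>F. (norm (Rep_ell2 f n))\<^sup>2)" if F: "finite F" for F
  proof (rule ell2_norm_eqI)
    have "((\<lambda>n. if n \<in> F then (norm (Rep_ell2 f n))\<^sup>2 else 0) has_sum (\<Sum>n\<in>F. (norm (Rep_ell2 f n))\<^sup>2)) UNIV"
      using has_sum_finite[OF F, of "\<lambda>n. (norm (Rep_ell2 f n))\<^sup>2"]
      by (rule has_sum_cong_neutral[THEN iffD1, rotated -1]) auto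
    then have "((\<lambda>n. - (if n \<in> F then (norm (Rep_ell2 f n))\<^sup>2 else 0)) has_sum - (\<Sum>n\<in>F. (norm (Rep_ell2 f n))\<^sup>2)) UNIV"
      by (simp only: has_sum_uminus minus_minus)
    from has_sum_add[OF ell2_has_sum_norm this]
    show "((\<lambda>n. (norm (Rep_ell2 (sum ?t F - f) n))\<^sup>2) has_sum (norm f)\<^sup>2 - (\<Sum>n\<in>F. (norm (Rep_ell2 f n))\<^sup>2)) UNIV"
      unfolding diff_conv_add_uminus[of "(norm f)\<^sup>2"]
      by (rule has_sum_cong[THEN iffD1, rotated]) (simp add: ell2_rep rep[OF F])
  qed
  have "((\<lambda>F. \<Sum>n\<in>F. (norm (Rep_ell2 f n))\<^sup>2) \<longlongrightarrow> (norm f)\<^sup>2) (finite_subsets_at_top UNIV)"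
    using ell2_has_sum_norm[of f] by (simp add: has_sum_def)
  then have "((\<lambda>F. sqrt ((norm f)\<^sup>2 - (\<Sum>n\<in>F. (norm (Rep_ell2 f n))\<^sup>2))) \<longlongrightarrow> sqrt ((norm f)\<^sup>2 - (norm f)\<^sup>2))
      (finite_subsets_at_top UNIV)" by (intro tendsto_intros)
  moreover have "sqrt ((norm f)\<^sup>2 - (\<Sum>n\<in>F. (norm (Rep_ell2 f n))\<^sup>2)) = norm (sum ?t F - f)" if "finite F" for F
    unfolding eq[OF that, symmetric] by simp
  then have "\<forall>\<^sub>F F in finite_subsets_at_top UNIV.
      sqrt ((norm f)\<^sup>2 - (\<Sum>n\<in>F. (norm (Rep_ell2 f n))\<^sup>2)) = norm (sum ?t F - f)"
    by (intro eventually_finite_subsets_at_top_weakI) auto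
  ultimately have "((\<lambda>F. norm (sum ?t F - f)) \<longlongrightarrow> sqrt ((norm f)\<^sup>2 - (norm f)\<^sup>2)) (finite_subsets_at_top UNIV)"
    by (rule Lim_transform_eventually)
  then have "((\<lambda>F. norm (sum ?t F - f)) \<longlongrightarrow> 0) (finite_subsets_at_top UNIV)" by simp
  then show ?thesis unfolding has_sum_def by (simp add: tendsto_norm_zero_iff LIM_zero_iff)
qed

text \<open>This makes the candidates in \<open>tensor_op\<close> and \<open>bra_tensor_op\<close>
  unique.\<close>

lemma clinear_eq_on_tensors:
  assumes "bounded_clinear S" "bounded_clinear T" "\<And>\<phi> g. S (tensor_vec \<phi> g) = T (tensor_vec \<phi> g)"
  shows "S = (T :: 'a::complex_inner ell2 \<Rightarrow> 'b::complex_inner)"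
proof
  fix f :: "'a ell2"
  have "bounded_linear S" "bounded_linear T" using assms(1,2) by (auto simp: bounded_clinear_def)
  then have "((\<lambda>n. S (tensor_vec (delta n) (Rep_ell2 f n))) has_sum S f) UNIV"
    "((\<lambda>n. T (tensor_vec (delta n) (Rep_ell2 f n))) has_sum T f) UNIV"
    using has_sum_bounded_linear[OF _ delta_has_sum[of f]] by auto
  then show "S f = T f" by (simp add: assms(3) has_sum_unique)
qed

lemma tensor_op_eqI:
  fixes T :: "'a::complex_inner ell2 \<Rightarrow> 'a ell2"
  assumes "bounded_clinear T" "\<And>\<phi> g. T (tensor_vec \<phi> g) = tensor_vec (A \<phi>) (B g)"
  shows "tensor_op A B = T"
  unfolding tensor_op_def
  by (rule the_equality) (use assms in \<open>auto intro!: clinear_eq_on_tensors\<close>)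

lemma bra_tensor_op_eqI:
  fixes T :: "'a::complex_inner ell2 \<Rightarrow> 'a"
  assumes "bounded_clinear T" "\<And>\<phi> g. T (tensor_vec \<phi> g) = cinner \<psi> \<phi> *\<^sub>C B g"
  shows "bra_tensor_op \<psi> B = T"
  unfolding bra_tensor_op_def
  by (rule the_equality) (use assms in \<open>auto intro!: clinear_eq_on_tensors\<close>)

lemma tensor_op_diagonal:
  fixes K :: "'a::complex_inner \<Rightarrow> 'a"
  assumes A: "\<And>\<phi> n. Rep_ell2 (A \<phi>) n = a n * Rep_ell2 \<phi> n" and a: "\<And>n. cmod (a n) \<le> c"
    and K: "bounded_clinear K"
  shows "tensor_op A K = ell2_map (\<lambda>n x. a n *\<^sub>C K x)"
proof -
  obtain k where k: "k > 0" "\<And>x. norm (K x) \<le> k * norm x" using bounded_clinear_bound[OF K] by blast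
  interpret bounded_family "\<lambda>n x. a n *\<^sub>C K x" "c * k"
    by (rule bounded_family_scale[OF K a k(2)]) (use k in simp)
  show ?thesis
    by (rule tensor_op_eqI[OF clin])
      (rule ell2_eqI, simp add: rep ell2_rep A bounded_clinearD[OF K] scaleC_scaleC)
qed

lemma tensor_op_id:
  fixes K :: "'a::complex_inner \<Rightarrow> 'a"
  assumes "bounded_clinear K"
  shows "tensor_op id K = ell2_map (\<lambda>n. K)"
  using tensor_op_diagonal[of id "\<lambda>_. 1" 1 K] assms by simp

lemma bounded_family_const:
  assumes "bounded_clinear K" "\<And>x. norm (K x) \<le> k * norm x" "0 \<le> k"
  shows "bounded_family (\<lambda>_. K) k"
  by unfold_locales (use assms in auto)

section \<open>Shifts and the free operator\<close>

definition shift :: "int \<Rightarrow> 'a::complex_inner ell2 \<Rightarrow> 'a ell2"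
  where "shift k f = Abs_ell2 (\<lambda>n. Rep_ell2 f (n + k))"

lemma Rep_shift: "Rep_ell2 (shift k f) n = Rep_ell2 f (n + k)"
  unfolding shift_def
  by (subst Rep_Abs_ell2) (use sq_summable_Rep[of f] in \<open>auto simp: sq_summable_def intro: ell2_shift\<close>)

lemma has_sum_shift:
  assumes "(f has_sum s) (UNIV :: int set)"
  shows "((\<lambda>n. f (n + k)) has_sum s) UNIV"
  using has_sum_reindex_bij_betw[OF bij_plus_right[of k], of f s] assms by simp

lemma norm_shift: "norm (shift k f) = norm f"
proof -
  have "(norm (shift k f))\<^sup>2 = (norm f)\<^sup>2"
    by (rule ell2_norm_eqI) (use has_sum_shift[OF ell2_has_sum_norm[of f], of k] in \<open>simp add: Rep_shift\<close>)
  then show ?thesis by simp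
qed

lemma shift_clinear: "bounded_clinear (shift k)"
  by (rule bounded_clinearI[where C = 1])
    ((rule ell2_eqI)?; simp add: Rep_shift ell2_rep norm_shift)+

lemma cinner_shift: "cinner (shift k f) g = cinner f (shift (- k) g)"
proof -
  have "((\<lambda>n. cinner (Rep_ell2 f (n + k)) (Rep_ell2 g n)) has_sum cinner (shift k f) g) UNIV"
    using cinner_ell2_has_sum[of "shift k f" g] by (simp add: Rep_shift)
  from has_sum_shift[OF this, of "- k"]
  have "((\<lambda>n. cinner (Rep_ell2 f n) (Rep_ell2 g (n - k))) has_sum cinner (shift k f) g) UNIV" by simp
  then show ?thesis
    using cinner_ell2_has_sum[of f "shift (- k) g"] by (simp add: Rep_shift has_sum_unique)
qed

lemma tensor_op_laplacian:
  "tensor_op (neg_laplacian h) (id :: 'a::complex_inner \<Rightarrow> 'a)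
    = (\<lambda>f. complex_of_real (1 / h\<^sup>2) *\<^sub>C (2 *\<^sub>C f - shift 1 f - shift (-1) f))" (is "_ = ?T")
proof (rule tensor_op_eqI)
  show "bounded_clinear ?T"
    by (intro bounded_clinear_scaleC bounded_clinear_diff bounded_clinear_id shift_clinear)
  fix \<phi> and g :: 'a
  show "?T (tensor_vec \<phi> g) = tensor_vec (neg_laplacian h \<phi>) (id g)"
  proof (rule ell2_eqI)
    fix n
    have "Rep_ell2 (?T (tensor_vec \<phi> g)) n = (complex_of_real (1 / h\<^sup>2) *
        (2 * Rep_ell2 \<phi> n - Rep_ell2 \<phi> (n + 1) - Rep_ell2 \<phi> (n - 1))) *\<^sub>C g"
      by (simp add: ell2_rep Rep_shift cvec.scale_left_diff_distrib cvec.scale_right_diff_distrib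
          scaleC_scaleC diff_divide_distrib mult.commute right_diff_distrib)
    then show "Rep_ell2 (?T (tensor_vec \<phi> g)) n = Rep_ell2 (tensor_vec (neg_laplacian h \<phi>) (id g)) n"
      by (simp add: ell2_rep neg_laplacian.rep_eq)
  qed
qed

lemma free_op_eq:
  fixes Q :: "'a::complex_inner \<Rightarrow> 'a"
  assumes "bounded_clinear Q"
  shows "free_op h Q = (\<lambda>f. complex_of_real (1 / h\<^sup>2) *\<^sub>C (2 *\<^sub>C f - shift 1 f - shift (-1) f) + ell2_map (\<lambda>_. Q) f)"
  unfolding free_op_def tensor_op_laplacian tensor_op_id[OF assms] ..

lemma selfadjoint_free_op:
  fixes Q :: "'a::complex_inner \<Rightarrow> 'a"
  assumes Q: "selfadjoint_op Q"
  shows "selfadjoint_op (free_op h Q)"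
proof -
  note Ql = selfadjointD(1)[OF Q]
  obtain k where k: "k > 0" "\<And>x. norm (Q x) \<le> k * norm x" using bounded_clinear_bound[OF Ql] by blast
  interpret Q: bounded_family "\<lambda>_. Q" k by (rule bounded_family_const) (use Ql k in auto)
  have "cinner (ell2_map (\<lambda>_. Q) f) g = cinner f (ell2_map (\<lambda>_. Q) g)" for f g
    using cinner_ell2_has_sum[of "ell2_map (\<lambda>_. Q) f" g] cinner_ell2_has_sum[of f "ell2_map (\<lambda>_. Q) g"]
    by (simp add: Q.rep selfadjointD(2)[OF Q] has_sum_unique)
  then show ?thesis
    unfolding selfadjoint_op_def free_op_eq[OF Ql]
    by (auto intro!: bounded_clinear_add bounded_clinear_scaleC bounded_clinear_diff bounded_clinear_id
        shift_clinear Q.clin simp: cinner_add_left cinner_add_right cinner_diff_left cinner_diff_right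
        cinner_scaleC_left cinner_scaleC_right cinner_shift)
qed

text \<open>A self-adjoint T has no non-real eigenvalue, so T - z is injective and
  \<open>inv\<close> returns the solution that has been exhibited.\<close>

lemma resolvent_eqI:
  fixes T :: "'a::complex_inner \<Rightarrow> 'a"
  assumes T: "selfadjoint_op T" and z: "Im z \<noteq> 0" and u: "T u - z *\<^sub>C u = v"
  shows "resolvent T z v = u"
proof -
  note L = selfadjointD(1)[OF T]
  have "inj (\<lambda>x. T x - z *\<^sub>C x)"
  proof (rule injI)
    fix x y assume "T x - z *\<^sub>C x = T y - z *\<^sub>C y"
    define d where "d = x - y"
    have 0: "T d = z *\<^sub>C d"
      using \<open>T x - z *\<^sub>C x = T y - z *\<^sub>C y\<close>
      by (simp add: d_def bounded_clinearD[OF L] cvec.scale_right_diff_distrib algebra_simps)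
    have "cinner (T d) d = cinner d (T d)" by (rule selfadjointD(2)[OF T])
    then have "(z - cnj z) * cinner d d = 0"
      unfolding 0 by (simp only: cinner_scaleC_left cinner_scaleC_right left_diff_distrib right_minus_eq)
    moreover have "z - cnj z \<noteq> 0" using z by (simp add: complex_eq_iff)
    ultimately show "x = y" by (simp add: cinner_self d_def)
  qed
  from inv_f_f[OF this, of u] show ?thesis unfolding resolvent_def u .
qed

section \<open>Weighted sums over the lattice\<close>

text \<open>The Japanese bracket <n>.\<close>

definition jap :: "int \<Rightarrow> real"
  where "jap n = sqrt (1 + (real_of_int n)\<^sup>2)"

lemma jap_ge1: "1 \<le> jap n"
  by (simp add: jap_def)

lemma jap_pos: "0 < jap n"
  using jap_ge1[of n] by linarith

lemma jap_ge_abs: "\<bar>real_of_int n\<bar> \<le> jap n"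
  unfolding jap_def by (rule real_le_rsqrt) simp

lemma psi_jap: "psi \<nu> n = jap n powr (- \<nu> / 2)"
  by (simp add: psi_def jap_def)

lemma int_summable_abs:
  fixes f :: "nat \<Rightarrow> real"
  assumes f: "summable f" "\<And>n. 0 \<le> f n"
  shows "(\<lambda>n::int. f (nat \<bar>n\<bar>)) summable_on UNIV"
proof -
  have s: "f summable_on UNIV"
    by (rule norm_summable_imp_summable_on) (use f in simp)
  have b1: "bij_betw int UNIV {0..}"
    by (rule bij_betwI[of _ _ _ nat]) auto
  have b2: "bij_betw (\<lambda>n. - int n) UNIV {..0}"
    by (rule bij_betwI[of _ _ _ "\<lambda>k. nat (- k)"]) auto
  have 1: "(\<lambda>n::int. f (nat \<bar>n\<bar>)) summable_on {0..}"
    using summable_on_reindex_bij_betw[OF b1, of "\<lambda>n. f (nat \<bar>n\<bar>)"] s by simp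
  have "(\<lambda>n::int. f (nat \<bar>n\<bar>)) summable_on {..0}"
    using summable_on_reindex_bij_betw[OF b2, of "\<lambda>n. f (nat \<bar>n\<bar>)"] s by simp
  then have 2: "(\<lambda>n::int. f (nat \<bar>n\<bar>)) summable_on {..<0}"
    by (rule summable_on_subset_banach) auto
  have "(\<lambda>n::int. f (nat \<bar>n\<bar>)) summable_on ({0..} \<union> {..<0})"
    by (rule summable_on_Un_disjoint[OF 1 2]) auto
  also have "{0..} \<union> {..<0} = (UNIV :: int set)" by auto
  finally show ?thesis .
qed

lemma jap_powr_summable:
  assumes "1 < p"
  shows "(\<lambda>n. jap n powr (- p)) summable_on UNIV"
proof (rule summable_on_comparison_test)
  \<comment> \<open>The extra 1 at k = 0 covers the bracket at 0, where
    \<open>real 0 powr (- p)\<close> is 0.\<close>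
  let ?f = "\<lambda>k::nat. real k powr (- p) + (if k = 0 then 1 else 0)"
  have "summable ?f"
    by (intro summable_add summable_single) (use assms in \<open>simp add: summable_real_powr_iff\<close>)
  then show "(\<lambda>n::int. ?f (nat \<bar>n\<bar>)) summable_on UNIV" by (rule int_summable_abs) auto
  show "jap n powr (- p) \<le> ?f (nat \<bar>n\<bar>)" for n
  proof (cases "n = 0")
    case False
    then have "jap n powr (- p) \<le> \<bar>real_of_int n\<bar> powr (- p)"
      using assms by (intro powr_mono2' jap_ge_abs) auto
    then show ?thesis using False by simp
  qed (simp add: jap_def)
qed auto

lemma infsum_cauchy_schwarz:
  fixes a b :: "int \<Rightarrow> real"
  assumes a: "((\<lambda>n. (a n)\<^sup>2) has_sum s) UNIV" and b: "((\<lambda>n. (b n)\<^sup>2) has_sum t) UNIV"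
    and nn: "\<And>n. 0 \<le> a n" "\<And>n. 0 \<le> b n"
  shows "(\<lambda>n. a n * b n) summable_on UNIV" "(\<Sum>\<^sub>\<infinity>n. a n * b n) \<le> sqrt s * sqrt t"
proof -
  have fin: "(\<Sum>n\<in>F. a n * b n) \<le> sqrt s * sqrt t" if F: "finite F" for F
  proof -
    have "(\<Sum>n\<in>F. a n * b n)\<^sup>2 \<le> (\<Sum>n\<in>F. (a n)\<^sup>2) * (\<Sum>n\<in>F. (b n)\<^sup>2)" by (rule Cauchy_Schwarz_ineq_sum)
    also have "\<dots> \<le> s * t"
    proof (intro mult_mono)
      show "(\<Sum>n\<in>F. (a n)\<^sup>2) \<le> s" by (rule finite_sum_le_has_sum[OF a F]) auto
      show "(\<Sum>n\<in>F. (b n)\<^sup>2) \<le> t" by (rule finite_sum_le_has_sum[OF b F]) auto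
      show "0 \<le> s" by (rule has_sum_nonneg[OF a]) simp
    qed (simp add: sum_nonneg)
    finally show ?thesis by (simp add: real_le_rsqrt flip: real_sqrt_mult)
  qed
  show "(\<lambda>n. a n * b n) summable_on UNIV"
    by (rule nonneg_bdd_above_summable_on) (auto intro!: bdd_aboveI[of _ "sqrt s * sqrt t"] fin simp: nn)
  then show "(\<Sum>\<^sub>\<infinity>n. a n * b n) \<le> sqrt s * sqrt t" by (rule infsum_le_finite_sums) (use fin in auto)
qed

lemma norm_infsum_le_infsum:
  fixes f :: "'i \<Rightarrow> 'a::banach"
  assumes "g summable_on A" "\<And>x. x \<in> A \<Longrightarrow> norm (f x) \<le> g x"
  shows "f summable_on A" "norm (infsum f A) \<le> infsum g A"
proof -
  have ab: "f abs_summable_on A"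
    by (rule summable_on_comparison_test[OF assms(1)]) (use assms(2) in auto)
  then show s: "f summable_on A" by (rule abs_summable_summable)
  show "norm (infsum f A) \<le> infsum g A"
    by (rule norm_infsum_le[OF has_sum_infsum[OF s] has_sum_infsum[OF assms(1)]]) (use assms(2) in auto)
qed

lemma has_sum_cinner_right: "(f has_sum s) A \<Longrightarrow> ((\<lambda>n. cinner x (f n)) has_sum cinner x s) A"
  by (rule has_sum_bounded_linear[OF bounded_linear_cinner_right])

section \<open>Spectral projections of the transverse operator\<close>

lemma eigenspace_subspace:
  assumes "bounded_clinear Q" shows "cvec.subspace (eigenspace Q r)"
  unfolding cvec.subspace_def eigenspace_def
  by (auto simp: bounded_clinearD[OF assms] scaleC_add_right scaleC_scaleC mult.commute)

lemma eigenspace_orthogonal: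
  assumes Q: "selfadjoint_op Q" and x: "x \<in> eigenspace Q r" and y: "y \<in> eigenspace Q r'" and "r \<noteq> r'"
  shows "cinner x y = 0"
proof -
  have "cinner (Q x) y = cinner x (Q y)" by (rule selfadjointD(2)[OF Q])
  then have "(of_real r - of_real r') * cinner x y = (0::complex)"
    using x y by (simp add: eigenspace_def cinner_scaleC_left cinner_scaleC_right left_diff_distrib)
  then show ?thesis using \<open>r \<noteq> r'\<close> by simp
qed

locale transverse_spectrum =
  fixes Q :: "'g::chilbert_space \<Rightarrow> 'g" and d :: nat and \<mu> :: "nat \<Rightarrow> real"
  assumes Q: "selfadjoint_op Q" and spec: "spectral_data Q d \<mu>"
begin

abbreviation I where "I \<equiv> index_set Q d"
abbreviation \<pi> where "\<pi> s \<equiv> eigenproj Q \<mu> s"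

lemma fin_I: "finite I"
  by (simp add: index_set_def)

lemma inj_I: "inj_on \<mu> I"
  using spec by (auto simp: spectral_data_def index_set_def split: if_splits)

lemma decomp: "\<exists>y. (\<forall>s\<in>I. y s \<in> eigenspace Q (\<mu> s)) \<and> x = (\<Sum>s\<in>I. y s)"
proof (cases "Q = (\<lambda>_. 0)")
  case True
  then have "\<mu> 0 = 0" using spec by (simp add: spectral_data_def)
  then show ?thesis using True by (intro exI[of _ "\<lambda>_. x"]) (simp add: index_set_def eigenspace_def)
qed (use spec in \<open>auto simp: spectral_data_def index_set_def\<close>)

text \<open>Eigenspaces of different eigenvalues are orthogonal, so the component of x in one of
  them is its orthogonal projection. Linearity of \<open>eigenproj\<close> and the completeness
  relation are read off from this.\<close>

lemma proj_eq:
  assumes y: "\<And>s. s \<in> I \<Longrightarrow> y s \<in> eigenspace Q (\<mu> s)" and x: "x = (\<Sum>s\<in>I. y s)" and s: "s \<in> I"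
  shows "\<pi> s x = y s"
  unfolding eigenproj_def
proof (rule orth_proj_eq[OF y[OF s] _ eigenspace_subspace[OF selfadjointD(1)[OF Q]]])
  fix w assume w: "w \<in> eigenspace Q (\<mu> s)"
  have "x - y s = (\<Sum>t\<in>I - {s}. y t)" unfolding x by (simp add: sum_diff1 fin_I s)
  then have "cinner w (x - y s) = (\<Sum>t\<in>I - {s}. cinner w (y t))" by (simp add: cinner_sum_right)
  also have "\<dots> = 0"
  proof (rule sum.neutral, rule ballI)
    fix t assume t: "t \<in> I - {s}"
    then have "\<mu> s \<noteq> \<mu> t" using inj_I s by (auto simp: inj_on_def)
    then show "cinner w (y t) = 0" using eigenspace_orthogonal[OF Q w y] t by blast
  qed
  finally show "cinner w (x - y s) = 0" .
qed

lemma proj_in: "s \<in> I \<Longrightarrow> \<pi> s x \<in> eigenspace Q (\<mu> s)"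
  using decomp[of x] proj_eq by metis

lemma proj_sum: "(\<Sum>s\<in>I. \<pi> s x) = x"
proof -
  obtain y where y: "\<And>s. s \<in> I \<Longrightarrow> y s \<in> eigenspace Q (\<mu> s)" "x = (\<Sum>s\<in>I. y s)" using decomp by blast
  then show ?thesis using proj_eq[OF y] by simp
qed

lemma Q_proj: "s \<in> I \<Longrightarrow> Q (\<pi> s x) = of_real (\<mu> s) *\<^sub>C \<pi> s x"
  using proj_in[of s x] by (simp add: eigenspace_def)

lemma proj_sa: "s \<in> I \<Longrightarrow> cinner (\<pi> s x) y = cinner (\<pi> s x) (\<pi> s y)"
proof -
  assume s: "s \<in> I"
  have "cinner (\<pi> s x) y = cinner (\<pi> s x) (\<Sum>t\<in>I. \<pi> t y)" by (simp only: proj_sum)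
  also have "\<dots> = (\<Sum>t\<in>I. if t = s then cinner (\<pi> s x) (\<pi> s y) else 0)"
    unfolding cinner_sum_right
  proof (rule sum.cong[OF refl])
    fix t assume t: "t \<in> I"
    show "cinner (\<pi> s x) (\<pi> t y) = (if t = s then cinner (\<pi> s x) (\<pi> s y) else 0)"
      using eigenspace_orthogonal[OF Q proj_in[OF s] proj_in[OF t]] inj_I s t by (auto simp: inj_on_def)
  qed
  also have "\<dots> = cinner (\<pi> s x) (\<pi> s y)" using s fin_I by simp
  finally show ?thesis .
qed

lemma proj_sa': "s \<in> I \<Longrightarrow> cinner (\<pi> s x) y = cinner x (\<pi> s y)"
  using proj_sa[of s x y] proj_sa[of s y x] cinner_commute by metis

lemma proj_add: "s \<in> I \<Longrightarrow> \<pi> s (x + y) = \<pi> s x + \<pi> s y"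
  by (rule proj_eq)
    (auto simp: sum.distrib proj_sum intro!: cvec.subspace_add[OF eigenspace_subspace[OF selfadjointD(1)[OF Q]]] proj_in)

lemma proj_scale: "s \<in> I \<Longrightarrow> \<pi> s (a *\<^sub>C x) = a *\<^sub>C \<pi> s x"
  by (rule proj_eq)
    (auto simp: proj_sum intro!: cvec.subspace_scale[OF eigenspace_subspace[OF selfadjointD(1)[OF Q]]] proj_in
      simp flip: cvec.scale_sum_right)

lemma proj_norm: assumes s: "s \<in> I" shows "norm (\<pi> s x) \<le> norm x"
proof -
  have "(norm (\<pi> s x))\<^sup>2 = Re (cinner (\<pi> s x) x)" by (simp add: proj_sa[OF s] cinner_self)
  also have "\<dots> \<le> norm (\<pi> s x) * norm x"
    using cinner_norm_bound complex_Re_le_cmod order_trans by blast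
  finally show ?thesis by (cases "\<pi> s x = 0") (auto simp: power2_eq_square)
qed

lemma proj_clinear: "s \<in> I \<Longrightarrow> bounded_clinear (\<pi> s)"
  by (rule bounded_clinearI[where C = 1]) (auto simp: proj_add proj_scale proj_norm)

end

section \<open>Sandwiched lattice kernels\<close>

locale lattice_model = transverse_spectrum Q d \<mu>
  for Q :: "'g::chilbert_space \<Rightarrow> 'g" and d :: nat and \<mu> :: "nat \<Rightarrow> real" +
  fixes \<nu> :: real and K :: "'g \<Rightarrow> 'g" and W :: "'g ell2 \<Rightarrow> 'g ell2"
  assumes \<nu>: "3 < \<nu>" and W: "positive_op W" and K: "hilbert_schmidt K"
begin

definition S :: "'g ell2 \<Rightarrow> 'g ell2" where "S = sqrt_op W"

lemma S_pos: "positive_op S" and SS: "S (S x) = W x"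
  unfolding S_def by (rule sqrt_op_props[OF W])+

lemma S_lin: "bounded_clinear S" by (rule positive_opD(1)[OF S_pos])

lemma S_sa: "cinner (S x) y = cinner x (S y)"
  by (rule selfadjointD(2)[OF positive_op_selfadjoint[OF S_pos]])

lemma K_lin: "bounded_clinear K" using K by (simp add: hilbert_schmidt_def)

definition Kc :: "'g \<Rightarrow> 'g" where "Kc = cadjoint K"

lemma Kc_lin: "bounded_clinear Kc" unfolding Kc_def by (rule bounded_clinear_cadjoint[OF K_lin])

lemma Kc: "cinner (Kc y) x = cinner y (K x)" "cinner x (Kc y) = cinner (K x) y"
  unfolding Kc_def by (rule cadjoint_works[OF K_lin] cadjoint_works'[OF K_lin])+

text \<open>Bounds for S and K, chosen once so that later constants such as \<open>C1\<close> and
  \<open>remainder_const\<close> can be named.\<close>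

definition cS where "cS = (SOME c. 0 < c \<and> (\<forall>x. norm (S x) \<le> c * norm x))"
definition cK where "cK = (SOME c. 0 < c \<and> (\<forall>x. norm (K x) \<le> c * norm x))"

lemma cS: "0 < cS" "norm (S x) \<le> cS * norm x"
proof -
  have "\<exists>c. 0 < c \<and> (\<forall>x. norm (S x) \<le> c * norm x)" using bounded_clinear_bound[OF S_lin] by metis
  from someI_ex[OF this] show "0 < cS" "norm (S x) \<le> cS * norm x" by (auto simp: cS_def)
qed

lemma cK: "0 < cK" "norm (K x) \<le> cK * norm x"
proof -
  have "\<exists>c. 0 < c \<and> (\<forall>x. norm (K x) \<le> c * norm x)" using bounded_clinear_bound[OF K_lin] by metis
  from someI_ex[OF this] show "0 < cK" "norm (K x) \<le> cK * norm x" by (auto simp: cK_def)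
qed

lemma cKc: "norm (Kc x) \<le> cK * norm x"
  unfolding Kc_def by (rule cadjoint_bound[OF K_lin]) (use cK less_imp_le in auto)

abbreviation \<psi> where "\<psi> n \<equiv> psi \<nu> n"

lemma psi_pos: "0 < \<psi> n" using jap_pos[of n] by (simp add: psi_jap)

text \<open>The weight \<open>w\<close> is summable even though \<open>w / \<psi>\<close> grows; this is what makes the
  sandwiched kernels of polynomial growth \<open>1/2\<close> converge in Hilbert-Schmidt norm.\<close>

definition w where "w n = \<psi> n * sqrt (jap n)"

lemma w_pos: "0 < w n" by (simp add: w_def psi_pos jap_pos)

lemma w_jap: "w n = jap n powr (- ((\<nu> - 1) / 2))"
proof -
  have "w n = jap n powr (- \<nu> / 2 + 1 / 2)"
    using jap_pos[of n] by (simp only: w_def psi_jap powr_add powr_half_sqrt less_imp_le)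
  also have "- \<nu> / 2 + 1 / 2 = - ((\<nu> - 1) / 2)" by (simp add: field_simps)
  finally show ?thesis .
qed

text \<open>The exponent (\<nu> - 1) / 2 exceeds 1 exactly for \<nu> > 3.\<close>

lemma w_summable: "w summable_on UNIV"
proof -
  have "(\<lambda>n. jap n powr (- ((\<nu> - 1) / 2))) summable_on UNIV"
    by (rule jap_powr_summable) (use \<nu> in simp)
  then show ?thesis by (simp only: w_jap[symmetric])
qed

text \<open>The exponent is \<nu> - 2, again above 1 exactly for \<nu> > 3.\<close>

lemma psi2_summable: "(\<lambda>n. (\<psi> n * jap n)\<^sup>2) summable_on UNIV"
proof -
  have "(\<psi> n * jap n)\<^sup>2 = jap n powr (- (\<nu> - 2))" for n
  proof -
    have "\<psi> n * jap n = jap n powr (- \<nu> / 2 + 1)"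
      using jap_pos[of n] by (simp only: psi_jap powr_add powr_one less_imp_le)
    then show ?thesis using jap_pos[of n] by (simp add: power2_eq_square powr_add[symmetric])
  qed
  moreover have "(\<lambda>n. jap n powr (- (\<nu> - 2))) summable_on UNIV"
    by (rule jap_powr_summable) (use \<nu> in simp)
  ultimately show ?thesis by simp
qed

definition sw where "sw = (\<Sum>\<^sub>\<infinity>n. w n)"
definition sp where "sp = (\<Sum>\<^sub>\<infinity>n. (\<psi> n * jap n)\<^sup>2)"

lemma sw_nonneg: "0 \<le> sw" unfolding sw_def by (rule infsum_nonneg) (use w_pos less_imp_le in auto)
lemma sp_nonneg: "0 \<le> sp" unfolding sp_def by (rule infsum_nonneg) auto

lemma psi_le_1: "\<psi> n \<le> 1"
proof -
  have "jap n powr (- \<nu> / 2) \<le> jap n powr 0" using jap_ge1 \<nu> by (intro powr_mono) auto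
  then show ?thesis using jap_pos[of n] by (simp add: psi_jap)
qed

lemma w_le_1: "w n \<le> 1"
proof -
  have "jap n powr (- ((\<nu> - 1) / 2)) \<le> jap n powr 0" using jap_ge1 \<nu> by (intro powr_mono) auto
  then show ?thesis using jap_pos[of n] by (simp add: w_jap)
qed

text \<open>\<open>V x\<close> lists the coordinates of M^* x with M = S (M_\<psi> \<otimes> K), see
  \<open>M_adjoint\<close>.\<close>

definition V where "V x n = complex_of_real (\<psi> n) *\<^sub>C Kc (Rep_ell2 (S x) n)"

lemma V_lin: "V (x + y) n = V x n + V y n" "V (a *\<^sub>C x) n = a *\<^sub>C V x n"
  by (simp_all add: V_def bounded_clinearD[OF S_lin] bounded_clinearD[OF Kc_lin] ell2_rep
      scaleC_add_right scaleC_scaleC mult.commute)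

sublocale Zf: bounded_family "\<lambda>n y. complex_of_real (sqrt (w n)) *\<^sub>C Kc y" "1 * cK"
  by (rule bounded_family_scale[OF Kc_lin _ cKc]) (use w_pos w_le_1 cK less_imp_le in \<open>auto simp: abs_of_pos\<close>)

sublocale Kf: bounded_family "\<lambda>_. K" cK
  by (rule bounded_family_const[OF K_lin cK(2)]) (use cK in simp)

sublocale Kcf: bounded_family "\<lambda>_. Kc" cK
  by (rule bounded_family_const[OF Kc_lin cKc]) (use cK in simp)

text \<open>The fixed operator of all remainder bounds: M^* with the weight \<psi> replaced by the
  more slowly decaying sqrt w. Its square w is still summable, which keeps Z
  Hilbert-Schmidt.\<close>

definition Z where "Z x = ell2_map (\<lambda>n y. complex_of_real (sqrt (w n)) *\<^sub>C Kc y) (S x)"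

lemma Z_lin: "bounded_clinear Z"
proof -
  have "Z = ell2_map (\<lambda>n y. complex_of_real (sqrt (w n)) *\<^sub>C Kc y) \<circ> S" by (rule ext) (simp add: Z_def)
  then show ?thesis using bounded_clinear_compose[OF Zf.clin S_lin] by simp
qed

lemma Z_has_sum: "((\<lambda>n. w n * (norm (Kc (Rep_ell2 (S x) n)))\<^sup>2) has_sum (norm (Z x))\<^sup>2) UNIV"
proof -
  have "(norm (Rep_ell2 (Z x) n))\<^sup>2 = w n * (norm (Kc (Rep_ell2 (S x) n)))\<^sup>2" for n
    using w_pos[of n] by (simp add: Z_def Zf.rep norm_scaleC power_mult_distrib)
  then show ?thesis using ell2_has_sum_norm[of "Z x"] by simp
qed

text \<open>The factor \<open>sqrt (jap n)\<close> turns \<psi> into w, written as sqrt w times sqrt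
  w; in Cauchy-Schwarz one factor is summed to \<open>sw\<close> and the other belongs to Z
  x.\<close>

lemma V_sum_half:
  "(\<lambda>n. sqrt (jap n) * norm (V x n)) summable_on UNIV"
  "(\<Sum>\<^sub>\<infinity>n. sqrt (jap n) * norm (V x n)) \<le> sqrt sw * norm (Z x)"
proof -
  have eq: "sqrt (w n) * (sqrt (w n) * norm (Kc (Rep_ell2 (S x) n))) = sqrt (jap n) * norm (V x n)" for n
  proof -
    have "sqrt (w n) * sqrt (w n) = w n" using w_pos[of n] by simp
    then have "sqrt (w n) * (sqrt (w n) * norm (Kc (Rep_ell2 (S x) n))) = w n * norm (Kc (Rep_ell2 (S x) n))"
      by (simp only: mult.assoc[symmetric])
    moreover have "norm (V x n) = \<psi> n * norm (Kc (Rep_ell2 (S x) n))"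
      using psi_pos[of n] by (simp add: V_def norm_scaleC)
    ultimately show ?thesis by (simp add: w_def mult_ac)
  qed
  have a: "((\<lambda>n. (sqrt (w n))\<^sup>2) has_sum sw) UNIV"
    using w_summable w_pos by (simp add: sw_def less_imp_le)
  have b: "((\<lambda>n. (sqrt (w n) * norm (Kc (Rep_ell2 (S x) n)))\<^sup>2) has_sum (norm (Z x))\<^sup>2) UNIV"
    using Z_has_sum[of x] w_pos by (simp add: power_mult_distrib less_imp_le)
  show "(\<lambda>n. sqrt (jap n) * norm (V x n)) summable_on UNIV"
    using infsum_cauchy_schwarz(1)[OF a b] w_pos by (simp add: eq less_imp_le)
  show "(\<Sum>\<^sub>\<infinity>n. sqrt (jap n) * norm (V x n)) \<le> sqrt sw * norm (Z x)"
    using infsum_cauchy_schwarz(2)[OF a b] w_pos by (simp add: eq less_imp_le)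
qed

lemma V_sum:
  "(\<lambda>n. norm (V x n)) summable_on UNIV"
  "(\<Sum>\<^sub>\<infinity>n. norm (V x n)) \<le> sqrt sw * norm (Z x)"
proof -
  have le: "norm (V x n) \<le> sqrt (jap n) * norm (V x n)" for n
    using jap_ge1[of n] by (simp add: mult_le_cancel_right1)
  show s: "(\<lambda>n. norm (V x n)) summable_on UNIV"
    by (rule summable_on_comparison_test[OF V_sum_half(1)[of x]]) (use le in auto)
  show "(\<Sum>\<^sub>\<infinity>n. norm (V x n)) \<le> sqrt sw * norm (Z x)"
    using infsum_mono[OF s V_sum_half(1)[of x] le] V_sum_half(2)[of x] by simp
qed

text \<open>A full power of the bracket uses up the decay: Cauchy-Schwarz pairs
  \<open>\<psi> n * jap n\<close> with K^* S x, and the bound is by |x| instead of |Z x|.\<close>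

lemma V_sum_full:
  "(\<lambda>n. jap n * norm (V x n)) summable_on UNIV"
  "(\<Sum>\<^sub>\<infinity>n. jap n * norm (V x n)) \<le> sqrt sp * cK * cS * norm x"
proof -
  have eq: "(\<psi> n * jap n) * norm (Kc (Rep_ell2 (S x) n)) = jap n * norm (V x n)" for n
    using psi_pos[of n] by (simp add: V_def norm_scaleC)
  have a: "((\<lambda>n. (\<psi> n * jap n)\<^sup>2) has_sum sp) UNIV" using psi2_summable by (simp add: sp_def)
  have b: "((\<lambda>n. (norm (Kc (Rep_ell2 (S x) n)))\<^sup>2) has_sum (norm (ell2_map (\<lambda>_. Kc) (S x)))\<^sup>2) UNIV"
    using ell2_has_sum_norm[of "ell2_map (\<lambda>_. Kc) (S x)"] by (simp add: Kcf.rep)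
  have nn: "0 \<le> \<psi> n * jap n" for n using psi_pos[of n] jap_pos[of n] by simp
  show "(\<lambda>n. jap n * norm (V x n)) summable_on UNIV"
    using infsum_cauchy_schwarz(1)[OF a b nn] by (simp add: eq)
  have "(\<Sum>\<^sub>\<infinity>n. jap n * norm (V x n)) \<le> sqrt sp * norm (ell2_map (\<lambda>_. Kc) (S x))"
    using infsum_cauchy_schwarz(2)[OF a b nn] by (simp add: eq)
  also have "norm (ell2_map (\<lambda>_. Kc) (S x)) \<le> cK * norm (S x)" by (rule Kcf.norm_le)
  also have "norm (S x) \<le> cS * norm x" by (rule cS)
  finally show "(\<Sum>\<^sub>\<infinity>n. jap n * norm (V x n)) \<le> sqrt sp * cK * cS * norm x"
    using sp_nonneg cK(1) by (simp add: mult.assoc mult_left_mono)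
qed

text \<open>At each site the sum over an orthonormal J is expanded by Parseval in the fibre and
  estimated by Bessel along J, which yields cS^2 times the squared Hilbert-Schmidt norm of K; the
  weights w then sum over the sites.\<close>

lemma hs_bound_Z: "\<exists>C0. hs_bound Z C0"
proof -
  define k2 where "k2 = (\<Sum>\<^sub>\<infinity>e\<in>some_onb. (norm (K e))\<^sup>2)"
  have k2: "((\<lambda>e. (norm (K e))\<^sup>2) has_sum k2) some_onb"
    using K by (simp add: hilbert_schmidt_def k2_def)
  have coord: "cinner (tensor_vec (delta m) g) y = cinner g (Rep_ell2 y m)" for m g and y :: "'g ell2"
  proof -
    have "((\<lambda>n. cinner (Rep_ell2 (tensor_vec (delta m) g) n) (Rep_ell2 y n)) has_sum cinner g (Rep_ell2 y m)) {m}"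
      by (simp add: has_sum_finiteI ell2_rep Rep_delta)
    then have "((\<lambda>n. cinner (Rep_ell2 (tensor_vec (delta m) g) n) (Rep_ell2 y n)) has_sum cinner g (Rep_ell2 y m)) UNIV"
      by (rule has_sum_cong_neutral[THEN iffD1, rotated -1]) (auto simp: ell2_rep Rep_delta)
    then show ?thesis using cinner_ell2_has_sum has_sum_unique by blast
  qed
  have nrm: "norm (tensor_vec (delta m) g) = norm g" for m and g :: 'g
  proof -
    have "cinner (tensor_vec (delta m) g) (tensor_vec (delta m) g) = cinner g g"
      by (simp add: coord ell2_rep Rep_delta)
    then have "(norm (tensor_vec (delta m) g))\<^sup>2 = (norm g)\<^sup>2"
      unfolding cinner_self by (simp only: of_real_eq_iff)
    then show ?thesis by simp
  qed
  have site: "(\<Sum>e\<in>J. (norm (Kc (Rep_ell2 (S e) m)))\<^sup>2) \<le> cS\<^sup>2 * k2" if J: "finite J" "orthonormal J" for J m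
  proof (rule has_sum_mono)
    show "((\<lambda>f. \<Sum>e\<in>J. (cmod (cinner f (Kc (Rep_ell2 (S e) m))))\<^sup>2) has_sum
      (\<Sum>e\<in>J. (norm (Kc (Rep_ell2 (S e) m)))\<^sup>2)) some_onb"
      by (rule has_sum_finite_sum[OF J(1) parseval])
    show "((\<lambda>f. cS\<^sup>2 * (norm (K f))\<^sup>2) has_sum cS\<^sup>2 * k2) some_onb" by (rule has_sum_cmult_right[OF k2])
    fix f :: 'g
    let ?t = "tensor_vec (delta m) (K f)"
    have "cinner f (Kc (Rep_ell2 (S e) m)) = cinner (S ?t) e" for e
      by (simp only: Kc(2) coord[symmetric] S_sa)
    then have "cinner f (Kc (Rep_ell2 (S e) m)) = cnj (cinner e (S ?t))" for e
      using cinner_commute[of "S ?t" e] by simp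
    then have "(\<Sum>e\<in>J. (cmod (cinner f (Kc (Rep_ell2 (S e) m))))\<^sup>2) = (\<Sum>e\<in>J. (cmod (cinner e (S ?t)))\<^sup>2)" by simp
    also have "\<dots> \<le> (norm (S ?t))\<^sup>2" by (rule bessel[OF J])
    also have "\<dots> \<le> (cS * norm ?t)\<^sup>2" by (intro power_mono cS) simp
    finally show "(\<Sum>e\<in>J. (cmod (cinner f (Kc (Rep_ell2 (S e) m))))\<^sup>2) \<le> cS\<^sup>2 * (norm (K f))\<^sup>2"
      by (simp add: nrm power_mult_distrib)
  qed
  have "hs_bound Z (cS\<^sup>2 * k2 * sw)"
    unfolding hs_bound_def
  proof (intro allI impI)
    fix J :: "'g ell2 set" assume J: "finite J" "orthonormal J"
    show "(\<Sum>e\<in>J. (norm (Z e))\<^sup>2) \<le> cS\<^sup>2 * k2 * sw"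
    proof (rule has_sum_mono)
      show "((\<lambda>m. \<Sum>e\<in>J. w m * (norm (Kc (Rep_ell2 (S e) m)))\<^sup>2) has_sum (\<Sum>e\<in>J. (norm (Z e))\<^sup>2)) UNIV"
        by (rule has_sum_finite_sum[OF J(1) Z_has_sum])
      show "((\<lambda>m. cS\<^sup>2 * k2 * w m) has_sum cS\<^sup>2 * k2 * sw) UNIV"
        by (rule has_sum_cmult_right) (use w_summable in \<open>simp add: sw_def\<close>)
      fix m
      have "(\<Sum>e\<in>J. w m * (norm (Kc (Rep_ell2 (S e) m)))\<^sup>2) = w m * (\<Sum>e\<in>J. (norm (Kc (Rep_ell2 (S e) m)))\<^sup>2)"
        by (simp add: sum_distrib_left)
      also have "\<dots> \<le> w m * (cS\<^sup>2 * k2)" using w_pos[of m] by (intro mult_left_mono site[OF J]) auto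
      finally show "(\<Sum>e\<in>J. w m * (norm (Kc (Rep_ell2 (S e) m)))\<^sup>2) \<le> cS\<^sup>2 * k2 * w m" by (simp add: mult.commute)
    qed
  qed
  then show ?thesis by blast
qed

section \<open>Operators given by channel kernels and their forms\<close>

definition app :: "(nat \<Rightarrow> int \<Rightarrow> int \<Rightarrow> complex) \<Rightarrow> (int \<Rightarrow> 'g) \<Rightarrow> int \<Rightarrow> 'g"
  where "app k v n = (\<Sum>\<^sub>\<infinity>m. \<Sum>s\<in>I. k s n m *\<^sub>C \<pi> s (v m))"

text \<open>Half a power in each variable is the growth by which differences of powers of nearby
  roots are small, see \<open>conv_kernel_diff_le\<close>, and \<open>V_sum_half\<close> absorbs
  it.\<close>

definition kernel_le :: "(nat \<Rightarrow> int \<Rightarrow> int \<Rightarrow> complex) \<Rightarrow> real \<Rightarrow> bool"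
  where "kernel_le k \<kappa> \<longleftrightarrow> (\<forall>n m. (\<Sum>s\<in>I. cmod (k s n m)) \<le> \<kappa> * (sqrt (jap n) * sqrt (jap m)))"

text \<open>The operator M k M^*, with the outer weight \<psi> kept inside \<open>Abs_ell2\<close>:
  inside a band the kernel does not decay, and k applied to V x is controlled in l^2 only after
  weighting.\<close>

definition Phi :: "(nat \<Rightarrow> int \<Rightarrow> int \<Rightarrow> complex) \<Rightarrow> 'g ell2 \<Rightarrow> 'g ell2"
  where "Phi k x = S (Abs_ell2 (\<lambda>n. complex_of_real (\<psi> n) *\<^sub>C K (app k (V x) n)))"

lemma term_norm: "norm (\<Sum>s\<in>I. k s n m *\<^sub>C \<pi> s g) \<le> (\<Sum>s\<in>I. cmod (k s n m)) * norm g"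
proof -
  have "norm (\<Sum>s\<in>I. k s n m *\<^sub>C \<pi> s g) \<le> (\<Sum>s\<in>I. cmod (k s n m) * norm g)"
    by (rule sum_norm_le) (simp add: norm_scaleC mult_left_mono proj_norm)
  then show ?thesis by (simp add: sum_distrib_right)
qed

lemma kernel_le_nonneg: "kernel_le k \<kappa> \<Longrightarrow> 0 \<le> \<kappa>"
proof -
  assume "kernel_le k \<kappa>"
  then have "0 \<le> \<kappa> * (sqrt (jap 0) * sqrt (jap 0))"
    unfolding kernel_le_def using sum_nonneg[of I "\<lambda>s. cmod (k s 0 0)"] order_trans by (metis norm_ge_zero)
  then show ?thesis by (simp add: jap_def)
qed

lemma app_bound:
  assumes k: "kernel_le k \<kappa>"
  shows "(\<lambda>m. \<Sum>s\<in>I. k s n m *\<^sub>C \<pi> s (V x m)) summable_on UNIV"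
    "norm (app k (V x) n) \<le> \<kappa> * sqrt sw * norm (Z x) * sqrt (jap n)"
proof -
  have s: "(\<lambda>m. \<kappa> * sqrt (jap n) * (sqrt (jap m) * norm (V x m))) summable_on UNIV"
    by (rule summable_on_cmult_right[OF V_sum_half(1)])
  have le: "norm (\<Sum>s\<in>I. k s n m *\<^sub>C \<pi> s (V x m)) \<le> \<kappa> * sqrt (jap n) * (sqrt (jap m) * norm (V x m))" for m
  proof -
    have "norm (\<Sum>s\<in>I. k s n m *\<^sub>C \<pi> s (V x m)) \<le> \<kappa> * (sqrt (jap n) * sqrt (jap m)) * norm (V x m)"
    proof (rule order_trans[OF term_norm mult_right_mono[OF _ norm_ge_zero]])
      show "(\<Sum>s\<in>I. cmod (k s n m)) \<le> \<kappa> * (sqrt (jap n) * sqrt (jap m))" using k by (simp add: kernel_le_def)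
    qed
    then show ?thesis by (simp add: mult.assoc)
  qed
  show "(\<lambda>m. \<Sum>s\<in>I. k s n m *\<^sub>C \<pi> s (V x m)) summable_on UNIV"
    by (rule norm_infsum_le_infsum(1)[OF s le])
  have "norm (app k (V x) n) \<le> (\<Sum>\<^sub>\<infinity>m. \<kappa> * sqrt (jap n) * (sqrt (jap m) * norm (V x m)))"
    unfolding app_def by (rule norm_infsum_le_infsum(2)[OF s le])
  also have "\<dots> = \<kappa> * sqrt (jap n) * (\<Sum>\<^sub>\<infinity>m. sqrt (jap m) * norm (V x m))" by (rule infsum_cmult_right')
  also have "\<dots> \<le> \<kappa> * sqrt (jap n) * (sqrt sw * norm (Z x))"
    using kernel_le_nonneg[OF k] jap_pos[of n] by (intro mult_left_mono V_sum_half(2)) auto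
  finally show "norm (app k (V x) n) \<le> \<kappa> * sqrt sw * norm (Z x) * sqrt (jap n)" by (simp add: mult_ac)
qed

lemma weighted_seq:
  assumes u: "\<And>n. norm (u n) \<le> c * sqrt (jap n)"
  shows "sq_summable (\<lambda>n. complex_of_real (\<psi> n) *\<^sub>C K (u n))"
    "norm (Abs_ell2 (\<lambda>n. complex_of_real (\<psi> n) *\<^sub>C K (u n))) \<le> cK * c * sqrt sp"
proof -
  let ?g = "\<lambda>n. complex_of_real (\<psi> n) *\<^sub>C K (u n)"
  have c: "0 \<le> c"
    using order_trans[OF norm_ge_zero u[of 0]] by (simp add: jap_def)
  have le: "(norm (?g n))\<^sup>2 \<le> (cK * c)\<^sup>2 * (\<psi> n * jap n)\<^sup>2" for n
  proof -
    have "norm (?g n) = \<psi> n * norm (K (u n))" using psi_pos[of n] by (simp add: norm_scaleC)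
    also have "\<dots> \<le> \<psi> n * (cK * (c * jap n))"
    proof (intro mult_left_mono)
      have "sqrt (jap n) \<le> jap n"
        by (rule real_le_lsqrt) (use jap_ge1[of n] in \<open>simp_all add: power2_eq_square\<close>)
      then have "norm (u n) \<le> c * jap n" using order_trans[OF u[of n] mult_left_mono[OF _ c]] by blast
      then have "cK * norm (u n) \<le> cK * (c * jap n)" using cK(1) by simp
      then show "norm (K (u n)) \<le> cK * (c * jap n)" using cK(2)[of "u n"] by linarith
    qed (use psi_pos[of n] in simp)
    finally have "norm (?g n) \<le> cK * c * (\<psi> n * jap n)" by (simp only: mult_ac)
    then have "(norm (?g n))\<^sup>2 \<le> (cK * c * (\<psi> n * jap n))\<^sup>2" by (rule power_mono) simp
    then show ?thesis by (simp add: power_mult_distrib)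
  qed
  have hs: "((\<lambda>n. (cK * c)\<^sup>2 * (\<psi> n * jap n)\<^sup>2) has_sum (cK * c)\<^sup>2 * sp) UNIV"
    by (rule has_sum_cmult_right) (use psi2_summable in \<open>simp add: sp_def\<close>)
  show sq: "sq_summable ?g"
    unfolding sq_summable_def
    by (rule summable_on_comparison_test[OF has_sum_imp_summable[OF hs] le]) simp
  have "(norm (Abs_ell2 ?g))\<^sup>2 \<le> (cK * c)\<^sup>2 * sp"
    by (rule has_sum_mono[OF ell2_has_sum_norm hs]) (use le in \<open>simp add: Rep_Abs_ell2[OF sq]\<close>)
  then have "(norm (Abs_ell2 ?g))\<^sup>2 \<le> (cK * c * sqrt sp)\<^sup>2" using sp_nonneg by (simp add: power_mult_distrib)
  then show "norm (Abs_ell2 ?g) \<le> cK * c * sqrt sp"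
    by (rule power2_le_imp_le) (use c cK(1) sp_nonneg in simp)
qed

definition C1 where "C1 = cS * cK * sqrt sw * sqrt sp"

lemma C1_nonneg: "0 \<le> C1" using cS(1) cK(1) sw_nonneg sp_nonneg by (simp add: C1_def)

text \<open>Keeping Z x on the right, rather than x, makes \<open>Phi k\<close> Hilbert-Schmidt with
  a norm bound proportional to \<kappa>, see \<open>Phi_hs\<close>.\<close>

lemma Phi_norm:
  assumes k: "kernel_le k \<kappa>"
  shows "norm (Phi k x) \<le> C1 * \<kappa> * norm (Z x)"
proof -
  have "norm (Phi k x) \<le> cS * norm (Abs_ell2 (\<lambda>n. complex_of_real (\<psi> n) *\<^sub>C K (app k (V x) n)))"
    unfolding Phi_def by (rule cS)
  also have "\<dots> \<le> cS * (cK * (\<kappa> * sqrt sw * norm (Z x)) * sqrt sp)"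
    using cS(1) by (intro mult_left_mono weighted_seq(2)[OF app_bound(2)[OF k]]) auto
  finally show ?thesis by (simp add: C1_def mult_ac)
qed

lemma Phi_diff:
  assumes k: "kernel_le k \<kappa>" and k': "kernel_le k' \<kappa>'"
  shows "Phi k x - Phi k' x = Phi (\<lambda>s n m. k s n m - k' s n m) x"
proof -
  have "app (\<lambda>s n m. k s n m - k' s n m) (V x) n = app k (V x) n - app k' (V x) n" for n
  proof -
    have "app (\<lambda>s n m. k s n m - k' s n m) (V x) n
      = (\<Sum>\<^sub>\<infinity>m. (\<Sum>s\<in>I. k s n m *\<^sub>C \<pi> s (V x m)) + - (\<Sum>s\<in>I. k' s n m *\<^sub>C \<pi> s (V x m)))"
      unfolding app_def by (simp add: cvec.scale_left_diff_distrib sum_subtractf)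
    also have "\<dots> = app k (V x) n + - app k' (V x) n"
      unfolding app_def
      by (subst infsum_add[OF app_bound(1)[OF k] summable_on_uminus[THEN iffD2, OF app_bound(1)[OF k']]])
        (simp add: infsum_uminus)
    finally show ?thesis by simp
  qed
  then have "Abs_ell2 (\<lambda>n. complex_of_real (\<psi> n) *\<^sub>C K (app (\<lambda>s n m. k s n m - k' s n m) (V x) n))
    = Abs_ell2 (\<lambda>n. complex_of_real (\<psi> n) *\<^sub>C K (app k (V x) n)) - Abs_ell2 (\<lambda>n. complex_of_real (\<psi> n) *\<^sub>C K (app k' (V x) n))"
    by (simp add: minus_ell2_def Rep_Abs_ell2[OF weighted_seq(1)[OF app_bound(2)[OF k]]]
        Rep_Abs_ell2[OF weighted_seq(1)[OF app_bound(2)[OF k']]] bounded_clinearD[OF K_lin] cvec.scale_right_diff_distrib)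
  then show ?thesis by (simp add: Phi_def bounded_clinearD[OF S_lin])
qed

lemma Phi_clinear:
  assumes k: "kernel_le k \<kappa>"
  shows "bounded_clinear (Phi k)"
proof -
  obtain c where c: "c > 0" "\<And>x. norm (Z x) \<le> c * norm x" using bounded_clinear_bound[OF Z_lin] by blast
  note sq = weighted_seq(1)[OF app_bound(2)[OF k]]
  show ?thesis
  proof (rule bounded_clinearI[where C = "C1 * \<kappa> * c"])
    fix x y a
    have "app k (V (x + y)) n = app k (V x) n + app k (V y) n" for n
    proof -
      have "app k (V (x + y)) n = (\<Sum>\<^sub>\<infinity>m. (\<Sum>s\<in>I. k s n m *\<^sub>C \<pi> s (V x m)) + (\<Sum>s\<in>I. k s n m *\<^sub>C \<pi> s (V y m)))"
        unfolding app_def by (simp add: V_lin proj_add scaleC_add_right sum.distrib)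
      then show ?thesis unfolding app_def by (simp add: infsum_add[OF app_bound(1)[OF k] app_bound(1)[OF k]])
    qed
    then have "Abs_ell2 (\<lambda>n. complex_of_real (\<psi> n) *\<^sub>C K (app k (V (x + y)) n))
      = Abs_ell2 (\<lambda>n. complex_of_real (\<psi> n) *\<^sub>C K (app k (V x) n)) + Abs_ell2 (\<lambda>n. complex_of_real (\<psi> n) *\<^sub>C K (app k (V y) n))"
      by (simp add: plus_ell2_def Rep_Abs_ell2[OF sq] bounded_clinearD[OF K_lin] scaleC_add_right)
    then show "Phi k (x + y) = Phi k x + Phi k y" by (simp add: Phi_def bounded_clinearD[OF S_lin])
    have "app k (V (a *\<^sub>C x)) n = a *\<^sub>C app k (V x) n" for n
    proof -
      have "app k (V (a *\<^sub>C x)) n = (\<Sum>\<^sub>\<infinity>m. a *\<^sub>C (\<Sum>s\<in>I. k s n m *\<^sub>C \<pi> s (V x m)))"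
        unfolding app_def by (simp add: V_lin proj_scale cvec.scale_sum_right scaleC_scaleC mult.commute)
      also have "\<dots> = a *\<^sub>C app k (V x) n"
        unfolding app_def
        using has_sum_bounded_linear[OF bounded_linear_scaleC_right has_sum_infsum[OF app_bound(1)[OF k]], THEN infsumI] .
      finally show ?thesis .
    qed
    then have "Abs_ell2 (\<lambda>n. complex_of_real (\<psi> n) *\<^sub>C K (app k (V (a *\<^sub>C x)) n))
      = a *\<^sub>C Abs_ell2 (\<lambda>n. complex_of_real (\<psi> n) *\<^sub>C K (app k (V x) n))"
      by (simp add: scaleC_ell2_def Rep_Abs_ell2[OF sq] bounded_clinearD[OF K_lin] scaleC_scaleC mult.commute)
    then show "Phi k (a *\<^sub>C x) = a *\<^sub>C Phi k x" by (simp add: Phi_def bounded_clinearD[OF S_lin])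
    have "norm (Phi k x) \<le> C1 * \<kappa> * norm (Z x)" by (rule Phi_norm[OF k])
    also have "\<dots> \<le> C1 * \<kappa> * (c * norm x)"
      using C1_nonneg kernel_le_nonneg[OF k] by (intro mult_left_mono c) simp
    finally show "norm (Phi k x) \<le> C1 * \<kappa> * c * norm x" by (simp add: mult.assoc)
  qed
qed

lemma Phi_form:
  assumes k: "kernel_le k \<kappa>"
  shows "((\<lambda>n. cinner (V x n) (app k (V x) n)) has_sum cinner x (Phi k x)) UNIV"
proof -
  have "cinner x (Phi k x) = cinner (S x) (Abs_ell2 (\<lambda>n. complex_of_real (\<psi> n) *\<^sub>C K (app k (V x) n)))"
    by (simp add: Phi_def S_sa)
  moreover have "cinner (Rep_ell2 (S x) n) (complex_of_real (\<psi> n) *\<^sub>C K (app k (V x) n)) = cinner (V x n) (app k (V x) n)" for n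
    by (simp add: V_def cinner_scaleC_left cinner_scaleC_right Kc)
  ultimately show ?thesis
    using cinner_ell2_has_sum[of "S x" "Abs_ell2 (\<lambda>n. complex_of_real (\<psi> n) *\<^sub>C K (app k (V x) n))"]
    by (simp add: Rep_Abs_ell2[OF weighted_seq(1)[OF app_bound(2)[OF k]]])
qed

text \<open>For a bounded kernel the double sum is at most C times the square of the l^1 norm of V
  x, and that norm is bounded through Z x.\<close>

lemma Phi_form_bounded:
  assumes k: "kernel_le k \<kappa>" and C: "\<And>n m. (\<Sum>s\<in>I. cmod (k s n m)) \<le> C"
  shows "cmod (cinner x (Phi k x)) \<le> C * sw * (norm (Z x))\<^sup>2"
proof -
  define A where "A = (\<Sum>\<^sub>\<infinity>m. norm (V x m))"
  have "0 \<le> (\<Sum>s\<in>I. cmod (k s 0 0))" by (rule sum_nonneg) simp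
  then have C0: "0 \<le> C" using C[of 0 0] by linarith
  have A: "0 \<le> A" "A \<le> sqrt sw * norm (Z x)" using V_sum(2)[of x] by (auto simp: A_def infsum_nonneg)
  have u: "norm (app k (V x) n) \<le> C * A" for n
  proof -
    have "norm (app k (V x) n) \<le> (\<Sum>\<^sub>\<infinity>m. C * norm (V x m))"
      unfolding app_def
    proof (rule norm_infsum_le_infsum(2))
      show "(\<lambda>m. C * norm (V x m)) summable_on UNIV" by (rule summable_on_cmult_right[OF V_sum(1)])
      show "norm (\<Sum>s\<in>I. k s n m *\<^sub>C \<pi> s (V x m)) \<le> C * norm (V x m)" for m
        by (rule order_trans[OF term_norm mult_right_mono[OF C norm_ge_zero]])
    qed
    then show ?thesis by (simp add: infsum_cmult_right' A_def)
  qed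
  have "cmod (cinner x (Phi k x)) \<le> (\<Sum>\<^sub>\<infinity>n. C * A * norm (V x n))"
  proof (rule norm_infsum_le[OF Phi_form[OF k] has_sum_infsum])
    show "(\<lambda>n. C * A * norm (V x n)) summable_on UNIV" by (rule summable_on_cmult_right[OF V_sum(1)])
    show "cmod (cinner (V x n) (app k (V x) n)) \<le> C * A * norm (V x n)" for n
    proof -
      have "cmod (cinner (V x n) (app k (V x) n)) \<le> norm (V x n) * norm (app k (V x) n)" by (rule cinner_norm_bound)
      also have "\<dots> \<le> norm (V x n) * (C * A)" by (intro mult_left_mono u) simp
      finally show ?thesis by (simp add: mult_ac)
    qed
  qed
  also have "\<dots> = C * A\<^sup>2" by (simp add: infsum_cmult_right' A_def power2_eq_square)
  also have "\<dots> \<le> C * (sqrt sw * norm (Z x))\<^sup>2" by (intro mult_left_mono power_mono A C0)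
  finally show ?thesis using sw_nonneg by (simp add: power_mult_distrib mult.assoc)
qed

text \<open>A growth like \<open>jap n + jap m\<close> puts the weight on one variable at a time.
  The weighted sum is bounded by |x| through \<open>V_sum_full\<close>, the other by |Z x| through
  \<open>V_sum\<close>.\<close>

lemma Phi_form_linear:
  assumes k: "kernel_le k \<kappa>" and C: "\<And>n m. (\<Sum>s\<in>I. cmod (k s n m)) \<le> C * (jap n + jap m)"
  shows "cmod (cinner x (Phi k x)) \<le> 2 * C * (sqrt sp * cK * cS) * sqrt sw * norm x * norm (Z x)"
proof -
  define A where "A = (\<Sum>\<^sub>\<infinity>m. norm (V x m))"
  define B where "B = (\<Sum>\<^sub>\<infinity>m. jap m * norm (V x m))"
  have "0 \<le> (\<Sum>s\<in>I. cmod (k s 0 0))" by (rule sum_nonneg) simp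
  then have C0: "0 \<le> C" using C[of 0 0] by (simp add: jap_def)
  have A: "0 \<le> A" "A \<le> sqrt sw * norm (Z x)" using V_sum(2)[of x] by (auto simp: A_def infsum_nonneg)
  have B: "0 \<le> B" "B \<le> sqrt sp * cK * cS * norm x"
    using V_sum_full(2)[of x] jap_pos less_imp_le by (auto simp: B_def intro!: infsum_nonneg mult_nonneg_nonneg)
  have hA: "((\<lambda>n. norm (V x n)) has_sum A) UNIV" using V_sum(1) by (simp add: A_def)
  have hB: "((\<lambda>n. jap n * norm (V x n)) has_sum B) UNIV" using V_sum_full(1) by (simp add: B_def)
  have u: "norm (app k (V x) n) \<le> C * (jap n * A + B)" for n
  proof -
    have hs: "((\<lambda>m. C * (jap n * norm (V x m) + jap m * norm (V x m))) has_sum C * (jap n * A + B)) UNIV"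
      by (intro has_sum_cmult_right has_sum_add hA hB)
    have "norm (app k (V x) n) \<le> (\<Sum>\<^sub>\<infinity>m. C * (jap n * norm (V x m) + jap m * norm (V x m)))"
      unfolding app_def
    proof (rule norm_infsum_le_infsum(2)[OF has_sum_imp_summable[OF hs]])
      show "norm (\<Sum>s\<in>I. k s n m *\<^sub>C \<pi> s (V x m)) \<le> C * (jap n * norm (V x m) + jap m * norm (V x m))" for m
        using term_norm[of k n m "V x m"] mult_right_mono[OF C[of n m] norm_ge_zero[of "V x m"]]
        by (simp add: algebra_simps)
    qed
    then show ?thesis by (simp add: infsumI[OF hs])
  qed
  have hs: "((\<lambda>n. C * (A * (jap n * norm (V x n)) + B * norm (V x n))) has_sum C * (A * B + B * A)) UNIV"
    by (intro has_sum_cmult_right has_sum_add hA hB)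
  have "cmod (cinner x (Phi k x)) \<le> C * (A * B + B * A)"
  proof (rule norm_infsum_le[OF Phi_form[OF k] hs])
    show "cmod (cinner (V x n) (app k (V x) n)) \<le> C * (A * (jap n * norm (V x n)) + B * norm (V x n))" for n
    proof -
      have "cmod (cinner (V x n) (app k (V x) n)) \<le> norm (V x n) * norm (app k (V x) n)" by (rule cinner_norm_bound)
      also have "\<dots> \<le> norm (V x n) * (C * (jap n * A + B))" by (intro mult_left_mono u) simp
      finally show ?thesis by (simp add: algebra_simps)
    qed
  qed
  also have "\<dots> = 2 * C * (B * A)" by simp
  also have "\<dots> \<le> 2 * C * ((sqrt sp * cK * cS * norm x) * (sqrt sw * norm (Z x)))"
    using A B C0 sp_nonneg cK(1) cS(1) by (intro mult_left_mono mult_mono) auto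
  finally show ?thesis by (simp add: mult_ac)
qed

end

section \<open>Effective operators\<close>

context lattice_model
begin

text \<open>The sign sequence is 1 at the lower threshold and \<open>alt\<close> at the upper one,
  so both can be treated together.\<close>

definition Jop :: "(int \<Rightarrow> real) \<Rightarrow> 'g ell2 \<Rightarrow> 'g ell2"
  where "Jop \<sigma> = ell2_map (\<lambda>n y. complex_of_real (\<sigma> n) *\<^sub>C y)"

definition bra :: "'g ell2 \<Rightarrow> 'g"
  where "bra f = (\<Sum>\<^sub>\<infinity>n. complex_of_real (\<psi> n) *\<^sub>C Rep_ell2 f n)"

definition P :: "nat \<Rightarrow> 'g ell2 \<Rightarrow> 'g"
  where "P s f = \<pi> s (bra f)"

text \<open>Y = S (I \<otimes> K) J P^* with P the map \<open>P s\<close> and J multiplication by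
  \<sigma>. Then Y^* Y is the effective operator on the fibre, while Y Y^* is the singular part on
  the lattice.\<close>

definition Y :: "nat \<Rightarrow> (int \<Rightarrow> real) \<Rightarrow> 'g \<Rightarrow> 'g ell2"
  where "Y s \<sigma> g = S (ell2_map (\<lambda>_. K) (Jop \<sigma> (cadjoint (P s) g)))"

lemma Jop_family:
  assumes "\<And>n. \<bar>\<sigma> n\<bar> = 1"
  shows "bounded_family (\<lambda>n (y::'g). complex_of_real (\<sigma> n) *\<^sub>C y) 1"
  using bounded_family_scale[OF bounded_clinear_id, of "\<lambda>n. complex_of_real (\<sigma> n)" 1 1] assms by simp

lemma Jop_sa:
  assumes "\<And>n. \<bar>\<sigma> n\<bar> = 1"
  shows "cinner (Jop \<sigma> f) g = cinner f (Jop \<sigma> g)"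
proof -
  interpret bounded_family "\<lambda>n (y::'g). complex_of_real (\<sigma> n) *\<^sub>C y" 1 by (rule Jop_family[OF assms])
  show ?thesis
    using cinner_ell2_has_sum[of "Jop \<sigma> f" g] cinner_ell2_has_sum[of f "Jop \<sigma> g"]
    by (simp add: Jop_def rep cinner_scaleC_left cinner_scaleC_right has_sum_unique)
qed

lemma psi_square: "(\<lambda>n. (\<psi> n)\<^sup>2) summable_on UNIV"
proof (rule summable_on_comparison_test[OF psi2_summable])
  show "(\<psi> n)\<^sup>2 \<le> (\<psi> n * jap n)\<^sup>2" for n
    using psi_pos[of n] jap_ge1[of n] by (intro power_mono) (auto simp: mult_le_cancel_left1)
qed simp

lemma bra_has_sum:
  "((\<lambda>n. complex_of_real (\<psi> n) *\<^sub>C Rep_ell2 f n) has_sum bra f) UNIV"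
  "norm (bra f) \<le> sqrt (\<Sum>\<^sub>\<infinity>n. (\<psi> n)\<^sup>2) * norm f"
proof -
  have a: "((\<lambda>n. (\<psi> n)\<^sup>2) has_sum (\<Sum>\<^sub>\<infinity>n. (\<psi> n)\<^sup>2)) UNIV" using psi_square by simp
  note cs = infsum_cauchy_schwarz[OF a ell2_has_sum_norm[of f] less_imp_le[OF psi_pos] norm_ge_zero]
  have le: "norm (complex_of_real (\<psi> n) *\<^sub>C Rep_ell2 f n) \<le> \<psi> n * norm (Rep_ell2 f n)" for n
    using psi_pos[of n] by (simp add: norm_scaleC)
  show "((\<lambda>n. complex_of_real (\<psi> n) *\<^sub>C Rep_ell2 f n) has_sum bra f) UNIV"
    unfolding bra_def by (rule has_sum_infsum[OF norm_infsum_le_infsum(1)[OF cs(1) le]])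
  show "norm (bra f) \<le> sqrt (\<Sum>\<^sub>\<infinity>n. (\<psi> n)\<^sup>2) * norm f"
    unfolding bra_def using norm_infsum_le_infsum(2)[OF cs(1) le] cs(2) by simp
qed

lemma bra_clinear: "bounded_clinear bra"
proof (rule bounded_clinearI[OF _ _ bra_has_sum(2)])
  fix f g a
  have "((\<lambda>n. complex_of_real (\<psi> n) *\<^sub>C Rep_ell2 (f + g) n) has_sum bra f + bra g) UNIV"
    using has_sum_add[OF bra_has_sum(1)[of f] bra_has_sum(1)[of g]] by (simp add: ell2_rep scaleC_add_right)
  then show "bra (f + g) = bra f + bra g" using bra_has_sum(1) has_sum_unique by blast
  have "((\<lambda>n. complex_of_real (\<psi> n) *\<^sub>C Rep_ell2 (a *\<^sub>C f) n) has_sum a *\<^sub>C bra f) UNIV"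
    using has_sum_bounded_linear[OF bounded_linear_scaleC_right bra_has_sum(1)[of f], of a]
    by (simp add: ell2_rep scaleC_scaleC mult.commute)
  then show "bra (a *\<^sub>C f) = a *\<^sub>C bra f" using bra_has_sum(1) has_sum_unique by blast
qed

lemma P_clinear: "s \<in> I \<Longrightarrow> bounded_clinear (P s)"
  using bounded_clinear_compose[OF proj_clinear bra_clinear] by (simp add: P_def[abs_def] comp_def)

lemma P_op_eq:
  assumes s: "s \<in> I"
  shows "P_op \<nu> Q \<mu> s = P s"
  unfolding P_op_def
proof (rule bra_tensor_op_eqI[OF P_clinear[OF s]])
  fix \<phi> :: "complex ell2" and g :: 'g
  have rep: "Rep_ell2 (psi_vec \<nu>) = (\<lambda>n. complex_of_real (\<psi> n))"
    unfolding psi_vec_def by (rule Rep_Abs_ell2) (use psi_square in \<open>simp add: sq_summable_def\<close>)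
  have "((\<lambda>n. complex_of_real (\<psi> n) * Rep_ell2 \<phi> n) has_sum cinner (psi_vec \<nu>) \<phi>) UNIV"
    using cinner_ell2_has_sum[of "psi_vec \<nu>" \<phi>] by (simp add: rep cinner_complex_def)
  then have "((\<lambda>n. complex_of_real (\<psi> n) *\<^sub>C Rep_ell2 (tensor_vec \<phi> g) n) has_sum cinner (psi_vec \<nu>) \<phi> *\<^sub>C g) UNIV"
    using has_sum_bounded_linear[OF bounded_linear_scaleC_left] by (simp add: ell2_rep scaleC_scaleC)
  then have "bra (tensor_vec \<phi> g) = cinner (psi_vec \<nu>) \<phi> *\<^sub>C g" using bra_has_sum(1) has_sum_unique by blast
  then show "P s (tensor_vec \<phi> g) = cinner (psi_vec \<nu>) \<phi> *\<^sub>C \<pi> s g" by (simp add: P_def proj_scale[OF s])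
qed

lemma Kmap_adjoint: "cinner (ell2_map (\<lambda>_. Kc) a) b = cinner a (ell2_map (\<lambda>_. K) b)"
  using cadjoint_works[OF Kf.clin] ell2_map_adjoint(2)[OF Kf.bounded_family_axioms] by (simp add: Kc_def)

lemma Y_clinear:
  assumes s: "s \<in> I" and \<sigma>: "\<And>n. \<bar>\<sigma> n\<bar> = 1"
  shows "bounded_clinear (Y s \<sigma>)"
proof -
  interpret bounded_family "\<lambda>n (y::'g). complex_of_real (\<sigma> n) *\<^sub>C y" 1 by (rule Jop_family[OF \<sigma>])
  have "Y s \<sigma> = S \<circ> (ell2_map (\<lambda>_. K) \<circ> (Jop \<sigma> \<circ> cadjoint (P s)))" by (rule ext) (simp add: Y_def)
  then show ?thesis
    using clin unfolding Jop_def[symmetric]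
    by (simp add: bounded_clinear_compose S_lin Kf.clin bounded_clinear_cadjoint[OF P_clinear[OF s]])
qed

lemma Y_adjoint:
  assumes s: "s \<in> I" and \<sigma>: "\<And>n. \<bar>\<sigma> n\<bar> = 1"
  shows "cadjoint (Y s \<sigma>) = (\<lambda>x. P s (Jop \<sigma> (ell2_map (\<lambda>_. Kc) (S x))))"
  by (rule cadjoint_eqI)
    (simp add: Y_def cadjoint_works'[OF P_clinear[OF s], symmetric] Jop_sa[OF \<sigma>] Kmap_adjoint S_sa)

text \<open>Since \<open>P s\<close> sums over the lattice, Y^* x is the projected signed sum of the
  coordinates of M^* x, the shape in which a rank one kernel produces it. The summand 1 makes the
  constant positive, as \<open>form_compact_gram_dual\<close> asks.\<close>

lemma Y_adjoint_sum:
  assumes s: "s \<in> I" and \<sigma>: "\<And>n. \<bar>\<sigma> n\<bar> = 1"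
  shows "(\<lambda>n. complex_of_real (\<sigma> n) *\<^sub>C V x n) summable_on UNIV"
    "cadjoint (Y s \<sigma>) x = \<pi> s (\<Sum>\<^sub>\<infinity>n. complex_of_real (\<sigma> n) *\<^sub>C V x n)"
    "norm (cadjoint (Y s \<sigma>) x) \<le> (sqrt sw + 1) * norm (Z x)"
proof -
  interpret bounded_family "\<lambda>n (y::'g). complex_of_real (\<sigma> n) *\<^sub>C y" 1 by (rule Jop_family[OF \<sigma>])
  have le: "norm (complex_of_real (\<sigma> n) *\<^sub>C V x n) \<le> norm (V x n)" for n by (simp add: norm_scaleC \<sigma>)
  show "(\<lambda>n. complex_of_real (\<sigma> n) *\<^sub>C V x n) summable_on UNIV"
    by (rule norm_infsum_le_infsum(1)[OF V_sum(1) le])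
  have "bra (Jop \<sigma> (ell2_map (\<lambda>_. Kc) (S x))) = (\<Sum>\<^sub>\<infinity>n. complex_of_real (\<sigma> n) *\<^sub>C V x n)"
    unfolding bra_def Jop_def rep Kcf.rep V_def by (simp add: scaleC_scaleC mult.commute)
  then show eq: "cadjoint (Y s \<sigma>) x = \<pi> s (\<Sum>\<^sub>\<infinity>n. complex_of_real (\<sigma> n) *\<^sub>C V x n)"
    unfolding Y_adjoint[OF s \<sigma>] P_def by simp
  have "norm (cadjoint (Y s \<sigma>) x) \<le> norm (\<Sum>\<^sub>\<infinity>n. complex_of_real (\<sigma> n) *\<^sub>C V x n)"
    unfolding eq by (rule proj_norm[OF s])
  also have "\<dots> \<le> (\<Sum>\<^sub>\<infinity>n. norm (V x n))" by (rule norm_infsum_le_infsum(2)[OF V_sum(1) le])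
  also have "\<dots> \<le> sqrt sw * norm (Z x)" by (rule V_sum(2))
  finally show "norm (cadjoint (Y s \<sigma>) x) \<le> (sqrt sw + 1) * norm (Z x)" by (simp add: distrib_right add_increasing2)
qed

lemma bold_V_eq:
  "bold_V K (\<lambda>x. complex_of_real c *\<^sub>C W x) f
    = complex_of_real c *\<^sub>C ell2_map (\<lambda>_. Kc) (S (S (ell2_map (\<lambda>_. K) f)))"
proof -
  have "bold_V K (\<lambda>x. complex_of_real c *\<^sub>C W x) f
    = ell2_map (\<lambda>_. Kc) (complex_of_real c *\<^sub>C W (ell2_map (\<lambda>_. K) f))"
    unfolding bold_V_def Kc_def[symmetric] tensor_op_id[OF K_lin] tensor_op_id[OF Kc_lin] comp_def ..
  also have "\<dots> = complex_of_real c *\<^sub>C ell2_map (\<lambda>_. Kc) (W (ell2_map (\<lambda>_. K) f))"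
    by (rule bounded_clinearD(2)[OF Kcf.clin])
  finally show ?thesis by (simp only: SS)
qed

text \<open>The factor c is carried along because \<open>sim_functional\<close> rescales W.\<close>

lemma effective_lower:
  assumes s: "s \<in> I"
  shows "effective_op \<nu> Q \<mu> s (bold_V K (\<lambda>x. complex_of_real c *\<^sub>C W x))
    = (\<lambda>g. complex_of_real c *\<^sub>C cadjoint (Y s (\<lambda>_. 1)) (Y s (\<lambda>_. 1) g))"
proof
  fix g
  have J: "Jop (\<lambda>_. 1) f = f" for f
  proof -
    interpret bounded_family "\<lambda>n (y::'g). complex_of_real 1 *\<^sub>C y" 1 by (rule Jop_family) simp
    show ?thesis by (rule ell2_eqI) (use rep in \<open>simp add: Jop_def\<close>)
  qed
  have A: "cadjoint (Y s (\<lambda>_. 1)) = (\<lambda>x. P s (Jop (\<lambda>_. 1) (ell2_map (\<lambda>_. Kc) (S x))))"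
    by (rule Y_adjoint[OF s]) simp
  show "effective_op \<nu> Q \<mu> s (bold_V K (\<lambda>x. complex_of_real c *\<^sub>C W x)) g
    = complex_of_real c *\<^sub>C cadjoint (Y s (\<lambda>_. 1)) (Y s (\<lambda>_. 1) g)"
    unfolding effective_op_def comp_def P_op_eq[OF s] bold_V_eq A
    by (simp add: J Y_def bounded_clinearD(2)[OF P_clinear[OF s]])
qed

definition alt :: "int \<Rightarrow> real" where "alt n = (- 1) powi n"

lemma alt_abs: "\<bar>alt n\<bar> = 1" by (simp add: alt_def)

lemma parity_eq: "tensor_op parity_op (id :: 'g \<Rightarrow> 'g) = Jop alt"
  using tensor_op_diagonal[of parity_op "\<lambda>n. complex_of_real (alt n)" 1 "id :: 'g \<Rightarrow> 'g"]
  by (simp add: parity_op.rep_eq alt_def Jop_def id_def bounded_clinear_id norm_power_int del: of_real_power_int)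
    (simp add: of_real_power_int)

lemma effective_upper:
  assumes s: "s \<in> I"
  shows "effective_op \<nu> Q \<mu> s (bold_VJ K (\<lambda>x. complex_of_real c *\<^sub>C W x))
    = (\<lambda>g. complex_of_real c *\<^sub>C cadjoint (Y s alt) (Y s alt g))"
proof
  fix g
  interpret J: bounded_family "\<lambda>n (y::'g). complex_of_real (alt n) *\<^sub>C y" 1 by (rule Jop_family[OF alt_abs])
  have lin: "bounded_clinear (Jop alt)" using J.clin by (simp add: Jop_def)
  have adj: "cadjoint (Jop alt) = Jop alt" by (rule cadjoint_eqI) (rule Jop_sa[OF alt_abs])
  show "effective_op \<nu> Q \<mu> s (bold_VJ K (\<lambda>x. complex_of_real c *\<^sub>C W x)) g
    = complex_of_real c *\<^sub>C cadjoint (Y s alt) (Y s alt g)"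
    unfolding effective_op_def bold_VJ_def parity_eq adj comp_def P_op_eq[OF s] bold_V_eq Y_adjoint[OF s alt_abs]
    by (simp add: Y_def bounded_clinearD(2)[OF P_clinear[OF s]] bounded_clinearD(2)[OF lin])
qed

section \<open>Quadratic forms of singular and of symmetric kernels\<close>

definition one_channel :: "nat \<Rightarrow> (int \<Rightarrow> int \<Rightarrow> complex) \<Rightarrow> nat \<Rightarrow> int \<Rightarrow> int \<Rightarrow> complex"
  where "one_channel s r s' n m = (if s' = s then r n m else 0)"

lemma one_channel_sum:
  assumes "s \<in> I"
  shows "(\<Sum>s'\<in>I. cmod (one_channel s r s' n m)) = cmod (r n m)"
    "(\<Sum>s'\<in>I. one_channel s r s' n m *\<^sub>C \<pi> s' g) = r n m *\<^sub>C \<pi> s g"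
proof -
  have "(\<Sum>s'\<in>I. cmod (one_channel s r s' n m)) = (\<Sum>s'\<in>I. if s' = s then cmod (r n m) else 0)"
    by (rule sum.cong) (auto simp: one_channel_def)
  then show "(\<Sum>s'\<in>I. cmod (one_channel s r s' n m)) = cmod (r n m)" using assms fin_I by simp
  have "(\<Sum>s'\<in>I. one_channel s r s' n m *\<^sub>C \<pi> s' g) = (\<Sum>s'\<in>I. if s' = s then r n m *\<^sub>C \<pi> s g else 0)"
    by (rule sum.cong) (auto simp: one_channel_def)
  then show "(\<Sum>s'\<in>I. one_channel s r s' n m *\<^sub>C \<pi> s' g) = r n m *\<^sub>C \<pi> s g" using assms fin_I by simp
qed

lemma kernel_leI:
  assumes "\<And>n m. (\<Sum>s\<in>I. cmod (k s n m)) \<le> \<kappa>" "0 \<le> \<kappa>"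
  shows "kernel_le k \<kappa>"
  unfolding kernel_le_def
proof (intro allI)
  fix n m
  have "1 * 1 \<le> sqrt (jap n) * sqrt (jap m)" using jap_ge1 jap_pos[of n] by (intro mult_mono) auto
  then have "\<kappa> * 1 \<le> \<kappa> * (sqrt (jap n) * sqrt (jap m))" using assms(2) by (intro mult_left_mono) auto
  then show "(\<Sum>s\<in>I. cmod (k s n m)) \<le> \<kappa> * (sqrt (jap n) * sqrt (jap m))" using assms(1)[of n m] by linarith
qed

text \<open>The kernel is a function of n times a function of m, so the double sum collapses to c
  times the squared norm of a single projected sum.\<close>

lemma singular_form:
  fixes c :: real
  assumes s: "s \<in> I" and \<sigma>: "\<And>n. \<bar>\<sigma> n\<bar> = 1"
  defines "k \<equiv> one_channel s (\<lambda>n m. complex_of_real (c * \<sigma> n * \<sigma> m))"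
  shows "kernel_le k \<bar>c\<bar>" "cinner x (Phi k x) = complex_of_real (c * (norm (cadjoint (Y s \<sigma>) x))\<^sup>2)"
proof -
  show k: "kernel_le k \<bar>c\<bar>"
  proof (rule kernel_leI)
    show "(\<Sum>s'\<in>I. cmod (k s' n m)) \<le> \<bar>c\<bar>" for n m
      unfolding k_def one_channel_sum(1)[OF s] by (simp add: \<sigma> abs_mult del: of_real_mult)
  qed simp
  define b where "b = (\<Sum>\<^sub>\<infinity>n. complex_of_real (\<sigma> n) *\<^sub>C V x n)"
  have hb: "((\<lambda>n. complex_of_real (\<sigma> n) *\<^sub>C V x n) has_sum b) UNIV"
    unfolding b_def by (rule has_sum_infsum[OF Y_adjoint_sum(1)[OF s \<sigma>]])
  have app: "app k (V x) n = complex_of_real (c * \<sigma> n) *\<^sub>C \<pi> s b" for n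
  proof -
    have "bounded_linear (\<pi> s)" using proj_clinear[OF s] by (simp add: bounded_clinear_def)
    from has_sum_bounded_linear[OF bounded_linear_scaleC_right has_sum_bounded_linear[OF this hb], of "complex_of_real (c * \<sigma> n)"]
    have "((\<lambda>m. \<Sum>s'\<in>I. k s' n m *\<^sub>C \<pi> s' (V x m)) has_sum complex_of_real (c * \<sigma> n) *\<^sub>C \<pi> s b) UNIV"
      unfolding k_def one_channel_sum(2)[OF s] by (simp add: proj_scale[OF s] scaleC_scaleC)
    then show ?thesis unfolding app_def by (rule infsumI)
  qed
  have "((\<lambda>n. cinner (\<pi> s b) (complex_of_real (\<sigma> n) *\<^sub>C V x n)) has_sum cinner (\<pi> s b) b) UNIV"
    by (rule has_sum_cinner_right[OF hb])
  then have "((\<lambda>n. cnj (cinner (\<pi> s b) (complex_of_real (\<sigma> n) *\<^sub>C V x n))) has_sum cnj (cinner (\<pi> s b) b)) UNIV"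
    by simp
  from has_sum_cmult_right[OF this, of "complex_of_real c"]
  have "((\<lambda>n. cinner (V x n) (app k (V x) n)) has_sum complex_of_real c * cnj (cinner (\<pi> s b) b)) UNIV"
    by (rule has_sum_cong[THEN iffD1, rotated])
      (simp add: app cinner_scaleC_right cinner_commute[of "V x _" "\<pi> s b"])
  then have "cinner x (Phi k x) = complex_of_real c * cnj (cinner (\<pi> s b) b)"
    using Phi_form[OF k, of x] has_sum_unique by blast
  also have "\<dots> = complex_of_real (c * (norm (\<pi> s b))\<^sup>2)" by (simp add: proj_sa[OF s] cinner_self)
  also have "\<pi> s b = cadjoint (Y s \<sigma>) x" unfolding b_def by (rule Y_adjoint_sum(2)[OF s \<sigma>, symmetric])
  finally show "cinner x (Phi k x) = complex_of_real (c * (norm (cadjoint (Y s \<sigma>) x))\<^sup>2)" .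
qed

text \<open>The kernel is real symmetric and \<open>\<pi> s\<close> self-adjoint, so conjugation
  exchanges the summation variables. The sums may be exchanged because the bound C and the l^1
  property of V x give absolute summability.\<close>

lemma symmetric_form:
  fixes r :: "int \<Rightarrow> int \<Rightarrow> real"
  assumes s: "s \<in> I" and r: "\<And>n m. r n m = r m n" "\<And>n m. \<bar>r n m\<bar> \<le> C"
  defines "k \<equiv> one_channel s (\<lambda>n m. complex_of_real (r n m))"
  shows "kernel_le k C" "Im (cinner x (Phi k x)) = 0"
proof -
  have C0: "0 \<le> C" using r(2)[of 0 0] by linarith
  show k: "kernel_le k C"
    by (rule kernel_leI) (use r(2) C0 in \<open>simp_all add: k_def one_channel_sum(1)[OF s]\<close>)
  define f where "f n m = complex_of_real (r n m) * cinner (V x n) (\<pi> s (V x m))" for n m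
  have t: "((\<lambda>m. \<Sum>s'\<in>I. k s' n m *\<^sub>C \<pi> s' (V x m)) has_sum app k (V x) n) UNIV" for n
    unfolding app_def by (rule has_sum_infsum[OF app_bound(1)[OF k]])
  have "((\<lambda>m. f n m) has_sum cinner (V x n) (app k (V x) n)) UNIV" for n
    using has_sum_cinner_right[OF t, of "V x n" n]
    unfolding k_def one_channel_sum(2)[OF s] f_def by (simp add: cinner_scaleC_right)
  then have inner: "(\<Sum>\<^sub>\<infinity>m. f n m) = cinner (V x n) (app k (V x) n)" for n by (rule infsumI)
  then have tot: "(\<Sum>\<^sub>\<infinity>n. \<Sum>\<^sub>\<infinity>m. f n m) = cinner x (Phi k x)" using infsumI[OF Phi_form[OF k, of x]] by simp
  have cnj_f: "cnj (f n m) = f m n" for n m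
    using cinner_commute[of "\<pi> s (V x m)" "V x n"] by (simp add: f_def proj_sa'[OF s, symmetric] r(1)[of n m])
  have "(\<lambda>z. norm (case z of (n, m) \<Rightarrow> f n m)) summable_on (UNIV \<times> UNIV)"
  proof (rule summable_on_comparison_test)
    have "(\<lambda>z. norm (case z of (n, m) \<Rightarrow> C * (norm (V x n) * norm (V x m)))) summable_on (UNIV \<times> UNIV)"
      unfolding Infinite_Sum.abs_summable_on_Sigma_iff
      using C0 V_sum(1)[of x]
      by (auto simp: infsum_cmult_right' abs_mult intro!: summable_on_cmult_right summable_on_cmult_left)
    then show "(\<lambda>(n, m). C * (norm (V x n) * norm (V x m))) summable_on (UNIV \<times> UNIV)"
      by (rule Infinite_Sum.abs_summable_summable)
    show "norm (case z of (n, m) \<Rightarrow> f n m) \<le> (case z of (n, m) \<Rightarrow> C * (norm (V x n) * norm (V x m)))" for z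
    proof (cases z)
      case (Pair n m)
      have "cmod (cinner (V x n) (\<pi> s (V x m))) \<le> norm (V x n) * norm (\<pi> s (V x m))" by (rule cinner_norm_bound)
      also have "\<dots> \<le> norm (V x n) * norm (V x m)" by (intro mult_left_mono proj_norm s) simp
      finally have "\<bar>r n m\<bar> * cmod (cinner (V x n) (\<pi> s (V x m))) \<le> C * (norm (V x n) * norm (V x m))"
        using r(2) C0 by (intro mult_mono) auto
      then show ?thesis by (simp add: Pair f_def norm_mult)
    qed
  qed auto
  then have "(\<lambda>(n, m). f n m) summable_on (UNIV \<times> UNIV)" by (rule Infinite_Sum.abs_summable_summable)
  then have "(\<Sum>\<^sub>\<infinity>n. \<Sum>\<^sub>\<infinity>m. f n m) = (\<Sum>\<^sub>\<infinity>m. \<Sum>\<^sub>\<infinity>n. f n m)" by (rule infsum_swap_banach)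
  also have "\<dots> = (\<Sum>\<^sub>\<infinity>m. \<Sum>\<^sub>\<infinity>n. cnj (f m n))" by (simp only: cnj_f)
  also have "\<dots> = cnj (\<Sum>\<^sub>\<infinity>m. \<Sum>\<^sub>\<infinity>n. f m n)" by simp
  finally have "cinner x (Phi k x) = cnj (cinner x (Phi k x))" by (simp only: tot)
  from arg_cong[OF this, of Im] show "Im (cinner x (Phi k x)) = 0" by simp
qed

end

section \<open>Roots of the characteristic equation\<close>

text \<open>The two roots have product 1. Were both on the unit circle, they would be conjugate and
  their sum w real.\<close>

lemma disc_root_exists:
  assumes "Im w \<noteq> 0"
  shows "\<exists>\<zeta>. \<zeta> \<noteq> 0 \<and> cmod \<zeta> < 1 \<and> \<zeta> + 1 / \<zeta> = w"
proof -
  define r1 where "r1 = (w + csqrt (w\<^sup>2 - 4)) / 2"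
  define r2 where "r2 = (w - csqrt (w\<^sup>2 - 4)) / 2"
  have sum: "r1 + r2 = w" by (simp add: r1_def r2_def field_simps)
  have "r1 * r2 = (w\<^sup>2 - (csqrt (w\<^sup>2 - 4))\<^sup>2) / 4" by (simp add: r1_def r2_def power2_eq_square field_simps)
  then have prod: "r1 * r2 = 1" by simp
  then have nz: "r1 \<noteq> 0" "r2 \<noteq> 0" by auto
  then have inv: "1 / r1 = r2" "1 / r2 = r1" using prod by (simp_all add: field_simps)
  have nprod: "cmod r1 * cmod r2 = 1" using prod by (metis norm_mult norm_one)
  consider "cmod r1 < 1" | "cmod r1 = 1" | "cmod r1 > 1" by linarith
  then show ?thesis
  proof cases
    case 1
    then show ?thesis using nz inv sum by (intro exI[of _ r1]) auto
  next
    case 2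
    then have "r1 * cnj r1 = 1" by (simp add: complex_norm_square[symmetric])
    then have "cnj r1 = r2" using prod nz by (metis mult_left_cancel)
    then have "w = r1 + cnj r1" using sum by simp
    then show ?thesis using assms by (simp add: complex_add_cnj)
  next
    case 3
    then have "cmod r2 < 1" using nprod by (metis less_1_mult linorder_not_less mult.right_neutral
          nle_le norm_ge_zero order_less_le mult_less_cancel_left_disj mult_le_cancel_left1 zero_less_one less_trans)
    then show ?thesis using nz inv sum by (intro exI[of _ r2]) (auto simp: add.commute)
  qed
qed

text \<open>Im (\<zeta> + 1/\<zeta>) = Im \<zeta> (1 - 1/|\<zeta>|^2), and the last factor is
  negative in the disc. Approaching the real axis from Im z > 0 means Im w < 0, hence roots in the
  upper half disc.\<close>

lemma disc_root_Im:
  assumes z: "\<zeta> \<noteq> 0" "cmod \<zeta> < 1" "\<zeta> + 1 / \<zeta> = w" and w: "Im w < 0"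
  shows "0 < Im \<zeta>"
proof -
  have p: "0 < (cmod \<zeta>)\<^sup>2" "(cmod \<zeta>)\<^sup>2 < 1" using z by (auto simp: power_less_one_iff abs_square_less_1)
  have "1 / \<zeta> = cnj \<zeta> / of_real ((cmod \<zeta>)\<^sup>2)"
    using z(1) by (simp add: complex_norm_square field_simps del: of_real_power)
  then have "Im w = Im \<zeta> - Im \<zeta> / (cmod \<zeta>)\<^sup>2"
    unfolding z(3)[symmetric] by (simp del: of_real_power)
  also have "\<dots> = - Im \<zeta> * (1 / (cmod \<zeta>)\<^sup>2 - 1)" using p by (simp add: field_simps)
  finally have "Im \<zeta> * (1 / (cmod \<zeta>)\<^sup>2 - 1) > 0" using w by simp
  moreover have "1 / (cmod \<zeta>)\<^sup>2 - 1 > 0" using p by simp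
  ultimately show ?thesis by (simp add: zero_less_mult_iff)
qed

text \<open>The limit of the root of \<open>\<zeta> + 1 / \<zeta> = w\<close> inside the unit disc as \<open>w\<close> tends to the real
  number \<open>w0\<close> from the lower half plane, which selects one of the two unimodular roots if \<open>\<bar>w0\<bar> < 2\<close>.\<close>

definition lim_root :: "real \<Rightarrow> complex"
  where "lim_root w0 =
    (if 2 < w0 then of_real ((w0 - sqrt (w0\<^sup>2 - 4)) / 2)
     else if w0 < -2 then of_real ((w0 + sqrt (w0\<^sup>2 - 4)) / 2)
     else Complex (w0 / 2) (sqrt (4 - w0\<^sup>2) / 2))"

lemma lim_root_outer:
  assumes "2 < \<bar>w0\<bar>"
  obtains a where "lim_root w0 = of_real (sgn w0 * a)" "0 < a" "a < 1" "a + 1 / a = \<bar>w0\<bar>"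
proof -
  define u where "u = \<bar>w0\<bar>"
  define r where "r = sqrt (u\<^sup>2 - 4)"
  define a where "a = (u - r) / 2"
  have u: "2 < u" using assms by (simp add: u_def)
  have "2\<^sup>2 < u\<^sup>2" using u by (intro power_strict_mono) auto
  then have r2: "r\<^sup>2 = u\<^sup>2 - 4" and r0: "0 < r" by (simp_all add: r_def)
  have "r < u" using r2 u by (intro power_less_imp_less_base[of r 2 u]) auto
  have "u - 2 < r"
  proof (rule power_less_imp_less_base[of _ 2])
    show "(u - 2)\<^sup>2 < r\<^sup>2" unfolding r2 using u by (simp add: power2_eq_square algebra_simps)
  qed (use r0 in simp)
  then have a: "0 < a" "a < 1" using \<open>r < u\<close> by (simp_all add: a_def)
  have "a * (u - a) = 1" using r2 by (simp add: a_def power2_eq_square field_simps)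
  then have "1 / a = u - a" using a(1) by (simp add: field_simps)
  then have "a + 1 / a = u" by simp
  moreover have "lim_root w0 = of_real (sgn w0 * a)"
    using assms by (cases "w0 > 0") (auto simp: lim_root_def a_def r_def u_def field_simps)
  ultimately show ?thesis using that[OF _ a] by (simp only: u_def)
qed

lemma lim_root_inner:
  assumes "\<bar>w0\<bar> < 2"
  shows "cmod (lim_root w0) = 1" "0 < Im (lim_root w0)" "lim_root w0 + cnj (lim_root w0) = of_real w0"
    "1 / lim_root w0 = cnj (lim_root w0)"
proof -
  have "\<bar>w0\<bar>\<^sup>2 < 2\<^sup>2" using assms by (intro power_strict_mono) auto
  then have p: "0 < 4 - w0\<^sup>2" by simp
  have e: "lim_root w0 = Complex (w0 / 2) (sqrt (4 - w0\<^sup>2) / 2)" using assms by (auto simp: lim_root_def)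
  have sq: "(cmod (lim_root w0))\<^sup>2 = 1" unfolding e cmod_power2 using p by (simp add: power_divide field_simps)
  then show n: "cmod (lim_root w0) = 1" by (intro power2_eq_imp_eq[of _ 1]) auto
  show "0 < Im (lim_root w0)" using p by (simp add: e)
  show "lim_root w0 + cnj (lim_root w0) = of_real w0" by (simp add: e complex_eq_iff)
  have "lim_root w0 * cnj (lim_root w0) = 1" using n by (simp add: complex_norm_square[symmetric])
  moreover have "lim_root w0 \<noteq> 0" using n by auto
  ultimately show "1 / lim_root w0 = cnj (lim_root w0)" by (simp add: field_simps)
qed

text \<open>The last clause keeps roots of the upper half disc away from the second limit root 1 /
  \<open>lim_root w0\<close>, which lies outside the closed disc for |w0| > 2 and in the lower half
  plane for |w0| < 2.\<close>

lemma lim_root: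
  assumes "\<bar>w0\<bar> \<noteq> 2"
  shows "lim_root w0 \<noteq> 0" "cmod (lim_root w0) \<le> 1" "lim_root w0 + 1 / lim_root w0 = of_real w0"
    "(1 / lim_root w0 - lim_root w0)\<^sup>2 = of_real (w0\<^sup>2 - 4)" "1 / lim_root w0 - lim_root w0 \<noteq> 0"
    "\<exists>g>0. \<forall>\<zeta>. cmod \<zeta> < 1 \<longrightarrow> 0 < Im \<zeta> \<longrightarrow> g \<le> cmod (\<zeta> - 1 / lim_root w0)"
proof -
  let ?a = "lim_root w0"
  have basic: "?a \<noteq> 0 \<and> cmod ?a \<le> 1 \<and> ?a + 1 / ?a = of_real w0 \<and>
    (\<exists>g>0. \<forall>\<zeta>. cmod \<zeta> < 1 \<longrightarrow> 0 < Im \<zeta> \<longrightarrow> g \<le> cmod (\<zeta> - 1 / ?a))"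
  proof (cases "2 < \<bar>w0\<bar>")
    case True
    then obtain a where a: "?a = of_real (sgn w0 * a)" "0 < a" "a < 1" "a + 1 / a = \<bar>w0\<bar>"
      by (rule lim_root_outer)
    have s: "sgn w0 = 1 \<or> sgn w0 = -1" using True by (auto simp: sgn_real_def)
    have "sgn w0 * a + 1 / (sgn w0 * a) = sgn w0 * (a + 1 / a)" using s a by (auto simp: field_simps)
    also have "\<dots> = w0" unfolding a(4) by (simp add: sgn_mult_abs)
    finally have "?a + 1 / ?a = of_real w0" unfolding a(1) by (metis of_real_1 of_real_add of_real_divide)
    moreover have na: "cmod ?a = a" using s a by (auto simp: norm_mult)
    moreover have "1 / a - 1 \<le> cmod (\<zeta> - 1 / ?a)" if "cmod \<zeta> < 1" for \<zeta>
    proof -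
      have "cmod (1 / ?a) - cmod \<zeta> \<le> cmod (1 / ?a - \<zeta>)" by (rule norm_triangle_ineq2)
      then show ?thesis using that na by (simp add: norm_divide norm_minus_commute)
    qed
    moreover have "0 < 1 / a - 1" using a by simp
    moreover have "?a \<noteq> 0" using na a(2) by auto
    moreover have "cmod ?a \<le> 1" using na a(3) by simp
    ultimately show ?thesis by blast
  next
    case False
    then have w: "\<bar>w0\<bar> < 2" using assms by simp
    note L = lim_root_inner[OF w]
    have "Im ?a \<le> cmod (\<zeta> - 1 / ?a)" if "0 < Im \<zeta>" for \<zeta>
    proof -
      have "Im ?a \<le> Im (\<zeta> - 1 / ?a)" using that by (simp add: L(4))
      also have "\<dots> \<le> cmod (\<zeta> - 1 / ?a)" using abs_Im_le_cmod[of "\<zeta> - 1 / ?a"] by linarith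
      finally show ?thesis .
    qed
    then show ?thesis using L by (auto intro!: exI[of _ "Im ?a"])
  qed
  then show nz: "?a \<noteq> 0" and "cmod ?a \<le> 1" and s: "?a + 1 / ?a = of_real w0"
    and "\<exists>g>0. \<forall>\<zeta>. cmod \<zeta> < 1 \<longrightarrow> 0 < Im \<zeta> \<longrightarrow> g \<le> cmod (\<zeta> - 1 / ?a)" by auto
  have "(1 / ?a - ?a)\<^sup>2 = (?a + 1 / ?a)\<^sup>2 - 4" using nz by (simp add: power2_eq_square field_simps)
  then show sq: "(1 / ?a - ?a)\<^sup>2 = of_real (w0\<^sup>2 - 4)" unfolding s by simp
  have "w0\<^sup>2 \<noteq> 2\<^sup>2" using assms by (metis abs_numeral power2_eq_iff abs_minus_cancel)
  then have "w0\<^sup>2 - 4 \<noteq> 0" by simp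
  then show "1 / ?a - ?a \<noteq> 0" using sq by (metis of_real_eq_0_iff zero_power2)
qed

lemma lim_root_tendsto:
  assumes w0: "\<bar>w0\<bar> \<noteq> 2" and b: "0 < b"
    and z: "\<And>\<epsilon>. 0 < \<epsilon> \<Longrightarrow> \<zeta> \<epsilon> \<noteq> 0 \<and> cmod (\<zeta> \<epsilon>) < 1 \<and> \<zeta> \<epsilon> + 1 / \<zeta> \<epsilon> = Complex w0 (- b * \<epsilon>)"
  shows "(\<zeta> \<longlongrightarrow> lim_root w0) (at_right 0)"
proof -
  note L = lim_root[OF w0]
  obtain g where g: "g > 0" "\<And>\<zeta>. cmod \<zeta> < 1 \<Longrightarrow> 0 < Im \<zeta> \<Longrightarrow> g \<le> cmod (\<zeta> - 1 / lim_root w0)"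
    using L(6) by blast
  have bnd: "cmod (\<zeta> \<epsilon> - lim_root w0) \<le> b / g * \<epsilon>" if e: "0 < \<epsilon>" for \<epsilon>
  proof -
    let ?z = "\<zeta> \<epsilon>" and ?a = "lim_root w0"
    note z = z[OF e]
    have "Im (Complex w0 (- b * \<epsilon>)) < 0" using b e by simp
    then have "0 < Im ?z" using disc_root_Im z by blast
    then have gz: "g \<le> cmod (?z - 1 / ?a)" using g(2) z by blast
    \<comment> \<open>The quadratic equation at w0 is factored over its two roots. The second factor
      has modulus at least g, so the distance to the chosen root is of order \<epsilon>.\<close>
    have "(?z - ?a) * (?z - 1 / ?a) = ?z\<^sup>2 - (?a + 1 / ?a) * ?z + 1"
      using L(1) by (simp add: power2_eq_square field_simps)
    also have "\<dots> = ?z * ((?z + 1 / ?z) - of_real w0)" unfolding L(3) using conjunct1[OF z]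
      by (simp add: power2_eq_square field_simps)
    also have "(?z + 1 / ?z) - of_real w0 = Complex 0 (- b * \<epsilon>)" using z by (simp add: complex_eq_iff)
    finally have e1: "(?z - ?a) * (?z - 1 / ?a) = ?z * Complex 0 (- b * \<epsilon>)" .
    have nc: "cmod (Complex 0 (- b * \<epsilon>)) = b * \<epsilon>" using b e by (simp add: cmod_def abs_mult)
    have "cmod (?z - ?a) * cmod (?z - 1 / ?a) = cmod ?z * (b * \<epsilon>)"
      unfolding norm_mult[symmetric] e1 by (simp only: norm_mult nc)
    also have "\<dots> \<le> 1 * (b * \<epsilon>)" using z b e by (intro mult_right_mono) auto
    finally have "cmod (?z - ?a) * cmod (?z - 1 / ?a) \<le> b * \<epsilon>" by simp
    moreover have "cmod (?z - ?a) * g \<le> cmod (?z - ?a) * cmod (?z - 1 / ?a)" by (intro mult_left_mono gz) simp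
    ultimately show ?thesis using g(1) by (simp add: field_simps)
  qed
  have "((\<lambda>\<epsilon>. b / g * \<epsilon>) \<longlongrightarrow> b / g * 0) (at_right 0)" by (intro tendsto_intros)
  then have t: "((\<lambda>\<epsilon>. b / g * \<epsilon>) \<longlongrightarrow> 0) (at_right 0)" by simp
  have "\<forall>\<^sub>F \<epsilon> in at_right 0. cmod (\<zeta> \<epsilon> - lim_root w0) \<le> b / g * \<epsilon>"
    using bnd by (auto simp: eventually_at_right_field intro!: exI[of _ 1])
  then have "((\<lambda>\<epsilon>. \<zeta> \<epsilon> - lim_root w0) \<longlongrightarrow> 0) (at_right 0)" by (rule Lim_null_comparison[OF _ t])
  then show ?thesis by (simp add: LIM_zero_iff)
qed

text \<open>The geometric mean of the bounds j |z - a| and 2: only half a power of j is spent, and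
  the bound still vanishes as z tends to a.\<close>

lemma power_diff_sqrt_bound:
  fixes z a :: complex
  assumes "cmod z \<le> 1" "cmod a \<le> 1"
  shows "cmod (z ^ j - a ^ j) \<le> sqrt (2 * real j * cmod (z - a))"
proof (rule real_le_rsqrt)
  have 1: "cmod (z ^ j - a ^ j) \<le> real j * cmod (z - a)" by (rule norm_power_diff[OF assms])
  have "cmod (z ^ j) \<le> 1" "cmod (a ^ j) \<le> 1" using assms by (simp_all add: norm_power power_le_one)
  then have 2: "cmod (z ^ j - a ^ j) \<le> 2" using norm_triangle_ineq4[of "z ^ j" "a ^ j"] by linarith
  have "(cmod (z ^ j - a ^ j))\<^sup>2 \<le> 2 * (real j * cmod (z - a))"
    unfolding power2_eq_square by (intro mult_mono 1 2) auto
  then show "(cmod (z ^ j - a ^ j))\<^sup>2 \<le> 2 * real j * cmod (z - a)" by (simp add: mult.assoc)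
qed

section \<open>The lattice resolvent and its boundary values\<close>

text \<open>Green's function of the lattice operator in one channel, with \<zeta> a root of the
  characteristic equation.\<close>

definition lattice_kernel :: "real \<Rightarrow> complex \<Rightarrow> int \<Rightarrow> complex"
  where "lattice_kernel h \<zeta> j = of_real (h\<^sup>2) / (1 / \<zeta> - \<zeta>) * \<zeta> ^ nat \<bar>j\<bar>"

text \<open>Away from j = 0 the powers solve the recurrence; at j = 0 they miss it by 1/\<zeta> -
  \<zeta>, which the denominator of the amplitude normalises.\<close>

lemma lattice_kernel_equation:
  assumes h: "h \<noteq> 0" and z: "\<zeta> \<noteq> 0" "1 / \<zeta> - \<zeta> \<noteq> 0" and w: "\<zeta> + 1 / \<zeta> = 2 - of_real (h\<^sup>2) * (z - m)"
  shows "complex_of_real (1 / h\<^sup>2) * (2 * lattice_kernel h \<zeta> j - lattice_kernel h \<zeta> (j + 1) - lattice_kernel h \<zeta> (j - 1))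
    + (m - z) * lattice_kernel h \<zeta> j = (if j = 0 then 1 else 0)" (is "?L = _")
proof -
  define c where "c = complex_of_real (h\<^sup>2) / (1 / \<zeta> - \<zeta>)"
  define p where "p j = \<zeta> ^ nat \<bar>j\<bar>" for j :: int
  have k: "lattice_kernel h \<zeta> j = c * p j" for j by (simp add: lattice_kernel_def c_def p_def)
  have h2: "complex_of_real (h\<^sup>2) \<noteq> 0" using h by simp
  have "complex_of_real (h\<^sup>2) * ?L = 2 * (c * p j) - c * p (j + 1) - c * p (j - 1) + complex_of_real (h\<^sup>2) * (m - z) * (c * p j)"
    unfolding k using h2 by (simp add: field_simps)
  also have "complex_of_real (h\<^sup>2) * (m - z) = \<zeta> + 1 / \<zeta> - 2" unfolding w by (simp add: algebra_simps)
  finally have e: "complex_of_real (h\<^sup>2) * ?L = c * ((\<zeta> + 1 / \<zeta>) * p j - p (j + 1) - p (j - 1))"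
    by (simp add: algebra_simps)
  have "(\<zeta> + 1 / \<zeta>) * p j - p (j + 1) - p (j - 1) = (if j = 0 then 1 / \<zeta> - \<zeta> else 0)"
  proof -
    consider "j = 0" | "0 < j" | "j < 0" by linarith
    then show ?thesis
    proof cases
      case 1
      then show ?thesis by (simp add: p_def)
    next
      case 2
      define i where "i = nat (j - 1)"
      have n: "nat \<bar>j\<bar> = Suc i" "nat \<bar>j + 1\<bar> = Suc (Suc i)" "nat \<bar>j - 1\<bar> = i" using 2 by (auto simp: i_def)
      show ?thesis using 2 z(1) unfolding p_def n by (simp add: field_simps)
    next
      case 3
      define i where "i = nat (- j - 1)"
      have n: "nat \<bar>j\<bar> = Suc i" "nat \<bar>j + 1\<bar> = i" "nat \<bar>j - 1\<bar> = Suc (Suc i)" using 3 by (auto simp: i_def)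
      show ?thesis using 3 z(1) unfolding p_def n by (simp add: field_simps)
    qed
  qed
  then have "complex_of_real (h\<^sup>2) * ?L = complex_of_real (h\<^sup>2) * (if j = 0 then 1 else 0)"
    unfolding e using z(2) by (simp add: c_def)
  then show ?thesis using h2 by (simp only: mult_cancel_left) simp
qed

lemma geometric_int_summable:
  fixes \<rho> :: real
  assumes "0 \<le> \<rho>" "\<rho> < 1"
  shows "(\<lambda>j::int. \<rho> ^ nat \<bar>j\<bar>) summable_on UNIV"
  by (rule int_summable_abs) (use assms in \<open>auto intro: summable_geometric\<close>)

text \<open>Young's inequality for the convolution of a square summable with a summable sequence, by
  Cauchy-Schwarz with respect to the weights a m.\<close>

lemma young_sq_summable:
  fixes g a :: "int \<Rightarrow> real" and u :: "int \<Rightarrow> 'a::real_normed_vector"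
  assumes g: "((\<lambda>j. (g j)\<^sup>2) has_sum G) UNIV" "\<And>j. 0 \<le> g j" and a: "(a has_sum A) UNIV" "\<And>m. 0 \<le> a m"
    and u: "\<And>n. norm (u n) \<le> (\<Sum>\<^sub>\<infinity>m. g (n - m) * a m)"
  shows "sq_summable u"
proof -
  have gG: "(\<Sum>n\<in>F. (g (n - m))\<^sup>2) \<le> G" if "finite F" for F m
  proof (rule finite_sum_le_has_sum[OF _ that])
    show "((\<lambda>n. (g (n - m))\<^sup>2) has_sum G) UNIV" using has_sum_shift[OF g(1), of "- m"] by simp
  qed auto
  have A0: "0 \<le> A" by (rule has_sum_nonneg[OF a(1)]) (use a(2) in simp)
  have ga: "(\<lambda>m. (g (n - m))\<^sup>2 * a m) summable_on UNIV" for n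
  proof (rule summable_on_comparison_test)
    show "(\<lambda>m. G * a m) summable_on UNIV" by (rule summable_on_cmult_right[OF has_sum_imp_summable[OF a(1)]])
    show "(g (n - m))\<^sup>2 * a m \<le> G * a m" for m
      using gG[of "{n}" m] by (intro mult_right_mono a) simp
  qed (use a(2) in simp)
  have u2: "(norm (u n))\<^sup>2 \<le> A * (\<Sum>\<^sub>\<infinity>m. (g (n - m))\<^sup>2 * a m)" for n
  proof -
    have 1: "((\<lambda>m. (sqrt (a m))\<^sup>2) has_sum A) UNIV" using a by simp
    have 2: "((\<lambda>m. (g (n - m) * sqrt (a m))\<^sup>2) has_sum (\<Sum>\<^sub>\<infinity>m. (g (n - m))\<^sup>2 * a m)) UNIV"
      using ga[of n] a(2) by (simp add: power_mult_distrib)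
    have 3: "sqrt (a m) * (g (n - m) * sqrt (a m)) = g (n - m) * a m" for m
      using a(2)[of m] by (simp add: mult.left_commute)
    have "norm (u n) \<le> sqrt A * sqrt (\<Sum>\<^sub>\<infinity>m. (g (n - m))\<^sup>2 * a m)"
      using u[of n] infsum_cauchy_schwarz(2)[OF 1 2] a(2) g(2) unfolding 3 by (simp add: order_trans)
    then have "(norm (u n))\<^sup>2 \<le> (sqrt A * sqrt (\<Sum>\<^sub>\<infinity>m. (g (n - m))\<^sup>2 * a m))\<^sup>2" by (rule power_mono) simp
    then show ?thesis using A0 a(2) by (simp add: power_mult_distrib infsum_nonneg)
  qed
  show ?thesis
    unfolding sq_summable_def
  proof (rule nonneg_bdd_above_summable_on)
    show "bdd_above (sum (\<lambda>n. (norm (u n))\<^sup>2) ` {F. F \<subseteq> UNIV \<and> finite F})"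
    proof (rule bdd_aboveI[of _ "A * (G * A)"], clarsimp)
      fix F :: "int set" assume F: "finite F"
      have "(\<Sum>n\<in>F. (norm (u n))\<^sup>2) \<le> A * (\<Sum>n\<in>F. \<Sum>\<^sub>\<infinity>m. (g (n - m))\<^sup>2 * a m)"
        unfolding sum_distrib_left by (rule sum_mono) (rule u2)
      also have "(\<Sum>n\<in>F. \<Sum>\<^sub>\<infinity>m. (g (n - m))\<^sup>2 * a m) \<le> G * A"
      proof (rule has_sum_mono)
        show "((\<lambda>m. \<Sum>n\<in>F. (g (n - m))\<^sup>2 * a m) has_sum (\<Sum>n\<in>F. \<Sum>\<^sub>\<infinity>m. (g (n - m))\<^sup>2 * a m)) UNIV"
          by (rule has_sum_finite_sum[OF F has_sum_infsum[OF ga]])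
        show "((\<lambda>m. G * a m) has_sum G * A) UNIV" by (rule has_sum_cmult_right[OF a(1)])
        show "(\<Sum>n\<in>F. (g (n - m))\<^sup>2 * a m) \<le> G * a m" for m
          unfolding sum_distrib_right[symmetric] by (intro mult_right_mono gG F a)
      qed
      finally show "(\<Sum>n\<in>F. (norm (u n))\<^sup>2) \<le> A * (G * A)" using A0 by (simp add: mult_left_mono)
    qed
  qed simp
qed

section \<open>The sandwiched resolvent off the real axis\<close>

context lattice_model
begin

definition conv_kernel :: "real \<Rightarrow> (nat \<Rightarrow> complex) \<Rightarrow> nat \<Rightarrow> int \<Rightarrow> int \<Rightarrow> complex"
  where "conv_kernel h \<zeta> s n m = lattice_kernel h (\<zeta> s) (n - m)"

text \<open>The factor of a channel kernel that blows up at its thresholds, where \<zeta> tends to 1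
  or -1.\<close>

definition amp :: "real \<Rightarrow> complex \<Rightarrow> complex"
  where "amp h \<zeta> = of_real (h\<^sup>2) / (1 / \<zeta> - \<zeta>)"

lemma conv_kernel_norm:
  assumes "cmod (\<zeta> s) \<le> 1"
  shows "cmod (conv_kernel h \<zeta> s n m) \<le> cmod (amp h (\<zeta> s))"
proof -
  have "cmod (\<zeta> s ^ nat \<bar>n - m\<bar>) \<le> 1" using assms by (simp add: norm_power power_le_one)
  then show ?thesis unfolding conv_kernel_def lattice_kernel_def amp_def[symmetric] norm_mult
    by (simp add: mult_left_le)
qed

lemma conv_kernel_le:
  assumes "\<And>s. s \<in> I \<Longrightarrow> cmod (\<zeta> s) \<le> 1"
  shows "kernel_le (conv_kernel h \<zeta>) (\<Sum>s\<in>I. cmod (amp h (\<zeta> s)))"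
  by (rule kernel_leI) (auto intro!: sum_mono conv_kernel_norm sum_nonneg assms)

text \<open>The difference splits into a change of amplitude and a change of root. The latter uses
  \<open>power_diff_sqrt_bound\<close>: |n - m| is at most 2 times the product of the brackets, and
  the square root separates the variables.\<close>

lemma conv_kernel_diff_le:
  assumes z: "\<And>s. s \<in> I \<Longrightarrow> cmod (\<zeta> s) \<le> 1" and a: "\<And>s. s \<in> I \<Longrightarrow> cmod (a s) \<le> 1"
  shows "kernel_le (\<lambda>s n m. conv_kernel h \<zeta> s n m - conv_kernel h a s n m)
    (\<Sum>s\<in>I. cmod (amp h (\<zeta> s) - amp h (a s)) + cmod (amp h (a s)) * (2 * sqrt (cmod (\<zeta> s - a s))))"
  unfolding kernel_le_def sum_distrib_right
proof (intro allI sum_mono)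
  fix n m s assume s: "s \<in> I"
  define j where "j = nat \<bar>n - m\<bar>"
  define J where "J = sqrt (jap n) * sqrt (jap m)"
  have J1: "1 * 1 \<le> J" unfolding J_def using jap_ge1 jap_pos[of n] by (intro mult_mono) auto
  have "real j \<le> \<bar>real_of_int n\<bar> + \<bar>real_of_int m\<bar>" by (simp add: j_def)
  also have "\<dots> \<le> jap n + jap m" by (intro add_mono jap_ge_abs)
  also have "\<dots> \<le> jap n * jap m + jap n * jap m"
    using jap_ge1[of n] jap_ge1[of m] by (intro add_mono) (auto simp: mult_le_cancel_left1 mult_le_cancel_right1)
  finally have j: "2 * real j \<le> 4 * (jap n * jap m)" by simp
  have "cmod (\<zeta> s ^ j - a s ^ j) \<le> sqrt (2 * real j * cmod (\<zeta> s - a s))"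
    by (rule power_diff_sqrt_bound[OF z[OF s] a[OF s]])
  also have "\<dots> \<le> sqrt (4 * (jap n * jap m) * cmod (\<zeta> s - a s))"
    by (intro real_sqrt_le_mono mult_right_mono j) simp
  also have "\<dots> = 2 * sqrt (cmod (\<zeta> s - a s)) * J" by (simp add: real_sqrt_mult J_def)
  finally have p: "cmod (\<zeta> s ^ j - a s ^ j) \<le> 2 * sqrt (cmod (\<zeta> s - a s)) * J" .
  have "conv_kernel h \<zeta> s n m - conv_kernel h a s n m
    = (amp h (\<zeta> s) - amp h (a s)) * \<zeta> s ^ j + amp h (a s) * (\<zeta> s ^ j - a s ^ j)"
    by (simp add: conv_kernel_def lattice_kernel_def amp_def j_def algebra_simps)
  then have "cmod (conv_kernel h \<zeta> s n m - conv_kernel h a s n m)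
    \<le> cmod (amp h (\<zeta> s) - amp h (a s)) * cmod (\<zeta> s ^ j) + cmod (amp h (a s)) * cmod (\<zeta> s ^ j - a s ^ j)"
    by (metis norm_mult norm_triangle_ineq)
  also have "\<dots> \<le> cmod (amp h (\<zeta> s) - amp h (a s)) * J + cmod (amp h (a s)) * (2 * sqrt (cmod (\<zeta> s - a s)) * J)"
  proof (intro add_mono mult_left_mono p)
    have "cmod (\<zeta> s ^ j) \<le> 1" using z[OF s] by (simp add: norm_power power_le_one)
    then show "cmod (\<zeta> s ^ j) \<le> J" using J1 by simp
  qed auto
  finally show "cmod (conv_kernel h \<zeta> s n m - conv_kernel h a s n m)
    \<le> (cmod (amp h (\<zeta> s) - amp h (a s)) + cmod (amp h (a s)) * (2 * sqrt (cmod (\<zeta> s - a s)))) * (sqrt (jap n) * sqrt (jap m))"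
    unfolding J_def[symmetric] by (simp add: algebra_simps)
qed

definition M :: "'g ell2 \<Rightarrow> 'g ell2" where "M = factor_op \<nu> K W"

lemma psi_family:
  fixes A :: "'g \<Rightarrow> 'g"
  assumes "bounded_clinear A" "\<And>x. norm (A x) \<le> cK * norm x"
  shows "bounded_family (\<lambda>n y. complex_of_real (\<psi> n) *\<^sub>C A y) (1 * cK)"
proof (rule bounded_family_scale[OF assms(1) _ assms(2)])
  show "cmod (complex_of_real (\<psi> n)) \<le> 1" for n using psi_le_1[of n] psi_pos[of n] by simp
qed (use cK(1) in simp)

lemma M_eq: "M x = S (ell2_map (\<lambda>n y. complex_of_real (\<psi> n) *\<^sub>C K y) x)"
proof -
  have n1: "cmod (complex_of_real (\<psi> n)) \<le> 1" for n using psi_le_1[of n] psi_pos[of n] by simp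
  have "sq_summable (\<lambda>n. complex_of_real (\<psi> n) * Rep_ell2 \<phi> n)" for \<phi>
    by (rule sq_summable_bound[OF sq_summable_Rep[of \<phi>], of _ 1]) (simp add: norm_mult mult_right_mono[OF n1, simplified])
  then have "tensor_op (mult_psi \<nu>) K = ell2_map (\<lambda>n y. complex_of_real (\<psi> n) *\<^sub>C K y)"
    by (intro tensor_op_diagonal[where c = 1] K_lin)
      (use n1 in \<open>auto simp: mult_psi_def Rep_Abs_ell2\<close>)
  then show ?thesis by (simp add: M_def factor_op_def S_def)
qed

lemma M_adjoint: "Rep_ell2 (cadjoint M x) = V x"
proof -
  interpret A: bounded_family "\<lambda>n y. complex_of_real (\<psi> n) *\<^sub>C K y" "1 * cK" by (rule psi_family[OF K_lin cK(2)])
  interpret B: bounded_family "\<lambda>n y. complex_of_real (\<psi> n) *\<^sub>C Kc y" "1 * cK" by (rule psi_family[OF Kc_lin cKc])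
  have e: "cinner (ell2_map (\<lambda>n y. complex_of_real (\<psi> n) *\<^sub>C Kc y) a) b = cinner a (ell2_map (\<lambda>n y. complex_of_real (\<psi> n) *\<^sub>C K y) b)" for a b
    using cinner_ell2_has_sum[of "ell2_map (\<lambda>n y. complex_of_real (\<psi> n) *\<^sub>C Kc y) a" b]
      cinner_ell2_has_sum[of a "ell2_map (\<lambda>n y. complex_of_real (\<psi> n) *\<^sub>C K y) b"]
    by (simp add: A.rep B.rep cinner_scaleC_left cinner_scaleC_right Kc has_sum_unique)
  have "cadjoint M = (\<lambda>x. ell2_map (\<lambda>n y. complex_of_real (\<psi> n) *\<^sub>C Kc y) (S x))"
    by (rule cadjoint_eqI) (simp add: M_eq e S_sa)
  then show ?thesis by (simp add: B.rep V_def fun_eq_iff)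
qed

text \<open>Off the axis the kernel decays exponentially and V x is summable, so their convolution u
  lies in l^2. Applying H - z channel by channel gives back M^* x, by
  \<open>lattice_kernel_equation\<close> and because the projections sum to the identity.\<close>

lemma sandwiched_resolvent_eq:
  assumes h: "0 < h" and z: "Im z \<noteq> 0"
    and \<zeta>: "\<And>s. s \<in> I \<Longrightarrow> \<zeta> s \<noteq> 0 \<and> cmod (\<zeta> s) < 1 \<and> \<zeta> s + 1 / \<zeta> s = 2 - of_real (h\<^sup>2) * (z - of_real (\<mu> s))"
  shows "sandwiched_resolvent (free_op h Q) M z = Phi (conv_kernel h \<zeta>)"
proof
  fix x
  let ?k = "conv_kernel h \<zeta>"
  have k: "kernel_le ?k (\<Sum>s\<in>I. cmod (amp h (\<zeta> s)))" by (rule conv_kernel_le) (use \<zeta> less_imp_le in blast)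
  have nz: "1 / \<zeta> s - \<zeta> s \<noteq> 0" if "s \<in> I" for s
  proof
    assume "1 / \<zeta> s - \<zeta> s = 0"
    then have "\<zeta> s * \<zeta> s = 1" using \<zeta>[OF that] by (simp add: field_simps)
    then have "cmod (\<zeta> s) * cmod (\<zeta> s) = 1" by (metis norm_mult norm_one)
    moreover have "cmod (\<zeta> s) * cmod (\<zeta> s) \<le> cmod (\<zeta> s) * 1" using \<zeta>[OF that] by (intro mult_left_mono) auto
    ultimately show False using \<zeta>[OF that] by simp
  qed
  define C where "C = (\<Sum>s\<in>I. cmod (amp h (\<zeta> s)))"
  \<comment> \<open>A common decay rate for the finitely many channels; the entry 0 makes it
    nonnegative.\<close>
  define \<rho> where "\<rho> = Max (insert 0 ((\<lambda>s. cmod (\<zeta> s)) ` I))"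
  have \<rho>: "0 \<le> \<rho>" "\<rho> < 1" "\<And>s. s \<in> I \<Longrightarrow> cmod (\<zeta> s) \<le> \<rho>"
    using fin_I \<zeta> unfolding \<rho>_def by (auto simp: Max_less_iff)
  have C0: "0 \<le> C" unfolding C_def by (rule sum_nonneg) simp
  have kb: "(\<Sum>s\<in>I. cmod (?k s n m)) \<le> C * \<rho> ^ nat \<bar>n - m\<bar>" for n m
    unfolding C_def sum_distrib_right
  proof (rule sum_mono)
    fix s assume s: "s \<in> I"
    have "cmod (\<zeta> s) ^ nat \<bar>n - m\<bar> \<le> \<rho> ^ nat \<bar>n - m\<bar>" by (intro power_mono \<rho> s) simp
    then show "cmod (?k s n m) \<le> cmod (amp h (\<zeta> s)) * \<rho> ^ nat \<bar>n - m\<bar>"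
      unfolding conv_kernel_def lattice_kernel_def amp_def norm_mult norm_power by (intro mult_left_mono) auto
  qed
  let ?t = "\<lambda>n m. \<Sum>s\<in>I. ?k s n m *\<^sub>C \<pi> s (V x m)"
  have t: "(?t n has_sum app ?k (V x) n) UNIV" for n
    unfolding app_def by (rule has_sum_infsum[OF app_bound(1)[OF k]])
  have sq: "sq_summable (app ?k (V x))"
  proof (rule young_sq_summable)
    have g2: "(\<lambda>j::int. (C * \<rho> ^ nat \<bar>j\<bar>)\<^sup>2) summable_on UNIV"
    proof -
      have "\<rho>\<^sup>2 < 1" using \<rho> by (simp add: power_less_one_iff abs_square_less_1)
      then have "(\<lambda>j::int. C\<^sup>2 * (\<rho>\<^sup>2) ^ nat \<bar>j\<bar>) summable_on UNIV"
        by (intro summable_on_cmult_right geometric_int_summable) auto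
      then show ?thesis by (simp add: power_mult_distrib power_commutes flip: power_mult) (simp add: mult.commute)
    qed
    show "((\<lambda>j::int. (C * \<rho> ^ nat \<bar>j\<bar>)\<^sup>2) has_sum (\<Sum>\<^sub>\<infinity>j::int. (C * \<rho> ^ nat \<bar>j\<bar>)\<^sup>2)) UNIV"
      by (rule has_sum_infsum[OF g2])
    show "((\<lambda>m. norm (V x m)) has_sum (\<Sum>\<^sub>\<infinity>m. norm (V x m))) UNIV" by (rule has_sum_infsum[OF V_sum(1)])
    fix n
    have p1: "\<rho> ^ nat \<bar>n - m\<bar> \<le> 1" for m using \<rho> by (simp add: power_le_one)
    have s: "(\<lambda>m. C * \<rho> ^ nat \<bar>n - m\<bar> * norm (V x m)) summable_on UNIV"
    proof (rule summable_on_comparison_test)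
      show "(\<lambda>m. C * norm (V x m)) summable_on UNIV" by (rule summable_on_cmult_right[OF V_sum(1)])
      show "C * \<rho> ^ nat \<bar>n - m\<bar> * norm (V x m) \<le> C * norm (V x m)" for m
        using p1[of m] C0 by (intro mult_right_mono) (auto simp: mult_left_le)
    qed (use C0 \<rho> in simp)
    show "norm (app ?k (V x) n) \<le> (\<Sum>\<^sub>\<infinity>m. C * \<rho> ^ nat \<bar>n - m\<bar> * norm (V x m))"
      unfolding app_def
    proof (rule norm_infsum_le_infsum(2)[OF s])
      show "norm (?t n m) \<le> C * \<rho> ^ nat \<bar>n - m\<bar> * norm (V x m)" for m
        using term_norm[of ?k n m "V x m"] mult_right_mono[OF kb[of n m] norm_ge_zero[of "V x m"]] by linarith
    qed
  qed (use C0 \<rho> in auto)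
  define u where "u = Abs_ell2 (app ?k (V x))"
  have Ru: "Rep_ell2 u = app ?k (V x)" unfolding u_def by (rule Rep_Abs_ell2[OF sq])
  have Ql: "bounded_clinear Q" by (rule selfadjointD(1)[OF Q])
  obtain q where q: "q > 0" "\<And>x. norm (Q x) \<le> q * norm x" using bounded_clinear_bound[OF Ql] by blast
  interpret Qf: bounded_family "\<lambda>_. Q" q by (rule bounded_family_const[OF Ql q(2)]) (use q in simp)
  have "free_op h Q u - z *\<^sub>C u = cadjoint M x"
  proof (rule ell2_eqI)
    fix n
    let ?H = "\<lambda>m. complex_of_real (1 / h\<^sup>2) *\<^sub>C (2 *\<^sub>C ?t n m - ?t (n + 1) m - ?t (n - 1) m) + Q (?t n m) - z *\<^sub>C ?t n m"
    have "bounded_linear Q" using Ql by (simp add: bounded_clinear_def)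
    note bl = bounded_linear_scaleC_right
    have d: "((\<lambda>m. f m - g m) has_sum a - b) UNIV" if "(f has_sum a) UNIV" "(g has_sum b) UNIV"
      for f g :: "int \<Rightarrow> 'g" and a b
    proof -
      have "((\<lambda>m. - g m) has_sum - b) UNIV" using that(2) by (simp add: has_sum_uminus)
      from has_sum_add[OF that(1) this] show ?thesis by simp
    qed
    have 1: "(?H has_sum (complex_of_real (1 / h\<^sup>2) *\<^sub>C (2 *\<^sub>C app ?k (V x) n - app ?k (V x) (n + 1) - app ?k (V x) (n - 1))
      + Q (app ?k (V x) n) - z *\<^sub>C app ?k (V x) n)) UNIV"
      by (intro d has_sum_add has_sum_bounded_linear[OF bl] has_sum_bounded_linear[OF \<open>bounded_linear Q\<close>] t)
    have "?H m = (if m = n then V x n else 0)" for m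
    proof -
      let ?l = "\<lambda>s. lattice_kernel h (\<zeta> s)"
      have "?H m = (\<Sum>s\<in>I. (complex_of_real (1 / h\<^sup>2) * (2 * ?l s (n - m) - ?l s (n - m + 1) - ?l s (n - m - 1))
          + (of_real (\<mu> s) - z) * ?l s (n - m)) *\<^sub>C \<pi> s (V x m))"
      proof -
        have Qt: "Q (?t n m) = (\<Sum>s\<in>I. (?k s n m * of_real (\<mu> s)) *\<^sub>C \<pi> s (V x m))"
          unfolding bounded_clinear_sum[OF Ql]
          by (rule sum.cong) (simp_all add: bounded_clinearD[OF Ql] Q_proj scaleC_scaleC)
        show ?thesis
          unfolding Qt unfolding conv_kernel_def
          by (simp add: cvec.scale_sum_right sum.distrib sum_subtractf scaleC_scaleC cvec.scale_right_diff_distrib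
              scaleC_add_left cvec.scale_left_diff_distrib algebra_simps)
      qed
      also have "\<dots> = (\<Sum>s\<in>I. (if m = n then 1 else 0) *\<^sub>C \<pi> s (V x m))"
      proof (rule sum.cong[OF refl])
        fix s assume s: "s \<in> I"
        show "(complex_of_real (1 / h\<^sup>2) * (2 * ?l s (n - m) - ?l s (n - m + 1) - ?l s (n - m - 1))
          + (of_real (\<mu> s) - z) * ?l s (n - m)) *\<^sub>C \<pi> s (V x m) = (if m = n then 1 else 0) *\<^sub>C \<pi> s (V x m)"
          using lattice_kernel_equation[OF _ _ nz[OF s], of h z "of_real (\<mu> s)" "n - m"] \<zeta>[OF s] h by auto
      qed
      also have "\<dots> = (if m = n then V x n else 0)" by (auto simp: proj_sum)
      finally show ?thesis .
    qed
    then have "((\<lambda>m. if m = n then V x n else 0) has_sum (complex_of_real (1 / h\<^sup>2) *\<^sub>C (2 *\<^sub>C app ?k (V x) n - app ?k (V x) (n + 1) - app ?k (V x) (n - 1))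
      + Q (app ?k (V x) n) - z *\<^sub>C app ?k (V x) n)) UNIV" using 1 by simp
    moreover have "((\<lambda>m. if m = n then V x n else 0) has_sum V x n) UNIV"
      by (rule has_sum_cong_neutral[THEN iffD1, rotated -1, OF has_sum_finiteI[of "{n}" "V x n" "\<lambda>_. V x n"]]) auto
    ultimately have "complex_of_real (1 / h\<^sup>2) *\<^sub>C (2 *\<^sub>C app ?k (V x) n - app ?k (V x) (n + 1) - app ?k (V x) (n - 1))
      + Q (app ?k (V x) n) - z *\<^sub>C app ?k (V x) n = V x n" by (rule has_sum_unique)
    then show "Rep_ell2 (free_op h Q u - z *\<^sub>C u) n = Rep_ell2 (cadjoint M x) n"
      by (simp add: free_op_eq[OF Ql] ell2_rep Rep_shift Qf.rep Ru M_adjoint)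
  qed
  then have "resolvent (free_op h Q) z (cadjoint M x) = u"
    by (rule resolvent_eqI[OF selfadjoint_free_op[OF Q] z])
  then show "sandwiched_resolvent (free_op h Q) M z x = Phi ?k x"
    by (simp add: sandwiched_resolvent_def M_eq Phi_def ell2_map_def Ru)
qed

lemma Phi_hs:
  assumes k: "kernel_le k \<kappa>" and C0: "hs_bound Z C0"
  shows "hilbert_schmidt (Phi k)" "hs_norm (Phi k) \<le> C1 * \<kappa> * sqrt C0"
proof -
  have c: "0 \<le> C1 * \<kappa>" using C1_nonneg kernel_le_nonneg[OF k] by simp
  have fin: "(\<Sum>e\<in>F. (norm (Phi k e))\<^sup>2) \<le> (C1 * \<kappa>)\<^sup>2 * C0" if F: "finite F" "F \<subseteq> some_onb" for F
  proof -
    have "(\<Sum>e\<in>F. (norm (Phi k e))\<^sup>2) \<le> (\<Sum>e\<in>F. (C1 * \<kappa>)\<^sup>2 * (norm (Z e))\<^sup>2)"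
      using power_mono[OF Phi_norm[OF k] norm_ge_zero, of _ 2] by (intro sum_mono) (simp add: power_mult_distrib)
    also have "\<dots> = (C1 * \<kappa>)\<^sup>2 * (\<Sum>e\<in>F. (norm (Z e))\<^sup>2)" by (simp add: sum_distrib_left)
    also have "\<dots> \<le> (C1 * \<kappa>)\<^sup>2 * C0"
      using C0 F orthonormal_subset[OF some_onb(1) F(2)] by (intro mult_left_mono) (auto simp: hs_bound_def)
    finally show ?thesis .
  qed
  have s: "(\<lambda>e. (norm (Phi k e))\<^sup>2) summable_on some_onb"
    by (rule nonneg_bdd_above_summable_on) (auto intro!: bdd_aboveI[of _ "(C1 * \<kappa>)\<^sup>2 * C0"] fin)
  then show "hilbert_schmidt (Phi k)" using Phi_clinear[OF k] by (simp add: hilbert_schmidt_def)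
  have "hs_norm (Phi k) \<le> sqrt ((C1 * \<kappa>)\<^sup>2 * C0)"
    unfolding hs_norm_def by (intro real_sqrt_le_mono infsum_le_finite_sums[OF s fin]) auto
  then show "hs_norm (Phi k) \<le> C1 * \<kappa> * sqrt C0" using c by (simp add: real_sqrt_mult)
qed

end

text \<open>The Hilbert-Schmidt norm dominates the values on basis vectors. That
  \<open>T \<epsilon>\<close> is eventually Hilbert-Schmidt provides the summability, as
  \<open>infsum\<close> is 0 for divergent series.\<close>

lemma hs_norm_limit_unique:
  fixes S1 S2 :: "'a::chilbert_space \<Rightarrow> 'a"
  assumes S: "hilbert_schmidt S1" "hilbert_schmidt S2"
    and T: "\<forall>\<^sub>F \<epsilon> in at_right (0::real). hilbert_schmidt (T \<epsilon>)"
    and lim: "((\<lambda>\<epsilon>. hs_norm (\<lambda>x. T \<epsilon> x - S1 x)) \<longlongrightarrow> 0) (at_right 0)"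
      "((\<lambda>\<epsilon>. hs_norm (\<lambda>x. T \<epsilon> x - S2 x)) \<longlongrightarrow> 0) (at_right 0)"
  shows "S1 = S2"
proof (rule bounded_clinear_eq_on_onb)
  fix e :: 'a assume e: "e \<in> some_onb"
  have le: "norm (A e - B e) \<le> hs_norm (\<lambda>x. A x - B x)" if "hilbert_schmidt A" "hilbert_schmidt B" for A B :: "'a \<Rightarrow> 'a"
  proof -
    have "(\<lambda>e. (norm (A e - B e))\<^sup>2) summable_on some_onb"
    proof (rule summable_on_comparison_test)
      show "(\<lambda>e. 2 * (norm (A e))\<^sup>2 + 2 * (norm (B e))\<^sup>2) summable_on some_onb"
        using that by (intro summable_on_add summable_on_cmult_right) (auto simp: hilbert_schmidt_def)
      show "(norm (A e - B e))\<^sup>2 \<le> 2 * (norm (A e))\<^sup>2 + 2 * (norm (B e))\<^sup>2" for e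
        using norm_diff_square[of "A e" "B e"] norm_add_square[of "A e" "B e"] zero_le_power2[of "norm (A e + B e)"] by linarith
    qed simp
    then have "(\<Sum>e\<in>{e}. (norm (A e - B e))\<^sup>2) \<le> (\<Sum>\<^sub>\<infinity>e\<in>some_onb. (norm (A e - B e))\<^sup>2)"
      by (rule finite_sum_le_infsum) (use e in auto)
    then show ?thesis unfolding hs_norm_def by (simp add: real_le_rsqrt)
  qed
  have "((\<lambda>\<epsilon>. hs_norm (\<lambda>x. T \<epsilon> x - S1 x) + hs_norm (\<lambda>x. T \<epsilon> x - S2 x)) \<longlongrightarrow> 0 + 0) (at_right 0)"
    by (intro tendsto_add lim)
  moreover have "\<forall>\<^sub>F \<epsilon> in at_right 0. norm (S1 e - S2 e) \<le> hs_norm (\<lambda>x. T \<epsilon> x - S1 x) + hs_norm (\<lambda>x. T \<epsilon> x - S2 x)"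
    using T
  proof eventually_elim
    case (elim \<epsilon>)
    have "norm (S1 e - S2 e) \<le> norm (T \<epsilon> e - S1 e) + norm (T \<epsilon> e - S2 e)"
      using norm_triangle_ineq4[of "T \<epsilon> e - S2 e" "T \<epsilon> e - S1 e"] by simp
    then show ?case using le[OF elim S(1)] le[OF elim S(2)] by linarith
  qed
  ultimately have "norm (S1 e - S2 e) \<le> 0 + 0"
    by (intro tendsto_lowerbound[of _ "0 + 0" "at_right (0::real)"]) auto
  then show "S1 e = S2 e" by simp
qed (use S in \<open>auto simp: hilbert_schmidt_def\<close>)

section \<open>Boundary values on the real axis\<close>

context lattice_model
begin

text \<open>The real number w0 of the characteristic equation in channel s: 2 at \<mu> s, -2 at
  \<mu> s + 4/h^2, and between them exactly on the band of that channel.\<close>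

definition energy :: "real \<Rightarrow> real \<Rightarrow> nat \<Rightarrow> real"
  where "energy h l s = 2 - h\<^sup>2 * (l - \<mu> s)"

text \<open>The roots at l + i\<epsilon> converge to \<open>lim_root\<close>, so the kernels
  converge in the sense of \<open>kernel_le\<close>, and \<open>Phi_hs\<close> turns this into
  convergence in Hilbert-Schmidt norm.\<close>

theorem boundary_value_eq:
  assumes h: "0 < h" and l: "\<And>s. s \<in> I \<Longrightarrow> \<bar>energy h l s\<bar> \<noteq> 2"
  shows "boundary_value (free_op h Q) M l = Phi (conv_kernel h (\<lambda>s. lim_root (energy h l s)))"
proof -
  define a where "a s = lim_root (energy h l s)" for s
  have "\<exists>\<zeta>. \<zeta> \<noteq> 0 \<and> cmod \<zeta> < 1 \<and> \<zeta> + 1 / \<zeta> = Complex (energy h l s) (- (h\<^sup>2) * \<epsilon>)" if "0 < \<epsilon>" for \<epsilon> s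
    by (rule disc_root_exists) (use that h in simp)
  then obtain \<zeta> where \<zeta>: "\<And>\<epsilon> s. 0 < \<epsilon> \<Longrightarrow> \<zeta> \<epsilon> s \<noteq> 0 \<and> cmod (\<zeta> \<epsilon> s) < 1 \<and>
      \<zeta> \<epsilon> s + 1 / \<zeta> \<epsilon> s = Complex (energy h l s) (- (h\<^sup>2) * \<epsilon>)"
    by metis
  have T: "sandwiched_resolvent (free_op h Q) M (Complex l \<epsilon>) = Phi (conv_kernel h (\<zeta> \<epsilon>))" if e: "0 < \<epsilon>" for \<epsilon>
  proof (rule sandwiched_resolvent_eq[OF h])
    show "Im (Complex l \<epsilon>) \<noteq> 0" using e by simp
    show "\<zeta> \<epsilon> s \<noteq> 0 \<and> cmod (\<zeta> \<epsilon> s) < 1 \<and> \<zeta> \<epsilon> s + 1 / \<zeta> \<epsilon> s = 2 - of_real (h\<^sup>2) * (Complex l \<epsilon> - of_real (\<mu> s))" for s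
      using \<zeta>[OF e, of s] by (simp add: complex_eq_iff energy_def)
  qed
  obtain C0 where C0: "hs_bound Z C0" using hs_bound_Z by blast
  have a1: "cmod (a s) \<le> 1" if "s \<in> I" for s unfolding a_def by (rule lim_root(2)[OF l[OF that]])
  have z1: "cmod (\<zeta> \<epsilon> s) \<le> 1" if "0 < \<epsilon>" for \<epsilon> s using \<zeta>[OF that, of s] by simp
  note ka = conv_kernel_le[OF a1, where h = h]
  have kz: "kernel_le (conv_kernel h (\<zeta> \<epsilon>)) (\<Sum>s\<in>I. cmod (amp h (\<zeta> \<epsilon> s)))" if "0 < \<epsilon>" for \<epsilon>
    by (rule conv_kernel_le[OF z1[OF that]])
  define \<kappa> where "\<kappa> \<epsilon> = (\<Sum>s\<in>I. cmod (amp h (\<zeta> \<epsilon> s) - amp h (a s)) + cmod (amp h (a s)) * (2 * sqrt (cmod (\<zeta> \<epsilon> s - a s))))" for \<epsilon>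
  have zlim: "((\<lambda>\<epsilon>. \<zeta> \<epsilon> s) \<longlongrightarrow> a s) (at_right 0)" if s: "s \<in> I" for s
    unfolding a_def by (rule lim_root_tendsto[OF l[OF s], of "h\<^sup>2"]) (use h \<zeta> in auto)
  have alim: "((\<lambda>\<epsilon>. amp h (\<zeta> \<epsilon> s)) \<longlongrightarrow> amp h (a s)) (at_right 0)" if s: "s \<in> I" for s
    unfolding amp_def
    by (intro tendsto_intros zlim[OF s]) (use lim_root(1,5)[OF l[OF s]] in \<open>auto simp: a_def\<close>)
  have "(\<kappa> \<longlongrightarrow> (\<Sum>s\<in>I. cmod (amp h (a s) - amp h (a s)) + cmod (amp h (a s)) * (2 * sqrt (cmod (a s - a s))))) (at_right 0)"
    unfolding \<kappa>_def by (intro tendsto_sum tendsto_intros zlim alim) auto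
  then have "(\<kappa> \<longlongrightarrow> 0) (at_right 0)" by simp
  then have \<kappa>lim: "((\<lambda>\<epsilon>. C1 * \<kappa> \<epsilon> * sqrt C0) \<longlongrightarrow> 0) (at_right 0)"
    using tendsto_mult[OF tendsto_mult[OF tendsto_const[of C1]] tendsto_const[of "sqrt C0"]] by fastforce
  have pos: "\<forall>\<^sub>F \<epsilon> in at_right (0::real). 0 < \<epsilon>" by (simp add: eventually_at_right_less)
  have hs_diff: "hs_norm (\<lambda>x. Phi (conv_kernel h (\<zeta> \<epsilon>)) x - Phi (conv_kernel h a) x) \<le> C1 * \<kappa> \<epsilon> * sqrt C0" if e: "0 < \<epsilon>" for \<epsilon>
  proof -
    have "(\<lambda>x. Phi (conv_kernel h (\<zeta> \<epsilon>)) x - Phi (conv_kernel h a) x)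
      = Phi (\<lambda>s n m. conv_kernel h (\<zeta> \<epsilon>) s n m - conv_kernel h a s n m)"
      by (rule ext) (rule Phi_diff[OF kz[OF e] ka])
    then show ?thesis
      unfolding \<kappa>_def using Phi_hs(2)[OF conv_kernel_diff_le[OF z1[OF e] a1] C0] by simp
  qed
  have conv: "hilbert_schmidt (Phi (conv_kernel h a)) \<and>
    (\<forall>\<^sub>F \<epsilon> in at_right 0. hilbert_schmidt (sandwiched_resolvent (free_op h Q) M (Complex l \<epsilon>))) \<and>
    ((\<lambda>\<epsilon>. hs_norm (\<lambda>x. sandwiched_resolvent (free_op h Q) M (Complex l \<epsilon>) x - Phi (conv_kernel h a) x)) \<longlongrightarrow> 0) (at_right 0)"
  proof (intro conjI)
    show "hilbert_schmidt (Phi (conv_kernel h a))" by (rule Phi_hs(1)[OF ka C0])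
    show "\<forall>\<^sub>F \<epsilon> in at_right 0. hilbert_schmidt (sandwiched_resolvent (free_op h Q) M (Complex l \<epsilon>))"
      using pos by eventually_elim (simp add: T Phi_hs(1)[OF kz C0])
    show "((\<lambda>\<epsilon>. hs_norm (\<lambda>x. sandwiched_resolvent (free_op h Q) M (Complex l \<epsilon>) x - Phi (conv_kernel h a) x)) \<longlongrightarrow> 0) (at_right 0)"
    proof (rule tendsto_sandwich[OF _ _ tendsto_const \<kappa>lim])
      show "\<forall>\<^sub>F \<epsilon> in at_right 0. 0 \<le> hs_norm (\<lambda>x. sandwiched_resolvent (free_op h Q) M (Complex l \<epsilon>) x - Phi (conv_kernel h a) x)"
        by (simp add: hs_norm_def infsum_nonneg)
      show "\<forall>\<^sub>F \<epsilon> in at_right 0. hs_norm (\<lambda>x. sandwiched_resolvent (free_op h Q) M (Complex l \<epsilon>) x - Phi (conv_kernel h a) x) \<le> C1 * \<kappa> \<epsilon> * sqrt C0"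
        using pos by eventually_elim (simp add: T hs_diff)
    qed
  qed
  have "boundary_value (free_op h Q) M l = Phi (conv_kernel h a)"
    unfolding boundary_value_def Let_def
  proof (rule the_equality, rule conv)
    fix S' assume S': "hilbert_schmidt S' \<and>
      (\<forall>\<^sub>F \<epsilon> in at_right 0. hilbert_schmidt (sandwiched_resolvent (free_op h Q) M (Complex l \<epsilon>))) \<and>
      ((\<lambda>\<epsilon>. hs_norm (\<lambda>x. sandwiched_resolvent (free_op h Q) M (Complex l \<epsilon>) x - S' x)) \<longlongrightarrow> 0) (at_right 0)"
    show "S' = Phi (conv_kernel h a)"
      using hs_norm_limit_unique[of S' "Phi (conv_kernel h a)" "\<lambda>\<epsilon>. sandwiched_resolvent (free_op h Q) M (Complex l \<epsilon>)"] S' conv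
      by blast
  qed
  then show ?thesis by (simp add: a_def[abs_def])
qed

end

section \<open>Threshold asymptotics\<close>

lemma re_op_props:
  fixes T :: "'a::chilbert_space \<Rightarrow> 'a"
  assumes T: "bounded_clinear T"
  shows "selfadjoint_op (re_op T)" "qform (re_op T) x = Re (cinner x (T x))"
proof -
  show "selfadjoint_op (re_op T)"
    unfolding selfadjoint_op_def re_op_def
    by (auto intro!: bounded_clinear_scaleC bounded_clinear_add T bounded_clinear_cadjoint
        simp: cinner_add_left cinner_add_right cinner_scaleC_left cinner_scaleC_right
          cadjoint_works[OF T] cadjoint_works'[OF T] add.commute)
  have "Re (cinner (T x) x) = Re (cinner x (T x))" by (subst cinner_commute) simp
  then show "qform (re_op T) x = Re (cinner x (T x))"
    by (simp add: qform_def re_op_def cinner_add_right cinner_scaleC_right cadjoint_works'[OF T])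
qed

lemma im_op_props:
  fixes T :: "'a::chilbert_space \<Rightarrow> 'a"
  assumes T: "bounded_clinear T"
  shows "selfadjoint_op (im_op T)" "qform (im_op T) x = Im (cinner x (T x))"
proof -
  have e: "1 / (2 * \<i>) = - \<i> / 2" by (simp add: field_simps)
  show "selfadjoint_op (im_op T)"
    unfolding selfadjoint_op_def im_op_def
    by (auto intro!: bounded_clinear_scaleC bounded_clinear_diff T bounded_clinear_cadjoint
        simp: cinner_diff_left cinner_diff_right cinner_scaleC_left cinner_scaleC_right
          cadjoint_works[OF T] cadjoint_works'[OF T] e algebra_simps)
  have "Im (cinner (T x) x) = - Im (cinner x (T x))" by (subst cinner_commute) simp
  then show "qform (im_op T) x = Im (cinner x (T x))"
    by (simp add: qform_def im_op_def e cinner_diff_right cinner_scaleC_right cinner_minus_right cadjoint_works'[OF T])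
qed

text \<open>With q = sqrt (4 + h^2 k^2) the amplitude is h / (k q). Both errors stay bounded as k
  tends to 0: Bernoulli bounds 1 - a^j by j (1 - a), where the amplitude times 1 - a is at most h^2,
  and replacing q by 2 costs at most h^3 k.\<close>

lemma threshold_kernel_bound:
  fixes h k a :: real
  assumes h: "0 < h" and k: "0 < k" "k \<le> 1" and a: "0 < a" "a < 1" "a + 1 / a = 2 + h\<^sup>2 * k\<^sup>2"
  shows "\<bar>h\<^sup>2 / (1 / a - a) * a ^ j - h / (2 * k)\<bar> \<le> (h\<^sup>2 + h ^ 3) * (1 + real j)"
proof -
  define u where "u = h\<^sup>2 * k\<^sup>2"
  define q where "q = sqrt (4 + u)"
  have u0: "0 < u" using h k by (simp add: u_def)
  have q2: "q\<^sup>2 = 4 + u" using u0 by (simp add: q_def)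
  have q: "2 < q" unfolding q_def by (rule real_less_rsqrt) (use u0 in simp)
  have pos: "0 < 1 / a - a"
  proof -
    have "a * a < 1 * 1" using a by (intro mult_strict_mono) auto
    then show ?thesis using a by (simp add: field_simps)
  qed
  have "(1 / a - a)\<^sup>2 = (a + 1 / a)\<^sup>2 - 4" using a(1) by (simp add: power2_eq_square field_simps)
  also have "\<dots> = (h * k * q)\<^sup>2" unfolding a(3) power_mult_distrib q2 by (simp add: u_def power2_eq_square algebra_simps)
  finally have d: "1 / a - a = h * k * q"
    by (rule power2_eq_imp_eq) (use pos h k q in auto)
  define g where "g = h\<^sup>2 / (1 / a - a)"
  have g: "g = h / (k * q)" unfolding g_def d using h k q by (simp add: power2_eq_square field_simps)
  have g0: "0 < g" unfolding g_def using pos h by simp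
  have aj: "0 \<le> a ^ j" "a ^ j \<le> 1" using a by (simp_all add: power_le_one)
  have "1 + real j * (a - 1) \<le> (1 + (a - 1)) ^ j" by (rule Bernoulli_inequality) (use a in simp)
  then have "1 - a ^ j \<le> real j * (1 - a)" by (simp add: algebra_simps)
  then have "g * (1 - a ^ j) \<le> g * (real j * (1 - a))" using g0 by (intro mult_left_mono) auto
  also have "g * (1 - a) \<le> h\<^sup>2"
  proof -
    have "1 - a \<le> 1 / a - a" using a by (simp add: field_simps)
    then have "h\<^sup>2 * (1 - a) \<le> h\<^sup>2 * (1 / a - a)" by (intro mult_left_mono) auto
    then show ?thesis unfolding g_def using pos by (simp add: pos_divide_le_eq)
  qed
  then have "g * (real j * (1 - a)) \<le> h\<^sup>2 * real j"
    using mult_right_mono[of "g * (1 - a)" "h\<^sup>2" "real j"] by (simp add: mult_ac)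
  finally have 1: "g * (1 - a ^ j) \<le> h\<^sup>2 * real j" .
  \<comment> \<open>As q^2 - 4 = u = h^2 k^2, the difference q - 2 is of second order in k and
    compensates the factor h / k.\<close>
  have "(q - 2) / (2 * q) = u / (2 * q * (q + 2))"
  proof -
    have "u = (q - 2) * (q + 2)" using q2 by (simp add: power2_eq_square algebra_simps)
    then show ?thesis using q by simp
  qed
  also have "\<dots> \<le> u / 1"
    using q u0 mult_mono[of 1 "2 * q" 1 "q + 2"] by (intro divide_left_mono) auto
  finally have "h / k * ((q - 2) / (2 * q)) \<le> h / k * (u / 1)" using h k by (intro mult_left_mono) auto
  also have "h / k * (u / 1) = h ^ 3 * k" using k by (simp add: u_def power2_eq_square power3_eq_cube)
  also have "h / k * ((q - 2) / (2 * q)) = h / (2 * k) - g" unfolding g using k q by (simp add: field_simps)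
  finally have 2: "h / (2 * k) - g \<le> h ^ 3 * k" .
  have 3: "h ^ 3 * k \<le> h ^ 3" using h k by (simp add: mult_left_le)
  have 4: "g \<le> h / (2 * k)" unfolding g using h k q by (intro divide_left_mono) (auto simp: mult.commute)
  have 5: "g * a ^ j \<le> g" using g0 aj by (simp add: mult_left_le)
  have "\<bar>g * a ^ j - h / (2 * k)\<bar> \<le> h\<^sup>2 * real j + h ^ 3"
    using 1 2 3 4 5 by (simp add: algebra_simps abs_le_iff)
  also have "\<dots> \<le> (h\<^sup>2 + h ^ 3) * (1 + real j)" using h by (simp add: algebra_simps)
  finally show ?thesis by (simp add: g_def)
qed

context lattice_model
begin

text \<open>The first summand is the constant of \<open>Phi_form_linear\<close>, the inner factor 2
  coming from 1 + |n - m| \<le> 2 (jap n + jap m). The second is that of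
  \<open>Phi_form_bounded\<close>, and the final 1 makes the sum positive.\<close>

definition remainder_const :: "real \<Rightarrow> real \<Rightarrow> real"
  where "remainder_const h D = 2 * (2 * (h\<^sup>2 + h ^ 3) + real (card I) * D) * (sqrt sp * cK * cS) * sqrt sw
     + real (card I) * D * sw + 1"

text \<open>For Re T the rank one kernel of channel s is subtracted, which leaves linear growth; for
  Im T the whole channel s is subtracted, as its form is real. The other channels are bounded by D.
  The sign \<tau> of the root in channel s is 1 at the lower and -1 at the upper edge.\<close>

lemma threshold_forms:
  assumes h: "0 < h" and s: "s \<in> I" and \<tau>: "\<tau> = 1 \<or> \<tau> = -1" and k: "0 < k" "k \<le> 1"
    and en: "energy h l s = \<tau> * (2 + h\<^sup>2 * k\<^sup>2)"
    and D: "\<And>s'. s' \<in> I - {s} \<Longrightarrow> \<bar>energy h l s'\<bar> \<noteq> 2 \<and> cmod (amp h (lim_root (energy h l s'))) \<le> D" "0 \<le> D"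
    and \<sigma>: "\<And>n. \<bar>\<sigma> n\<bar> = 1" "\<And>n m. \<tau> ^ nat \<bar>n - m\<bar> = \<sigma> n * \<sigma> m"
  defines "T \<equiv> boundary_value (free_op h Q) M l"
  shows "bounded_clinear T"
    "\<bar>Re (cinner x (T x)) - \<tau> * (h / (2 * k)) * (norm (cadjoint (Y s \<sigma>) x))\<^sup>2\<bar> \<le> remainder_const h D * norm x * norm (Z x)"
    "\<bar>Im (cinner x (T x))\<bar> \<le> remainder_const h D * (norm (Z x))\<^sup>2"
proof -
  define \<zeta> where "\<zeta> s = lim_root (energy h l s)" for s
  define k0 where "k0 = conv_kernel h \<zeta>"
  have hk: "0 < h\<^sup>2 * k\<^sup>2" using h k by simp
  have es: "\<bar>energy h l s\<bar> = 2 + h\<^sup>2 * k\<^sup>2" "sgn (energy h l s) = \<tau>"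
    using \<tau> hk unfolding en by (auto simp: abs_mult sgn_mult)
  have l: "\<bar>energy h l s'\<bar> \<noteq> 2" if "s' \<in> I" for s'
    using D(1)[of s'] that es(1) hk by (cases "s' = s") auto
  have T: "T = Phi k0" unfolding T_def k0_def \<zeta>_def by (rule boundary_value_eq[OF h l])
  have z1: "cmod (\<zeta> s') \<le> 1" if "s' \<in> I" for s' unfolding \<zeta>_def by (rule lim_root(2)[OF l[OF that]])
  define \<kappa> where "\<kappa> = (\<Sum>s\<in>I. cmod (amp h (\<zeta> s)))"
  have k0: "kernel_le k0 \<kappa>" unfolding k0_def \<kappa>_def by (rule conv_kernel_le[OF z1])
  show "bounded_clinear T" unfolding T by (rule Phi_clinear[OF k0])
  \<comment> \<open>Just outside the band the root is real and has the sign of the energy.\<close>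
  obtain a where a: "\<zeta> s = of_real (\<tau> * a)" "0 < a" "a < 1" "a + 1 / a = 2 + h\<^sup>2 * k\<^sup>2"
    using lim_root_outer[of "energy h l s"] es hk unfolding \<zeta>_def by auto
  define r where "r n m = h\<^sup>2 / (1 / a - a) * a ^ nat \<bar>n - m\<bar>" for n m :: int
  have ks: "k0 s n m = complex_of_real (\<tau> * \<sigma> n * \<sigma> m * r n m)" for n m
  proof -
    have "h\<^sup>2 / (1 / (\<tau> * a) - \<tau> * a) * (\<tau> * a) ^ nat \<bar>n - m\<bar> = \<tau> * (\<tau> ^ nat \<bar>n - m\<bar>) * r n m"
    proof -
      have "1 / (\<tau> * a) - \<tau> * a = \<tau> * (1 / a - a)" using \<tau> by auto
      moreover have "h\<^sup>2 / (\<tau> * y) = \<tau> * (h\<^sup>2 / y)" for y using \<tau> by auto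
      ultimately show ?thesis by (simp add: r_def power_mult_distrib)
    qed
    then show ?thesis
      unfolding k0_def conv_kernel_def lattice_kernel_def a(1) \<sigma>(2)
      by (metis (no_types, lifting) mult.assoc of_real_1 of_real_diff of_real_divide of_real_mult of_real_power)
  qed
  have osum: "(\<Sum>s'\<in>I - {s}. cmod (k0 s' n m)) \<le> real (card I) * D" for n m
  proof -
    have "(\<Sum>s'\<in>I - {s}. cmod (k0 s' n m)) \<le> (\<Sum>s'\<in>I - {s}. D)"
    proof (rule sum_mono)
      fix s' assume s': "s' \<in> I - {s}"
      have "cmod (k0 s' n m) \<le> cmod (amp h (\<zeta> s'))"
        unfolding k0_def by (rule conv_kernel_norm) (use z1 s' in auto)
      then show "cmod (k0 s' n m) \<le> D" using D(1)[OF s'] by (simp add: \<zeta>_def)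
    qed
    also have "\<dots> \<le> real (card I) * D"
      using D(2) card_mono[OF fin_I, of "I - {s}"] by (simp add: mult_right_mono)
    finally show ?thesis .
  qed
  have split: "(\<Sum>s'\<in>I. cmod (k0 s' n m - one_channel s p s' n m))
    = cmod (k0 s n m - p n m) + (\<Sum>s'\<in>I - {s}. cmod (k0 s' n m))" for p n m
    unfolding sum.remove[OF fin_I s] by (simp add: one_channel_def)
  let ?C = "2 * (h\<^sup>2 + h ^ 3) + real (card I) * D"
  let ?c = "\<tau> * (h / (2 * k))"
  define ksing where "ksing = one_channel s (\<lambda>n m. complex_of_real (?c * \<sigma> n * \<sigma> m))"
  note sing = singular_form[where \<sigma> = \<sigma> and c = ?c, OF s \<sigma>(1), folded ksing_def]
  have rem: "(\<Sum>s'\<in>I. cmod (k0 s' n m - ksing s' n m)) \<le> ?C * (jap n + jap m)" for n m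
  proof -
    have "k0 s n m - complex_of_real (?c * \<sigma> n * \<sigma> m) = complex_of_real (\<tau> * \<sigma> n * \<sigma> m * (r n m - h / (2 * k)))"
      unfolding ks by (simp add: algebra_simps)
    then have "cmod (k0 s n m - complex_of_real (?c * \<sigma> n * \<sigma> m)) = \<bar>r n m - h / (2 * k)\<bar>"
      using \<tau> \<sigma>(1) by (simp only: norm_of_real abs_mult) auto
    also have "\<dots> \<le> (h\<^sup>2 + h ^ 3) * (1 + real (nat \<bar>n - m\<bar>))"
      unfolding r_def by (rule threshold_kernel_bound[OF h k a(2-4)])
    also have "\<dots> \<le> (h\<^sup>2 + h ^ 3) * (2 * (jap n + jap m))"
    proof (intro mult_left_mono)
      have "real (nat \<bar>n - m\<bar>) \<le> \<bar>real_of_int n\<bar> + \<bar>real_of_int m\<bar>" by simp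
      also have "\<dots> \<le> jap n + jap m" by (intro add_mono jap_ge_abs)
      finally have "1 + real (nat \<bar>n - m\<bar>) \<le> jap n + (jap n + jap m)" using jap_ge1[of n] by (intro add_mono)
      then show "1 + real (nat \<bar>n - m\<bar>) \<le> 2 * (jap n + jap m)"
        using jap_pos[of m] by (simp add: algebra_simps)
    qed (use h in simp)
    finally have 1: "cmod (k0 s n m - complex_of_real (?c * \<sigma> n * \<sigma> m)) \<le> 2 * (h\<^sup>2 + h ^ 3) * (jap n + jap m)"
      by (simp only: mult_ac)
    have "real (card I) * D * 1 \<le> real (card I) * D * (jap n + jap m)"
      using jap_ge1[of n] jap_ge1[of m] D(2) by (intro mult_left_mono) auto
    then show ?thesis unfolding ksing_def split using 1 osum[of n m] by (simp add: distrib_right)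
  qed
  have krem: "kernel_le (\<lambda>s n m. k0 s n m - ksing s n m) (\<kappa> + \<bar>?c\<bar>)"
    unfolding kernel_le_def
  proof (intro allI)
    fix n m
    have "(\<Sum>s\<in>I. cmod (k0 s n m - ksing s n m)) \<le> (\<Sum>s\<in>I. cmod (k0 s n m)) + (\<Sum>s\<in>I. cmod (ksing s n m))"
      unfolding sum.distrib[symmetric] by (intro sum_mono norm_triangle_ineq4)
    also have "\<dots> \<le> (\<kappa> + \<bar>?c\<bar>) * (sqrt (jap n) * sqrt (jap m))"
      using k0 sing(1) unfolding kernel_le_def distrib_right by (intro add_mono) auto
    finally show "(\<Sum>s\<in>I. cmod (k0 s n m - ksing s n m)) \<le> (\<kappa> + \<bar>?c\<bar>) * (sqrt (jap n) * sqrt (jap m))" .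
  qed
  have "cinner x (T x) - complex_of_real (?c * (norm (cadjoint (Y s \<sigma>) x))\<^sup>2) = cinner x (Phi (\<lambda>s n m. k0 s n m - ksing s n m) x)"
    unfolding T sing(2)[symmetric] cinner_diff_right[symmetric] Phi_diff[OF k0 sing(1)] ..
  then have "Re (cinner x (T x)) - ?c * (norm (cadjoint (Y s \<sigma>) x))\<^sup>2 = Re (cinner x (Phi (\<lambda>s n m. k0 s n m - ksing s n m) x))"
    by (metis Re_complex_of_real minus_complex.sel(1))
  then have "\<bar>Re (cinner x (T x)) - ?c * (norm (cadjoint (Y s \<sigma>) x))\<^sup>2\<bar> \<le> cmod (cinner x (Phi (\<lambda>s n m. k0 s n m - ksing s n m) x))"
    using abs_Re_le_cmod by simp
  also have "\<dots> \<le> 2 * ?C * (sqrt sp * cK * cS) * sqrt sw * norm x * norm (Z x)"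
    by (rule Phi_form_linear[OF krem rem])
  also have "\<dots> \<le> remainder_const h D * norm x * norm (Z x)"
    unfolding remainder_const_def using D(2) sw_nonneg by (intro mult_right_mono) auto
  finally show "\<bar>Re (cinner x (T x)) - ?c * (norm (cadjoint (Y s \<sigma>) x))\<^sup>2\<bar> \<le> remainder_const h D * norm x * norm (Z x)" .
  \<comment> \<open>The full kernel of channel s, real and symmetric. Its bound, which blows up as k
    tends to 0, serves summability only and does not enter the estimate of Im T.\<close>
  define q where "q n m = \<tau> * \<sigma> n * \<sigma> m * r n m" for n m
  have qs: "q n m = q m n" for n m by (simp add: q_def r_def abs_minus_commute mult_ac)
  have qb: "\<bar>q n m\<bar> \<le> cmod (amp h (\<zeta> s))" for n m
  proof -
    have "cmod (k0 s n m) \<le> cmod (amp h (\<zeta> s))" unfolding k0_def by (rule conv_kernel_norm) (rule z1[OF s])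
    then show ?thesis unfolding ks q_def by (simp only: norm_of_real)
  qed
  define ksym where "ksym = one_channel s (\<lambda>n m. complex_of_real (q n m))"
  note sym = symmetric_form[where r = q, OF s qs qb, folded ksym_def]
  have oth: "(\<Sum>s'\<in>I. cmod (k0 s' n m - ksym s' n m)) \<le> real (card I) * D" for n m
    unfolding ksym_def split ks q_def using osum[of n m] by simp
  have koth: "kernel_le (\<lambda>s n m. k0 s n m - ksym s n m) (real (card I) * D)"
    by (rule kernel_leI[OF oth]) (use D(2) in simp)
  have "cinner x (T x) - cinner x (Phi ksym x) = cinner x (Phi (\<lambda>s n m. k0 s n m - ksym s n m) x)"
    unfolding T cinner_diff_right[symmetric] Phi_diff[OF k0 sym(1)] ..
  then have "Im (cinner x (T x)) = Im (cinner x (Phi (\<lambda>s n m. k0 s n m - ksym s n m) x))"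
    using sym(2)[of x] by (metis diff_zero minus_complex.sel(2))
  then have "\<bar>Im (cinner x (T x))\<bar> \<le> cmod (cinner x (Phi (\<lambda>s n m. k0 s n m - ksym s n m) x))"
    using abs_Im_le_cmod by simp
  also have "\<dots> \<le> real (card I) * D * sw * (norm (Z x))\<^sup>2" by (rule Phi_form_bounded[OF koth oth])
  also have "\<dots> \<le> remainder_const h D * (norm (Z x))\<^sup>2"
    unfolding remainder_const_def using D(2) sw_nonneg sp_nonneg cK(1) cS(1) h
    by (intro mult_right_mono) (auto intro!: add_nonneg_nonneg mult_nonneg_nonneg)
  finally show "\<bar>Im (cinner x (T x))\<bar> \<le> remainder_const h D * (norm (Z x))\<^sup>2" .
qed

text \<open>\<theta> = 1 gives minus the function of H^-, and \<theta> = -1 gives that of H^+, since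
  eigenvalues of A + t B below -1 are eigenvalues of its negative above 1.\<close>

definition xi_signed :: "real \<Rightarrow> real \<Rightarrow> real \<Rightarrow> real"
  where "xi_signed \<theta> h l = ssf_int (\<lambda>x. complex_of_real \<theta> *\<^sub>C re_op (boundary_value (free_op h Q) M l) x)
    (\<lambda>x. complex_of_real \<theta> *\<^sub>C im_op (boundary_value (free_op h Q) M l) x)"

lemma xi_minus_eq: "xi_minus h Q \<nu> K W l = - xi_signed 1 h l"
  by (simp add: xi_minus_def ssf_minus_def Let_def xi_signed_def ssf_int_def nplus_def pencil_def M_def[symmetric])

lemma xi_plus_eq: "xi_plus h Q \<nu> K W l = xi_signed (-1) h l"
proof -
  let ?A = "re_op (boundary_value (free_op h Q) M l)" and ?B = "im_op (boundary_value (free_op h Q) M l)"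
  have "the_enat (N_minus 1 (\<lambda>x. ?A x + complex_of_real t *\<^sub>C ?B x))
    = nplus 1 (pencil (\<lambda>x. complex_of_real (-1) *\<^sub>C ?A x) (\<lambda>x. complex_of_real (-1) *\<^sub>C ?B x) t)" for t
    by (simp add: N_minus_def N_plus_def nplus_def pencil_def)
  then show ?thesis
    unfolding xi_plus_def ssf_plus_def Let_def xi_signed_def ssf_int_def M_def[symmetric] by (simp only:)
qed

text \<open>The singular part of \<theta> Re T has the coefficient c = \<theta> \<tau> h / (2 k).
  For \<theta> = \<tau> it is positive and 1 / c = 2 k / h sets the level of the count; for \<theta>
  = - \<tau> it is negative, and \<open>ssf_int_bounds\<close> gives boundedness.\<close>

lemma threshold_asymptotics:
  assumes h: "0 < h" and s: "s \<in> I" and \<tau>: "\<tau> = 1 \<or> \<tau> = -1"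
    and k: "\<forall>\<^sub>F l in F. 0 < k l \<and> k l \<le> 1 \<and> energy h l s = \<tau> * (2 + h\<^sup>2 * (k l)\<^sup>2)"
    and D: "\<forall>\<^sub>F l in F. \<forall>s'\<in>I - {s}. \<bar>energy h l s'\<bar> \<noteq> 2 \<and> cmod (amp h (lim_root (energy h l s'))) \<le> D" "0 \<le> D"
    and \<sigma>: "\<And>n. \<bar>\<sigma> n\<bar> = 1" "\<And>n m. \<tau> ^ nat \<bar>n - m\<bar> = \<sigma> n * \<sigma> m"
    and \<epsilon>: "0 < \<epsilon>" "\<epsilon> < 1"
  defines "E \<equiv> (\<lambda>g. cadjoint (Y s \<sigma>) (Y s \<sigma> g))"
  shows "\<exists>C. \<forall>\<^sub>F l in F. 0 < k l \<and> real (nplus ((1 + \<epsilon>) * (2 / h * k l)) E) - C \<le> xi_signed \<tau> h l \<and>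
      xi_signed \<tau> h l \<le> real (nplus ((1 - \<epsilon>) * (2 / h * k l)) E) + C \<and> \<bar>xi_signed (- \<tau>) h l\<bar> \<le> C"
proof -
  obtain C0 where C0: "hs_bound Z C0" using hs_bound_Z by blast
  define R where "R = remainder_const h D"
  have R: "0 < R"
    unfolding R_def remainder_const_def using D(2) sw_nonneg sp_nonneg cK(1) cS(1) h
    by (intro add_nonneg_pos add_nonneg_nonneg mult_nonneg_nonneg) auto
  have "\<exists>C. \<forall>A B (Y::'g \<Rightarrow> 'g ell2) c a.
    selfadjoint_op A \<longrightarrow> selfadjoint_op B \<longrightarrow> bounded_clinear Y \<longrightarrow> 0 < a \<longrightarrow>
    (\<forall>x. norm (cadjoint Y x) \<le> a * norm (Z x)) \<longrightarrow>
    (\<forall>x. \<bar>qform A x - c * (norm (cadjoint Y x))\<^sup>2\<bar> \<le> R * norm x * norm (Z x)) \<longrightarrow>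
    (\<forall>x. \<bar>qform B x\<bar> \<le> R * (norm (Z x))\<^sup>2) \<longrightarrow>
    (0 < c \<longrightarrow> real (nplus ((1 + \<epsilon>) / c) (\<lambda>g. cadjoint Y (Y g))) - C \<le> ssf_int A B \<and>
       ssf_int A B \<le> real (nplus ((1 - \<epsilon>) / c) (\<lambda>g. cadjoint Y (Y g))) + C) \<and>
    (c \<le> 0 \<longrightarrow> \<bar>ssf_int A B\<bar> \<le> C)"
    by (rule ssf_int_bounds[OF Z_lin C0 R \<epsilon>])
  then obtain C where C: "\<forall>A B (Y::'g \<Rightarrow> 'g ell2) c a.
    selfadjoint_op A \<longrightarrow> selfadjoint_op B \<longrightarrow> bounded_clinear Y \<longrightarrow> 0 < a \<longrightarrow>
    (\<forall>x. norm (cadjoint Y x) \<le> a * norm (Z x)) \<longrightarrow>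
    (\<forall>x. \<bar>qform A x - c * (norm (cadjoint Y x))\<^sup>2\<bar> \<le> R * norm x * norm (Z x)) \<longrightarrow>
    (\<forall>x. \<bar>qform B x\<bar> \<le> R * (norm (Z x))\<^sup>2) \<longrightarrow>
    (0 < c \<longrightarrow> real (nplus ((1 + \<epsilon>) / c) (\<lambda>g. cadjoint Y (Y g))) - C \<le> ssf_int A B \<and>
       ssf_int A B \<le> real (nplus ((1 - \<epsilon>) / c) (\<lambda>g. cadjoint Y (Y g))) + C) \<and>
    (c \<le> 0 \<longrightarrow> \<bar>ssf_int A B\<bar> \<le> C)" ..
  have pt: "0 < k l \<and> real (nplus ((1 + \<epsilon>) * (2 / h * k l)) E) - C \<le> xi_signed \<tau> h l \<and>
      xi_signed \<tau> h l \<le> real (nplus ((1 - \<epsilon>) * (2 / h * k l)) E) + C \<and> \<bar>xi_signed (- \<tau>) h l\<bar> \<le> C"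
    if kl: "0 < k l" "k l \<le> 1" "energy h l s = \<tau> * (2 + h\<^sup>2 * (k l)\<^sup>2)"
      and Dl: "\<forall>s'\<in>I - {s}. \<bar>energy h l s'\<bar> \<noteq> 2 \<and> cmod (amp h (lim_root (energy h l s'))) \<le> D" for l
  proof -
    define T where "T = boundary_value (free_op h Q) M l"
    have Dl': "\<And>s'. s' \<in> I - {s} \<Longrightarrow> \<bar>energy h l s'\<bar> \<noteq> 2 \<and> cmod (amp h (lim_root (energy h l s'))) \<le> D"
      using Dl by blast
    note forms = threshold_forms[where \<sigma> = \<sigma>, OF h s \<tau> kl Dl' D(2) \<sigma>, folded T_def R_def]
    have main: "(0 < c \<longrightarrow> real (nplus ((1 + \<epsilon>) / c) E) - C \<le> xi_signed \<theta> h l \<and>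
        xi_signed \<theta> h l \<le> real (nplus ((1 - \<epsilon>) / c) E) + C) \<and> (c \<le> 0 \<longrightarrow> \<bar>xi_signed \<theta> h l\<bar> \<le> C)"
      if \<theta>: "\<bar>\<theta>\<bar> = 1" and c: "c = \<theta> * (\<tau> * (h / (2 * k l)))" for \<theta> c
    proof -
      let ?A = "\<lambda>x. complex_of_real \<theta> *\<^sub>C re_op T x" and ?B = "\<lambda>x. complex_of_real \<theta> *\<^sub>C im_op T x"
      have q: "qform ?A x = \<theta> * Re (cinner x (T x))" "qform ?B x = \<theta> * Im (cinner x (T x))" for x
        using re_op_props(2)[OF forms(1), of x] im_op_props(2)[OF forms(1), of x]
        by (simp_all add: qform_def cinner_scaleC_right)
      have qA: "\<bar>qform ?A x - c * (norm (cadjoint (Y s \<sigma>) x))\<^sup>2\<bar> \<le> R * norm x * norm (Z x)" for x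
      proof -
        have "qform ?A x - c * (norm (cadjoint (Y s \<sigma>) x))\<^sup>2
          = \<theta> * (Re (cinner x (T x)) - \<tau> * (h / (2 * k l)) * (norm (cadjoint (Y s \<sigma>) x))\<^sup>2)"
          unfolding q c by (simp add: algebra_simps)
        then show ?thesis using forms(2)[of x] \<theta> by (simp add: abs_mult)
      qed
      have qB: "\<bar>qform ?B x\<bar> \<le> R * (norm (Z x))\<^sup>2" for x
        unfolding q abs_mult \<theta> using forms(3)[of x] by simp
      have a: "0 < sqrt sw + 1" using sw_nonneg by (simp add: add_nonneg_pos)
      show ?thesis
        unfolding xi_signed_def E_def T_def[symmetric]
        using C[rule_format, OF selfadjoint_scale[OF re_op_props(1)[OF forms(1)]]
            selfadjoint_scale[OF im_op_props(1)[OF forms(1)]] Y_clinear[where \<sigma> = \<sigma>, OF s \<sigma>(1)] a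
            Y_adjoint_sum(3)[where \<sigma> = \<sigma>, OF s \<sigma>(1)] qA qB]
        by blast
    qed
    have pos: "0 < h / (2 * k l)" using h kl by simp
    have "\<tau> * (\<tau> * (h / (2 * k l))) = h / (2 * k l)" using \<tau> by auto
    then have 1: "real (nplus ((1 + \<epsilon>) / (h / (2 * k l))) E) - C \<le> xi_signed \<tau> h l \<and>
        xi_signed \<tau> h l \<le> real (nplus ((1 - \<epsilon>) / (h / (2 * k l))) E) + C"
      using main[of \<tau> "h / (2 * k l)"] \<tau> pos by auto
    have "- \<tau> * (\<tau> * (h / (2 * k l))) = - (h / (2 * k l))" using \<tau> by auto
    then have 2: "\<bar>xi_signed (- \<tau>) h l\<bar> \<le> C"
      using main[of "- \<tau>" "- (h / (2 * k l))"] \<tau> pos by auto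
    have "x / (h / (2 * k l)) = x * (2 / h * k l)" for x using h kl by (simp add: field_simps)
    then show ?thesis using 1 2 kl by simp
  qed
  have "\<forall>\<^sub>F l in F. 0 < k l \<and> real (nplus ((1 + \<epsilon>) * (2 / h * k l)) E) - C \<le> xi_signed \<tau> h l \<and>
      xi_signed \<tau> h l \<le> real (nplus ((1 - \<epsilon>) * (2 / h * k l)) E) + C \<and> \<bar>xi_signed (- \<tau>) h l\<bar> \<le> C"
    using k D(1) by eventually_elim (use pt in blast)
  then show ?thesis by blast
qed

text \<open>The modulus of \<open>amp\<close> is h^2 / sqrt |w^2 - 4| with w the energy of the
  channel, which is continuous in l and stays off \<plusminus>2 near l0.\<close>

lemma channel_amplitudes_bounded:
  assumes h: "0 < h" and l0: "\<And>s'. s' \<in> I - {s} \<Longrightarrow> \<bar>energy h l0 s'\<bar> \<noteq> 2"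
  shows "\<exists>D\<ge>0. \<forall>\<^sub>F l in nhds l0. \<forall>s'\<in>I - {s}. \<bar>energy h l s'\<bar> \<noteq> 2 \<and> cmod (amp h (lim_root (energy h l s'))) \<le> D"
proof -
  \<comment> \<open>Near l0 the quantity |w^2 - 4| exceeds half its value at l0.\<close>
  define b where "b s' = h\<^sup>2 / sqrt (\<bar>(energy h l0 s')\<^sup>2 - 4\<bar> / 2)" for s'
  define D where "D = (\<Sum>s'\<in>I - {s}. b s')"
  have b0: "0 \<le> b s'" for s' by (simp add: b_def)
  have "\<forall>\<^sub>F l in nhds l0. \<bar>energy h l s'\<bar> \<noteq> 2 \<and> cmod (amp h (lim_root (energy h l s'))) \<le> D"
    if s': "s' \<in> I - {s}" for s'
  proof -
    define v where "v l = \<bar>(energy h l s')\<^sup>2 - 4\<bar>" for l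
    have "(energy h l0 s')\<^sup>2 \<noteq> 2\<^sup>2" using l0[OF s'] by (metis abs_numeral power2_eq_iff abs_minus_cancel)
    then have v0: "0 < v l0" by (simp add: v_def)
    have "isCont v l0" unfolding v_def energy_def by (intro continuous_intros)
    then have "(v \<longlongrightarrow> v l0) (nhds l0)" by (simp add: isCont_def tendsto_nhds_iff)
    moreover have "v l0 / 2 < v l0" using v0 by simp
    ultimately have "\<forall>\<^sub>F l in nhds l0. v l0 / 2 < v l" by (rule order_tendstoD(1))
    then show ?thesis
    proof eventually_elim
      case (elim l)
      have "v l \<noteq> 0" using elim v0 by linarith
      then have ne: "\<bar>energy h l s'\<bar> \<noteq> 2" unfolding v_def
        by (metis abs_numeral abs_zero cancel_comm_monoid_add_class.diff_cancel power2_abs four_x_squared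
            mult_2 numeral_Bit0 power2_eq_square)
      let ?a = "lim_root (energy h l s')"
      have "(cmod (1 / ?a - ?a))\<^sup>2 = v l"
        unfolding norm_power[symmetric] lim_root(4)[OF ne] norm_of_real v_def ..
      then have "cmod (1 / ?a - ?a) = sqrt (v l)" by (metis norm_ge_zero real_sqrt_unique)
      then have "cmod (amp h ?a) = h\<^sup>2 / sqrt (v l)" by (simp add: amp_def norm_divide norm_power)
      also have "\<dots> \<le> h\<^sup>2 / sqrt (v l0 / 2)"
        using elim v0 by (intro divide_left_mono real_sqrt_le_mono mult_pos_pos) auto
      also have "\<dots> = b s'" by (simp add: b_def v_def)
      also have "\<dots> \<le> D" unfolding D_def by (rule member_le_sum[OF s']) (use b0 fin_I in auto)
      finally show ?case using ne by simp
    qed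
  qed
  then have "\<forall>\<^sub>F l in nhds l0. \<forall>s'\<in>I - {s}. \<bar>energy h l s'\<bar> \<noteq> 2 \<and> cmod (amp h (lim_root (energy h l s'))) \<le> D"
    using fin_I by (intro eventually_ball_finite) auto
  moreover have "0 \<le> D" unfolding D_def by (rule sum_nonneg) (use b0 in simp)
  ultimately show ?thesis by blast
qed

text \<open>Powers of the negative root at the upper edge carry this sign; its factorisation makes
  the singular kernel one of rank one on the lattice.\<close>

lemma alt_product: "(-1) ^ nat \<bar>n - m\<bar> = alt n * alt m"
proof -
  have alt: "alt i = (if even i then 1 else -1)" for i
    unfolding alt_def by (cases "0 \<le> i") (auto simp: power_int_def minus_one_power_iff even_nat_iff)
  have "even (nat \<bar>n - m\<bar>) \<longleftrightarrow> (even n \<longleftrightarrow> even m)" by (simp add: even_nat_iff)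
  then show ?thesis by (auto simp: alt minus_one_power_iff)
qed

lemma effective_form_compact:
  assumes "s \<in> I" "\<And>n. \<bar>\<sigma> n\<bar> = 1"
  shows "form_compact (\<lambda>g. cadjoint (Y s \<sigma>) (Y s \<sigma> g))"
proof -
  obtain C0 where C0: "hs_bound Z C0" using hs_bound_Z by blast
  have "0 < sqrt sw + 1" using sw_nonneg by (simp add: add_nonneg_pos)
  then show ?thesis
    by (rule form_compact_gram_dual[OF Z_lin C0 Y_clinear[OF assms] Y_adjoint_sum(3)[OF assms]])
qed

end

text \<open>As k tends to 0, the level b k falls below every r0, so the count exceeds any given
  bound.\<close>

lemma threshold_unbounded:
  fixes f k :: "real \<Rightarrow> real" and N :: "real \<Rightarrow> nat"
  assumes F: "F \<noteq> bot" and k: "(k \<longlongrightarrow> 0) F" "\<forall>\<^sub>F l in F. 0 < k l"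
    and f: "\<forall>\<^sub>F l in F. real (N (b * k l)) - C \<le> \<bar>f l\<bar>" and b: "0 < b"
    and N: "\<And>n. \<exists>r0>0. \<forall>r. 0 < r \<longrightarrow> r < r0 \<longrightarrow> n \<le> N r"
  shows "f \<notin> O[F](\<lambda>_. 1)"
proof
  assume "f \<in> O[F](\<lambda>_. 1)"
  then obtain c where c: "\<forall>\<^sub>F l in F. norm (f l) \<le> c * norm (1::real)" by (rule landau_o.bigE) blast
  obtain r0 where r0: "r0 > 0" "\<And>r. 0 < r \<Longrightarrow> r < r0 \<Longrightarrow> nat \<lceil>c + C\<rceil> + 1 \<le> N r" using N by blast
  have "((\<lambda>l. b * k l) \<longlongrightarrow> b * 0) F" by (intro tendsto_intros k)
  then have "\<forall>\<^sub>F l in F. b * k l < r0" by (rule order_tendstoD(2)) (use r0 in simp)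
  with c f k(2) have "\<forall>\<^sub>F l in F. False"
  proof eventually_elim
    case (elim l)
    have "nat \<lceil>c + C\<rceil> + 1 \<le> N (b * k l)" using elim b by (intro r0(2)) auto
    then have "c + C < real (N (b * k l))" by linarith
    then show False using elim by simp
  qed
  then show False using F by simp
qed

lemma bounded_bigo: "\<forall>\<^sub>F l in F. \<bar>f l\<bar> \<le> C \<Longrightarrow> f \<in> O[F](\<lambda>_. 1 :: real)"
  by (rule landau_o.bigI[of "\<bar>C\<bar> + 1"]) (auto elim!: eventually_mono)

lemma form_compact_scale:
  assumes S: "form_compact S" and c: "0 < c"
  shows "form_compact (\<lambda>x. complex_of_real c *\<^sub>C S x)"
  unfolding form_compact_def
proof (intro conjI allI impI selfadjoint_scale[OF form_compact_sa[OF S]])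
  fix \<epsilon> :: real assume "0 < \<epsilon>"
  then have "0 < \<epsilon> / c" using c by simp
  then obtain F where F: "finite F" "\<And>x. orth_to F x \<Longrightarrow> \<bar>qform S x\<bar> \<le> \<epsilon> / c * (norm x)\<^sup>2"
    using S unfolding form_compact_def by blast
  have "qform (\<lambda>x. complex_of_real c *\<^sub>C S x) x = c * qform S x" for x
    by (simp add: qform_def cinner_scaleC_right)
  then show "\<exists>F. finite F \<and> (\<forall>x. orth_to F x \<longrightarrow> \<bar>qform (\<lambda>x. complex_of_real c *\<^sub>C S x) x\<bar> \<le> \<epsilon> * (norm x)\<^sup>2)"
    using F c by (intro exI[of _ F]) (simp add: abs_mult field_simps)
qed

lemma trace_spectral_proj_scaled:
  fixes S :: "'a::chilbert_space \<Rightarrow> 'a"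
  assumes "form_compact S" "0 < r" "0 < c"
  shows "Re (trace_op (spectral_proj {r<..} (\<lambda>x. complex_of_real c *\<^sub>C S x))) = real (nplus (r / c) S)"
  using trace_spectral_proj[OF form_compact_scale[OF assms(1,3)] assms(2)] nplus_scale[OF assms] by simp

section \<open>Assembly at a singular threshold\<close>

context lattice_model
begin

text \<open>Covers both edges: \<tau> = 1 with constant signs, \<tau> = -1 with \<open>alt\<close>.
  G sends W to the effective operator, and its homogeneity turns the rescaling of W in
  \<open>sim_functional\<close> into a change of the spectral level.\<close>

lemma singular_threshold:
  assumes h: "0 < h" and s: "s \<in> I" and \<tau>: "\<tau> = 1 \<or> \<tau> = -1"
    and F: "F \<noteq> bot" "(k \<longlongrightarrow> 0) F"
    and k: "\<forall>\<^sub>F l in F. 0 < k l \<and> k l \<le> 1 \<and> energy h l s = \<tau> * (2 + h\<^sup>2 * (k l)\<^sup>2)"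
    and D: "\<forall>\<^sub>F l in F. \<forall>s'\<in>I - {s}. \<bar>energy h l s'\<bar> \<noteq> 2 \<and> cmod (amp h (lim_root (energy h l s'))) \<le> D" "0 \<le> D"
    and \<sigma>: "\<And>n. \<bar>\<sigma> n\<bar> = 1" "\<And>n m. \<tau> ^ nat \<bar>n - m\<bar> = \<sigma> n * \<sigma> m"
    and G: "\<And>c. G (\<lambda>x. complex_of_real c *\<^sub>C W x) = (\<lambda>g. complex_of_real c *\<^sub>C cadjoint (Y s \<sigma>) (Y s \<sigma> g))"
    and rank: "rank_op (G W) = \<infinity>" and f: "\<And>l. f W l = - xi_signed \<tau> h l"
  shows "xi_signed \<tau> h \<notin> O[F](\<lambda>_. 1)"
    "sim_functional F W f (\<lambda>W l. - Re (trace_op (spectral_proj {2 / h * k l<..} (G W))))"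
    "xi_signed (- \<tau>) h \<in> O[F](\<lambda>_. 1)"
proof -
  let ?E = "\<lambda>g. cadjoint (Y s \<sigma>) (Y s \<sigma> g)"
  note asym = threshold_asymptotics[where \<sigma> = \<sigma>, OF h s \<tau> k D \<sigma>]
  have fc: "form_compact ?E" by (rule effective_form_compact[OF s \<sigma>(1)])
  have "rank_op ?E = \<infinity>" using G[of 1] rank by simp
  then have unb: "\<exists>r0>0. \<forall>r. 0 < r \<longrightarrow> r < r0 \<longrightarrow> n \<le> nplus r ?E" for n
    by (rule nplus_unbounded[OF Y_clinear[OF s \<sigma>(1)] fc])
  \<comment> \<open>One fixed \<epsilon> settles unboundedness and the bounded sign.\<close>
  obtain C where C: "\<forall>\<^sub>F l in F. 0 < k l \<and> real (nplus ((1 + 1/2) * (2 / h * k l)) ?E) - C \<le> xi_signed \<tau> h l \<and>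
      xi_signed \<tau> h l \<le> real (nplus ((1 - 1/2) * (2 / h * k l)) ?E) + C \<and> \<bar>xi_signed (- \<tau>) h l\<bar> \<le> C"
    using asym[of "1/2"] by auto
  show "xi_signed (- \<tau>) h \<in> O[F](\<lambda>_. 1)"
    by (rule bounded_bigo[of _ C]) (use C in \<open>auto elim!: eventually_mono\<close>)
  show "xi_signed \<tau> h \<notin> O[F](\<lambda>_. 1)"
  proof (rule threshold_unbounded[OF F _ _ _ unb, of "(1 + 1/2) * (2 / h)" C])
    show "\<forall>\<^sub>F l in F. 0 < k l" using C by eventually_elim simp
    show "\<forall>\<^sub>F l in F. real (nplus ((1 + 1/2) * (2 / h) * k l) ?E) - C \<le> \<bar>xi_signed \<tau> h l\<bar>"
      using C
    proof eventually_elim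
      case (elim l)
      have "(1 + 1/2) * (2 / h) * k l = (1 + 1/2) * (2 / h * k l)" by (simp only: mult.assoc)
      moreover have "real (nplus ((1 + 1/2) * (2 / h * k l)) ?E) - C \<le> xi_signed \<tau> h l" using elim by blast
      ultimately show ?case by simp
    qed
  qed (use h in simp)
  show "sim_functional F W f (\<lambda>W l. - Re (trace_op (spectral_proj {2 / h * k l<..} (G W))))"
    unfolding sim_functional_def
  proof
    fix \<epsilon> :: real assume e: "\<epsilon> \<in> {0<..<1}"
    then obtain C where C: "\<forall>\<^sub>F l in F. 0 < k l \<and> real (nplus ((1 + \<epsilon>) * (2 / h * k l)) ?E) - C \<le> xi_signed \<tau> h l \<and>
        xi_signed \<tau> h l \<le> real (nplus ((1 - \<epsilon>) * (2 / h * k l)) ?E) + C \<and> \<bar>xi_signed (- \<tau>) h l\<bar> \<le> C"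
      using asym[of \<epsilon>] by auto
    have "\<forall>\<^sub>F l in F. - Re (trace_op (spectral_proj {2 / h * k l<..} (G (\<lambda>x. complex_of_real (1 / (1 - \<epsilon>)) *\<^sub>C W x)))) - C \<le> f W l \<and>
       f W l \<le> - Re (trace_op (spectral_proj {2 / h * k l<..} (G (\<lambda>x. complex_of_real (1 / (1 + \<epsilon>)) *\<^sub>C W x)))) + C"
      using C
    proof eventually_elim
      case (elim l)
      have p: "0 < 2 / h * k l" using h elim by simp
      have q: "0 < 1 / (1 - \<epsilon>)" "0 < 1 / (1 + \<epsilon>)" using e by auto
      \<comment> \<open>Scaling W by 1 / (1 - \<epsilon>) lowers the level to (1 - \<epsilon>) 2 k /
        h. The minus sign in f exchanges the bounds, so the larger count bounds f from
        below.\<close>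
      have "2 / h * k l / (1 / (1 - \<epsilon>)) = (1 - \<epsilon>) * (2 / h * k l)" "2 / h * k l / (1 / (1 + \<epsilon>)) = (1 + \<epsilon>) * (2 / h * k l)"
        by (simp_all add: mult.commute)
      then show ?case
        using elim trace_spectral_proj_scaled[OF fc p q(1)] trace_spectral_proj_scaled[OF fc p q(2)]
        unfolding G f by (simp only:) linarith
    qed
    then show "\<exists>C. \<forall>\<^sub>F l in F. - Re (trace_op (spectral_proj {2 / h * k l<..} (G (\<lambda>x. complex_of_real (1 / (1 - \<epsilon>)) *\<^sub>C W x)))) - C \<le> f W l \<and>
       f W l \<le> - Re (trace_op (spectral_proj {2 / h * k l<..} (G (\<lambda>x. complex_of_real (1 / (1 + \<epsilon>)) *\<^sub>C W x)))) + C"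
      by blast
  qed
qed

end

theorem theorem5p13:
  fixes h \<nu>\<^sub>0 :: real and Q K :: "'g::chilbert_space \<Rightarrow> 'g"
    and W :: "'g ell2 \<Rightarrow> 'g ell2" and d s :: nat and \<mu> :: "nat \<Rightarrow> real"
  assumes h: "0 < h"
    and separable: "\<exists>D :: 'g set. countable D \<and> closure D = UNIV"
    and dim: "cdim (UNIV :: 'g set) = \<infinity>"
    and Q: "selfadjoint_op Q" "spectral_data Q d \<mu>"
    and \<nu>\<^sub>0: "3 < \<nu>\<^sub>0"
    and W: "positive_op W"
    and K: "hilbert_schmidt K"
    and s: "s \<in> index_set Q d"
    and nondeg: "nondegenerate_lower h Q d \<mu> s" "nondegenerate_upper h Q d \<mu> s"
    and rank: "rank_op (effective_op \<nu>\<^sub>0 Q \<mu> s (bold_V K W)) = \<infinity>"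
      "rank_op (effective_op \<nu>\<^sub>0 Q \<mu> s (bold_VJ K W)) = \<infinity>"
  shows "xi_minus h Q \<nu>\<^sub>0 K W \<notin> O[at_left (\<mu> s)](\<lambda>_. 1)
    \<and> xi_plus h Q \<nu>\<^sub>0 K W \<notin> O[at_right (4 / h\<^sup>2 + \<mu> s)](\<lambda>_. 1)
    \<and> sim_functional (at_left (\<mu> s)) W
        (\<lambda>W l. xi_minus h Q \<nu>\<^sub>0 K W l)
        (\<lambda>W l. - Re (trace_op (spectral_proj {2 / h * sqrt (\<mu> s - l)<..}
                   (effective_op \<nu>\<^sub>0 Q \<mu> s (bold_V K W)))))
    \<and> xi_minus h Q \<nu>\<^sub>0 K W \<in> O[at_right (4 / h\<^sup>2 + \<mu> s)](\<lambda>_. 1)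
    \<and> xi_plus h Q \<nu>\<^sub>0 K W \<in> O[at_left (\<mu> s)](\<lambda>_. 1)
    \<and> sim_functional (at_right (4 / h\<^sup>2 + \<mu> s)) W
        (\<lambda>W l. - xi_plus h Q \<nu>\<^sub>0 K W l)
        (\<lambda>W l. - Re (trace_op (spectral_proj {2 / h * sqrt (l - 4 / h\<^sup>2 - \<mu> s)<..}
                   (effective_op \<nu>\<^sub>0 Q \<mu> s (bold_VJ K W)))))"
proof -
  interpret lattice_model Q d \<mu> \<nu>\<^sub>0 K W
    by unfold_locales (fact Q \<nu>\<^sub>0 W K)+
  have ne: "\<mu> s \<noteq> \<mu> s' \<and> \<mu> s \<noteq> 4 / h\<^sup>2 + \<mu> s' \<and> 4 / h\<^sup>2 + \<mu> s \<noteq> \<mu> s'" if "s' \<in> I - {s}" for s'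
  proof -
    \<comment> \<open>For Q = 0 the index set is a singleton, so a second channel forces Q \<noteq>
      0.\<close>
    have "Q \<noteq> (\<lambda>_. 0)"
    proof
      assume "Q = (\<lambda>_. 0)"
      then show False using s that by (simp add: index_set_def)
    qed
    moreover have "\<mu> s \<noteq> \<mu> s'" using inj_I s that by (auto simp: inj_on_def)
    ultimately show ?thesis using nondeg that by (auto simp: nondegenerate_lower_def nondegenerate_upper_def)
  qed
  have h2: "0 < h\<^sup>2" using h by simp

  \<comment> \<open>Below \<mu> s the energy is 2 + h^2 k^2 with k = sqrt (\<mu> s - l), and k \<le>
    1 within distance 1 of the threshold.\<close>
  define kl where "kl l = sqrt (\<mu> s - l)" for l
  obtain Dl where Dl: "0 \<le> Dl" "\<forall>\<^sub>F l in nhds (\<mu> s). \<forall>s'\<in>I - {s}.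
      \<bar>energy h l s'\<bar> \<noteq> 2 \<and> cmod (amp h (lim_root (energy h l s'))) \<le> Dl"
  proof -
    \<comment> \<open>The energy of channel s' at \<mu> s is 2 or -2 exactly if \<mu> s' = \<mu> s
      or \<mu> s = 4/h^2 + \<mu> s'; both are excluded by \<open>ne\<close>.\<close>
    have "\<bar>energy h (\<mu> s) s'\<bar> \<noteq> 2" if "s' \<in> I - {s}" for s'
      using ne[OF that] h2 by (auto simp: energy_def abs_if field_simps split: if_splits)
    then show ?thesis using channel_amplitudes_bounded[OF h, of s "\<mu> s"] that by blast
  qed
  have k_lower: "\<forall>\<^sub>F l in at_left (\<mu> s). 0 < kl l \<and> kl l \<le> 1 \<and> energy h l s = 1 * (2 + h\<^sup>2 * (kl l)\<^sup>2)"
    unfolding eventually_at_left_field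
    by (intro exI[of _ "\<mu> s - 1"]) (auto simp: kl_def energy_def algebra_simps)
  have lim_lower: "(kl \<longlongrightarrow> 0) (at_left (\<mu> s))"
  proof -
    have "(kl \<longlongrightarrow> sqrt (\<mu> s - \<mu> s)) (at_left (\<mu> s))" unfolding kl_def by (intro tendsto_intros)
    then show ?thesis by simp
  qed
  note lower = singular_threshold[where \<tau> = 1 and \<sigma> = "\<lambda>_. 1" and k = kl and F = "at_left (\<mu> s)" and D = Dl
      and G = "\<lambda>W. effective_op \<nu>\<^sub>0 Q \<mu> s (bold_V K W)" and f = "\<lambda>W l. xi_minus h Q \<nu>\<^sub>0 K W l",
      OF h s _ trivial_limit_at_left_real lim_lower k_lower
      filter_leD[OF at_within_le_nhds Dl(2)] Dl(1) _ _ effective_lower[OF s] rank(1) xi_minus_eq, simplified]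

  \<comment> \<open>Above the upper edge the energy is - (2 + h^2 k^2) with this k, hence \<tau> =
    -1.\<close>
  define ku where "ku l = sqrt (l - 4 / h\<^sup>2 - \<mu> s)" for l
  define u where "u = 4 / h\<^sup>2 + \<mu> s"
  obtain Du where Du: "0 \<le> Du" "\<forall>\<^sub>F l in nhds u. \<forall>s'\<in>I - {s}.
      \<bar>energy h l s'\<bar> \<noteq> 2 \<and> cmod (amp h (lim_root (energy h l s'))) \<le> Du"
  proof -
    have "\<bar>energy h u s'\<bar> \<noteq> 2" if "s' \<in> I - {s}" for s'
    proof -
      \<comment> \<open>A modulus 2 of the energy means x = 0 or x = -4, that is \<mu> s' = \<mu> s
        or \<mu> s' = 4/h^2 + \<mu> s.\<close>
      define x where "x = h\<^sup>2 * (\<mu> s - \<mu> s')"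
      have "energy h u s' = - 2 - x" using h2 by (simp add: energy_def u_def x_def algebra_simps)
      moreover have "x \<noteq> 0" "x \<noteq> - 4" using ne[OF that] h2 by (auto simp: x_def field_simps)
      ultimately show ?thesis by (auto simp: abs_if)
    qed
    then show ?thesis using channel_amplitudes_bounded[OF h, of s u] that by blast
  qed
  have k_upper: "\<forall>\<^sub>F l in at_right u. 0 < ku l \<and> ku l \<le> 1 \<and> energy h l s = - 1 * (2 + h\<^sup>2 * (ku l)\<^sup>2)"
    unfolding eventually_at_right_field
    by (intro exI[of _ "u + 1"]) (use h2 in \<open>auto simp: ku_def u_def energy_def field_simps\<close>)
  have lim_upper: "(ku \<longlongrightarrow> 0) (at_right u)"
  proof -
    have "(ku \<longlongrightarrow> sqrt (u - 4 / h\<^sup>2 - \<mu> s)) (at_right u)" unfolding ku_def by (intro tendsto_intros)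
    then show ?thesis by (simp add: u_def)
  qed
  have xi_p: "- xi_plus h Q \<nu>\<^sub>0 K W l = - xi_signed (- 1) h l" for l by (simp add: xi_plus_eq)
  note upper = singular_threshold[where \<tau> = "- 1" and \<sigma> = alt and k = ku and F = "at_right u" and D = Du
      and G = "\<lambda>W. effective_op \<nu>\<^sub>0 Q \<mu> s (bold_VJ K W)" and f = "\<lambda>W l. - xi_plus h Q \<nu>\<^sub>0 K W l",
      OF h s _ trivial_limit_at_right_real lim_upper k_upper
      filter_leD[OF at_within_le_nhds Du(2)] Du(1) alt_abs alt_product effective_upper[OF s] rank(2) xi_p, simplified]
  have m: "xi_minus h Q \<nu>\<^sub>0 K W = (\<lambda>l. - xi_signed 1 h l)" by (rule ext) (rule xi_minus_eq)
  have p: "xi_plus h Q \<nu>\<^sub>0 K W = xi_signed (- 1) h" by (rule ext) (rule xi_plus_eq)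
  show ?thesis
    using lower upper by (simp add: m p kl_def ku_def u_def)
qed

end
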